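(* Let $A$ be a ring and $(\mathcal{C},x)$ an $A$-coring with a fixed grouplike element, and assume that $\mathcal{C}$ is a left $A$-progenerator. Let $B=A^{\mathrm{co}\mathcal{C}}$, let $B'$ be a subring of $B$, and consider the map $$\mathrm{can}':\ \mathcal{D}'=A\otimes_{B'}A\to\mathcal{C},\qquad \mathrm{can}'(a\otimes_{B'}a')=axa'.$$ Then the following statements are equivalent: (1) $\mathrm{can}'$ is an isomorphism and $A$ is faithfully flat as a left $B'$-module; (2) ${}^*\mathrm{can}'$ is an isomorphism and $A$ is a left $B'$-progenerator; (3) $B=B'$ and the Morita context $(B,{}^*\mathcal{C},A,Q,\tau,\mu)$ is strict; (4) $B=B'$ and the adjoint pair $(F,G)$ between $\mathcal{M}_B$ and $\mathcal{M}^{\mathcal{C}}$ is an equivalence of categories.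
   Context: Rings are unital. An $A$-coring is a coalgebra $(\mathcal{C},\Delta,\varepsilon)$ in the monoidal category of $A$-bimodules; write $\Delta(c)=c_{(1)}\otimes_A c_{(2)}$. An element $x\in\mathcal{C}$ is grouplike if $\Delta(x)=x\otimes_A x$ and $\varepsilon(x)=1_A$. A right $\mathcal{C}$-comodule is a right $A$-module $M$ with a right $A$-linear, coassociative and counital coaction $\rho:M\to M\otimes_A\mathcal{C}$; $\mathcal{M}^{\mathcal{C}}$ is the category of right $\mathcal{C}$-comodules and right $A$-linear maps commuting with coactions. $M^{\mathrm{co}\mathcal{C}}=\{m\in M\mid\rho(m)=m\otimes_A x\}$. $A$ is a right $\mathcal{C}$-comodule via $\rho(a)=xa$, so $A^{\mathrm{co}\mathcal{C}}=\{b\in A\mid bx=xb\}$, a subring of $A$. The functors are $F=-\otimes_B A:\mathcal{M}_B\to\mathcal{M}^{\mathcal{C}}$ (coaction $n\otimes_B a\mapsto (n\otimes_B 1)\otimes_A xa$) and its right adjoint $G=(-)^{\mathrm{co}\mathcal{C}}$, with unit $n\mapsto n\otimes_B 1$ and counit $m\otimes_B a\mapsto ma$. The left dual ${}^*\mathcal{C}={}_A\mathrm{Hom}(\mathcal{C},A)$ (left $A$-linear maps) is a ring with product $(f\# g)(c)=g(c_{(1)}f(c_{(2)}))$ and unit $\varepsilon$; there is a ring morphism $i:A\to{}^*\mathcal{C}$, $i(a)(c)=\varepsilon(c)a$. The left dual of $\mathrm{can}'$ is, after identifying ${}^*\mathcal{D}'={}_A\mathrm{Hom}(A\otimes_{B'}A,A)\cong{}_{B'}\mathrm{End}(A)^{\mathrm{op}}$,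 the map ${}^*\mathrm{can}':{}^*\mathcal{C}\to{}_{B'}\mathrm{End}(A)^{\mathrm{op}}$, ${}^*\mathrm{can}'(f)(a)=f(xa)$. Morita context: $Q=\{q\in{}^*\mathcal{C}\mid c_{(1)}q(c_{(2)})=q(c)x\text{ for all }c\in\mathcal{C}\}$ is a $({}^*\mathcal{C},B)$-bimodule via $f\cdot q=f\# q$ and $q\cdot b=q\# i(b)$; $A$ is a $(B,{}^*\mathcal{C})$-bimodule with right action $a\cdot f=f(xa)$; $\tau:A\otimes_{{}^*\mathcal{C}}Q\to B$, $\tau(a\otimes q)=q(xa)$; $\mu:Q\otimes_B A\to{}^*\mathcal{C}$, $\mu(q\otimes_B a)=q\# i(a)$. The context is strict if $\tau$ and $\mu$ are both surjective (equivalently, bijective). A progenerator is a finitely generated projective generator. *)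

theory Defs
  imports "HOL-Algebra.Algebra"
begin

section \<open>Modules and bimodules over noncommutative rings\<close>

text \<open>
  One record carries both actions.  A one-sided module is an element of this record whose other
  action is arbitrary (typically over the type \<^typ>\<open>unit\<close>), just as an abelian group in HOL-Algebra
  carries an arbitrary multiplication; the predicates below never look at the unused action.
\<close>

record ('l, 'r, 'm) bimodule = "'m ring" +
  lact :: "'l \<Rightarrow> 'm \<Rightarrow> 'm"
  ract :: "'m \<Rightarrow> 'r \<Rightarrow> 'm"

locale left_module = L?: ring R + M?: abelian_group M
  for R :: "('l, 'z) ring_scheme" and M :: "('l, 'r, 'm, 'y) bimodule_scheme" +
  assumes lact_closed: "\<lbrakk>a \<in> carrier R; m \<in> carrier M\<rbrakk> \<Longrightarrow> lact M a m \<in> carrier M"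
    and lact_add_left: "\<lbrakk>a \<in> carrier R; b \<in> carrier R; m \<in> carrier M\<rbrakk>
      \<Longrightarrow> lact M (a \<oplus>\<^bsub>R\<^esub> b) m = lact M a m \<oplus>\<^bsub>M\<^esub> lact M b m"
    and lact_add_right: "\<lbrakk>a \<in> carrier R; m \<in> carrier M; n \<in> carrier M\<rbrakk>
      \<Longrightarrow> lact M a (m \<oplus>\<^bsub>M\<^esub> n) = lact M a m \<oplus>\<^bsub>M\<^esub> lact M a n"
    and lact_assoc: "\<lbrakk>a \<in> carrier R; b \<in> carrier R; m \<in> carrier M\<rbrakk>
      \<Longrightarrow> lact M (a \<otimes>\<^bsub>R\<^esub> b) m = lact M a (lact M b m)"
    and lact_one: "m \<in> carrier M \<Longrightarrow> lact M \<one>\<^bsub>R\<^esub> m = m"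

locale right_module = R?: ring R + M?: abelian_group M
  for R :: "('r, 'z) ring_scheme" and M :: "('l, 'r, 'm, 'y) bimodule_scheme" +
  assumes ract_closed: "\<lbrakk>a \<in> carrier R; m \<in> carrier M\<rbrakk> \<Longrightarrow> ract M m a \<in> carrier M"
    and ract_add_right: "\<lbrakk>a \<in> carrier R; b \<in> carrier R; m \<in> carrier M\<rbrakk>
      \<Longrightarrow> ract M m (a \<oplus>\<^bsub>R\<^esub> b) = ract M m a \<oplus>\<^bsub>M\<^esub> ract M m b"
    and ract_add_left: "\<lbrakk>a \<in> carrier R; m \<in> carrier M; n \<in> carrier M\<rbrakk>
      \<Longrightarrow> ract M (m \<oplus>\<^bsub>M\<^esub> n) a = ract M m a \<oplus>\<^bsub>M\<^esub> ract M n a"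
    and ract_assoc: "\<lbrakk>a \<in> carrier R; b \<in> carrier R; m \<in> carrier M\<rbrakk>
      \<Longrightarrow> ract M m (a \<otimes>\<^bsub>R\<^esub> b) = ract M (ract M m a) b"
    and ract_one: "m \<in> carrier M \<Longrightarrow> ract M m \<one>\<^bsub>R\<^esub> = m"

locale bimodule = left_module L M + right_module R M
  for L :: "('l, 'z) ring_scheme" and R :: "('r, 'w) ring_scheme"
    and M :: "('l, 'r, 'm, 'y) bimodule_scheme" +
  assumes lact_ract: "\<lbrakk>a \<in> carrier L; b \<in> carrier R; m \<in> carrier M\<rbrakk>
      \<Longrightarrow> ract M (lact M a m) b = lact M a (ract M m b)"

definition left_hom ::
  "('l, 'z) ring_scheme \<Rightarrow> ('l, 'r, 'm, 'x) bimodule_scheme \<Rightarrow> ('l, 's, 'n, 'y) bimodule_scheme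
    \<Rightarrow> ('m \<Rightarrow> 'n) set"
  where "left_hom R M N = {f \<in> hom (add_monoid M) (add_monoid N).
    \<forall>a\<in>carrier R. \<forall>m\<in>carrier M. f (lact M a m) = lact N a (f m)}"

definition right_hom ::
  "('r, 'z) ring_scheme \<Rightarrow> ('l, 'r, 'm, 'x) bimodule_scheme \<Rightarrow> ('k, 'r, 'n, 'y) bimodule_scheme
    \<Rightarrow> ('m \<Rightarrow> 'n) set"
  where "right_hom R M N = {f \<in> hom (add_monoid M) (add_monoid N).
    \<forall>a\<in>carrier R. \<forall>m\<in>carrier M. f (ract M m a) = ract N (f m) a}"

definition right_iso ::
  "('r, 'z) ring_scheme \<Rightarrow> ('l, 'r, 'm, 'x) bimodule_scheme \<Rightarrow> ('k, 'r, 'n, 'y) bimodule_scheme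
    \<Rightarrow> ('m \<Rightarrow> 'n) set"
  where "right_iso R M N = {f \<in> right_hom R M N. bij_betw f (carrier M) (carrier N)}"

definition bimod_hom ::
  "('l, 'z) ring_scheme \<Rightarrow> ('r, 'w) ring_scheme \<Rightarrow> ('l, 'r, 'm, 'x) bimodule_scheme
    \<Rightarrow> ('l, 'r, 'n, 'y) bimodule_scheme \<Rightarrow> ('m \<Rightarrow> 'n) set"
  where "bimod_hom L R M N = left_hom L M N \<inter> right_hom R M N"

text \<open>The ring \<open>A\<close> as a bimodule over itself, or over any of its subrings.\<close>

definition regular :: "('a, 'z) ring_scheme \<Rightarrow> ('a, 'a, 'a) bimodule"
  where "regular A =
    ring.extend (ring.truncate A) \<lparr>lact = \<lambda>a b. a \<otimes>\<^bsub>A\<^esub> b, ract = \<lambda>a b. a \<otimes>\<^bsub>A\<^esub> b\<rparr>"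


section \<open>Tensor products\<close>

definition tensor_relators ::
  "('r, 'z) ring_scheme \<Rightarrow> ('l, 'r, 'm, 'x) bimodule_scheme \<Rightarrow> ('r, 's, 'n, 'y) bimodule_scheme
    \<Rightarrow> (('m \<times> 'n) \<Rightarrow>\<^sub>0 int) set"
  where "tensor_relators R M N =
      {frag_of (m \<oplus>\<^bsub>M\<^esub> m', n) - frag_of (m, n) - frag_of (m', n) | m m' n.
         m \<in> carrier M \<and> m' \<in> carrier M \<and> n \<in> carrier N}
    \<union> {frag_of (m, n \<oplus>\<^bsub>N\<^esub> n') - frag_of (m, n) - frag_of (m, n') | m n n'.
         m \<in> carrier M \<and> n \<in> carrier N \<and> n' \<in> carrier N}
    \<union> {frag_of (ract M m a, n) - frag_of (m, lact N a n) | m a n.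
         m \<in> carrier M \<and> a \<in> carrier R \<and> n \<in> carrier N}"

definition tensor_kernel ::
  "('r, 'z) ring_scheme \<Rightarrow> ('l, 'r, 'm, 'x) bimodule_scheme \<Rightarrow> ('r, 's, 'n, 'y) bimodule_scheme
    \<Rightarrow> (('m \<times> 'n) \<Rightarrow>\<^sub>0 int) set"
  where "tensor_kernel R M N =
    generate (free_Abelian_group (carrier M \<times> carrier N)) (tensor_relators R M N)"

definition tensor_group ::
  "('r, 'z) ring_scheme \<Rightarrow> ('l, 'r, 'm, 'x) bimodule_scheme \<Rightarrow> ('r, 's, 'n, 'y) bimodule_scheme
    \<Rightarrow> (('m \<times> 'n) \<Rightarrow>\<^sub>0 int) set ring"
  where "tensor_group R M N =
    (let T = free_Abelian_group (carrier M \<times> carrier N) Mod tensor_kernel R M N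
     in \<lparr>carrier = carrier T, monoid.mult = undefined, one = undefined, ring.zero = one T, ring.add = monoid.mult T\<rparr>)"

definition pure_tensor ::
  "('r, 'z) ring_scheme \<Rightarrow> ('l, 'r, 'm, 'x) bimodule_scheme \<Rightarrow> ('r, 's, 'n, 'y) bimodule_scheme
    \<Rightarrow> 'm \<Rightarrow> 'n \<Rightarrow> (('m \<times> 'n) \<Rightarrow>\<^sub>0 int) set"
  where "pure_tensor R M N m n =
    tensor_kernel R M N #>\<^bsub>free_Abelian_group (carrier M \<times> carrier N)\<^esub> frag_of (m, n)"

text \<open>
  \<open>tensor_lift G \<beta>\<close> is the additive map on a tensor product with values in \<open>G\<close> that sends
  \<open>m \<otimes> n\<close> to \<open>\<beta> m n\<close>, i.e. \<open>\<Sum>\<^sub>i m\<^sub>i \<otimes> n\<^sub>i \<mapsto> \<Sum>\<^sub>i \<beta> m\<^sub>i n\<^sub>i\<close>.  It is used below only for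
  biadditive balanced \<open>\<beta>\<close>, where the result does not depend on the chosen representative.
\<close>

definition tensor_lift ::
  "('g, 'z) ring_scheme \<Rightarrow> ('m \<Rightarrow> 'n \<Rightarrow> 'g) \<Rightarrow> (('m \<times> 'n) \<Rightarrow>\<^sub>0 int) set \<Rightarrow> 'g"
  where "tensor_lift G \<beta> t =
    (let p = (SOME p. p \<in> t)
     in \<Oplus>\<^bsub>G\<^esub>z \<in> Poly_Mapping.keys p. add_pow G (Poly_Mapping.lookup p z) (\<beta> (fst z) (snd z)))"

definition tensor ::
  "('r, 'z) ring_scheme \<Rightarrow> ('l, 'r, 'm, 'x) bimodule_scheme \<Rightarrow> ('r, 's, 'n, 'y) bimodule_scheme
    \<Rightarrow> ('l, 's, (('m \<times> 'n) \<Rightarrow>\<^sub>0 int) set) bimodule"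
  where "tensor R M N = ring.extend (tensor_group R M N)
    \<lparr>lact = \<lambda>l. tensor_lift (tensor_group R M N) (\<lambda>m n. pure_tensor R M N (lact M l m) n),
     ract = \<lambda>t s. tensor_lift (tensor_group R M N) (\<lambda>m n. pure_tensor R M N m (ract N n s)) t\<rparr>"

text \<open>The map \<open>f \<otimes> g\<close>; the module arguments are those of the codomain.\<close>

definition tensor_map ::
  "('r, 'z) ring_scheme \<Rightarrow> ('l, 'r, 'm, 'x) bimodule_scheme \<Rightarrow> ('r, 's, 'n, 'y) bimodule_scheme
    \<Rightarrow> ('p \<Rightarrow> 'm) \<Rightarrow> ('q \<Rightarrow> 'n) \<Rightarrow> (('p \<times> 'q) \<Rightarrow>\<^sub>0 int) set \<Rightarrow> (('m \<times> 'n) \<Rightarrow>\<^sub>0 int) set"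
  where "tensor_map R M N f g =
    tensor_lift (tensor R M N) (\<lambda>p q. pure_tensor R M N (f p) (g q))"

text \<open>The canonical map \<open>(M \<otimes>\<^sub>R N) \<otimes>\<^sub>S P \<rightarrow> M \<otimes>\<^sub>R (N \<otimes>\<^sub>S P)\<close>.\<close>

definition tensor_assoc ::
  "('r, 'z) ring_scheme \<Rightarrow> ('s, 'w) ring_scheme \<Rightarrow> ('l, 'r, 'm, 'x) bimodule_scheme
    \<Rightarrow> ('r, 's, 'n, 'y) bimodule_scheme \<Rightarrow> ('s, 't, 'p, 'v) bimodule_scheme
    \<Rightarrow> ((((('m \<times> 'n) \<Rightarrow>\<^sub>0 int) set) \<times> 'p) \<Rightarrow>\<^sub>0 int) set
    \<Rightarrow> (('m \<times> (('n \<times> 'p) \<Rightarrow>\<^sub>0 int) set) \<Rightarrow>\<^sub>0 int) set"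
  where "tensor_assoc R S M N P =
    (let T = tensor R M (tensor S N P)
     in tensor_lift T (\<lambda>t p. tensor_lift T
          (\<lambda>m n. pure_tensor R M (tensor S N P) m (pure_tensor S N P n p)) t))"


section \<open>Progenerators and faithful flatness\<close>

text \<open>
  Projectivity, generation and faithful flatness quantify over modules.  In HOL such a
  quantifier ranges over the modules whose carrier lies in one type \<open>'u\<close>, passed as
  \<^term>\<open>TYPE('u)\<close>; it plays the role of a universe and is to be taken sufficiently large.
\<close>

definition left_finitely_generated ::
  "('r, 'z) ring_scheme \<Rightarrow> ('r, 's, 'p, 'y) bimodule_scheme \<Rightarrow> bool"
  where "left_finitely_generated R P \<longleftrightarrow>
    (\<exists>S. finite S \<and> S \<subseteq> carrier P \<and>
      (\<forall>p\<in>carrier P. \<exists>a\<in>S \<rightarrow> carrier R. p = (\<Oplus>\<^bsub>P\<^esub>s\<in>S. lact P (a s) s)))"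

definition left_projective ::
  "'u itself \<Rightarrow> ('r, 'z) ring_scheme \<Rightarrow> ('r, 's, 'p, 'y) bimodule_scheme \<Rightarrow> bool"
  where "left_projective (_ :: 'u itself) R P \<longleftrightarrow>
    (\<forall>(N :: ('r, unit, 'u) bimodule) (N' :: ('r, unit, 'u) bimodule).
      left_module R N \<longrightarrow> left_module R N' \<longrightarrow>
      (\<forall>g\<in>left_hom R N N'. \<forall>f\<in>left_hom R P N'. g ` carrier N = carrier N' \<longrightarrow>
        (\<exists>h\<in>left_hom R P N. \<forall>p\<in>carrier P. g (h p) = f p)))"

text \<open>A generator is a module \<open>P\<close> for which the functor \<open>Hom(P, -)\<close> is faithful.\<close>

definition left_generator ::
  "'u itself \<Rightarrow> ('r, 'z) ring_scheme \<Rightarrow> ('r, 's, 'p, 'y) bimodule_scheme \<Rightarrow> bool"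
  where "left_generator (_ :: 'u itself) R P \<longleftrightarrow>
    (\<forall>(N :: ('r, unit, 'u) bimodule) (N' :: ('r, unit, 'u) bimodule).
      left_module R N \<longrightarrow> left_module R N' \<longrightarrow>
      (\<forall>f\<in>left_hom R N N'. \<forall>g\<in>left_hom R N N'.
        (\<forall>h\<in>left_hom R P N. \<forall>p\<in>carrier P. f (h p) = g (h p)) \<longrightarrow>
        (\<forall>x\<in>carrier N. f x = g x)))"

definition left_progenerator ::
  "'u itself \<Rightarrow> ('r, 'z) ring_scheme \<Rightarrow> ('r, 's, 'p, 'y) bimodule_scheme \<Rightarrow> bool"
  where "left_progenerator U R P \<longleftrightarrow> left_module R P \<and> left_finitely_generated R P \<and>
    left_projective U R P \<and> left_generator U R P"

definition exact_at ::
  "('m, 'x) ring_scheme \<Rightarrow> ('n, 'y) ring_scheme \<Rightarrow> ('p, 'z) ring_scheme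
    \<Rightarrow> ('m \<Rightarrow> 'n) \<Rightarrow> ('n \<Rightarrow> 'p) \<Rightarrow> bool"
  where "exact_at N N' N'' f g \<longleftrightarrow> f ` carrier N = {y \<in> carrier N'. g y = \<zero>\<^bsub>N''\<^esub>}"

definition left_faithfully_flat ::
  "'u itself \<Rightarrow> ('r, 'z) ring_scheme \<Rightarrow> ('r, 's, 'p, 'y) bimodule_scheme \<Rightarrow> bool"
  where "left_faithfully_flat (_ :: 'u itself) R P \<longleftrightarrow> left_module R P \<and>
    (\<forall>(N :: (unit, 'r, 'u) bimodule) (N' :: (unit, 'r, 'u) bimodule) (N'' :: (unit, 'r, 'u) bimodule).
      right_module R N \<longrightarrow> right_module R N' \<longrightarrow> right_module R N'' \<longrightarrow>
      (\<forall>f\<in>right_hom R N N'. \<forall>g\<in>right_hom R N' N''.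
        exact_at N N' N'' f g \<longleftrightarrow>
        exact_at (tensor R N P) (tensor R N' P) (tensor R N'' P)
          (tensor_map R N' P f (\<lambda>p. p)) (tensor_map R N'' P g (\<lambda>p. p))))"


section \<open>Corings and comodules\<close>

record ('a, 'c) coring = "('a, 'a, 'c) bimodule" +
  comul :: "'c \<Rightarrow> (('c \<times> 'c) \<Rightarrow>\<^sub>0 int) set"
  counit :: "'c \<Rightarrow> 'a"

locale coring = bimodule A A C
  for A :: "('a, 'z) ring_scheme" and C :: "('a, 'c, 'y) coring_scheme" +
  assumes comul_hom: "comul C \<in> bimod_hom A A C (tensor A C C)"
    and counit_hom: "counit C \<in> bimod_hom A A C (regular A)"
    and coassoc: "c \<in> carrier C \<Longrightarrow>
      tensor_assoc A A C C C (tensor_map A (tensor A C C) C (comul C) (\<lambda>d. d) (comul C c)) =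
      tensor_map A C (tensor A C C) (\<lambda>d. d) (comul C) (comul C c)"
    and counit_left: "c \<in> carrier C \<Longrightarrow>
      tensor_lift C (\<lambda>d e. lact C (counit C d) e) (comul C c) = c"
    and counit_right: "c \<in> carrier C \<Longrightarrow>
      tensor_lift C (\<lambda>d e. ract C d (counit C e)) (comul C c) = c"

definition grouplike :: "('a, 'z) ring_scheme \<Rightarrow> ('a, 'c, 'y) coring_scheme \<Rightarrow> 'c \<Rightarrow> bool"
  where "grouplike A C x \<longleftrightarrow>
    x \<in> carrier C \<and> comul C x = pure_tensor A C C x x \<and> counit C x = \<one>\<^bsub>A\<^esub>"

definition coring_hom ::
  "('a, 'z) ring_scheme \<Rightarrow> ('a, 'c, 'x) coring_scheme \<Rightarrow> ('a, 'd, 'y) coring_scheme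
    \<Rightarrow> ('c \<Rightarrow> 'd) set"
  where "coring_hom A C D = {f \<in> bimod_hom A A C D. \<forall>c\<in>carrier C.
    comul D (f c) = tensor_map A D D f f (comul C c) \<and> counit D (f c) = counit C c}"

definition coring_iso ::
  "('a, 'z) ring_scheme \<Rightarrow> ('a, 'c, 'x) coring_scheme \<Rightarrow> ('a, 'd, 'y) coring_scheme
    \<Rightarrow> ('c \<Rightarrow> 'd) set"
  where "coring_iso A C D = {f \<in> coring_hom A C D. bij_betw f (carrier C) (carrier D)}"

record ('l, 'a, 'm, 'c) comodule = "('l, 'a, 'm) bimodule" +
  coact :: "'m \<Rightarrow> (('m \<times> 'c) \<Rightarrow>\<^sub>0 int) set"

locale comodule = right_module A M
  for A :: "('a, 'z) ring_scheme" and C :: "('a, 'c, 'y) coring_scheme"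
    and M :: "('l, 'a, 'm, 'c, 'x) comodule_scheme" +
  assumes coact_hom: "coact M \<in> right_hom A M (tensor A M C)"
    and coact_coassoc: "m \<in> carrier M \<Longrightarrow>
      tensor_assoc A A M C C (tensor_map A (tensor A M C) C (coact M) (\<lambda>c. c) (coact M m)) =
      tensor_map A M (tensor A C C) (\<lambda>n. n) (comul C) (coact M m)"
    and coact_counit: "m \<in> carrier M \<Longrightarrow>
      tensor_lift M (\<lambda>n c. ract M n (counit C c)) (coact M m) = m"

definition comodule_hom ::
  "('a, 'z) ring_scheme \<Rightarrow> ('a, 'c, 'y) coring_scheme \<Rightarrow> ('l, 'a, 'm, 'c, 'x) comodule_scheme
    \<Rightarrow> ('k, 'a, 'n, 'c, 'w) comodule_scheme \<Rightarrow> ('m \<Rightarrow> 'n) set"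
  where "comodule_hom A C M N = {f \<in> right_hom A M N. \<forall>m\<in>carrier M.
    coact N (f m) = tensor_map A N C f (\<lambda>c. c) (coact M m)}"

definition comodule_iso ::
  "('a, 'z) ring_scheme \<Rightarrow> ('a, 'c, 'y) coring_scheme \<Rightarrow> ('l, 'a, 'm, 'c, 'x) comodule_scheme
    \<Rightarrow> ('k, 'a, 'n, 'c, 'w) comodule_scheme \<Rightarrow> ('m \<Rightarrow> 'n) set"
  where "comodule_iso A C M N =
    {f \<in> comodule_hom A C M N. bij_betw f (carrier M) (carrier N)}"


section \<open>Coinvariants and the canonical map\<close>

text \<open>
  The ring \<open>B = A\<^sup>c\<^sup>o\<^sup>C\<close>: under \<open>A \<otimes>\<^sub>A C \<cong> C\<close> the coaction \<open>a \<mapsto> 1 \<otimes> xa\<close> of \<open>A\<close> becomes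
  \<open>a \<mapsto> xa\<close>, and \<open>b \<otimes> x\<close> becomes \<open>bx\<close>.
\<close>

definition coinvariant_ring :: "'a ring \<Rightarrow> ('a, 'c, 'y) coring_scheme \<Rightarrow> 'c \<Rightarrow> 'a ring"
  where "coinvariant_ring A C x = A\<lparr>carrier := {b \<in> carrier A. lact C b x = ract C x b}\<rparr>"

text \<open>
  The coring \<open>A \<otimes>\<^sub>S A\<close> of a subring \<open>S\<close> of \<open>A\<close>, with
  \<open>\<Delta>(a \<otimes> a') = (a \<otimes> 1) \<otimes>\<^sub>A (1 \<otimes> a')\<close> and \<open>\<epsilon>(a \<otimes> a') = aa'\<close>.
\<close>

definition sweedler_coring ::
  "'a ring \<Rightarrow> 'a set \<Rightarrow> ('a, (('a \<times> 'a) \<Rightarrow>\<^sub>0 int) set) coring"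
  where "sweedler_coring A S =
    (let R = A\<lparr>carrier := S\<rparr>; D = tensor R (regular A) (regular A);
         t = pure_tensor R (regular A) (regular A)
     in bimodule.extend D
       \<lparr>comul = tensor_lift (tensor A D D) (\<lambda>a a'. pure_tensor A D D (t a \<one>\<^bsub>A\<^esub>) (t \<one>\<^bsub>A\<^esub> a')),
        counit = tensor_lift A (\<lambda>a a'. a \<otimes>\<^bsub>A\<^esub> a')\<rparr>)"

definition can :: "('a, 'c, 'y) coring_scheme \<Rightarrow> 'c \<Rightarrow> (('a \<times> 'a) \<Rightarrow>\<^sub>0 int) set \<Rightarrow> 'c"
  where "can C x = tensor_lift C (\<lambda>a a'. ract C (lact C a x) a')"


section \<open>The left dual ring and its comparison map\<close>

text \<open>
  The elements of function rings are extensional functions.  In the left dual,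
  \<open>(f # g)(c) = g (c\<^sub>1 f(c\<^sub>2))\<close>.
\<close>

definition left_dual :: "'a ring \<Rightarrow> ('a, 'c, 'y) coring_scheme \<Rightarrow> ('c \<Rightarrow> 'a) ring"
  where "left_dual A C =
    \<lparr>carrier = left_hom A C (regular A) \<inter> extensional (carrier C),
     monoid.mult = \<lambda>f g. \<lambda>c\<in>carrier C. g (tensor_lift C (\<lambda>d e. ract C d (f e)) (comul C c)),
     one = (\<lambda>c\<in>carrier C. counit C c),
     ring.zero = (\<lambda>c\<in>carrier C. \<zero>\<^bsub>A\<^esub>),
     ring.add = \<lambda>f g. \<lambda>c\<in>carrier C. f c \<oplus>\<^bsub>A\<^esub> g c\<rparr>"

definition dual_incl :: "'a ring \<Rightarrow> ('a, 'c, 'y) coring_scheme \<Rightarrow> 'a \<Rightarrow> 'c \<Rightarrow> 'a"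
  where "dual_incl A C a = (\<lambda>c\<in>carrier C. counit C c \<otimes>\<^bsub>A\<^esub> a)"

definition left_End ::
  "('r, 'z) ring_scheme \<Rightarrow> ('r, 's, 'm, 'y) bimodule_scheme \<Rightarrow> ('m \<Rightarrow> 'm) ring"
  where "left_End R M =
    \<lparr>carrier = left_hom R M M \<inter> extensional (carrier M),
     monoid.mult = \<lambda>f g. \<lambda>m\<in>carrier M. f (g m),
     one = (\<lambda>m\<in>carrier M. m),
     ring.zero = (\<lambda>m\<in>carrier M. \<zero>\<^bsub>M\<^esub>),
     ring.add = \<lambda>f g. \<lambda>m\<in>carrier M. f m \<oplus>\<^bsub>M\<^esub> g m\<rparr>"

definition op_ring :: "'a ring \<Rightarrow> 'a ring"
  where "op_ring R = R\<lparr>monoid.mult := \<lambda>a b. b \<otimes>\<^bsub>R\<^esub> a\<rparr>"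

definition dual_can :: "'a ring \<Rightarrow> ('a, 'c, 'y) coring_scheme \<Rightarrow> 'c \<Rightarrow> ('c \<Rightarrow> 'a) \<Rightarrow> 'a \<Rightarrow> 'a"
  where "dual_can A C x f = (\<lambda>a\<in>carrier A. f (ract C x a))"


section \<open>The Morita context\<close>

definition morita_Q ::
  "'a ring \<Rightarrow> ('a, 'c, 'y) coring_scheme \<Rightarrow> 'c \<Rightarrow> ('c \<Rightarrow> 'a, 'a, 'c \<Rightarrow> 'a) bimodule"
  where "morita_Q A C x = ring.extend
    ((left_dual A C)\<lparr>carrier := {q \<in> carrier (left_dual A C). \<forall>c\<in>carrier C.
        tensor_lift C (\<lambda>d e. ract C d (q e)) (comul C c) = lact C (q c) x}\<rparr>)
    \<lparr>lact = \<lambda>f q. f \<otimes>\<^bsub>left_dual A C\<^esub> q, ract = \<lambda>q b. q \<otimes>\<^bsub>left_dual A C\<^esub> dual_incl A C b\<rparr>"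

definition morita_A ::
  "'a ring \<Rightarrow> ('a, 'c, 'y) coring_scheme \<Rightarrow> 'c \<Rightarrow> ('a, 'c \<Rightarrow> 'a, 'a) bimodule"
  where "morita_A A C x = ring.extend A
    \<lparr>lact = \<lambda>b a. b \<otimes>\<^bsub>A\<^esub> a, ract = \<lambda>a f. f (ract C x a)\<rparr>"

definition morita_tau ::
  "'a ring \<Rightarrow> ('a, 'c, 'y) coring_scheme \<Rightarrow> 'c \<Rightarrow> (('a \<times> ('c \<Rightarrow> 'a)) \<Rightarrow>\<^sub>0 int) set \<Rightarrow> 'a"
  where "morita_tau A C x = tensor_lift (coinvariant_ring A C x) (\<lambda>a q. q (ract C x a))"

definition morita_mu ::
  "'a ring \<Rightarrow> ('a, 'c, 'y) coring_scheme \<Rightarrow> ((('c \<Rightarrow> 'a) \<times> 'a) \<Rightarrow>\<^sub>0 int) set \<Rightarrow> 'c \<Rightarrow> 'a"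
  where "morita_mu A C =
    tensor_lift (left_dual A C) (\<lambda>q a. q \<otimes>\<^bsub>left_dual A C\<^esub> dual_incl A C a)"

definition morita_strict :: "'a ring \<Rightarrow> ('a, 'c, 'y) coring_scheme \<Rightarrow> 'c \<Rightarrow> bool"
  where "morita_strict A C x \<longleftrightarrow>
    morita_tau A C x ` carrier (tensor (left_dual A C) (morita_A A C x) (morita_Q A C x)) =
      carrier (coinvariant_ring A C x) \<and>
    morita_mu A C ` carrier (tensor (coinvariant_ring A C x) (morita_Q A C x) (morita_A A C x)) =
      carrier (left_dual A C)"


section \<open>The adjoint pair\<close>

definition induced_comodule ::
  "'a ring \<Rightarrow> ('a, 'c, 'y) coring_scheme \<Rightarrow> 'c \<Rightarrow> ('l, 'a, 'n, 'w) bimodule_scheme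
    \<Rightarrow> ('l, 'a, (('n \<times> 'a) \<Rightarrow>\<^sub>0 int) set, 'c) comodule"
  where "induced_comodule A C x N =
    (let B = coinvariant_ring A C x; T = tensor B N (regular A)
     in bimodule.extend T
       \<lparr>coact = tensor_lift (tensor A T C)
          (\<lambda>n a. pure_tensor A T C (pure_tensor B N (regular A) n \<one>\<^bsub>A\<^esub>) (ract C x a))\<rparr>)"

text \<open>
  \<open>M\<^sup>c\<^sup>o\<^sup>C\<close> with the \<open>A\<close>-action of \<open>M\<close>, of which only the restriction to \<open>B\<close> is used; the
  coaction is dropped.
\<close>

definition coinvariants ::
  "'a ring \<Rightarrow> ('a, 'c, 'y) coring_scheme \<Rightarrow> 'c \<Rightarrow> ('l, 'a, 'm, 'c, 'w) comodule_scheme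
    \<Rightarrow> ('l, 'a, 'm) bimodule"
  where "coinvariants A C x M =
    (bimodule.truncate M)\<lparr>carrier := {m \<in> carrier M. coact M m = pure_tensor A M C m x}\<rparr>"

definition unit_map ::
  "'a ring \<Rightarrow> ('a, 'c, 'y) coring_scheme \<Rightarrow> 'c \<Rightarrow> ('l, 'a, 'n, 'w) bimodule_scheme
    \<Rightarrow> 'n \<Rightarrow> (('n \<times> 'a) \<Rightarrow>\<^sub>0 int) set"
  where "unit_map A C x N n = pure_tensor (coinvariant_ring A C x) N (regular A) n \<one>\<^bsub>A\<^esub>"

definition counit_map ::
  "('l, 'a, 'm, 'c, 'w) comodule_scheme \<Rightarrow> (('m \<times> 'a) \<Rightarrow>\<^sub>0 int) set \<Rightarrow> 'm"
  where "counit_map M = tensor_lift M (\<lambda>m a. ract M m a)"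

text \<open>
  The adjoint pair \<open>(F, G)\<close> is an equivalence of categories iff all components of its unit and
  counit are isomorphisms.  Modules and comodules range over those with carrier in \<open>'u\<close>.  If
  \<open>'u\<close> is infinite and at least as large as \<open>A\<close> and \<open>C\<close>, then, up to isomorphism, \<open>F\<close> and \<open>G\<close>
  restrict to these.
\<close>

definition adjoint_equivalence ::
  "'u itself \<Rightarrow> 'a ring \<Rightarrow> ('a, 'c, 'y) coring_scheme \<Rightarrow> 'c \<Rightarrow> bool"
  where "adjoint_equivalence (_ :: 'u itself) A C x \<longleftrightarrow>
    (\<forall>N :: (unit, 'a, 'u) bimodule. right_module (coinvariant_ring A C x) N \<longrightarrow>
      unit_map A C x N \<in> right_iso (coinvariant_ring A C x) N
        (coinvariants A C x (induced_comodule A C x N))) \<and>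
    (\<forall>M :: (unit, 'a, 'u, 'c) comodule. comodule A C M \<longrightarrow>
      counit_map M \<in> comodule_iso A C (induced_comodule A C x (coinvariants A C x M)) M)"

end

theory Submission
  imports Defs
begin

text \<open>
  The proof passes through elements.  Since \<open>q # i(a)\<close> is the map \<open>c \<mapsto> q(c) a\<close>, strictness of the
  Morita context means that there are \<open>r\<^sub>i \<in> Q\<close> and \<open>a\<^sub>i \<in> A\<close> with \<open>\<Sum>\<^sub>i r\<^sub>i(c) a\<^sub>i = \<epsilon>(c)\<close> and that \<open>1\<close> is a
  sum of elements \<open>q(xs)\<close> with \<open>q \<in> Q\<close> and \<open>s \<in> A\<close>.  The elements \<open>q(xa)\<close> lie in \<open>B\<close>, so \<open>r\<^sub>i(x-)\<close> and
  \<open>a\<^sub>i\<close> form a dual basis of the left \<open>B\<close>-module \<open>A\<close>, and \<open>c = \<Sum>\<^sub>i r\<^sub>i(c) x a\<^sub>i\<close>.  Explicit inverses follow: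
  \<open>c \<mapsto> \<Sum>\<^sub>i r\<^sub>i(c) \<otimes> a\<^sub>i\<close> for \<open>can\<close>, \<open>\<phi> \<mapsto> (c \<mapsto> \<Sum>\<^sub>i r\<^sub>i(c) \<phi>(a\<^sub>i))\<close> for its dual, and \<open>m \<mapsto> \<Sum>\<^sub>i m\<^sub>0 r\<^sub>i(m\<^sub>1) \<otimes> a\<^sub>i\<close>
  for the counit of the adjunction.

  Conversely, (2) gives the \<open>r\<^sub>i\<close> as preimages of a dual basis of \<open>A\<close> over \<open>B'\<close>; they lie in \<open>Q\<close> because
  the comparison map is injective.  For (1), \<open>B'\<close> is the kernel of \<open>a \<mapsto> ax - xa\<close> by faithful flatness,
  and tensoring the kernel sequence of \<open>Q \<subseteq> \<^sup>*C\<close> with the flat module \<open>A\<close> shows that \<open>\<mu>\<close> is surjective.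
  For (4), \<open>\<mu>\<close> is the counit at the comodule \<open>\<^sup>*C\<close>.  If \<open>\<mu>\<close> is surjective then \<open>A = IA\<close> for the image \<open>I\<close>
  of \<open>\<tau>\<close>, so that \<open>I = B\<close> by faithful flatness, respectively because the unit at \<open>B/I\<close> is injective.
\<close>

section \<open>Additive maps and the universal property of tensor products\<close>

text \<open>The quantifiers in flatness, projectivity, generation and the equivalence range over
  modules with carrier in \<open>'u\<close>, so every module to which such a hypothesis is applied
  needs a copy there. Quotients are therefore realised by choosing representatives, and free modules
  are finite powers.

  The hypothesis on \<open>C\<close> enters through a finite dual basis over \<open>A\<close>. It
  has four consequences: a functional on \<open>C\<close> is determined by finitely many values,
  which lets the left dual ring embed in \<open>'u\<close>; functionals separate the points of
  \<open>C\<close>; a tensor with right factor in \<open>C\<close> is recovered from its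
  contractions with functionals, so that comodule axioms become ring identities; and the equation
  that defines \<open>Q\<close>, being left linear in \<open>c\<close>, has to be checked only at
  the dual basis, so that \<open>Q\<close> is the kernel of a map into a finite power of
  \<open>C\<close>, again a module that fits in \<open>'u\<close>.

  A tensor is a coset in a free abelian group, and \<open>tensor_lift\<close> evaluates at a chosen
  representative. Once this value is known not to depend on the choice, identities between tensors
  are proved by comparing additive maps on pure tensors.\<close>

definition addmap :: "('m, 'x) ring_scheme \<Rightarrow> ('n, 'y) ring_scheme \<Rightarrow> ('m \<Rightarrow> 'n) \<Rightarrow> bool"
  where "addmap M N f \<longleftrightarrow> (\<forall>m\<in>carrier M. f m \<in> carrier N) \<and>
    (\<forall>m\<in>carrier M. \<forall>n\<in>carrier M. f (m \<oplus>\<^bsub>M\<^esub> n) = f m \<oplus>\<^bsub>N\<^esub> f n)"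

lemma addmapI:
  assumes "\<And>m. m \<in> carrier M \<Longrightarrow> f m \<in> carrier N"
    and "\<And>m n. m \<in> carrier M \<Longrightarrow> n \<in> carrier M \<Longrightarrow> f (m \<oplus>\<^bsub>M\<^esub> n) = f m \<oplus>\<^bsub>N\<^esub> f n"
  shows "addmap M N f"
  using assms by (auto simp: addmap_def)

lemma addmap_closed: "addmap M N f \<Longrightarrow> m \<in> carrier M \<Longrightarrow> f m \<in> carrier N"
  and addmap_add: "addmap M N f \<Longrightarrow> m \<in> carrier M \<Longrightarrow> n \<in> carrier M
    \<Longrightarrow> f (m \<oplus>\<^bsub>M\<^esub> n) = f m \<oplus>\<^bsub>N\<^esub> f n"
  by (auto simp: addmap_def)

lemma hom_add_monoid_iff: "f \<in> hom (add_monoid M) (add_monoid N) \<longleftrightarrow> addmap M N f"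
  by (auto simp: hom_def addmap_def)

lemma left_hom_iff: "f \<in> left_hom R M N \<longleftrightarrow> addmap M N f \<and>
    (\<forall>a\<in>carrier R. \<forall>m\<in>carrier M. f (lact M a m) = lact N a (f m))"
  unfolding left_hom_def mem_Collect_eq hom_add_monoid_iff ..

lemma right_hom_iff: "f \<in> right_hom R M N \<longleftrightarrow> addmap M N f \<and>
    (\<forall>a\<in>carrier R. \<forall>m\<in>carrier M. f (ract M m a) = ract N (f m) a)"
  unfolding right_hom_def mem_Collect_eq hom_add_monoid_iff ..

context
  fixes M :: "('m, 'x) ring_scheme" and N :: "('n, 'y) ring_scheme" and f
  assumes M: "abelian_group M" and N: "abelian_group N" and f: "addmap M N f"
begin

interpretation M: abelian_group M by (rule M)
interpretation N: abelian_group N by (rule N)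

lemma addmap_zero: "f \<zero>\<^bsub>M\<^esub> = \<zero>\<^bsub>N\<^esub>"
proof -
  have "f \<zero>\<^bsub>M\<^esub> \<oplus>\<^bsub>N\<^esub> f \<zero>\<^bsub>M\<^esub> = f \<zero>\<^bsub>M\<^esub>"
    using addmap_add [OF f, of "\<zero>\<^bsub>M\<^esub>" "\<zero>\<^bsub>M\<^esub>"] by simp
  then show ?thesis
    using addmap_closed [OF f] by (metis M.zero_closed N.add.l_cancel_one' N.add.r_cancel_one')
qed

lemma addmap_neg: "m \<in> carrier M \<Longrightarrow> f (\<ominus>\<^bsub>M\<^esub> m) = \<ominus>\<^bsub>N\<^esub> f m"
  using addmap_add [OF f, of "\<ominus>\<^bsub>M\<^esub> m" m] addmap_closed [OF f] addmap_zero
  by (simp add: M.l_neg N.minus_equality)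

lemma addmap_minus: "m \<in> carrier M \<Longrightarrow> n \<in> carrier M \<Longrightarrow> f (m \<ominus>\<^bsub>M\<^esub> n) = f m \<ominus>\<^bsub>N\<^esub> f n"
  by (simp add: a_minus_def addmap_add [OF f] addmap_neg)

lemma addmap_finsum:
  "g \<in> I \<rightarrow> carrier M \<Longrightarrow> f (\<Oplus>\<^bsub>M\<^esub>i\<in>I. g i) = (\<Oplus>\<^bsub>N\<^esub>i\<in>I. f (g i))"
proof (induction I rule: infinite_finite_induct)
  case (insert i I)
  then have "g i \<in> carrier M" "g \<in> I \<rightarrow> carrier M" "(\<lambda>i. f (g i)) \<in> I \<rightarrow> carrier N"
    "f (g i) \<in> carrier N"
    using addmap_closed [OF f] by auto
  with insert show ?case
    by (simp add: addmap_add [OF f])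
qed (simp_all add: addmap_zero M.finsum_infinite N.finsum_infinite)

end

lemma addmap_comp: "addmap M N f \<Longrightarrow> addmap N K g \<Longrightarrow> addmap M K (\<lambda>m. g (f m))"
  by (simp add: addmap_def)

lemma addmap_id: "addmap M M (\<lambda>m. m)"
  by (simp add: addmap_def)

lemma addmap_sum:
  assumes "abelian_group N" and f: "\<And>i. i \<in> I \<Longrightarrow> addmap M N (f i)"
  shows "addmap M N (\<lambda>m. \<Oplus>\<^bsub>N\<^esub>i\<in>I. f i m)"
proof (rule addmapI)
  interpret N: abelian_group N by fact
  show "(\<Oplus>\<^bsub>N\<^esub>i\<in>I. f i m) \<in> carrier N" if "m \<in> carrier M" for m
    using addmap_closed [OF f that] by (auto intro!: N.finsum_closed)
  show "(\<Oplus>\<^bsub>N\<^esub>i\<in>I. f i (m \<oplus>\<^bsub>M\<^esub> n)) = (\<Oplus>\<^bsub>N\<^esub>i\<in>I. f i m) \<oplus>\<^bsub>N\<^esub> (\<Oplus>\<^bsub>N\<^esub>i\<in>I. f i n)"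
    if m: "m \<in> carrier M" and n: "n \<in> carrier M" for m n
  proof -
    have "(\<Oplus>\<^bsub>N\<^esub>i\<in>I. f i (m \<oplus>\<^bsub>M\<^esub> n)) = (\<Oplus>\<^bsub>N\<^esub>i\<in>I. f i m \<oplus>\<^bsub>N\<^esub> f i n)"
      by (rule N.finsum_cong') (use m n addmap_add [OF f] addmap_closed [OF f] in auto)
    also have "\<dots> = (\<Oplus>\<^bsub>N\<^esub>i\<in>I. f i m) \<oplus>\<^bsub>N\<^esub> (\<Oplus>\<^bsub>N\<^esub>i\<in>I. f i n)"
      by (rule N.finsum_addf) (use m n addmap_closed [OF f] in auto)
    finally show ?thesis .
  qed
qed

text \<open>Carrier, addition and zero already determine finite sums, integer multiples and
  \<open>tensor_lift\<close>. The congruences move facts between records that share these three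
  fields, such as \<open>A\<close>, \<open>regular A\<close> and the modules of the Morita
  context.\<close>

lemma abelian_group_cong:
  assumes "abelian_group M" "carrier M = carrier N" "ring.add M = ring.add N" "ring.zero M = ring.zero N"
  shows "abelian_group N"
proof -
  interpret M: abelian_group M by (rule assms(1))
  show ?thesis
  proof (rule abelian_groupI, unfold assms(2-4) [symmetric])
    show "\<And>u. u \<in> carrier M \<Longrightarrow> \<exists>v\<in>carrier M. v \<oplus>\<^bsub>M\<^esub> u = \<zero>\<^bsub>M\<^esub>"
      by (rule M.add.l_inv_ex)
  qed (erule (2) M.a_assoc | erule (1) M.a_closed | erule (1) M.a_comm | erule M.l_zero | rule M.zero_closed)+
qed

lemma finsum_ring_cong:
  assumes "carrier M = carrier N" "ring.add M = ring.add N" "ring.zero M = ring.zero N"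
  shows "finsum M f I = finsum N f I"
  using assms by (simp add: finsum_def finprod_def)

lemma add_pow_ring_cong:
  assumes "carrier M = carrier N" "ring.add M = ring.add N" "ring.zero M = ring.zero N"
  shows "add_pow M (k::int) a = add_pow N k a"
  using assms by (simp add: add_pow_def int_pow_def nat_pow_def m_inv_def Let_def)

lemma tensor_lift_ring_cong:
  assumes "carrier M = carrier N" "ring.add M = ring.add N" "ring.zero M = ring.zero N"
  shows "tensor_lift M \<beta> t = tensor_lift N \<beta> t"
  unfolding tensor_lift_def finsum_ring_cong [OF assms] add_pow_ring_cong [OF assms] ..

lemma regular_simps [simp]:
  "carrier (regular A) = carrier A" "add (regular A) = add A" "ring.zero (regular A) = ring.zero A"
  "lact (regular A) = monoid.mult A" "ract (regular A) = monoid.mult A"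
  "one (regular A) = one A" "monoid.mult (regular A) = monoid.mult A"
  by (simp_all add: regular_def ring.defs fun_eq_iff)

lemma tensor_simps:
  "carrier (tensor R M N) = carrier (tensor_group R M N)"
  "ring.add (tensor R M N) = ring.add (tensor_group R M N)"
  "ring.zero (tensor R M N) = ring.zero (tensor_group R M N)"
  by (simp_all add: tensor_def ring.defs)

lemma tensor_lift_tensor: "tensor_lift (tensor R M N) = tensor_lift (tensor_group R M N)"
  by (intro ext tensor_lift_ring_cong tensor_simps)

lemma tensor_lact: "lact (tensor R M N) l t = tensor_lift (tensor R M N) (\<lambda>m n. pure_tensor R M N (lact M l m) n) t"
  unfolding tensor_lift_tensor by (simp add: tensor_def ring.defs)

lemma tensor_ract: "ract (tensor R M N) t s = tensor_lift (tensor R M N) (\<lambda>m n. pure_tensor R M N m (ract N n s)) t"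
  unfolding tensor_lift_tensor by (simp add: tensor_def ring.defs)

text \<open>The right-hand side is the expression by which \<open>tensor_lift\<close> is defined,
  obtained by expanding \<open>p\<close> into multiples of generators. This identifies
  \<open>tensor_lift\<close> on a representative with a group homomorphism.\<close>

lemma frag_hom_expansion:
  assumes "comm_group G" "h \<in> hom (free_Abelian_group S) G" "Poly_Mapping.keys p \<subseteq> S"
  shows "h p = finprod G (\<lambda>z. h (frag_of z) [^]\<^bsub>G\<^esub> (Poly_Mapping.lookup p z :: int)) (Poly_Mapping.keys p)"
proof -
  interpret G: comm_group G by fact
  interpret F: comm_group "free_Abelian_group S" by (rule abelian_free_Abelian_group)
  interpret h: group_hom "free_Abelian_group S" G h
    using assms by unfold_locales (auto simp: hom_def)
  \<comment> \<open>The key set and the coefficients are decoupled from \<open>p\<close>, since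
    removing a key from the sum would change \<open>p\<close>.\<close>
  have *: "finite K \<Longrightarrow> K \<subseteq> S \<Longrightarrow> Poly_Mapping.keys (\<Sum>z\<in>K. frag_cmul (c z) (frag_of z)) \<subseteq> S \<and>
     h (\<Sum>z\<in>K. frag_cmul (c z) (frag_of z)) = finprod G (\<lambda>z. h (frag_of z) [^]\<^bsub>G\<^esub> (c z)) K" for K and c :: "_ \<Rightarrow> int"
  proof (induction K rule: finite_induct)
    case empty
    then show ?case using h.hom_one by simp
  next
    case (insert z K)
    then have z: "z \<in> S" and sub: "Poly_Mapping.keys (\<Sum>z\<in>K. frag_cmul (c z) (frag_of z)) \<subseteq> S" by auto
    have "Poly_Mapping.keys (frag_cmul (c z) (frag_of z)) \<subseteq> S"
      using keys_cmul [of "c z" "frag_of z"] z by auto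
    then have c: "frag_cmul (c z) (frag_of z) \<in> carrier (free_Abelian_group S)" by simp
    have hp: "h (frag_cmul (c z) (frag_of z)) = h (frag_of z) [^]\<^bsub>G\<^esub> (c z)"
      using h.hom_int_pow [of "frag_of z" "c z"] z by simp
    have "h (frag_cmul (c z) (frag_of z) + (\<Sum>z\<in>K. frag_cmul (c z) (frag_of z)))
      = h (frag_cmul (c z) (frag_of z)) \<otimes>\<^bsub>G\<^esub> h (\<Sum>z\<in>K. frag_cmul (c z) (frag_of z))"
      using h.hom_mult [OF c, of "\<Sum>z\<in>K. frag_cmul (c z) (frag_of z)"] sub by simp
    moreover have "Poly_Mapping.keys (frag_cmul (c z) (frag_of z) + (\<Sum>z\<in>K. frag_cmul (c z) (frag_of z))) \<subseteq> S"
      using F.m_closed [OF c, of "\<Sum>z\<in>K. frag_cmul (c z) (frag_of z)"] sub by simp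
    moreover have "(\<lambda>z. h (frag_of z) [^]\<^bsub>G\<^esub> (c z)) \<in> K \<rightarrow> carrier G" "h (frag_of z) [^]\<^bsub>G\<^esub> (c z) \<in> carrier G"
      using insert.prems z by (auto intro!: G.int_pow_closed h.hom_closed)
    ultimately show ?case
      using insert by (simp add: hp)
  qed
  have "p = (\<Sum>z\<in>Poly_Mapping.keys p. frag_cmul (Poly_Mapping.lookup p z) (frag_of z))"
    using frag_expansion [of p] by (simp add: frag_extend_def)
  then show ?thesis
    using * [of "Poly_Mapping.keys p" "Poly_Mapping.lookup p"] assms(3) by simp
qed

section \<open>Balanced maps and the universal property of the tensor product\<close>

definition balanced ::
  "('r, 'z) ring_scheme \<Rightarrow> ('l, 'r, 'm, 'x) bimodule_scheme \<Rightarrow> ('r, 's, 'n, 'y) bimodule_scheme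
    \<Rightarrow> ('g, 'w) ring_scheme \<Rightarrow> ('m \<Rightarrow> 'n \<Rightarrow> 'g) \<Rightarrow> bool"
  where "balanced R M N G \<beta> \<longleftrightarrow>
    (\<forall>n\<in>carrier N. addmap M G (\<lambda>m. \<beta> m n)) \<and> (\<forall>m\<in>carrier M. addmap N G (\<beta> m)) \<and>
    (\<forall>m\<in>carrier M. \<forall>a\<in>carrier R. \<forall>n\<in>carrier N. \<beta> (ract M m a) n = \<beta> m (lact N a n))"

lemma balancedI:
  assumes "\<And>m n. m \<in> carrier M \<Longrightarrow> n \<in> carrier N \<Longrightarrow> \<beta> m n \<in> carrier G"
    and "\<And>m m' n. m \<in> carrier M \<Longrightarrow> m' \<in> carrier M \<Longrightarrow> n \<in> carrier N \<Longrightarrow>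
      \<beta> (m \<oplus>\<^bsub>M\<^esub> m') n = \<beta> m n \<oplus>\<^bsub>G\<^esub> \<beta> m' n"
    and "\<And>m n n'. m \<in> carrier M \<Longrightarrow> n \<in> carrier N \<Longrightarrow> n' \<in> carrier N \<Longrightarrow>
      \<beta> m (n \<oplus>\<^bsub>N\<^esub> n') = \<beta> m n \<oplus>\<^bsub>G\<^esub> \<beta> m n'"
    and "\<And>m a n. m \<in> carrier M \<Longrightarrow> a \<in> carrier R \<Longrightarrow> n \<in> carrier N \<Longrightarrow>
      \<beta> (ract M m a) n = \<beta> m (lact N a n)"
  shows "balanced R M N G \<beta>"
  using assms by (auto simp: balanced_def addmap_def)

lemma (in abelian_group) neg_zero: "\<ominus> \<zero> = \<zero>"
  by (rule minus_equality) simp_all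

lemma (in abelian_group) minus_eq_zero_iff:
  "x \<in> carrier G \<Longrightarrow> y \<in> carrier G \<Longrightarrow> x \<ominus> y = \<zero> \<longleftrightarrow> x = y"
  using add.inv_solve_right [of "\<zero>" x y] by (auto simp: a_minus_def)

text \<open>The two closure conditions place the relators in the free abelian group, which is what
  the construction of the quotient requires. The pairs of the Morita context, over the left dual
  ring and over \<open>B\<close>, enter in this form.\<close>

locale tensor_pair = M: abelian_group M + N: abelian_group N
  for R :: "('r, 'z) ring_scheme" and M :: "('l, 'r, 'm, 'x) bimodule_scheme"
    and N :: "('r, 's, 'n, 'y) bimodule_scheme" +
  assumes ract_M: "m \<in> carrier M \<Longrightarrow> a \<in> carrier R \<Longrightarrow> ract M m a \<in> carrier M"
    and lact_N: "n \<in> carrier N \<Longrightarrow> a \<in> carrier R \<Longrightarrow> lact N a n \<in> carrier N"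
begin

abbreviation "F \<equiv> free_Abelian_group (carrier M \<times> carrier N)"
abbreviation "K \<equiv> tensor_kernel R M N"
abbreviation T where "T \<equiv> tensor R M N"
abbreviation pure (infixl "\<otimes>\<otimes>" 72) where "m \<otimes>\<otimes> n \<equiv> pure_tensor R M N m n"

interpretation F: comm_group F by (rule abelian_free_Abelian_group)

lemma relators_subset: "tensor_relators R M N \<subseteq> carrier F"
proof -
  have 1: "frag_of p \<in> carrier F \<Longrightarrow> frag_of q \<in> carrier F \<Longrightarrow> frag_of p - frag_of q \<in> carrier F" for p q
    using keys_diff [of "frag_of p" "frag_of q"] by auto
  have 2: "frag_of p \<in> carrier F \<Longrightarrow> frag_of q \<in> carrier F \<Longrightarrow> frag_of s \<in> carrier F \<Longrightarrow>
      frag_of p - frag_of q - frag_of s \<in> carrier F" for p q s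
    using keys_diff [of "frag_of p - frag_of q" "frag_of s"] keys_diff [of "frag_of p" "frag_of q"]
    by auto
  show ?thesis
    unfolding tensor_relators_def by (auto intro!: 1 2 simp: ract_M lact_N simp del: carrier_free_Abelian_group_iff)
qed

lemma K_subgroup: "subgroup K F"
  unfolding tensor_kernel_def by (rule F.generate_is_subgroup [OF relators_subset])

lemma K_normal: "K \<lhd> F"
  by (rule F.subgroup_imp_normal [OF K_subgroup])

interpretation K: normal K F by (rule K_normal)

lemma tensor_fields:
  "carrier T = rcosets\<^bsub>F\<^esub> K" "add T = (<#>\<^bsub>F\<^esub>)" "ring.zero T = K"
  by (simp_all add: tensor_simps tensor_group_def Let_def FactGroup_def fun_eq_iff)

lemma tensor_abelian: "abelian_group T"
proof -
  interpret Q: comm_group "F Mod K"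
    by (rule F.abelian_FactGroup [OF K_subgroup])
  have e: "carrier T = carrier (F Mod K)" "ring.add T = monoid.mult (F Mod K)" "ring.zero T = one (F Mod K)"
    by (simp_all add: tensor_fields FactGroup_def)
  show ?thesis
  proof (rule abelian_groupI, unfold e)
    show "\<And>u. u \<in> carrier (F Mod K) \<Longrightarrow>
        \<exists>v\<in>carrier (F Mod K). v \<otimes>\<^bsub>F Mod K\<^esub> u = \<one>\<^bsub>F Mod K\<^esub>"
      by (rule Q.l_inv_ex)
  qed (erule (2) Q.m_assoc | erule (1) Q.m_closed | erule (1) Q.m_comm | erule Q.l_one | rule Q.one_closed)+
qed

sublocale T: abelian_group T by (rule tensor_abelian)

definition "coset_of p = K #>\<^bsub>F\<^esub> p"

lemma coset_of_closed: "p \<in> carrier F \<Longrightarrow> coset_of p \<in> carrier T"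
  by (auto simp: tensor_fields coset_of_def RCOSETS_def)

lemma coset_of_add: "p \<in> carrier F \<Longrightarrow> q \<in> carrier F \<Longrightarrow> coset_of (p + q) = coset_of p \<oplus>\<^bsub>T\<^esub> coset_of q"
  using K.rcos_sum [of p q] by (simp add: tensor_fields coset_of_def)

lemma coset_of_eq_zero: "p \<in> K \<Longrightarrow> coset_of p = \<zero>\<^bsub>T\<^esub>"
  using F.coset_join2 [OF _ K_subgroup] K.subset by (auto simp: tensor_fields coset_of_def)

lemma coset_of_zero: "coset_of 0 = \<zero>\<^bsub>T\<^esub>"
  using K.one_closed by (intro coset_of_eq_zero) simp

lemma coset_of_neg: "p \<in> carrier F \<Longrightarrow> coset_of (- p) = \<ominus>\<^bsub>T\<^esub> coset_of p"
  using coset_of_add [of "- p" p] coset_of_zero coset_of_closed [of p] coset_of_closed [of "-p"]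
  by (simp add: T.minus_equality)

lemma coset_of_diff: "p \<in> carrier F \<Longrightarrow> q \<in> carrier F \<Longrightarrow> coset_of (p - q) = coset_of p \<ominus>\<^bsub>T\<^esub> coset_of q"
  using coset_of_add [of p "- q"] coset_of_neg [of q] by (simp add: a_minus_def)

lemma pure_coset_of: "m \<otimes>\<otimes> n = coset_of (frag_of (m, n))"
  by (simp add: pure_tensor_def coset_of_def)

lemma coset_ofE:
  assumes "t \<in> carrier T" obtains p where "p \<in> carrier F" "t = coset_of p"
  using assms by (auto simp: tensor_fields coset_of_def RCOSETS_def)

lemma pure_closed: "m \<in> carrier M \<Longrightarrow> n \<in> carrier N \<Longrightarrow> m \<otimes>\<otimes> n \<in> carrier T"
  by (simp add: pure_coset_of coset_of_closed)

lemma relator_zero: "r \<in> tensor_relators R M N \<Longrightarrow> coset_of r = \<zero>\<^bsub>T\<^esub>"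
  unfolding tensor_kernel_def by (rule coset_of_eq_zero) (simp add: tensor_kernel_def generate.incl)

text \<open>Both additivity relators have the shape \<open>p - q - s\<close>, and this turns either
  of them into an equation between cosets.\<close>

lemma three_diff:
  assumes "p \<in> carrier F" "q \<in> carrier F" "s \<in> carrier F" "coset_of (p - q - s) = \<zero>\<^bsub>T\<^esub>"
  shows "coset_of p = coset_of q \<oplus>\<^bsub>T\<^esub> coset_of s"
proof -
  have "p - q \<in> carrier F" using assms(1,2) keys_diff [of p q] by auto
  then have 1: "p - q - s \<in> carrier F" using assms(3) keys_diff [of "p - q" s] by auto
  have 2: "p - q - s + q \<in> carrier F" using F.m_closed [OF 1 assms(2)] by simp
  have "coset_of p = coset_of (p - q - s + q + s)" by (simp add: algebra_simps)
  also have "\<dots> = coset_of q \<oplus>\<^bsub>T\<^esub> coset_of s"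
    unfolding coset_of_add [OF 2 assms(3)] coset_of_add [OF 1 assms(2)] assms(4)
    using coset_of_closed [OF assms(2)] by simp
  finally show ?thesis .
qed

lemma pure_add_left:
  assumes "m \<in> carrier M" "m' \<in> carrier M" "n \<in> carrier N"
  shows "(m \<oplus>\<^bsub>M\<^esub> m') \<otimes>\<otimes> n = m \<otimes>\<otimes> n \<oplus>\<^bsub>T\<^esub> m' \<otimes>\<otimes> n"
  unfolding pure_coset_of
  by (rule three_diff, use assms in \<open>simp_all\<close>, rule relator_zero, unfold tensor_relators_def, use assms in blast)

lemma pure_add_right:
  assumes "m \<in> carrier M" "n \<in> carrier N" "n' \<in> carrier N"
  shows "m \<otimes>\<otimes> (n \<oplus>\<^bsub>N\<^esub> n') = m \<otimes>\<otimes> n \<oplus>\<^bsub>T\<^esub> m \<otimes>\<otimes> n'"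
  unfolding pure_coset_of
  by (rule three_diff, use assms in \<open>simp_all\<close>, rule relator_zero, unfold tensor_relators_def, use assms in blast)

lemma pure_balanced:
  assumes "m \<in> carrier M" "a \<in> carrier R" "n \<in> carrier N"
  shows "ract M m a \<otimes>\<otimes> n = m \<otimes>\<otimes> lact N a n"
proof -
  have "coset_of (frag_of (ract M m a, n) - frag_of (m, lact N a n)) = \<zero>\<^bsub>T\<^esub>"
    by (rule relator_zero, unfold tensor_relators_def, use assms in blast)
  then have "coset_of (frag_of (ract M m a, n)) \<ominus>\<^bsub>T\<^esub> coset_of (frag_of (m, lact N a n)) = \<zero>\<^bsub>T\<^esub>"
    using assms ract_M lact_N by (simp add: coset_of_diff)
  then show ?thesis
    using assms by (simp add: pure_coset_of T.minus_eq_zero_iff coset_of_closed ract_M lact_N)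
qed

lemma balanced_pure: "balanced R M N T pure"
  by (rule balancedI) (simp_all add: pure_closed pure_add_left pure_add_right pure_balanced)

lemma pure_addmap_left: "n \<in> carrier N \<Longrightarrow> addmap M T (\<lambda>m. m \<otimes>\<otimes> n)"
  and pure_addmap_right: "m \<in> carrier M \<Longrightarrow> addmap N T (pure m)"
  using balanced_pure by (auto simp: balanced_def)

lemmas pure_zero_left = addmap_zero [OF M.abelian_group_axioms T.abelian_group_axioms pure_addmap_left]
lemmas pure_neg_left = addmap_neg [OF M.abelian_group_axioms T.abelian_group_axioms pure_addmap_left]
lemmas pure_sum_left = addmap_finsum [OF M.abelian_group_axioms T.abelian_group_axioms pure_addmap_left]
lemmas pure_sum_right = addmap_finsum [OF N.abelian_group_axioms T.abelian_group_axioms pure_addmap_right]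

text \<open>Induction on the free abelian group proceeds by differences, so the predicate is carried
  for a coset together with its negative. The negative of a pure tensor is again pure, because the
  sign can be moved into the left factor; hence no case for negatives is left.\<close>

lemma tensor_induct [consumes 1, case_names pure add]:
  assumes "t \<in> carrier T"
    and pure: "\<And>m n. m \<in> carrier M \<Longrightarrow> n \<in> carrier N \<Longrightarrow> P (m \<otimes>\<otimes> n)"
    and add: "\<And>t u. t \<in> carrier T \<Longrightarrow> u \<in> carrier T \<Longrightarrow> P t \<Longrightarrow> P u \<Longrightarrow> P (t \<oplus>\<^bsub>T\<^esub> u)"
  shows "P t"
proof -
  obtain p where p: "p \<in> carrier F" "t = coset_of p" using assms(1) by (rule coset_ofE)
  have "P (coset_of p) \<and> P (\<ominus>\<^bsub>T\<^esub> coset_of p)"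
  proof (rule free_Abelian_group_induct [where P = "\<lambda>p. P (coset_of p) \<and> P (\<ominus>\<^bsub>T\<^esub> coset_of p)"])
    show "Poly_Mapping.keys p \<subseteq> carrier M \<times> carrier N" using p(1) by simp
    show "P (coset_of 0) \<and> P (\<ominus>\<^bsub>T\<^esub> coset_of 0)"
      using pure [of "\<zero>\<^bsub>M\<^esub>" "\<zero>\<^bsub>N\<^esub>"] by (simp add: coset_of_zero pure_zero_left T.neg_zero)
  next
    fix p q
    assume pq: "Poly_Mapping.keys p \<subseteq> carrier M \<times> carrier N" "Poly_Mapping.keys q \<subseteq> carrier M \<times> carrier N"
      "P (coset_of p) \<and> P (\<ominus>\<^bsub>T\<^esub> coset_of p)" "P (coset_of q) \<and> P (\<ominus>\<^bsub>T\<^esub> coset_of q)"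
    then have c: "coset_of p \<in> carrier T" "coset_of q \<in> carrier T" by (simp_all add: coset_of_closed)
    have "coset_of (p - q) = coset_of p \<oplus>\<^bsub>T\<^esub> \<ominus>\<^bsub>T\<^esub> coset_of q" using pq by (simp add: coset_of_diff a_minus_def)
    moreover have "\<ominus>\<^bsub>T\<^esub> (coset_of p \<oplus>\<^bsub>T\<^esub> \<ominus>\<^bsub>T\<^esub> coset_of q) = \<ominus>\<^bsub>T\<^esub> coset_of p \<oplus>\<^bsub>T\<^esub> coset_of q"
      using c by (simp add: T.minus_add)
    ultimately show "P (coset_of (p - q)) \<and> P (\<ominus>\<^bsub>T\<^esub> coset_of (p - q))"
      using c pq add [of "coset_of p" "\<ominus>\<^bsub>T\<^esub> coset_of q"] add [of "\<ominus>\<^bsub>T\<^esub> coset_of p" "coset_of q"] by simp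
  next
    fix z
    assume "z \<in> carrier M \<times> carrier N"
    then obtain m n where z: "z = (m, n)" "m \<in> carrier M" "n \<in> carrier N" by auto
    then show "P (coset_of (frag_of z)) \<and> P (\<ominus>\<^bsub>T\<^esub> coset_of (frag_of z))"
      using pure [of m n] pure [of "\<ominus>\<^bsub>M\<^esub> m" n] by (simp add: pure_coset_of [symmetric] pure_neg_left)
  qed
  then show ?thesis by (simp add: p)
qed

lemma hom_ext:
  assumes "addmap T G f" "addmap T G g" "t \<in> carrier T"
    and "\<And>m n. m \<in> carrier M \<Longrightarrow> n \<in> carrier N \<Longrightarrow> f (m \<otimes>\<otimes> n) = g (m \<otimes>\<otimes> n)"
  shows "f t = g t"
  using assms(3)
  by (induction rule: tensor_induct) (simp_all add: assms(4) addmap_add [OF assms(1)] addmap_add [OF assms(2)])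

text \<open>Sums of tensors are handled by concatenation: the second family is placed on
  \<open>{k..<k+l}\<close>, shifted by \<open>k\<close>. The numbered families obtained here later
  become the finite families of elements of \<open>Q\<close> and \<open>A\<close>.\<close>

lemma tensor_sumE:
  assumes "t \<in> carrier T"
  obtains k :: nat and f g where "f \<in> {..<k} \<rightarrow> carrier M" "g \<in> {..<k} \<rightarrow> carrier N"
    "t = (\<Oplus>\<^bsub>T\<^esub>i\<in>{..<k}. f i \<otimes>\<otimes> g i)"
proof -
  have "\<exists>(k::nat) f g. f \<in> {..<k} \<rightarrow> carrier M \<and> g \<in> {..<k} \<rightarrow> carrier N \<and> t = (\<Oplus>\<^bsub>T\<^esub>i\<in>{..<k}. f i \<otimes>\<otimes> g i)"
    using assms
  proof (induction rule: tensor_induct)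
    case (pure m n)
    then show ?case
      by (intro exI [of _ 1] exI [of _ "\<lambda>_. m"] exI [of _ "\<lambda>_. n"]) (simp add: pure_closed lessThan_Suc)
  next
    case (add t u)
    obtain k :: nat and f g where 1: "f \<in> {..<k} \<rightarrow> carrier M" "g \<in> {..<k} \<rightarrow> carrier N"
      "t = (\<Oplus>\<^bsub>T\<^esub>i\<in>{..<k}. f i \<otimes>\<otimes> g i)" using add by blast
    obtain l :: nat and f' g' where 2: "f' \<in> {..<l} \<rightarrow> carrier M" "g' \<in> {..<l} \<rightarrow> carrier N"
      "u = (\<Oplus>\<^bsub>T\<^esub>i\<in>{..<l}. f' i \<otimes>\<otimes> g' i)" using add by blast
    let ?f = "\<lambda>i. if i < k then f i else f' (i - k)" and ?g = "\<lambda>i. if i < k then g i else g' (i - k)"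
    have f: "?f \<in> {..<k+l} \<rightarrow> carrier M" and g: "?g \<in> {..<k+l} \<rightarrow> carrier N"
      using 1 2 by (auto simp: Pi_iff)
    have fg: "?f i \<otimes>\<otimes> ?g i \<in> carrier T" if "i < k + l" for i
      using funcset_mem [OF f, of i] funcset_mem [OF g, of i] that by (intro pure_closed) simp_all
    define p where "p i = ?f i \<otimes>\<otimes> ?g i" for i
    have pT: "p i \<in> carrier T" if "i < k + l" for i using fg [OF that] by (simp only: p_def)
    have "(\<Oplus>\<^bsub>T\<^esub>i\<in>{..<k+l}. p i) = (\<Oplus>\<^bsub>T\<^esub>i\<in>{..<k} \<union> {k..<k+l}. p i)"
      by (rule arg_cong [of _ _ "finsum T _"]) auto
    also have "\<dots> = (\<Oplus>\<^bsub>T\<^esub>i\<in>{..<k}. p i) \<oplus>\<^bsub>T\<^esub> (\<Oplus>\<^bsub>T\<^esub>i\<in>{k..<k+l}. p i)"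
      by (rule T.finsum_Un_disjoint) (auto intro!: pT)
    also have "(\<Oplus>\<^bsub>T\<^esub>i\<in>{..<k}. p i) = t"
      unfolding 1 by (rule T.finsum_cong') (use 1 in \<open>auto intro!: pure_closed simp: p_def\<close>)
    also have "(\<Oplus>\<^bsub>T\<^esub>i\<in>{k..<k+l}. p i) = (\<Oplus>\<^bsub>T\<^esub>i\<in>(\<lambda>i. i + k) ` {..<l}. p i)"
      by (simp add: lessThan_atLeast0 add.commute)
    also have "\<dots> = (\<Oplus>\<^bsub>T\<^esub>i\<in>{..<l}. p (i + k))"
      by (rule T.finsum_reindex) (auto intro!: pT)
    also have "\<dots> = u"
      unfolding 2 by (rule T.finsum_cong') (use 2 in \<open>auto intro!: pure_closed simp: p_def\<close>)
    finally have "t \<oplus>\<^bsub>T\<^esub> u = (\<Oplus>\<^bsub>T\<^esub>i\<in>{..<k+l}. ?f i \<otimes>\<otimes> ?g i)" by (simp only: p_def)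
    with f g show ?case by blast
  qed
  then show ?thesis using that by blast
qed

context
  fixes G :: "('g, 'w) ring_scheme" and \<beta>
  assumes G: "abelian_group G" and \<beta>: "balanced R M N G \<beta>"
begin

interpretation G: abelian_group G by (rule G)

lemma balanced_rules:
  shows "\<And>m n. m \<in> carrier M \<Longrightarrow> n \<in> carrier N \<Longrightarrow> \<beta> m n \<in> carrier G"
    and "\<And>m m' n. m \<in> carrier M \<Longrightarrow> m' \<in> carrier M \<Longrightarrow> n \<in> carrier N \<Longrightarrow>
      \<beta> (m \<oplus>\<^bsub>M\<^esub> m') n = \<beta> m n \<oplus>\<^bsub>G\<^esub> \<beta> m' n"
    and "\<And>m n n'. m \<in> carrier M \<Longrightarrow> n \<in> carrier N \<Longrightarrow> n' \<in> carrier N \<Longrightarrow>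
      \<beta> m (n \<oplus>\<^bsub>N\<^esub> n') = \<beta> m n \<oplus>\<^bsub>G\<^esub> \<beta> m n'"
    and "\<And>m a n. m \<in> carrier M \<Longrightarrow> a \<in> carrier R \<Longrightarrow> n \<in> carrier N \<Longrightarrow>
      \<beta> (ract M m a) n = \<beta> m (lact N a n)"
  using \<beta> by (auto simp: balanced_def addmap_def)

text \<open>The universal property of the free abelian group provides \<open>h\<close>. Biadditivity
  and balancedness say that \<open>h\<close> kills the relators, hence the subgroup generated by
  them, so \<open>h\<close> depends only on the coset.\<close>

lemma lift_exists:
  "\<exists>h. h \<in> hom F (add_monoid G) \<and> (\<forall>m\<in>carrier M. \<forall>n\<in>carrier N. h (frag_of (m, n)) = \<beta> m n) \<and>
    (\<forall>p\<in>carrier F. tensor_lift G \<beta> (coset_of p) = h p)"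
proof -
  have "(\<lambda>z. \<beta> (fst z) (snd z)) ` (carrier M \<times> carrier N) \<subseteq> carrier (add_monoid G)"
    using balanced_rules by auto
  then obtain h where h: "h \<in> hom F (add_monoid G)"
    and hf: "\<And>z. z \<in> carrier M \<times> carrier N \<Longrightarrow> h (frag_of z) = \<beta> (fst z) (snd z)"
    using comm_group.free_Abelian_group_universal [OF G.a_comm_group] by blast
  interpret h: group_hom F "add_monoid G" h
    using h by unfold_locales (auto simp: hom_def)
  have hd: "h (p - q) = h p \<ominus>\<^bsub>G\<^esub> h q" if "p \<in> carrier F" "q \<in> carrier F" for p q
  proof -
    have "h (p - q) \<oplus>\<^bsub>G\<^esub> h q = h p"
      using h.hom_mult [of "p - q" q] that keys_diff [of p q] by fastforce
    moreover have "h (p - q) \<in> carrier G" "h p \<in> carrier G" "h q \<in> carrier G"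
      using h.hom_closed [of "p - q"] h.hom_closed [of p] h.hom_closed [of q] that keys_diff [of p q] by auto
    ultimately show ?thesis
      by (metis G.add.inv_solve_right a_minus_def)
  qed
  have kk: "frag_of p - frag_of q \<in> carrier F" if "p \<in> carrier M \<times> carrier N" "q \<in> carrier M \<times> carrier N" for p q
    using that keys_diff [of "frag_of p" "frag_of q"] by auto
  have "tensor_relators R M N \<subseteq> kernel F (add_monoid G) h"
  proof
    fix r assume r: "r \<in> tensor_relators R M N"
    then have rF: "r \<in> carrier F" using relators_subset by blast
    have "h r = \<zero>\<^bsub>G\<^esub>"
      using r unfolding tensor_relators_def
    proof (elim UnE CollectE exE conjE, goal_cases)
      case (1 m m' n)
      have "h r = h (frag_of (m \<oplus>\<^bsub>M\<^esub> m', n)) \<ominus>\<^bsub>G\<^esub> h (frag_of (m, n)) \<ominus>\<^bsub>G\<^esub> h (frag_of (m', n))"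
        using 1 kk by (simp add: hd del: carrier_free_Abelian_group_iff)
      then show ?case using 1 hf balanced_rules
        by (simp add: a_minus_def G.a_ac G.r_neg1 G.r_neg G.minus_add)
    next
      case (2 m n n')
      have "h r = h (frag_of (m, n \<oplus>\<^bsub>N\<^esub> n')) \<ominus>\<^bsub>G\<^esub> h (frag_of (m, n)) \<ominus>\<^bsub>G\<^esub> h (frag_of (m, n'))"
        using 2 kk by (simp add: hd del: carrier_free_Abelian_group_iff)
      then show ?case using 2 hf balanced_rules
        by (simp add: a_minus_def G.a_ac G.r_neg1 G.r_neg G.minus_add)
    next
      case (3 m a n)
      then show ?case using hf balanced_rules
        by (simp add: hd ract_M lact_N a_minus_def G.r_neg)
    qed
    then show "r \<in> kernel F (add_monoid G) h" using rF by (simp add: kernel_def)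
  qed
  then have "K \<subseteq> kernel F (add_monoid G) h"
    unfolding tensor_kernel_def by (rule F.generate_subgroup_incl [OF _ h.subgroup_kernel])
  then have hK: "h k = \<zero>\<^bsub>G\<^esub>" if "k \<in> K" for k using that by (auto simp: kernel_def)
  have "tensor_lift G \<beta> (coset_of p) = h p" if p: "p \<in> carrier F" for p
  proof -
    \<comment> \<open>\<open>q\<close> is the representative picked by \<open>tensor_lift\<close>;
      it differs from \<open>p\<close> by an element of the kernel, where \<open>h\<close>
      vanishes.\<close>
    define q where "q = (SOME q. q \<in> coset_of p)"
    have "p \<in> coset_of p" unfolding coset_of_def by (rule F.rcos_self [OF p K_subgroup])
    then have "q \<in> coset_of p" unfolding q_def by (rule someI)
    then obtain k where k: "k \<in> K" "q = k + p" by (auto simp: coset_of_def r_coset_def)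
    have kF: "k \<in> carrier F" using k(1) K.subset by blast
    have q: "q \<in> carrier F" using F.m_closed [OF kF p] k by simp
    have "tensor_lift G \<beta> (coset_of p) = (\<Oplus>\<^bsub>G\<^esub>z \<in> Poly_Mapping.keys q. add_pow G (Poly_Mapping.lookup q z) (\<beta> (fst z) (snd z)))"
      by (simp add: tensor_lift_def q_def Let_def)
    also have "\<dots> = (\<Oplus>\<^bsub>G\<^esub>z \<in> Poly_Mapping.keys q. add_pow G (Poly_Mapping.lookup q z) (h (frag_of z)))"
    proof (rule G.finsum_cong')
      show "(\<lambda>z. add_pow G (Poly_Mapping.lookup q z) (h (frag_of z))) \<in> Poly_Mapping.keys q \<rightarrow> carrier G"
        using q h.hom_closed by (auto intro!: G.add.int_pow_closed)
    qed (use q hf in auto)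
    also have "\<dots> = h q"
      using frag_hom_expansion [OF G.a_comm_group h, of q] q by (simp add: finsum_def add_pow_def)
    also have "\<dots> = h p"
      using h.hom_mult [OF kF p] hK [OF k(1)] h.hom_closed [OF p] by (simp add: k)
    finally show ?thesis .
  qed
  then show ?thesis using h hf by (intro exI [of _ h]) simp
qed

lemma lift_pure: "m \<in> carrier M \<Longrightarrow> n \<in> carrier N \<Longrightarrow> tensor_lift G \<beta> (m \<otimes>\<otimes> n) = \<beta> m n"
  using lift_exists by (auto simp: pure_coset_of)

lemma lift_addmap: "addmap T G (tensor_lift G \<beta>)"
proof -
  obtain h where h: "h \<in> hom F (add_monoid G)"
    "\<forall>p\<in>carrier F. tensor_lift G \<beta> (coset_of p) = h p" using lift_exists by blast
  have hp: "p + q \<in> carrier F" if "p \<in> carrier F" "q \<in> carrier F" for p q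
    using that F.m_closed by simp
  show ?thesis
  proof (rule addmapI)
    show "tensor_lift G \<beta> t \<in> carrier G" if "t \<in> carrier T" for t
      using coset_ofE [OF that] h(2) hom_in_carrier [OF h(1)] by (metis monoid_record_simps(1) partial_object.select_convs(1))
    show "tensor_lift G \<beta> (t \<oplus>\<^bsub>T\<^esub> u) = tensor_lift G \<beta> t \<oplus>\<^bsub>G\<^esub> tensor_lift G \<beta> u"
      if t: "t \<in> carrier T" and u: "u \<in> carrier T" for t u
    proof -
      obtain p q where p: "p \<in> carrier F" "t = coset_of p" and q: "q \<in> carrier F" "u = coset_of q"
        using t u coset_ofE by metis
      have "tensor_lift G \<beta> (t \<oplus>\<^bsub>T\<^esub> u) = h (p + q)"
        using p q h(2) hp by (simp add: coset_of_add [symmetric] del: carrier_free_Abelian_group_iff)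
      also have "\<dots> = h p \<oplus>\<^bsub>G\<^esub> h q"
        using hom_mult [OF h(1) p(1) q(1)] by simp
      finally show ?thesis using h(2) p q by (simp del: carrier_free_Abelian_group_iff)
    qed
  qed
qed


end

end

section \<open>Module structures on tensor products\<close>

lemma tensor_pairI: "right_module R M \<Longrightarrow> left_module R N \<Longrightarrow> tensor_pair R M N"
  by (simp add: tensor_pair_def tensor_pair_axioms_def right_module_def left_module_def
      right_module_axioms_def left_module_axioms_def)

locale tensor_right = tensor_pair R M N + N: right_module S N
  for R :: "('r, 'z) ring_scheme" and S :: "('s, 'w) ring_scheme" and M :: "('l, 'r, 'm, 'x) bimodule_scheme"
    and N :: "('r, 's, 'n, 'y) bimodule_scheme" +
  assumes compat_N: "a \<in> carrier R \<Longrightarrow> b \<in> carrier S \<Longrightarrow> n \<in> carrier N \<Longrightarrow>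
    ract N (lact N a n) b = lact N a (ract N n b)"
begin

lemma ract_balanced: "s \<in> carrier S \<Longrightarrow> balanced R M N T (\<lambda>m n. m \<otimes>\<otimes> ract N n s)"
  by (rule balancedI) (simp_all add: N.ract_closed N.ract_add_left pure_closed pure_add_left pure_add_right
      lact_N compat_N pure_balanced)

lemma ract_pure: "s \<in> carrier S \<Longrightarrow> m \<in> carrier M \<Longrightarrow> n \<in> carrier N \<Longrightarrow>
    ract T (m \<otimes>\<otimes> n) s = m \<otimes>\<otimes> ract N n s"
  unfolding tensor_ract by (rule lift_pure [OF tensor_abelian ract_balanced])

lemma ract_addmap: "s \<in> carrier S \<Longrightarrow> addmap T T (\<lambda>t. ract T t s)"
  unfolding tensor_ract by (rule lift_addmap [OF tensor_abelian ract_balanced])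

lemma tensor_right_module: "right_module S T"
proof -
  note rc = addmap_closed [OF ract_addmap] and ra = addmap_add [OF ract_addmap]
  have 1: "ract T t (a \<oplus>\<^bsub>S\<^esub> b) = ract T t a \<oplus>\<^bsub>T\<^esub> ract T t b"
    if ab: "a \<in> carrier S" "b \<in> carrier S" and t: "t \<in> carrier T" for a b t
    using t
  proof (induction rule: tensor_induct)
    case (pure m n)
    then show ?case
      using ab by (simp add: ract_pure N.ract_add_right pure_add_right N.ract_closed N.R.a_closed)
  next
    case (add t u)
    then show ?case using ab by (simp add: ra N.R.a_closed rc T.a_ac)
  qed
  have 2: "ract T t (a \<otimes>\<^bsub>S\<^esub> b) = ract T (ract T t a) b"
    if ab: "a \<in> carrier S" "b \<in> carrier S" and t: "t \<in> carrier T" for a b t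
    using t
  proof (induction rule: tensor_induct)
    case (pure m n)
    then show ?case
      using ab by (simp add: ract_pure N.ract_assoc N.ract_closed N.R.m_closed)
  next
    case (add t u)
    then show ?case using ab by (simp add: ra N.R.m_closed rc)
  qed
  have 3: "ract T t \<one>\<^bsub>S\<^esub> = t" if t: "t \<in> carrier T" for t
    using t by (induction rule: tensor_induct) (simp_all add: ract_pure N.ract_one ra)
  show ?thesis
    by (intro right_module.intro right_module_axioms.intro N.R.ring_axioms tensor_abelian rc ra 1 2 3)
qed

end

locale tensor_left = tensor_pair R M N + M: left_module L M
  for R :: "('r, 'z) ring_scheme" and L :: "('l, 'w) ring_scheme" and M :: "('l, 'r, 'm, 'x) bimodule_scheme"
    and N :: "('r, 's, 'n, 'y) bimodule_scheme" +
  assumes compat_M: "a \<in> carrier L \<Longrightarrow> b \<in> carrier R \<Longrightarrow> m \<in> carrier M \<Longrightarrow>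
    ract M (lact M a m) b = lact M a (ract M m b)"
begin

lemma lact_balanced: "l \<in> carrier L \<Longrightarrow> balanced R M N T (\<lambda>m n. lact M l m \<otimes>\<otimes> n)"
  by (rule balancedI) (simp_all add: M.lact_closed M.lact_add_right pure_closed pure_add_left pure_add_right
      ract_M compat_M [symmetric] pure_balanced)

lemma lact_pure: "l \<in> carrier L \<Longrightarrow> m \<in> carrier M \<Longrightarrow> n \<in> carrier N \<Longrightarrow>
    lact T l (m \<otimes>\<otimes> n) = lact M l m \<otimes>\<otimes> n"
  unfolding tensor_lact by (rule lift_pure [OF tensor_abelian lact_balanced])

lemma lact_addmap: "l \<in> carrier L \<Longrightarrow> addmap T T (lact T l)"
  unfolding tensor_lact [abs_def] by (rule lift_addmap [OF tensor_abelian lact_balanced])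

lemma tensor_left_module: "left_module L T"
proof -
  note lc = addmap_closed [OF lact_addmap] and la = addmap_add [OF lact_addmap]
  have 1: "lact T (a \<oplus>\<^bsub>L\<^esub> b) t = lact T a t \<oplus>\<^bsub>T\<^esub> lact T b t"
    if ab: "a \<in> carrier L" "b \<in> carrier L" and t: "t \<in> carrier T" for a b t
    using t
  proof (induction rule: tensor_induct)
    case (pure m n)
    then show ?case
      using ab by (simp add: lact_pure M.lact_add_left pure_add_left M.lact_closed M.L.a_closed)
  next
    case (add t u)
    then show ?case using ab by (simp add: la M.L.a_closed lc T.a_ac)
  qed
  have 2: "lact T (a \<otimes>\<^bsub>L\<^esub> b) t = lact T a (lact T b t)"
    if ab: "a \<in> carrier L" "b \<in> carrier L" and t: "t \<in> carrier T" for a b t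
    using t
  proof (induction rule: tensor_induct)
    case (pure m n)
    then show ?case
      using ab by (simp add: lact_pure M.lact_assoc M.lact_closed M.L.m_closed)
  next
    case (add t u)
    then show ?case using ab by (simp add: la M.L.m_closed lc)
  qed
  have 3: "lact T \<one>\<^bsub>L\<^esub> t = t" if t: "t \<in> carrier T" for t
    using t by (induction rule: tensor_induct) (simp_all add: lact_pure M.lact_one la)
  show ?thesis
    by (intro left_module.intro left_module_axioms.intro M.L.ring_axioms tensor_abelian lc la 1 2 3)
qed

end

lemma tensor_rightI: "right_module R M \<Longrightarrow> bimodule R S N \<Longrightarrow> tensor_right R S M N"
  by (intro tensor_right.intro tensor_right_axioms.intro tensor_pairI)
    (auto simp: bimodule_def bimodule_axioms_def)

lemma tensor_leftI: "bimodule L R M \<Longrightarrow> left_module R N \<Longrightarrow> tensor_left R L M N"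
  by (intro tensor_left.intro tensor_left_axioms.intro tensor_pairI)
    (auto simp: bimodule_def bimodule_axioms_def)

lemma tensor_bimodule:
  assumes "bimodule L R M" "bimodule R S N"
  shows "bimodule L S (tensor R M N)"
proof -
  interpret M: bimodule L R M by fact
  interpret N: bimodule R S N by fact
  interpret l: tensor_left R L M N by (intro tensor_leftI M.bimodule_axioms N.left_module_axioms)
  interpret r: tensor_right R S M N by (intro tensor_rightI M.right_module_axioms N.bimodule_axioms)
  interpret lm: left_module L l.T by (rule l.tensor_left_module)
  interpret rm: right_module S l.T by (rule r.tensor_right_module)
  have "ract l.T (lact l.T a t) b = lact l.T a (ract l.T t b)"
    if "a \<in> carrier L" "b \<in> carrier S" and t: "t \<in> carrier l.T" for a b t
    using t
  proof (induction rule: l.tensor_induct)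
    case (pure m n)
    with that show ?case by (simp add: l.lact_pure r.ract_pure M.lact_closed N.ract_closed)
  next
    case (add t u)
    with that show ?case
      by (simp add: lm.lact_add_right rm.ract_add_left lm.lact_closed rm.ract_closed)
  qed
  then show ?thesis
    by (intro bimodule.intro bimodule_axioms.intro lm.left_module_axioms rm.right_module_axioms)
qed

section \<open>Functoriality and associativity of tensor products\<close>

lemma
  assumes P: "tensor_pair R M N" and Q: "tensor_pair R M' N'"
    and f: "f \<in> right_hom R M M'" and g: "g \<in> left_hom R N N'"
  shows tensor_map_pure: "m \<in> carrier M \<Longrightarrow> n \<in> carrier N \<Longrightarrow>
      tensor_map R M' N' f g (pure_tensor R M N m n) = pure_tensor R M' N' (f m) (g n)"
    and tensor_map_addmap: "addmap (tensor R M N) (tensor R M' N') (tensor_map R M' N' f g)"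
proof -
  interpret P: tensor_pair R M N by fact
  interpret Q: tensor_pair R M' N' by fact
  have b: "balanced R M N Q.T (\<lambda>m n. pure_tensor R M' N' (f m) (g n))"
    using f g unfolding right_hom_iff left_hom_iff
    by (intro balancedI)
      (auto simp: addmap_closed addmap_add Q.pure_closed Q.pure_add_left Q.pure_add_right Q.pure_balanced)
  show "m \<in> carrier M \<Longrightarrow> n \<in> carrier N \<Longrightarrow>
      tensor_map R M' N' f g (pure_tensor R M N m n) = pure_tensor R M' N' (f m) (g n)"
    unfolding tensor_map_def by (rule P.lift_pure [OF Q.tensor_abelian b])
  show "addmap (tensor R M N) (tensor R M' N') (tensor_map R M' N' f g)"
    unfolding tensor_map_def by (rule P.lift_addmap [OF Q.tensor_abelian b])
qed

lemma id_left_hom: "(\<lambda>p. p) \<in> left_hom R P P"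
  by (simp add: left_hom_iff addmap_def)

lemma id_right_hom: "(\<lambda>p. p) \<in> right_hom R P P"
  by (simp add: right_hom_iff addmap_def)

text \<open>A lift of lifts: for each fixed \<open>p\<close> the inner lift is a map on
  \<open>M \<otimes> N\<close>, and the outer one needs these maps to be additive and balanced in
  \<open>p\<close>, which is checked by induction on the inner tensor.\<close>

lemma
  assumes M: "right_module R M" and N: "bimodule R S N" and P: "left_module S P"
  shows tensor_assoc_pure: "m \<in> carrier M \<Longrightarrow> n \<in> carrier N \<Longrightarrow> p \<in> carrier P \<Longrightarrow>
      tensor_assoc R S M N P (pure_tensor S (tensor R M N) P (pure_tensor R M N m n) p)
        = pure_tensor R M (tensor S N P) m (pure_tensor S N P n p)"
    and tensor_assoc_addmap: "addmap (tensor S (tensor R M N) P) (tensor R M (tensor S N P)) (tensor_assoc R S M N P)"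
proof -
  interpret M: right_module R M by fact
  interpret N: bimodule R S N by fact
  interpret P: left_module S P by fact
  interpret MN: tensor_right R S M N by (intro tensor_rightI M.right_module_axioms N.bimodule_axioms)
  interpret NP: tensor_left S R N P by (intro tensor_leftI N.bimodule_axioms P.left_module_axioms)
  interpret MNm: right_module S MN.T by (rule MN.tensor_right_module)
  interpret NPm: left_module R NP.T by (rule NP.tensor_left_module)
  interpret X: tensor_pair S MN.T P by (intro tensor_pairI MNm.right_module_axioms P.left_module_axioms)
  interpret Y: tensor_pair R M NP.T by (intro tensor_pairI M.right_module_axioms NPm.left_module_axioms)
  let ?\<beta> = "\<lambda>p m n. pure_tensor R M NP.T m (pure_tensor S N P n p)"
  have b: "balanced R M N Y.T (?\<beta> p)" if "p \<in> carrier P" for p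
    using that
    by (intro balancedI) (simp_all add: NP.pure_closed Y.pure_closed Y.pure_add_left NP.pure_add_left
        Y.pure_add_right NP.lact_pure [symmetric] Y.pure_balanced)
  note l = MN.lift_pure [OF Y.tensor_abelian b] and a = MN.lift_addmap [OF Y.tensor_abelian b]
  have "tensor_lift Y.T (?\<beta> (p \<oplus>\<^bsub>P\<^esub> q)) t = tensor_lift Y.T (?\<beta> p) t \<oplus>\<^bsub>Y.T\<^esub> tensor_lift Y.T (?\<beta> q) t"
    if t: "t \<in> carrier MN.T" and pq: "p \<in> carrier P" "q \<in> carrier P" for p q t
    using t
  proof (induction rule: MN.tensor_induct)
    case (pure m n)
    with pq show ?case by (simp add: l NP.pure_add_right Y.pure_add_right NP.pure_closed)
  next
    case (add t u)
    with pq show ?case by (simp add: addmap_add [OF a] addmap_closed [OF a] Y.T.a_ac)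
  qed
  moreover have "tensor_lift Y.T (?\<beta> p) (ract MN.T t s) = tensor_lift Y.T (?\<beta> (lact P s p)) t"
    if t: "t \<in> carrier MN.T" and p: "p \<in> carrier P" "s \<in> carrier S" for p s t
    using t
  proof (induction rule: MN.tensor_induct)
    case (pure m n)
    with p show ?case by (simp add: l MN.ract_pure N.ract_closed P.lact_closed NP.pure_balanced)
  next
    case (add t u)
    with p show ?case
      by (simp add: addmap_add [OF a] MNm.ract_add_left MNm.ract_closed P.lact_closed)
  qed
  ultimately have B: "balanced S MN.T P Y.T (\<lambda>t p. tensor_lift Y.T (?\<beta> p) t)"
    by (intro balancedI) (simp_all add: addmap_closed [OF a] addmap_add [OF a])
  show "addmap X.T Y.T (tensor_assoc R S M N P)"
    unfolding tensor_assoc_def Let_def by (rule X.lift_addmap [OF Y.tensor_abelian B])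
  have 1: "tensor_assoc R S M N P (pure_tensor S MN.T P t p) = tensor_lift Y.T (?\<beta> p) t"
    if "t \<in> carrier MN.T" "p \<in> carrier P" for t p
    unfolding tensor_assoc_def Let_def by (rule X.lift_pure [OF Y.tensor_abelian B that])
  show "tensor_assoc R S M N P (pure_tensor S MN.T P (pure_tensor R M N m n) p) = ?\<beta> p m n"
    if "m \<in> carrier M" "n \<in> carrier N" "p \<in> carrier P" for m n p
    using that by (simp add: 1 l MN.pure_closed)
qed

section \<open>Transport of modules into a universe\<close>

lemma right_hom_addmap: "f \<in> right_hom R M N \<Longrightarrow> addmap M N f"
  and right_hom_ract: "f \<in> right_hom R M N \<Longrightarrow> a \<in> carrier R \<Longrightarrow> m \<in> carrier M \<Longrightarrow> f (ract M m a) = ract N (f m) a"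
  by (auto simp: right_hom_iff)

lemma left_hom_addmap: "f \<in> left_hom R M N \<Longrightarrow> addmap M N f"
  and left_hom_lact: "f \<in> left_hom R M N \<Longrightarrow> a \<in> carrier R \<Longrightarrow> m \<in> carrier M \<Longrightarrow> f (lact M a m) = lact N a (f m)"
  by (auto simp: left_hom_iff)

lemmas right_hom_closed = addmap_closed [OF right_hom_addmap]
lemmas left_hom_closed = addmap_closed [OF left_hom_addmap]

lemma right_hom_comp: "f \<in> right_hom R M N \<Longrightarrow> g \<in> right_hom R N K \<Longrightarrow> (\<lambda>m. g (f m)) \<in> right_hom R M K"
  by (auto simp: right_hom_iff addmap_def)

lemma left_hom_comp: "f \<in> left_hom R M N \<Longrightarrow> g \<in> left_hom R N K \<Longrightarrow> (\<lambda>m. g (f m)) \<in> left_hom R M K"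
  by (auto simp: left_hom_iff addmap_def)

lemma tensor_map_comp:
  assumes "tensor_pair R M P" "tensor_pair R N P" "tensor_pair R K P"
    and f: "f \<in> right_hom R M N" and g: "g \<in> right_hom R N K" and t: "t \<in> carrier (tensor R M P)"
  shows "tensor_map R K P g (\<lambda>p. p) (tensor_map R N P f (\<lambda>p. p) t) = tensor_map R K P (\<lambda>m. g (f m)) (\<lambda>p. p) t"
proof -
  interpret M: tensor_pair R M P by fact
  interpret N: tensor_pair R N P by fact
  interpret K: tensor_pair R K P by fact
  note F = tensor_map_addmap [OF assms(1,2) f id_left_hom] and G = tensor_map_addmap [OF assms(2,3) g id_left_hom]
    and GF = tensor_map_addmap [OF assms(1,3) right_hom_comp [OF f g] id_left_hom]
  show ?thesis
    using t
  proof (rule M.hom_ext [rotated 2])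
    show "addmap M.T K.T (\<lambda>t. tensor_map R K P g (\<lambda>p. p) (tensor_map R N P f (\<lambda>p. p) t))"
      using F G by (auto simp: addmap_def)
    show "addmap M.T K.T (tensor_map R K P (\<lambda>m. g (f m)) (\<lambda>p. p))" by (rule GF)
  qed (simp add: tensor_map_pure [OF assms(1,2) f id_left_hom] tensor_map_pure [OF assms(2,3) g id_left_hom]
        tensor_map_pure [OF assms(1,3) right_hom_comp [OF f g] id_left_hom] right_hom_closed [OF f])
qed

lemma tensor_map_id:
  assumes K: "tensor_pair R K P" and h: "\<And>k. k \<in> carrier K \<Longrightarrow> h k = k" and t: "t \<in> carrier (tensor R K P)"
  shows "tensor_map R K P h (\<lambda>p. p) t = t"
proof -
  interpret K: tensor_pair R K P by fact
  have hh: "h \<in> right_hom R K K" using h by (auto simp: right_hom_iff addmap_def K.ract_M)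
  show ?thesis using t
    by (rule K.hom_ext [OF tensor_map_addmap [OF K K hh id_left_hom], where g = "\<lambda>t. t", rotated])
      (auto simp: addmap_def tensor_map_pure [OF K K hh id_left_hom] h)
qed

text \<open>\<open>tensor_map\<close> is functorial in its left factor, so a pair of inverse
  homomorphisms induces a pair of inverse maps.\<close>

lemma tensor_map_bij:
  fixes R :: "('r, 'z) ring_scheme" and P :: "('r, 's, 'p, 'y) bimodule_scheme"
  assumes "tensor_pair R M P" "tensor_pair R N P"
    and f: "f \<in> right_hom R M N" and g: "g \<in> right_hom R N M"
    and gf: "\<And>m. m \<in> carrier M \<Longrightarrow> g (f m) = m" and fg: "\<And>n. n \<in> carrier N \<Longrightarrow> f (g n) = n"
  shows "bij_betw (tensor_map R N P f (\<lambda>p. p)) (carrier (tensor R M P)) (carrier (tensor R N P))"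
proof (rule bij_betw_byWitness [where f' = "tensor_map R M P g (\<lambda>p. p)"])
  note F = tensor_map_addmap [OF assms(1,2) f id_left_hom] and G = tensor_map_addmap [OF assms(2,1) g id_left_hom]
  show "tensor_map R N P f (\<lambda>p. p) ` carrier (tensor R M P) \<subseteq> carrier (tensor R N P)"
    "tensor_map R M P g (\<lambda>p. p) ` carrier (tensor R N P) \<subseteq> carrier (tensor R M P)"
    using F G by (auto simp: addmap_def)
  show "\<forall>t\<in>carrier (tensor R M P). tensor_map R M P g (\<lambda>p. p) (tensor_map R N P f (\<lambda>p. p) t) = t"
    by (simp add: tensor_map_comp [OF assms(1,2,1) f g] tensor_map_id [OF assms(1) gf])
  show "\<forall>t\<in>carrier (tensor R N P). tensor_map R N P f (\<lambda>p. p) (tensor_map R M P g (\<lambda>p. p) t) = t"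
    by (simp add: tensor_map_comp [OF assms(2,1,2) g f] tensor_map_id [OF assms(2) fg])
qed

text \<open>
  The structure on the image of \<open>M\<close> under a map into the universe \<open>'u\<close>.  An injective \<open>e\<close> gives a copy of \<open>M\<close>;
  an \<open>e\<close> whose fibres are the cosets of a submodule gives the quotient.
\<close>

definition image_struct ::
  "('m \<Rightarrow> 'u) \<Rightarrow> ('l \<Rightarrow> 'm \<Rightarrow> 'm) \<Rightarrow> ('m \<Rightarrow> 'r \<Rightarrow> 'm) \<Rightarrow> ('m, 'x) ring_scheme \<Rightarrow> ('l, 'r, 'u) bimodule"
  where "image_struct e la ra M = (let s = inv_into (carrier M) e in
    \<lparr>carrier = e ` carrier M, monoid.mult = undefined, one = undefined, ring.zero = e \<zero>\<^bsub>M\<^esub>,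
     ring.add = \<lambda>u v. e (s u \<oplus>\<^bsub>M\<^esub> s v), lact = \<lambda>l u. e (la l (s u)), ract = \<lambda>u r. e (ra (s u) r)\<rparr>)"

lemma image_struct_simps:
  "carrier (image_struct e la ra M) = e ` carrier M"
  "ring.zero (image_struct e la ra M) = e \<zero>\<^bsub>M\<^esub>"
  by (simp_all add: image_struct_def Let_def)

locale image_congruence = abelian_group M for M :: "('m, 'x) ring_scheme" +
  fixes e :: "'m \<Rightarrow> 'u"
  assumes add_cong: "\<lbrakk>m \<in> carrier M; m' \<in> carrier M; n \<in> carrier M; n' \<in> carrier M; e m = e m'; e n = e n'\<rbrakk>
    \<Longrightarrow> e (m \<oplus>\<^bsub>M\<^esub> n) = e (m' \<oplus>\<^bsub>M\<^esub> n')"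
begin

lemma section_closed: "m \<in> carrier M \<Longrightarrow> inv_into (carrier M) e (e m) \<in> carrier M"
  and e_section: "m \<in> carrier M \<Longrightarrow> e (inv_into (carrier M) e (e m)) = e m"
  by (auto intro: inv_into_into f_inv_into_f)

lemma e_mem: "m \<in> carrier M \<Longrightarrow> e m \<in> e ` carrier M"
  by (rule imageI)

lemma image_add: "m \<in> carrier M \<Longrightarrow> n \<in> carrier M \<Longrightarrow>
    e m \<oplus>\<^bsub>image_struct e la ra M\<^esub> e n = e (m \<oplus>\<^bsub>M\<^esub> n)"
  by (simp add: image_struct_def Let_def) (rule add_cong; simp add: section_closed e_section)

lemma image_lact:
  assumes "\<And>m m'. m \<in> carrier M \<Longrightarrow> m' \<in> carrier M \<Longrightarrow> e m = e m' \<Longrightarrow> e (la l m) = e (la l m')"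
    and "m \<in> carrier M"
  shows "lact (image_struct e la ra M) l (e m) = e (la l m)"
  by (simp add: image_struct_def Let_def) (rule assms; simp add: assms section_closed e_section)

lemma image_ract:
  assumes "\<And>m m'. m \<in> carrier M \<Longrightarrow> m' \<in> carrier M \<Longrightarrow> e m = e m' \<Longrightarrow> e (ra m r) = e (ra m' r)"
    and "m \<in> carrier M"
  shows "ract (image_struct e la ra M) (e m) r = e (ra m r)"
  by (simp add: image_struct_def Let_def) (rule assms; simp add: assms section_closed e_section)

lemma image_abelian: "abelian_group (image_struct e la ra M)"
proof (rule abelian_groupI, unfold image_struct_simps)
  show "\<exists>y\<in>e ` carrier M. y \<oplus>\<^bsub>image_struct e la ra M\<^esub> u = e \<zero>\<^bsub>M\<^esub>" if u: "u \<in> e ` carrier M" for u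
  proof -
    from u obtain m where m: "u = e m" "m \<in> carrier M" by (rule imageE)
    then show ?thesis by (intro bexI [of _ "e (\<ominus>\<^bsub>M\<^esub> m)"]) (simp_all add: image_add l_neg)
  qed
next
  fix u v w assume "u \<in> e ` carrier M" "v \<in> e ` carrier M" "w \<in> e ` carrier M"
  then show "u \<oplus>\<^bsub>image_struct e la ra M\<^esub> v \<oplus>\<^bsub>image_struct e la ra M\<^esub> w =
      u \<oplus>\<^bsub>image_struct e la ra M\<^esub> (v \<oplus>\<^bsub>image_struct e la ra M\<^esub> w)"
    by (elim imageE) (simp add: image_add a_assoc)
next
  fix u v assume "u \<in> e ` carrier M" "v \<in> e ` carrier M"
  then show "u \<oplus>\<^bsub>image_struct e la ra M\<^esub> v \<in> e ` carrier M"
    and "u \<oplus>\<^bsub>image_struct e la ra M\<^esub> v = v \<oplus>\<^bsub>image_struct e la ra M\<^esub> u"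
    by (elim imageE, simp add: image_add e_mem a_comm)+
next
  fix u assume "u \<in> e ` carrier M"
  then show "e \<zero>\<^bsub>M\<^esub> \<oplus>\<^bsub>image_struct e la ra M\<^esub> u = u"
    by (elim imageE) (simp add: image_add)
qed (simp add: e_mem)

lemma image_addmap: "addmap M (image_struct e la ra M) e"
  by (rule addmapI) (simp_all add: image_struct_simps image_add)

end

lemma image_left_module:
  assumes M: "left_module R M" and "image_congruence M e"
    and c: "\<And>a m m'. a \<in> carrier R \<Longrightarrow> m \<in> carrier M \<Longrightarrow> m' \<in> carrier M \<Longrightarrow> e m = e m' \<Longrightarrow> e (lact M a m) = e (lact M a m')"
  shows "left_module R (image_struct e (lact M) ra M)" and "e \<in> left_hom R M (image_struct e (lact M) ra M)"
proof -
  interpret M: left_module R M by fact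
  interpret image_congruence M e by fact
  have l: "lact (image_struct e (lact M) ra M) a (e m) = e (lact M a m)" if "a \<in> carrier R" "m \<in> carrier M" for a m
    by (rule image_lact [where la = "lact M" and l = a, OF c [OF that(1)] that(2)])
  let ?I = "image_struct e (lact M) ra M"
  show "left_module R ?I"
  proof (intro left_module.intro left_module_axioms.intro M.L.ring_axioms image_abelian, unfold image_struct_simps)
    show "lact ?I a u \<in> e ` carrier M" if "a \<in> carrier R" "u \<in> e ` carrier M" for a u
      using that by (elim imageE) (simp add: l image_add e_mem M.lact_closed M.lact_add_left M.lact_add_right M.lact_assoc M.lact_one)
    show "lact ?I (a \<oplus>\<^bsub>R\<^esub> b) u = lact ?I a u \<oplus>\<^bsub>?I\<^esub> lact ?I b u" if "a \<in> carrier R" "b \<in> carrier R" "u \<in> e ` carrier M" for a b u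
      using that by (elim imageE) (simp add: l image_add e_mem M.lact_closed M.lact_add_left M.lact_add_right M.lact_assoc M.lact_one)
    show "lact ?I a (u \<oplus>\<^bsub>?I\<^esub> v) = lact ?I a u \<oplus>\<^bsub>?I\<^esub> lact ?I a v" if "a \<in> carrier R" "u \<in> e ` carrier M" "v \<in> e ` carrier M" for a u v
      using that by (elim imageE) (simp add: l image_add e_mem M.lact_closed M.lact_add_left M.lact_add_right M.lact_assoc M.lact_one)
    show "lact ?I (a \<otimes>\<^bsub>R\<^esub> b) u = lact ?I a (lact ?I b u)" if "a \<in> carrier R" "b \<in> carrier R" "u \<in> e ` carrier M" for a b u
      using that by (elim imageE) (simp add: l image_add e_mem M.lact_closed M.lact_add_left M.lact_add_right M.lact_assoc M.lact_one)
    show "lact ?I \<one>\<^bsub>R\<^esub> u = u" if "u \<in> e ` carrier M" for u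
      using that by (elim imageE) (simp add: l image_add e_mem M.lact_closed M.lact_add_left M.lact_add_right M.lact_assoc M.lact_one)
  qed
  show "e \<in> left_hom R M (image_struct e (lact M) ra M)"
    by (simp add: left_hom_iff image_addmap l)
qed

lemma image_right_module:
  assumes M: "right_module R M" and "image_congruence M e"
    and c: "\<And>a m m'. a \<in> carrier R \<Longrightarrow> m \<in> carrier M \<Longrightarrow> m' \<in> carrier M \<Longrightarrow> e m = e m' \<Longrightarrow> e (ract M m a) = e (ract M m' a)"
  shows "right_module R (image_struct e la (ract M) M)" and "e \<in> right_hom R M (image_struct e la (ract M) M)"
proof -
  interpret M: right_module R M by fact
  interpret image_congruence M e by fact
  have l: "ract (image_struct e la (ract M) M) (e m) a = e (ract M m a)" if "a \<in> carrier R" "m \<in> carrier M" for a m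
    by (rule image_ract [where ra = "ract M" and r = a, OF c [OF that(1)] that(2)])
  let ?I = "image_struct e la (ract M) M"
  show "right_module R ?I"
  proof (intro right_module.intro right_module_axioms.intro M.R.ring_axioms image_abelian, unfold image_struct_simps)
    show "ract ?I u a \<in> e ` carrier M" if "a \<in> carrier R" "u \<in> e ` carrier M" for a u
      using that by (elim imageE) (simp add: l image_add e_mem M.ract_closed M.ract_add_left M.ract_add_right M.ract_assoc M.ract_one)
    show "ract ?I u (a \<oplus>\<^bsub>R\<^esub> b) = ract ?I u a \<oplus>\<^bsub>?I\<^esub> ract ?I u b" if "a \<in> carrier R" "b \<in> carrier R" "u \<in> e ` carrier M" for a b u
      using that by (elim imageE) (simp add: l image_add e_mem M.ract_closed M.ract_add_left M.ract_add_right M.ract_assoc M.ract_one)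
    show "ract ?I (u \<oplus>\<^bsub>?I\<^esub> v) a = ract ?I u a \<oplus>\<^bsub>?I\<^esub> ract ?I v a" if "a \<in> carrier R" "u \<in> e ` carrier M" "v \<in> e ` carrier M" for a u v
      using that by (elim imageE) (simp add: l image_add e_mem M.ract_closed M.ract_add_left M.ract_add_right M.ract_assoc M.ract_one)
    show "ract ?I u (a \<otimes>\<^bsub>R\<^esub> b) = ract ?I (ract ?I u a) b" if "a \<in> carrier R" "b \<in> carrier R" "u \<in> e ` carrier M" for a b u
      using that by (elim imageE) (simp add: l image_add e_mem M.ract_closed M.ract_add_left M.ract_add_right M.ract_assoc M.ract_one)
    show "ract ?I u \<one>\<^bsub>R\<^esub> = u" if "u \<in> e ` carrier M" for u
      using that by (elim imageE) (simp add: l image_add e_mem M.ract_closed M.ract_add_left M.ract_add_right M.ract_assoc M.ract_one)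
  qed
  show "e \<in> right_hom R M (image_struct e la (ract M) M)"
    by (simp add: right_hom_iff image_addmap l)
qed

lemma inj_image_congruence: "abelian_group M \<Longrightarrow> inj_on e (carrier M) \<Longrightarrow> image_congruence M e"
  by (auto simp: image_congruence_def image_congruence_axioms_def inj_on_eq_iff)

lemma left_hom_inverse:
  assumes M: "left_module R M" and f: "f \<in> left_hom R M N" and b: "bij_betw f (carrier M) (carrier N)"
  shows "inv_into (carrier M) f \<in> left_hom R N M"
proof -
  interpret M: left_module R M by fact
  let ?g = "inv_into (carrier M) f"
  have g: "\<And>n. n \<in> carrier N \<Longrightarrow> ?g n \<in> carrier M" "\<And>n. n \<in> carrier N \<Longrightarrow> f (?g n) = n"
    "\<And>m. m \<in> carrier M \<Longrightarrow> ?g (f m) = m"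
    using b by (auto simp: bij_betw_def inv_into_into f_inv_into_f)
  have "?g (m \<oplus>\<^bsub>N\<^esub> n) = ?g m \<oplus>\<^bsub>M\<^esub> ?g n" if "m \<in> carrier N" "n \<in> carrier N" for m n
    using g(3) [of "?g m \<oplus>\<^bsub>M\<^esub> ?g n"] that by (simp add: addmap_add [OF left_hom_addmap [OF f]] g)
  moreover have "?g (lact N a n) = lact M a (?g n)" if "a \<in> carrier R" "n \<in> carrier N" for a n
    using g(3) [of "lact M a (?g n)"] that by (simp add: left_hom_lact [OF f] g M.lact_closed)
  ultimately show ?thesis by (auto simp: left_hom_iff addmap_def g)
qed

lemma right_hom_inverse:
  assumes M: "right_module R M" and f: "f \<in> right_hom R M N" and b: "bij_betw f (carrier M) (carrier N)"
  shows "inv_into (carrier M) f \<in> right_hom R N M"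
proof -
  interpret M: right_module R M by fact
  let ?g = "inv_into (carrier M) f"
  have g: "\<And>n. n \<in> carrier N \<Longrightarrow> ?g n \<in> carrier M" "\<And>n. n \<in> carrier N \<Longrightarrow> f (?g n) = n"
    "\<And>m. m \<in> carrier M \<Longrightarrow> ?g (f m) = m"
    using b by (auto simp: bij_betw_def inv_into_into f_inv_into_f)
  have "?g (m \<oplus>\<^bsub>N\<^esub> n) = ?g m \<oplus>\<^bsub>M\<^esub> ?g n" if "m \<in> carrier N" "n \<in> carrier N" for m n
    using g(3) [of "?g m \<oplus>\<^bsub>M\<^esub> ?g n"] that by (simp add: addmap_add [OF right_hom_addmap [OF f]] g)
  moreover have "?g (ract N n a) = ract M (?g n) a" if "a \<in> carrier R" "n \<in> carrier N" for a n
    using g(3) [of "ract M (?g n) a"] that by (simp add: right_hom_ract [OF f] g M.ract_closed)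
  ultimately show ?thesis by (auto simp: right_hom_iff addmap_def g)
qed

lemma left_module_copy:
  assumes M: "left_module R M" and c: "carrier M \<lesssim> (UNIV :: 'u set)"
  obtains N :: "('r, 's, 'u) bimodule" and e d where "left_module R N" "e \<in> left_hom R M N" "d \<in> left_hom R N M"
    "\<And>m. m \<in> carrier M \<Longrightarrow> d (e m) = m" "\<And>n. n \<in> carrier N \<Longrightarrow> e (d n) = n"
    "bij_betw e (carrier M) (carrier N)"
proof -
  interpret M: left_module R M by fact
  obtain e :: "_ \<Rightarrow> 'u" where e: "inj_on e (carrier M)" using c by (auto simp: lepoll_def)
  let ?N = "image_struct e (lact M) undefined M"
  have ic: "image_congruence M e" by (rule inj_image_congruence [OF M.M.abelian_group_axioms e])
  have N: "left_module R ?N" "e \<in> left_hom R M ?N"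
    using image_left_module [OF M ic] e by (simp_all add: inj_on_eq_iff)
  have b: "bij_betw e (carrier M) (carrier ?N)" using e by (simp add: bij_betw_def image_struct_simps)
  show ?thesis
    by (rule that [OF N left_hom_inverse [OF M N(2) b] bij_betw_inv_into_left [OF b] bij_betw_inv_into_right [OF b] b])
qed

lemma right_module_copy:
  assumes M: "right_module R M" and c: "carrier M \<lesssim> (UNIV :: 'u set)"
  obtains N :: "('s, 'r, 'u) bimodule" and e d where "right_module R N" "e \<in> right_hom R M N" "d \<in> right_hom R N M"
    "\<And>m. m \<in> carrier M \<Longrightarrow> d (e m) = m" "\<And>n. n \<in> carrier N \<Longrightarrow> e (d n) = n"
    "bij_betw e (carrier M) (carrier N)"
proof -
  interpret M: right_module R M by fact
  obtain e :: "_ \<Rightarrow> 'u" where e: "inj_on e (carrier M)" using c by (auto simp: lepoll_def)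
  let ?N = "image_struct e undefined (ract M) M"
  have ic: "image_congruence M e" by (rule inj_image_congruence [OF M.M.abelian_group_axioms e])
  have N: "right_module R ?N" "e \<in> right_hom R M ?N"
    using image_right_module [OF M ic] e by (simp_all add: inj_on_eq_iff)
  have b: "bij_betw e (carrier M) (carrier ?N)" using e by (simp add: bij_betw_def image_struct_simps)
  show ?thesis
    by (rule that [OF N right_hom_inverse [OF M N(2) b] bij_betw_inv_into_left [OF b] bij_betw_inv_into_right [OF b] b])
qed

text \<open>An infinite type absorbs its own square, so finite powers of a set that embeds in it
  embed again, by induction on the index set. The powers in question are the free modules
  \<open>R^S\<close> and the powers \<open>A^J\<close> and \<open>C^J\<close> over the dual basis of
  the coring.\<close>

lemma lepoll_PiE:
  assumes "infinite (UNIV :: 'u set)" "finite I" "W \<lesssim> (UNIV :: 'u set)"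
  shows "(I \<rightarrow>\<^sub>E W) \<lesssim> (UNIV :: 'u set)"
  using assms(2)
proof (induction I rule: finite_induct)
  case empty
  then show ?case by (simp add: lepoll_def)
next
  case (insert i I)
  have "(insert i I \<rightarrow>\<^sub>E W) \<lesssim> W \<times> (I \<rightarrow>\<^sub>E W)"
    unfolding lepoll_def
  proof (intro exI conjI)
    show "inj_on (\<lambda>f. (f i, restrict f I)) (insert i I \<rightarrow>\<^sub>E W)"
      by (rule inj_onI, rule PiE_ext, assumption+) (auto, metis restrict_apply')
  qed (auto simp: PiE_iff)
  also have "\<dots> \<lesssim> (UNIV :: 'u set) \<times> (UNIV :: 'u set)"
    by (rule times_lepoll_mono [OF assms(3) insert.IH])
  also have "\<dots> \<lesssim> (UNIV :: 'u set)"
    unfolding lepoll_def card_of_ordLeq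
    using card_of_Times_same_infinite [OF assms(1)] by (simp add: ordIso_iff_ordLeq)
  finally show ?case .
qed

text \<open>The lifting problem is conjugated by the isomorphisms with copies in \<open>'u\<close>,
  solved there, and the solution is brought back along \<open>d\<close>.\<close>

lemma left_projective_lift:
  assumes P: "left_projective TYPE('u) R P" and N: "left_module R N" "left_module R N'"
    and c: "carrier N \<lesssim> (UNIV :: 'u set)" "carrier N' \<lesssim> (UNIV :: 'u set)"
    and g: "g \<in> left_hom R N N'" and f: "f \<in> left_hom R P N'" and s: "g ` carrier N = carrier N'"
  obtains h where "h \<in> left_hom R P N" "\<And>p. p \<in> carrier P \<Longrightarrow> g (h p) = f p"
proof -
  obtain W :: "('a, unit, 'u) bimodule" and e d where W: "left_module R W" "e \<in> left_hom R N W" "d \<in> left_hom R W N"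
    "\<And>m. m \<in> carrier N \<Longrightarrow> d (e m) = m" "\<And>n. n \<in> carrier W \<Longrightarrow> e (d n) = n" "bij_betw e (carrier N) (carrier W)"
    using left_module_copy [OF N(1) c(1)] by metis
  obtain W' :: "('a, unit, 'u) bimodule" and e' d' where W': "left_module R W'" "e' \<in> left_hom R N' W'" "d' \<in> left_hom R W' N'"
    "\<And>m. m \<in> carrier N' \<Longrightarrow> d' (e' m) = m" "\<And>n. n \<in> carrier W' \<Longrightarrow> e' (d' n) = n" "bij_betw e' (carrier N') (carrier W')"
    using left_module_copy [OF N(2) c(2)] by metis
  have g': "(\<lambda>u. e' (g (d u))) \<in> left_hom R W W'"
    by (rule left_hom_comp [OF left_hom_comp [OF W(3) g] W'(2)])
  have f': "(\<lambda>u. e' (f u)) \<in> left_hom R P W'"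
    by (rule left_hom_comp [OF f W'(2)])
  have "(\<lambda>u. e' (g (d u))) ` carrier W = e' ` (g ` (d ` (e ` carrier N)))"
    using W(6) by (auto simp: bij_betw_def)
  also have "d ` (e ` carrier N) = carrier N" using W(4) by force
  finally have "(\<lambda>u. e' (g (d u))) ` carrier W = carrier W'"
    using W'(6) by (simp add: s bij_betw_def)
  from P [unfolded left_projective_def, rule_format, OF W(1) W'(1) g' f' this]
  obtain h where h: "h \<in> left_hom R P W" "\<And>p. p \<in> carrier P \<Longrightarrow> e' (g (d (h p))) = e' (f p)"
    by blast
  show ?thesis
  proof (rule that [OF left_hom_comp [OF h(1) W(3)]])
    show "g (d (h p)) = f p" if "p \<in> carrier P" for p
      using arg_cong [OF h(2) [OF that], of d'] that
      by (simp add: W'(4) left_hom_closed [OF g] left_hom_closed [OF f] left_hom_closed [OF W(3)] left_hom_closed [OF h(1)])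
  qed
qed

lemma left_generator_separates:
  assumes P: "left_generator TYPE('u) R P" and N: "left_module R N" "left_module R N'"
    and c: "carrier N \<lesssim> (UNIV :: 'u set)" "carrier N' \<lesssim> (UNIV :: 'u set)"
    and f: "f \<in> left_hom R N N'" and g: "g \<in> left_hom R N N'"
    and eq: "\<And>h p. h \<in> left_hom R P N \<Longrightarrow> p \<in> carrier P \<Longrightarrow> f (h p) = g (h p)"
    and x: "x \<in> carrier N"
  shows "f x = g x"
proof -
  obtain W :: "('a, unit, 'u) bimodule" and e d where W: "left_module R W" "e \<in> left_hom R N W" "d \<in> left_hom R W N"
    "\<And>m. m \<in> carrier N \<Longrightarrow> d (e m) = m" "\<And>n. n \<in> carrier W \<Longrightarrow> e (d n) = n" "bij_betw e (carrier N) (carrier W)"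
    using left_module_copy [OF N(1) c(1)] by metis
  obtain W' :: "('a, unit, 'u) bimodule" and e' d' where W': "left_module R W'" "e' \<in> left_hom R N' W'" "d' \<in> left_hom R W' N'"
    "\<And>m. m \<in> carrier N' \<Longrightarrow> d' (e' m) = m" "\<And>n. n \<in> carrier W' \<Longrightarrow> e' (d' n) = n" "bij_betw e' (carrier N') (carrier W')"
    using left_module_copy [OF N(2) c(2)] by metis
  have *: "(\<lambda>u. e' (k (d u))) \<in> left_hom R W W'" if "k \<in> left_hom R N N'" for k
    by (rule left_hom_comp [OF left_hom_comp [OF W(3) that] W'(2)])
  define f' where "f' = (\<lambda>u. e' (f (d u)))"
  define g' where "g' = (\<lambda>u. e' (g (d u)))"
  have f': "f' \<in> left_hom R W W'" and g': "g' \<in> left_hom R W W'"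
    unfolding f'_def g'_def by (rule * [OF f], rule * [OF g])
  have "\<forall>h\<in>left_hom R P W. \<forall>p\<in>carrier P. f' (h p) = g' (h p)"
    using eq [OF left_hom_comp [OF _ W(3)]] by (simp add: f'_def g'_def)
  from P [unfolded left_generator_def, THEN spec [of _ W], THEN spec [of _ W'], THEN mp, OF W(1), THEN mp, OF W'(1),
      THEN bspec, OF f', THEN bspec, OF g', THEN mp, OF this, THEN bspec, OF left_hom_closed [OF W(2) x]]
  have "f' (e x) = g' (e x)" .
  then have "e' (f x) = e' (g x)"
    unfolding f'_def g'_def W(4) [OF x] .
  then show ?thesis
    using W'(4) [OF left_hom_closed [OF f x]] W'(4) [OF left_hom_closed [OF g x]] by metis
qed

text \<open>In a ladder with bijective vertical maps at the first two places, image and kernel at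
  the middle correspond under \<open>E'\<close>. At the third place injectivity lets zero be
  recognised.\<close>

lemma exact_at_transfer:
  assumes E: "bij_betw E (carrier W) (carrier Y)" "bij_betw E' (carrier W') (carrier Y')" "inj_on E'' (carrier W'')"
    and f: "\<And>x. x \<in> carrier W \<Longrightarrow> f x \<in> carrier W'" "\<And>x. x \<in> carrier W \<Longrightarrow> E' (f x) = f' (E x)"
    and g: "\<And>x. x \<in> carrier W' \<Longrightarrow> g x \<in> carrier W''" "\<And>x. x \<in> carrier W' \<Longrightarrow> E'' (g x) = g' (E' x)"
    and z: "\<zero>\<^bsub>W''\<^esub> \<in> carrier W''" "E'' \<zero>\<^bsub>W''\<^esub> = \<zero>\<^bsub>Y''\<^esub>"
  shows "exact_at W W' W'' f g \<longleftrightarrow> exact_at Y Y' Y'' f' g'"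
proof -
  have 1: "f' ` carrier Y = E' ` (f ` carrier W)"
    unfolding bij_betw_imp_surj_on [OF E(1), symmetric] image_image by (rule image_cong) (simp_all add: f(2))
  have "g x = \<zero>\<^bsub>W''\<^esub> \<longleftrightarrow> g' (E' x) = \<zero>\<^bsub>Y''\<^esub>" if "x \<in> carrier W'" for x
    using inj_on_eq_iff [OF E(3) g(1) [OF that] z(1)] g(2) [OF that] z(2) by simp
  then have 2: "{y \<in> carrier Y'. g' y = \<zero>\<^bsub>Y''\<^esub>} = E' ` {x \<in> carrier W'. g x = \<zero>\<^bsub>W''\<^esub>}"
    unfolding bij_betw_imp_surj_on [OF E(2), symmetric] by auto
  have "f ` carrier W \<subseteq> carrier W'" using f(1) by auto
  then show ?thesis
    unfolding exact_at_def 1 2 using E(2)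
    by (subst inj_on_image_eq_iff [of E' "carrier W'"]) (auto simp: bij_betw_def)
qed

text \<open>Exactness is transferred along two ladders: one between the modules and their copies in
  \<open>'u\<close>, and the one obtained from it by tensoring with \<open>P\<close>, which commutes
  because \<open>tensor_map\<close> respects composition.\<close>

lemma left_faithfully_flat_exact:
  assumes P: "left_faithfully_flat TYPE('u) R P"
    and N: "right_module R N" "right_module R N'" "right_module R N''"
    and c: "carrier N \<lesssim> (UNIV :: 'u set)" "carrier N' \<lesssim> (UNIV :: 'u set)" "carrier N'' \<lesssim> (UNIV :: 'u set)"
    and f: "f \<in> right_hom R N N'" and g: "g \<in> right_hom R N' N''"
  shows "exact_at N N' N'' f g \<longleftrightarrow> exact_at (tensor R N P) (tensor R N' P) (tensor R N'' P)
          (tensor_map R N' P f (\<lambda>p. p)) (tensor_map R N'' P g (\<lambda>p. p))"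
proof -
  have lP: "left_module R P" using P by (simp add: left_faithfully_flat_def)
  obtain W :: "(unit, 'a, 'u) bimodule" and e d where W: "right_module R W" "e \<in> right_hom R N W" "d \<in> right_hom R W N"
    "\<And>m. m \<in> carrier N \<Longrightarrow> d (e m) = m" "\<And>n. n \<in> carrier W \<Longrightarrow> e (d n) = n" "bij_betw e (carrier N) (carrier W)"
    using right_module_copy [OF N(1) c(1)] by metis
  obtain W' :: "(unit, 'a, 'u) bimodule" and e' d' where W': "right_module R W'" "e' \<in> right_hom R N' W'" "d' \<in> right_hom R W' N'"
    "\<And>m. m \<in> carrier N' \<Longrightarrow> d' (e' m) = m" "\<And>n. n \<in> carrier W' \<Longrightarrow> e' (d' n) = n" "bij_betw e' (carrier N') (carrier W')"
    using right_module_copy [OF N(2) c(2)] by metis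
  obtain W'' :: "(unit, 'a, 'u) bimodule" and e'' d'' where W'': "right_module R W''" "e'' \<in> right_hom R N'' W''" "d'' \<in> right_hom R W'' N''"
    "\<And>m. m \<in> carrier N'' \<Longrightarrow> d'' (e'' m) = m" "\<And>n. n \<in> carrier W'' \<Longrightarrow> e'' (d'' n) = n" "bij_betw e'' (carrier N'') (carrier W'')"
    using right_module_copy [OF N(3) c(3)] by metis
  interpret N: right_module R N by fact
  interpret N': right_module R N' by fact
  interpret N'': right_module R N'' by fact
  interpret W'': right_module R W'' by fact
  let ?f = "\<lambda>u. e' (f (d u))" and ?g = "\<lambda>u. e'' (g (d' u))"
  have f': "?f \<in> right_hom R W W'" by (rule right_hom_comp [OF right_hom_comp [OF W(3) f] W'(2)])
  have g': "?g \<in> right_hom R W' W''" by (rule right_hom_comp [OF right_hom_comp [OF W'(3) g] W''(2)])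
  note p = tensor_pairI [OF N(1) lP] tensor_pairI [OF N(2) lP] tensor_pairI [OF N(3) lP]
    tensor_pairI [OF W(1) lP] tensor_pairI [OF W'(1) lP] tensor_pairI [OF W''(1) lP]
  interpret TN'': tensor_pair R N'' P by (rule p)
  interpret TX'': tensor_pair R W'' P by (rule p)
  have "exact_at N N' N'' f g \<longleftrightarrow> exact_at W W' W'' ?f ?g"
    by (rule exact_at_transfer [OF W(6) W'(6), where E'' = e''])
      (use W''(6) in \<open>auto simp: bij_betw_def W W' right_hom_closed [OF f] right_hom_closed [OF g]
        addmap_zero [OF N''.M.abelian_group_axioms W''.M.abelian_group_axioms right_hom_addmap [OF W''(2)]]\<close>)
  also have "\<dots> \<longleftrightarrow> exact_at (tensor R W P) (tensor R W' P) (tensor R W'' P)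
          (tensor_map R W' P ?f (\<lambda>p. p)) (tensor_map R W'' P ?g (\<lambda>p. p))"
    using P f' g' unfolding left_faithfully_flat_def by (simp add: W(1) W'(1) W''(1))
  also have "\<dots> \<longleftrightarrow> exact_at (tensor R N P) (tensor R N' P) (tensor R N'' P)
          (tensor_map R N' P f (\<lambda>p. p)) (tensor_map R N'' P g (\<lambda>p. p))"
  proof (rule exact_at_transfer [symmetric])
    show "bij_betw (tensor_map R W P e (\<lambda>p. p)) (carrier (tensor R N P)) (carrier (tensor R W P))"
      by (rule tensor_map_bij [OF p(1) p(4) W(2,3,4,5)])
    show "bij_betw (tensor_map R W' P e' (\<lambda>p. p)) (carrier (tensor R N' P)) (carrier (tensor R W' P))"
      by (rule tensor_map_bij [OF p(2) p(5) W'(2,3,4,5)])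
    show "inj_on (tensor_map R W'' P e'' (\<lambda>p. p)) (carrier (tensor R N'' P))"
      using tensor_map_bij [OF p(3) p(6) W''(2,3,4,5)] by (simp add: bij_betw_def)
    show "tensor_map R N' P f (\<lambda>p. p) t \<in> carrier (tensor R N' P)" if "t \<in> carrier (tensor R N P)" for t
      by (rule addmap_closed [OF tensor_map_addmap [OF p(1,2) f id_left_hom] that])
    show "tensor_map R N'' P g (\<lambda>p. p) t \<in> carrier (tensor R N'' P)" if "t \<in> carrier (tensor R N' P)" for t
      by (rule addmap_closed [OF tensor_map_addmap [OF p(2,3) g id_left_hom] that])
    show "tensor_map R W' P e' (\<lambda>p. p) (tensor_map R N' P f (\<lambda>p. p) t) =
        tensor_map R W' P ?f (\<lambda>p. p) (tensor_map R W P e (\<lambda>p. p) t)" if t: "t \<in> carrier (tensor R N P)" for t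
      unfolding tensor_map_comp [OF p(1,2,5) f W'(2) t] tensor_map_comp [OF p(1,4,5) W(2) f' t]
      by (rule tensor_pair.hom_ext [OF p(1) tensor_map_addmap [OF p(1,5) right_hom_comp [OF f W'(2)] id_left_hom]
            tensor_map_addmap [OF p(1,5) right_hom_comp [OF W(2) f'] id_left_hom] t])
        (simp add: tensor_map_pure [OF p(1,5) right_hom_comp [OF f W'(2)] id_left_hom]
            tensor_map_pure [OF p(1,5) right_hom_comp [OF W(2) f'] id_left_hom] W(4))
    show "tensor_map R W'' P e'' (\<lambda>p. p) (tensor_map R N'' P g (\<lambda>p. p) t) =
        tensor_map R W'' P ?g (\<lambda>p. p) (tensor_map R W' P e' (\<lambda>p. p) t)" if t: "t \<in> carrier (tensor R N' P)" for t
      unfolding tensor_map_comp [OF p(2,3,6) g W''(2) t] tensor_map_comp [OF p(2,5,6) W'(2) g' t]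
      by (rule tensor_pair.hom_ext [OF p(2) tensor_map_addmap [OF p(2,6) right_hom_comp [OF g W''(2)] id_left_hom]
            tensor_map_addmap [OF p(2,6) right_hom_comp [OF W'(2) g'] id_left_hom] t])
        (simp add: tensor_map_pure [OF p(2,6) right_hom_comp [OF g W''(2)] id_left_hom]
            tensor_map_pure [OF p(2,6) right_hom_comp [OF W'(2) g'] id_left_hom] W'(4))
    show "tensor_map R W'' P e'' (\<lambda>p. p) \<zero>\<^bsub>TN''.T\<^esub> = \<zero>\<^bsub>TX''.T\<^esub>"
      by (rule addmap_zero [OF TN''.tensor_abelian TX''.tensor_abelian tensor_map_addmap [OF p(3,6) W''(2) id_left_hom]])
  qed simp
  finally show ?thesis .
qed

section \<open>Dual bases, trace ideals and faithful flatness\<close>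

lemma regular_abelian: "ring A \<Longrightarrow> abelian_group (regular A)"
  by (rule abelian_group_cong [OF ring.is_abelian_group]) simp_all

lemma regular_left_module: "ring A \<Longrightarrow> left_module A (regular A)"
  by (intro left_module.intro left_module_axioms.intro regular_abelian)
    (simp_all add: ring.ring_simprules monoid.m_closed ring.is_monoid)

lemma regular_right_module: "ring A \<Longrightarrow> right_module A (regular A)"
  by (intro right_module.intro right_module_axioms.intro regular_abelian)
    (simp_all add: ring.ring_simprules monoid.r_one ring.is_monoid)

context left_module
begin

lemma lact_addmap: "a \<in> carrier R \<Longrightarrow> addmap M M (lact M a)"
  by (simp add: addmap_def lact_closed lact_add_right)

lemma act_addmap_left: "m \<in> carrier M \<Longrightarrow> addmap R M (\<lambda>a. lact M a m)"
  by (simp add: addmap_def lact_closed lact_add_left)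

lemmas lact_zero = addmap_zero [OF M.abelian_group_axioms M.abelian_group_axioms lact_addmap]
lemmas lact_sum = addmap_finsum [OF M.abelian_group_axioms M.abelian_group_axioms lact_addmap]
lemmas zero_lact = addmap_zero [OF L.abelian_group_axioms M.abelian_group_axioms act_addmap_left]
lemmas sum_lact = addmap_finsum [OF L.abelian_group_axioms M.abelian_group_axioms act_addmap_left]

end

context right_module
begin

lemma ract_addmap: "a \<in> carrier R \<Longrightarrow> addmap M M (\<lambda>m. ract M m a)"
  by (simp add: addmap_def ract_closed ract_add_left)

lemma act_addmap_right: "m \<in> carrier M \<Longrightarrow> addmap R M (ract M m)"
  by (simp add: addmap_def ract_closed ract_add_right)

lemmas ract_zero = addmap_zero [OF M.abelian_group_axioms M.abelian_group_axioms ract_addmap]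
lemmas zero_ract = addmap_zero [OF R.abelian_group_axioms M.abelian_group_axioms act_addmap_right]
lemmas sum_ract = addmap_finsum [OF R.abelian_group_axioms M.abelian_group_axioms act_addmap_right]

end

section \<open>Finite powers and dual bases\<close>

definition power_module :: "'i set \<Rightarrow> ('l, 'r, 'm, 'x) bimodule_scheme \<Rightarrow> ('l, 'r, 'i \<Rightarrow> 'm) bimodule"
  where "power_module I M = \<lparr>carrier = I \<rightarrow>\<^sub>E carrier M, monoid.mult = undefined, one = undefined,
    ring.zero = (\<lambda>i\<in>I. \<zero>\<^bsub>M\<^esub>), ring.add = \<lambda>f g. \<lambda>i\<in>I. f i \<oplus>\<^bsub>M\<^esub> g i,
    lact = \<lambda>a f. \<lambda>i\<in>I. lact M a (f i), ract = \<lambda>f a. \<lambda>i\<in>I. ract M (f i) a\<rparr>"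

lemma power_module_simps [simp]:
  "carrier (power_module I M) = I \<rightarrow>\<^sub>E carrier M"
  "ring.zero (power_module I M) = (\<lambda>i\<in>I. \<zero>\<^bsub>M\<^esub>)"
  "ring.add (power_module I M) f g = (\<lambda>i\<in>I. f i \<oplus>\<^bsub>M\<^esub> g i)"
  "lact (power_module I M) a f = (\<lambda>i\<in>I. lact M a (f i))"
  "ract (power_module I M) f b = (\<lambda>i\<in>I. ract M (f i) b)"
  by (simp_all add: power_module_def)

lemma power_module_abelian:
  assumes "abelian_group M" shows "abelian_group (power_module I M)"
proof -
  interpret M: abelian_group M by fact
  show ?thesis
  proof (rule abelian_groupI)
    show "\<exists>g\<in>carrier (power_module I M). g \<oplus>\<^bsub>power_module I M\<^esub> f = \<zero>\<^bsub>power_module I M\<^esub>"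
      if "f \<in> carrier (power_module I M)" for f
    proof
      have f: "f \<in> I \<rightarrow>\<^sub>E carrier M" using that by simp
      show "(\<lambda>i\<in>I. \<ominus>\<^bsub>M\<^esub> f i) \<oplus>\<^bsub>power_module I M\<^esub> f = \<zero>\<^bsub>power_module I M\<^esub>"
        using PiE_mem [OF f] by (auto simp: fun_eq_iff restrict_def M.l_neg)
      show "(\<lambda>i\<in>I. \<ominus>\<^bsub>M\<^esub> f i) \<in> carrier (power_module I M)"
        using PiE_mem [OF f] by simp
    qed
  next
    fix f assume f: "f \<in> carrier (power_module I M)"
    show "\<zero>\<^bsub>power_module I M\<^esub> \<oplus>\<^bsub>power_module I M\<^esub> f = f"
      using f by (auto simp: PiE_iff fun_eq_iff restrict_def extensional_def)
  qed (auto simp: PiE_iff fun_eq_iff restrict_def extensional_def M.a_ac)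
qed

lemma power_module_left:
  assumes "left_module R M" shows "left_module R (power_module I M)"
proof -
  interpret M: left_module R M by fact
  show ?thesis
  proof (intro left_module.intro left_module_axioms.intro M.L.ring_axioms power_module_abelian M.M.abelian_group_axioms)
    show "lact (power_module I M) \<one>\<^bsub>R\<^esub> f = f" if "f \<in> carrier (power_module I M)" for f
      using that by (auto simp: PiE_iff fun_eq_iff restrict_def extensional_def M.lact_one)
  qed (auto simp: PiE_iff fun_eq_iff restrict_def extensional_def M.lact_closed M.lact_add_left M.lact_add_right M.lact_assoc)
qed

lemma power_module_right:
  assumes "right_module R M" shows "right_module R (power_module I M)"
proof -
  interpret M: right_module R M by fact
  show ?thesis
  proof (intro right_module.intro right_module_axioms.intro M.R.ring_axioms power_module_abelian M.M.abelian_group_axioms)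
    show "ract (power_module I M) f \<one>\<^bsub>R\<^esub> = f" if "f \<in> carrier (power_module I M)" for f
      using that by (auto simp: PiE_iff fun_eq_iff restrict_def extensional_def M.ract_one)
  qed (auto simp: PiE_iff fun_eq_iff restrict_def extensional_def M.ract_closed M.ract_add_left M.ract_add_right M.ract_assoc)
qed

text \<open>Families rather than sets: repetitions among the \<open>p i\<close> are allowed, so that
  numbered families obtained from expansions of tensors qualify as well as a generating set indexed
  by itself.\<close>

definition dual_basis :: "('r, 'z) ring_scheme \<Rightarrow> ('r, 's, 'p, 'y) bimodule_scheme \<Rightarrow> 'i set
    \<Rightarrow> ('i \<Rightarrow> 'p \<Rightarrow> 'r) \<Rightarrow> ('i \<Rightarrow> 'p) \<Rightarrow> bool"
  where "dual_basis R P I \<phi> p \<longleftrightarrow> finite I \<and> p \<in> I \<rightarrow> carrier P \<and>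
    (\<forall>i\<in>I. \<phi> i \<in> left_hom R P (regular R)) \<and>
    (\<forall>v\<in>carrier P. (\<Oplus>\<^bsub>P\<^esub>i\<in>I. lact P (\<phi> i v) (p i)) = v)"

lemma dual_basisD:
  assumes "dual_basis R P I \<phi> p"
  shows "finite I" "i \<in> I \<Longrightarrow> p i \<in> carrier P" "i \<in> I \<Longrightarrow> \<phi> i \<in> left_hom R P (regular R)"
    "v \<in> carrier P \<Longrightarrow> (\<Oplus>\<^bsub>P\<^esub>i\<in>I. lact P (\<phi> i v) (p i)) = v"
    "i \<in> I \<Longrightarrow> v \<in> carrier P \<Longrightarrow> \<phi> i v \<in> carrier R"
proof -
  show "i \<in> I \<Longrightarrow> v \<in> carrier P \<Longrightarrow> \<phi> i v \<in> carrier R"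
    using left_hom_closed [of "\<phi> i" R P "regular R" v] assms by (auto simp: dual_basis_def)
qed (use assms in \<open>auto simp: dual_basis_def\<close>)

text \<open>Projectivity lifts the identity of \<open>P\<close> along the surjection
  \<open>g\<close> from the free module on a finite generating set. The coordinates of such a
  splitting are the functionals, the generators themselves the vectors.\<close>

lemma dual_basis_exists:
  assumes P: "left_module R P" and fg: "left_finitely_generated R P" and pr: "left_projective TYPE('u) R P"
    and u: "infinite (UNIV :: 'u set)" "carrier R \<lesssim> (UNIV :: 'u set)" "carrier P \<lesssim> (UNIV :: 'u set)"
  obtains S \<phi> where "dual_basis R P S \<phi> (\<lambda>s. s)"
proof -
  interpret P: left_module R P by fact
  obtain S where S: "finite S" "S \<subseteq> carrier P"
    and gen: "\<And>p. p \<in> carrier P \<Longrightarrow> \<exists>a\<in>S \<rightarrow> carrier R. p = (\<Oplus>\<^bsub>P\<^esub>s\<in>S. lact P (a s) s)"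
    using fg unfolding left_finitely_generated_def by blast
  let ?N = "power_module S (regular R)"
  have N: "left_module R ?N" by (rule power_module_left [OF regular_left_module [OF P.L.ring_axioms]])
  define g where "g f = (\<Oplus>\<^bsub>P\<^esub>s\<in>S. lact P (f s) s)" for f
  have cl: "lact P (f s) s \<in> carrier P" if "f \<in> S \<rightarrow>\<^sub>E carrier R" "s \<in> S" for f s
    using PiE_mem [OF that] S(2) that(2) by (auto intro: P.lact_closed)
  have g: "g \<in> left_hom R ?N P"
    unfolding left_hom_iff
  proof (intro conjI ballI)
    show "addmap ?N P g"
      unfolding g_def
      by (rule addmap_sum [OF P.M.abelian_group_axioms])
        (use cl S(2) in \<open>auto simp: addmap_def PiE_iff P.lact_add_left subset_iff\<close>)
    show "g (lact ?N a f) = lact P a (g f)" if a: "a \<in> carrier R" and f: "f \<in> carrier ?N" for a f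
    proof -
      have "lact P a (g f) = (\<Oplus>\<^bsub>P\<^esub>s\<in>S. lact P a (lact P (f s) s))"
        unfolding g_def by (rule P.lact_sum) (use a f cl in auto)
      also have "\<dots> = g (lact ?N a f)"
        unfolding g_def
        by (rule P.M.finsum_cong') (use a f cl S(2) in \<open>auto simp: PiE_iff P.lact_assoc subset_iff P.lact_closed\<close>)
      finally show ?thesis ..
    qed
  qed
  have surj: "g ` carrier ?N = carrier P"
  proof
    show "g ` carrier ?N \<subseteq> carrier P" using left_hom_closed [OF g] by blast
    show "carrier P \<subseteq> g ` carrier ?N"
    proof
      fix p assume "p \<in> carrier P"
      then obtain a where a: "a \<in> S \<rightarrow> carrier R" "p = (\<Oplus>\<^bsub>P\<^esub>s\<in>S. lact P (a s) s)" using gen by blast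
      have "g (restrict a S) = p"
        unfolding a(2) g_def by (rule P.M.finsum_cong') (use a(1) S(2) in \<open>auto intro!: P.lact_closed\<close>)
      then show "p \<in> g ` carrier ?N" using a(1) by (intro image_eqI [of _ _ "restrict a S"]) auto
    qed
  qed
  have "carrier ?N \<lesssim> (UNIV :: 'u set)"
    using lepoll_PiE [OF u(1) S(1) u(2)] by simp
  from left_projective_lift [OF pr N P this u(3) g id_left_hom surj]
  obtain h where h: "h \<in> left_hom R P ?N" "\<And>p. p \<in> carrier P \<Longrightarrow> g (h p) = p"
    by blast
  note hc = left_hom_closed [OF h(1)]
  have "dual_basis R P S (\<lambda>s v. h v s) (\<lambda>s. s)"
    unfolding dual_basis_def
  proof (intro conjI ballI S(1))
    show "(\<lambda>s. s) \<in> S \<rightarrow> carrier P" using S(2) by auto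
    show "(\<lambda>v. h v s) \<in> left_hom R P (regular R)" if "s \<in> S" for s
      using hc that left_hom_lact [OF h(1)] addmap_add [OF left_hom_addmap [OF h(1)]]
      by (auto simp: left_hom_iff addmap_def)
    show "(\<Oplus>\<^bsub>P\<^esub>s\<in>S. lact P (h v s) s) = v" if "v \<in> carrier P" for v
      using h(2) [OF that] by (simp add: g_def)
  qed
  then show ?thesis by (rule that)
qed

text \<open>Since finite generation is stated with a set, coefficients belonging to equal vectors
  have to be added up: \<open>a s\<close> collects the fibre of \<open>p\<close> over
  \<open>s\<close>.\<close>

lemma dual_basis_finitely_generated:
  assumes P: "left_module R P" and d: "dual_basis R P I \<phi> p"
  shows "left_finitely_generated R P"
proof -
  interpret P: left_module R P by fact
  note D = dual_basisD [OF d]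
  show ?thesis
    unfolding left_finitely_generated_def
  proof (intro exI [of _ "p ` I"] conjI ballI)
    fix v assume v: "v \<in> carrier P"
    define a where "a s = (\<Oplus>\<^bsub>R\<^esub>i\<in>{i \<in> I. p i = s}. \<phi> i v)" for s
    have a: "a \<in> p ` I \<rightarrow> carrier R"
      unfolding a_def using D v by (auto intro!: P.L.finsum_closed)
    have "(\<Oplus>\<^bsub>P\<^esub>s\<in>J. lact P (a s) s) = (\<Oplus>\<^bsub>P\<^esub>i\<in>{i \<in> I. p i \<in> J}. lact P (\<phi> i v) (p i))"
      if "J \<subseteq> p ` I" for J
      using finite_subset [OF that finite_imageI [OF D(1)]] that
    proof (induction J rule: finite_induct)
      case empty
      then show ?case by simp
    next
      case (insert s J)
      have sP: "s \<in> carrier P" using insert.prems D(2) by auto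
      have "lact P (a s) s = (\<Oplus>\<^bsub>P\<^esub>i\<in>{i \<in> I. p i = s}. lact P (\<phi> i v) s)"
        unfolding a_def by (rule P.sum_lact [OF sP]) (use D(5) v in auto)
      also have "\<dots> = (\<Oplus>\<^bsub>P\<^esub>i\<in>{i \<in> I. p i = s}. lact P (\<phi> i v) (p i))"
        by (rule P.M.finsum_cong') (use D v in \<open>auto intro!: P.lact_closed\<close>)
      finally have 1: "lact P (a s) s = \<dots>" .
      have "{i \<in> I. p i \<in> insert s J} = {i \<in> I. p i = s} \<union> {i \<in> I. p i \<in> J}" by auto
      then have "(\<Oplus>\<^bsub>P\<^esub>i\<in>{i \<in> I. p i \<in> insert s J}. lact P (\<phi> i v) (p i)) =
          (\<Oplus>\<^bsub>P\<^esub>i\<in>{i \<in> I. p i = s}. lact P (\<phi> i v) (p i)) \<oplus>\<^bsub>P\<^esub> (\<Oplus>\<^bsub>P\<^esub>i\<in>{i \<in> I. p i \<in> J}. lact P (\<phi> i v) (p i))"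
        using insert.hyps D v by (simp only:) (rule P.M.finsum_Un_disjoint; auto intro!: P.lact_closed)
      moreover have "(\<Oplus>\<^bsub>P\<^esub>t\<in>insert s J. lact P (a t) t) = lact P (a s) s \<oplus>\<^bsub>P\<^esub> (\<Oplus>\<^bsub>P\<^esub>t\<in>J. lact P (a t) t)"
        by (rule P.M.finsum_insert) (use insert a D(2) in \<open>auto intro!: P.lact_closed\<close>)
      ultimately show ?case using insert 1 by simp
    qed
    from this [of "p ` I"] have "(\<Oplus>\<^bsub>P\<^esub>s\<in>p ` I. lact P (a s) s) = (\<Oplus>\<^bsub>P\<^esub>i\<in>I. lact P (\<phi> i v) (p i))"
      by (simp add: Collect_conj_eq Int_absorb2 subset_eq)
    then show "\<exists>a\<in>p ` I \<rightarrow> carrier R. v = (\<Oplus>\<^bsub>P\<^esub>s\<in>p ` I. lact P (a s) s)"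
      using a D(4) [OF v] by auto
  qed (use D in auto)
qed

text \<open>The finitely many values \<open>f (p i)\<close> are lifted along \<open>g\<close> to
  elements \<open>n i\<close>, and the functionals of the dual basis extend this choice linearly to
  all of \<open>P\<close>.\<close>

lemma dual_basis_projective:
  assumes P: "left_module R P" and d: "dual_basis R P I \<phi> p"
  shows "left_projective TYPE('u) R P"
  unfolding left_projective_def
proof (intro allI impI ballI)
  fix N N' :: "('a, unit, 'u) bimodule" and g f
  assume N: "left_module R N" and N': "left_module R N'" and g: "g \<in> left_hom R N N'"
    and f: "f \<in> left_hom R P N'" and s: "g ` carrier N = carrier N'"
  interpret P: left_module R P by fact
  interpret N: left_module R N by fact
  interpret N': left_module R N' by fact
  note D = dual_basisD [OF d]
  have "\<forall>i\<in>I. \<exists>n. n \<in> carrier N \<and> g n = f (p i)"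
    using s left_hom_closed [OF f] D(2) by (metis imageE)
  then obtain n where n: "\<And>i. i \<in> I \<Longrightarrow> n i \<in> carrier N" "\<And>i. i \<in> I \<Longrightarrow> g (n i) = f (p i)"
    by metis
  define h where "h v = (\<Oplus>\<^bsub>N\<^esub>i\<in>I. lact N (\<phi> i v) (n i))" for v
  have cl: "lact N (\<phi> i v) (n i) \<in> carrier N" if "i \<in> I" "v \<in> carrier P" for i v
    using D n that by (auto intro!: N.lact_closed)
  have h: "h \<in> left_hom R P N"
    unfolding left_hom_iff
  proof (intro conjI ballI)
    show "addmap P N h"
      unfolding h_def
      by (rule addmap_sum [OF N.M.abelian_group_axioms])
        (use cl D n addmap_add [OF left_hom_addmap [OF D(3)]] in \<open>auto simp: addmap_def N.lact_add_left\<close>)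
    show "h (lact P a v) = lact N a (h v)" if a: "a \<in> carrier R" and v: "v \<in> carrier P" for a v
    proof -
      have "lact N a (h v) = (\<Oplus>\<^bsub>N\<^esub>i\<in>I. lact N a (lact N (\<phi> i v) (n i)))"
        unfolding h_def by (rule N.lact_sum) (use a v cl in auto)
      also have "\<dots> = h (lact P a v)"
        unfolding h_def
        by (rule N.M.finsum_cong')
          (use a v cl D n left_hom_lact [OF D(3)] P.lact_closed N.lact_closed in \<open>auto simp: N.lact_assoc\<close>)
      finally show ?thesis ..
    qed
  qed
  have "g (h v) = f v" if v: "v \<in> carrier P" for v
  proof -
    have "g (h v) = (\<Oplus>\<^bsub>N'\<^esub>i\<in>I. g (lact N (\<phi> i v) (n i)))"
      unfolding h_def
      by (rule addmap_finsum [OF N.M.abelian_group_axioms N'.M.abelian_group_axioms left_hom_addmap [OF g]])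
        (use v cl in auto)
    also have "\<dots> = (\<Oplus>\<^bsub>N'\<^esub>i\<in>I. f (lact P (\<phi> i v) (p i)))"
      by (rule N'.M.finsum_cong')
        (use v D n left_hom_closed [OF f] in \<open>auto simp: left_hom_lact [OF g] left_hom_lact [OF f] P.lact_closed N'.lact_closed\<close>)
    also have "\<dots> = f (\<Oplus>\<^bsub>P\<^esub>i\<in>I. lact P (\<phi> i v) (p i))"
      by (rule addmap_finsum [OF P.M.abelian_group_axioms N'.M.abelian_group_axioms left_hom_addmap [OF f], symmetric])
        (use v D in \<open>auto intro!: P.lact_closed\<close>)
    finally show ?thesis by (simp add: D(4) [OF v])
  qed
  with h show "\<exists>h\<in>left_hom R P N. \<forall>p\<in>carrier P. g (h p) = f p" by blast
qed

section \<open>Trace ideals and generators\<close>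

inductive_set trace_ideal :: "('r, 'z) ring_scheme \<Rightarrow> ('r, 's, 'p, 'y) bimodule_scheme \<Rightarrow> 'r set"
  for R and P where
  zero: "\<zero>\<^bsub>R\<^esub> \<in> trace_ideal R P"
| add: "\<psi> \<in> left_hom R P (regular R) \<Longrightarrow> p \<in> carrier P \<Longrightarrow> t \<in> trace_ideal R P \<Longrightarrow> \<psi> p \<oplus>\<^bsub>R\<^esub> t \<in> trace_ideal R P"

text \<open>A coset is encoded by a representative chosen from it, followed by an embedding into
  \<open>'u\<close>. Congruent elements have the same set of candidates, so the choice operator
  returns the same representative for both.\<close>

lemma quotient_map_exists:
  assumes M: "abelian_group M" and T: "T \<subseteq> carrier M" "\<zero>\<^bsub>M\<^esub> \<in> T" "\<And>a b. a \<in> T \<Longrightarrow> b \<in> T \<Longrightarrow> a \<oplus>\<^bsub>M\<^esub> b \<in> T"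
      "\<And>a. a \<in> T \<Longrightarrow> \<ominus>\<^bsub>M\<^esub> a \<in> T"
    and c: "carrier M \<lesssim> (UNIV :: 'u set)"
  obtains e :: "_ \<Rightarrow> 'u" where "\<And>a b. a \<in> carrier M \<Longrightarrow> b \<in> carrier M \<Longrightarrow> e a = e b \<longleftrightarrow> a \<ominus>\<^bsub>M\<^esub> b \<in> T"
    and "image_congruence M e"
proof -
  interpret M: abelian_group M by fact
  obtain \<iota> :: "_ \<Rightarrow> 'u" where \<iota>: "inj_on \<iota> (carrier M)" using c by (auto simp: lepoll_def)
  have tr: "a \<ominus>\<^bsub>M\<^esub> d \<in> T" if "a \<ominus>\<^bsub>M\<^esub> b \<in> T" "b \<ominus>\<^bsub>M\<^esub> d \<in> T" "a \<in> carrier M" "b \<in> carrier M" "d \<in> carrier M" for a b d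
    using T(3) [OF that(1,2)] that(3-5) by (simp add: a_minus_def M.a_assoc M.r_neg1 M.r_neg2 M.l_neg)
  have sy: "b \<ominus>\<^bsub>M\<^esub> a \<in> T" if "a \<ominus>\<^bsub>M\<^esub> b \<in> T" "a \<in> carrier M" "b \<in> carrier M" for a b
    using T(4) [OF that(1)] that(2,3) by (simp add: a_minus_def M.minus_add M.a_comm)
  define rep where "rep a = (SOME b. b \<in> carrier M \<and> a \<ominus>\<^bsub>M\<^esub> b \<in> T)" for a
  have rep: "rep a \<in> carrier M" "a \<ominus>\<^bsub>M\<^esub> rep a \<in> T" if "a \<in> carrier M" for a
  proof -
    have "a \<ominus>\<^bsub>M\<^esub> a = \<zero>\<^bsub>M\<^esub>" using that by (simp add: M.minus_eq_zero_iff)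
    then have "\<exists>b. b \<in> carrier M \<and> a \<ominus>\<^bsub>M\<^esub> b \<in> T" using that T(2) by metis
    from someI_ex [OF this] show "rep a \<in> carrier M" "a \<ominus>\<^bsub>M\<^esub> rep a \<in> T" by (simp_all add: rep_def)
  qed
  have "rep a = rep b \<longleftrightarrow> a \<ominus>\<^bsub>M\<^esub> b \<in> T" if a: "a \<in> carrier M" and b: "b \<in> carrier M" for a b
  proof
    assume "rep a = rep b"
    then show "a \<ominus>\<^bsub>M\<^esub> b \<in> T"
      using tr [OF rep(2) [OF a] sy [OF _ b rep(1) [OF a]] a rep(1) [OF a] b] rep(2) [OF b] by simp
  next
    assume ab: "a \<ominus>\<^bsub>M\<^esub> b \<in> T"
    have "a \<ominus>\<^bsub>M\<^esub> d \<in> T \<longleftrightarrow> b \<ominus>\<^bsub>M\<^esub> d \<in> T" if "d \<in> carrier M" for d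
      using tr [OF ab _ a b that] tr [OF sy [OF ab a b] _ b a that] by blast
    then show "rep a = rep b" unfolding rep_def by (intro arg_cong [where f = Eps]) auto
  qed
  then have e: "(\<iota> \<circ> rep) a = (\<iota> \<circ> rep) b \<longleftrightarrow> a \<ominus>\<^bsub>M\<^esub> b \<in> T" if "a \<in> carrier M" "b \<in> carrier M" for a b
    using that inj_on_eq_iff [OF \<iota> rep(1) [OF that(1)] rep(1) [OF that(2)]] by simp
  have "image_congruence M (\<iota> \<circ> rep)"
  proof (intro image_congruence.intro image_congruence_axioms.intro M)
    fix m m' n n'
    assume c: "m \<in> carrier M" "m' \<in> carrier M" "n \<in> carrier M" "n' \<in> carrier M"
      and "(\<iota> \<circ> rep) m = (\<iota> \<circ> rep) m'" "(\<iota> \<circ> rep) n = (\<iota> \<circ> rep) n'"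
    then have "(m \<ominus>\<^bsub>M\<^esub> m') \<oplus>\<^bsub>M\<^esub> (n \<ominus>\<^bsub>M\<^esub> n') \<in> T" using e T(3) by blast
    moreover have "(m \<ominus>\<^bsub>M\<^esub> m') \<oplus>\<^bsub>M\<^esub> (n \<ominus>\<^bsub>M\<^esub> n') = (m \<oplus>\<^bsub>M\<^esub> n) \<ominus>\<^bsub>M\<^esub> (m' \<oplus>\<^bsub>M\<^esub> n')"
      using c by (simp add: a_minus_def M.minus_add M.a_ac)
    ultimately show "(\<iota> \<circ> rep) (m \<oplus>\<^bsub>M\<^esub> n) = (\<iota> \<circ> rep) (m' \<oplus>\<^bsub>M\<^esub> n')" using e c by simp
  qed
  with e show ?thesis by (rule that)
qed

text \<open>
  The map \<open>n \<otimes> v \<mapsto> n \<psi>(v)\<close>.  For a coaction \<open>\<rho>\<close> on \<open>N\<close>, the right action \<open>n\<^sub>0 f(n\<^sub>1)\<close> of \<open>f \<in> \<^sup>*C\<close> is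
  \<open>contract N f (\<rho> n)\<close>.
\<close>

definition contract :: "('l, 'r, 'n, 'x) bimodule_scheme \<Rightarrow> ('p \<Rightarrow> 'r) \<Rightarrow> (('n \<times> 'p) \<Rightarrow>\<^sub>0 int) set \<Rightarrow> 'n"
  where "contract N \<psi> = tensor_lift N (\<lambda>n v. ract N n (\<psi> v))"

context
  fixes R :: "('r, 'z) ring_scheme" and P :: "('r, 's, 'p, 'y) bimodule_scheme"
  assumes P: "left_module R P"
begin

interpretation P: left_module R P by (rule P)

lemma
  shows trace_ideal_closed: "t \<in> trace_ideal R P \<Longrightarrow> t \<in> carrier R"
    and trace_ideal_add: "t \<in> trace_ideal R P \<Longrightarrow> u \<in> trace_ideal R P \<Longrightarrow> t \<oplus>\<^bsub>R\<^esub> u \<in> trace_ideal R P"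
    and trace_ideal_neg: "t \<in> trace_ideal R P \<Longrightarrow> \<ominus>\<^bsub>R\<^esub> t \<in> trace_ideal R P"
    and trace_ideal_mult: "t \<in> trace_ideal R P \<Longrightarrow> a \<in> carrier R \<Longrightarrow> a \<otimes>\<^bsub>R\<^esub> t \<in> trace_ideal R P"
    and trace_ideal_hom: "\<psi> \<in> left_hom R P (regular R) \<Longrightarrow> p \<in> carrier P \<Longrightarrow> \<psi> p \<in> trace_ideal R P"
proof -
  have rc: "\<psi> p \<in> carrier R" if "\<psi> \<in> left_hom R P (regular R)" "p \<in> carrier P" for \<psi> p
    using left_hom_closed [OF that] by simp
  show c: "t \<in> carrier R" if "t \<in> trace_ideal R P" for t
    using that by induction (simp_all add: rc)
  show "t \<oplus>\<^bsub>R\<^esub> u \<in> trace_ideal R P" if "t \<in> trace_ideal R P" "u \<in> trace_ideal R P"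
    using that
  proof (induction t)
    case (add \<psi> p t)
    then show ?case
      using trace_ideal.add [of \<psi> R P p "t \<oplus>\<^bsub>R\<^esub> u"] by (simp add: P.L.a_assoc rc c)
  qed (simp add: c)
  have neg: "\<psi> (\<ominus>\<^bsub>P\<^esub> p) = \<ominus>\<^bsub>R\<^esub> \<psi> p" if "\<psi> \<in> left_hom R P (regular R)" "p \<in> carrier P" for \<psi> p
    using addmap_neg [OF P.M.abelian_group_axioms P.L.abelian_group_axioms _ that(2), of \<psi>] left_hom_addmap [OF that(1)]
    by (simp add: addmap_def)
  show "\<ominus>\<^bsub>R\<^esub> t \<in> trace_ideal R P" if "t \<in> trace_ideal R P"
    using that
  proof (induction t)
    case zero
    then show ?case by (simp add: P.L.neg_zero trace_ideal.zero)
  next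
    case (add \<psi> p t)
    then show ?case
      using trace_ideal.add [OF add(1), of "\<ominus>\<^bsub>P\<^esub> p" "\<ominus>\<^bsub>R\<^esub> t"] by (simp add: P.L.minus_add rc c neg)
  qed
  show "a \<otimes>\<^bsub>R\<^esub> t \<in> trace_ideal R P" if "t \<in> trace_ideal R P" "a \<in> carrier R"
    using that
  proof (induction t)
    case (add \<psi> p t)
    then show ?case
      using trace_ideal.add [OF add(1), of "lact P a p" "a \<otimes>\<^bsub>R\<^esub> t"]
      by (simp add: P.L.r_distr rc c left_hom_lact [OF add(1)] P.lact_closed)
  qed (simp add: trace_ideal.zero)
  show "\<psi> p \<in> trace_ideal R P" if "\<psi> \<in> left_hom R P (regular R)" "p \<in> carrier P"
    using trace_ideal.add [OF that trace_ideal.zero] by (simp add: rc [OF that])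
qed

text \<open>Let \<open>T\<close> be the trace ideal. The projection from \<open>R\<close> to
  \<open>R/T\<close> and the zero map agree after every homomorphism from \<open>P\<close> to
  \<open>R\<close>, because the values of such a homomorphism lie in \<open>T\<close>. A generator
  separates distinct maps, so the projection is zero.\<close>

lemma one_in_trace_ideal:
  assumes g: "left_generator TYPE('u) R P" and c: "carrier R \<lesssim> (UNIV :: 'u set)"
  shows "\<one>\<^bsub>R\<^esub> \<in> trace_ideal R P"
proof -
  let ?A = "regular R"
  have A: "left_module R ?A" by (rule regular_left_module [OF P.L.ring_axioms])
  interpret A: left_module R ?A by (rule A)
  have m: "a \<ominus>\<^bsub>?A\<^esub> b = a \<ominus>\<^bsub>R\<^esub> b" "\<ominus>\<^bsub>?A\<^esub> a = \<ominus>\<^bsub>R\<^esub> a" if "a \<in> carrier R" "b \<in> carrier R" for a b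
  proof -
    show "\<ominus>\<^bsub>?A\<^esub> a = \<ominus>\<^bsub>R\<^esub> a"
      using A.M.minus_equality [of "\<ominus>\<^bsub>R\<^esub> a" a] that by (simp add: P.L.l_neg)
    then have *: "\<ominus>\<^bsub>?A\<^esub> b = \<ominus>\<^bsub>R\<^esub> b"
      using A.M.minus_equality [of "\<ominus>\<^bsub>R\<^esub> b" b] that by (simp add: P.L.l_neg)
    then show "a \<ominus>\<^bsub>?A\<^esub> b = a \<ominus>\<^bsub>R\<^esub> b" by (simp add: a_minus_def)
  qed
  obtain e :: "'r \<Rightarrow> 'u" where e: "\<And>a b. a \<in> carrier ?A \<Longrightarrow> b \<in> carrier ?A \<Longrightarrow> e a = e b \<longleftrightarrow> a \<ominus>\<^bsub>?A\<^esub> b \<in> trace_ideal R P"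
    and ic: "image_congruence ?A e"
  proof (rule quotient_map_exists [of ?A "trace_ideal R P"])
    show "\<ominus>\<^bsub>?A\<^esub> a \<in> trace_ideal R P" if "a \<in> trace_ideal R P" for a
      using that m(2) trace_ideal_neg trace_ideal_closed by metis
  qed (use A.M.abelian_group_axioms c trace_ideal.zero trace_ideal_add trace_ideal_closed in auto)
  define Q :: "('r, unit, 'u) bimodule" where "Q = image_struct e (lact ?A) undefined ?A"
  have cong: "e (lact ?A a u) = e (lact ?A a v)"
    if "a \<in> carrier R" "u \<in> carrier ?A" "v \<in> carrier ?A" "e u = e v" for a u v
  proof -
    have "u \<ominus>\<^bsub>R\<^esub> v \<in> trace_ideal R P" using that e m by simp
    then have "a \<otimes>\<^bsub>R\<^esub> (u \<ominus>\<^bsub>R\<^esub> v) \<in> trace_ideal R P" by (rule trace_ideal_mult) (rule that)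
    then show ?thesis
      using that e m by (simp add: a_minus_def P.L.r_distr P.L.r_minus)
  qed
  have Q1: "left_module R Q" unfolding Q_def by (rule image_left_module(1) [OF A ic cong])
  have Q2: "e \<in> left_hom R ?A Q" unfolding Q_def by (rule image_left_module(2) [OF A ic cong])
  have zQ: "\<zero>\<^bsub>Q\<^esub> = e \<zero>\<^bsub>R\<^esub>" by (simp add: Q_def image_struct_simps)
  interpret Q: left_module R Q by (rule Q1)
  have z: "(\<lambda>_. \<zero>\<^bsub>Q\<^esub>) \<in> left_hom R ?A Q"
    by (simp add: left_hom_iff addmap_def Q.lact_zero)
  have "e \<one>\<^bsub>R\<^esub> = \<zero>\<^bsub>Q\<^esub>"
  proof (rule left_generator_separates [OF g A Q1 _ _ Q2 z])
    show "carrier Q \<lesssim> (UNIV :: 'u set)" by (simp add: lepoll_def) (metis inj_on_id)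
    show "e (h p) = \<zero>\<^bsub>Q\<^esub>" if "h \<in> left_hom R P ?A" "p \<in> carrier P" for h p
      using trace_ideal_hom [OF that] trace_ideal_closed [OF trace_ideal_hom [OF that]] e [of "h p" "\<zero>\<^bsub>R\<^esub>"] m
      by (simp add: zQ a_minus_def P.L.neg_zero)
  qed (use c in auto)
  then show ?thesis
    using e [of "\<one>\<^bsub>R\<^esub>" "\<zero>\<^bsub>R\<^esub>"] m [of "\<one>\<^bsub>R\<^esub>" "\<zero>\<^bsub>R\<^esub>"] by (simp add: zQ a_minus_def P.L.neg_zero)
qed

text \<open>For a functional \<psi> and an element \<open>x\<close> of \<open>N\<close>, the map
  \<open>p \<mapsto> \<psi>(p) x\<close> goes from \<open>P\<close> to \<open>N\<close>. Hence
  \<open>f\<close> and \<open>g\<close> agree on \<open>t x\<close> for all \<open>t\<close> in the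
  trace ideal, in particular for \<open>t = 1\<close>.\<close>

lemma trace_ideal_generator:
  assumes one: "\<one>\<^bsub>R\<^esub> \<in> trace_ideal R P"
  shows "left_generator TYPE('u) R P"
  unfolding left_generator_def
proof (intro allI impI ballI)
  fix N N' :: "('r, unit, 'u) bimodule" and f g x
  assume N: "left_module R N" and N': "left_module R N'" and f: "f \<in> left_hom R N N'" and g: "g \<in> left_hom R N N'"
    and eq: "\<forall>h\<in>left_hom R P N. \<forall>p\<in>carrier P. f (h p) = g (h p)" and x: "x \<in> carrier N"
  interpret N: left_module R N by fact
  interpret N': left_module R N' by fact
  have "f (lact N t x) = g (lact N t x)" if "t \<in> trace_ideal R P" for t
    using that
  proof (induction t)
    case zero
    then show ?case
      using addmap_zero [OF N.M.abelian_group_axioms N'.M.abelian_group_axioms left_hom_addmap [OF f]]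
        addmap_zero [OF N.M.abelian_group_axioms N'.M.abelian_group_axioms left_hom_addmap [OF g]]
      by (simp add: N.zero_lact x)
  next
    case (add \<psi> p t)
    have c: "\<psi> q \<in> carrier R" if "q \<in> carrier P" for q using left_hom_closed [OF add(1) that] by simp
    have "(\<lambda>p. lact N (\<psi> p) x) \<in> left_hom R P N"
      using x c addmap_add [OF left_hom_addmap [OF add(1)]] left_hom_lact [OF add(1)]
      by (simp add: left_hom_iff addmap_def N.lact_closed N.lact_add_left N.lact_assoc)
    from bspec [OF bspec [OF eq this] add(2)] have "f (lact N (\<psi> p) x) = g (lact N (\<psi> p) x)" .
    then show ?case
      using add x c trace_ideal_closed
      by (simp add: N.lact_add_left N.lact_closed addmap_add [OF left_hom_addmap [OF f]] addmap_add [OF left_hom_addmap [OF g]])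
  qed
  from this [OF one] show "f x = g x" by (simp add: N.lact_one x)
qed

lemma contract_balanced:
  assumes N: "right_module R N" and \<psi>: "\<psi> \<in> left_hom R P (regular R)"
  shows "balanced R N P N (\<lambda>n v. ract N n (\<psi> v))"
proof -
  interpret N: right_module R N by fact
  have c: "\<psi> q \<in> carrier R" if "q \<in> carrier P" for q using left_hom_closed [OF \<psi> that] by simp
  show ?thesis
    using addmap_add [OF left_hom_addmap [OF \<psi>]] left_hom_lact [OF \<psi>]
    by (intro balancedI) (simp_all add: c N.ract_closed N.ract_add_left N.ract_add_right N.ract_assoc)
qed

lemma
  assumes N: "right_module R N" and \<psi>: "\<psi> \<in> left_hom R P (regular R)"
  shows contract_addmap: "addmap (tensor R N P) N (contract N \<psi>)"
    and contract_pure: "n \<in> carrier N \<Longrightarrow> v \<in> carrier P \<Longrightarrow> contract N \<psi> (pure_tensor R N P n v) = ract N n (\<psi> v)"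
proof -
  interpret N: right_module R N by fact
  interpret T: tensor_pair R N P by (rule tensor_pairI [OF N P])
  note b = contract_balanced [OF N \<psi>]
  show "addmap T.T N (contract N \<psi>)"
    unfolding contract_def by (rule T.lift_addmap [OF N.M.abelian_group_axioms b])
  show "n \<in> carrier N \<Longrightarrow> v \<in> carrier P \<Longrightarrow> contract N \<psi> (pure_tensor R N P n v) = ract N n (\<psi> v)"
    unfolding contract_def by (rule T.lift_pure [OF N.M.abelian_group_axioms b])
qed

lemma contract_natural:
  assumes N: "right_module R N" and N': "right_module R N'" and \<psi>: "\<psi> \<in> left_hom R P (regular R)"
    and f: "f \<in> right_hom R N N'" and t: "t \<in> carrier (tensor R N P)"
  shows "contract N' \<psi> (tensor_map R N' P f (\<lambda>p. p) t) = f (contract N \<psi> t)"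
proof -
  note p = tensor_pairI [OF N P] tensor_pairI [OF N' P]
  have c: "\<psi> q \<in> carrier R" if "q \<in> carrier P" for q using left_hom_closed [OF \<psi> that] by simp
  note m = tensor_map_addmap [OF p f id_left_hom] and mp = tensor_map_pure [OF p f id_left_hom]
  show ?thesis
    using t
  proof (rule tensor_pair.hom_ext [OF p(1), rotated 2])
    show "addmap (tensor R N P) N' (\<lambda>t. contract N' \<psi> (tensor_map R N' P f (\<lambda>p. p) t))"
      using m contract_addmap [OF N' \<psi>] by (auto simp: addmap_def)
    show "addmap (tensor R N P) N' (\<lambda>t. f (contract N \<psi> t))"
      using right_hom_addmap [OF f] contract_addmap [OF N \<psi>] by (auto simp: addmap_def)
  qed (simp add: mp contract_pure [OF N \<psi>] contract_pure [OF N' \<psi>] right_hom_closed [OF f] right_hom_ract [OF f] c)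
qed

section \<open>Coordinates in tensor products and faithful flatness\<close>

context
  fixes I :: "'i set" and \<phi> p
  assumes d: "dual_basis R P I \<phi> p"
begin

lemmas basis = dual_basisD [OF d]

text \<open>On pure tensors, \<open>n \<otimes> v\<close> is
  \<open>n \<otimes> \<Sum> \<phi>\<^sub>i(v) p\<^sub>i\<close>, and the coefficients move to the
  left factor. A tensor is thus determined by its contractions with the dual basis.\<close>

lemma contract_expand:
  assumes N: "right_module R N" and t: "t \<in> carrier (tensor R N P)"
  shows "(\<Oplus>\<^bsub>tensor R N P\<^esub>i\<in>I. pure_tensor R N P (contract N (\<phi> i) t) (p i)) = t"
proof -
  interpret N: right_module R N by fact
  interpret T: tensor_pair R N P by (rule tensor_pairI [OF N P])
  note ca = contract_addmap [OF N basis(3)] and cp = contract_pure [OF N basis(3)]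
  show ?thesis
    using t
  proof (rule T.hom_ext [rotated 2])
    show "addmap T.T T.T (\<lambda>t. \<Oplus>\<^bsub>T.T\<^esub>i\<in>I. T.pure (contract N (\<phi> i) t) (p i))"
      by (rule addmap_sum [OF T.tensor_abelian]) (rule addmap_comp [OF ca T.pure_addmap_left [OF basis(2)]])
    fix n v assume pure: "n \<in> carrier N" "v \<in> carrier P"
    have "(\<Oplus>\<^bsub>T.T\<^esub>i\<in>I. T.pure (contract N (\<phi> i) (T.pure n v)) (p i)) = (\<Oplus>\<^bsub>T.T\<^esub>i\<in>I. T.pure n (lact P (\<phi> i v) (p i)))"
      by (rule T.T.finsum_cong')
        (use pure basis in \<open>auto simp: cp T.pure_balanced intro!: T.pure_closed P.lact_closed\<close>)
    also have "\<dots> = T.pure n (\<Oplus>\<^bsub>P\<^esub>i\<in>I. lact P (\<phi> i v) (p i))"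
      by (rule T.pure_sum_right [symmetric]) (use pure basis in \<open>auto intro!: P.lact_closed\<close>)
    finally show "(\<Oplus>\<^bsub>T.T\<^esub>i\<in>I. T.pure (contract N (\<phi> i) (T.pure n v)) (p i)) = T.pure n v"
      by (simp add: basis(4) pure)
  qed (rule addmap_id)
qed

text \<open>Kernel and image after tensoring with \<open>P\<close> are both detected by
  contractions. Flatness follows at once. In the converse direction the criterion is applied to
  \<open>y \<otimes> v\<close>, which gives statements about \<open>y \<psi>(v)\<close>; these are
  added up along a representation of \<open>1\<close> as an element of the trace ideal.\<close>

lemma dual_basis_faithfully_flat:
  assumes one: "\<one>\<^bsub>R\<^esub> \<in> trace_ideal R P"
  shows "left_faithfully_flat TYPE('u) R P"
  unfolding left_faithfully_flat_def
proof (intro conjI P allI impI ballI)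
  fix N N' N'' :: "(unit, 'r, 'u) bimodule" and f g
  assume N: "right_module R N" and N': "right_module R N'" and N'': "right_module R N''"
    and f: "f \<in> right_hom R N N'" and g: "g \<in> right_hom R N' N''"
  interpret N: right_module R N by fact
  interpret N': right_module R N' by fact
  interpret N'': right_module R N'' by fact
  note p = tensor_pairI [OF N P] tensor_pairI [OF N' P] tensor_pairI [OF N'' P]
  interpret TN: tensor_pair R N P by (rule p)
  interpret TN': tensor_pair R N' P by (rule p)
  interpret TN'': tensor_pair R N'' P by (rule p)
  let ?f = "tensor_map R N' P f (\<lambda>p. p)" and ?g = "tensor_map R N'' P g (\<lambda>p. p)"
  note fm = tensor_map_addmap [OF p(1,2) f id_left_hom] and fp = tensor_map_pure [OF p(1,2) f id_left_hom]
  note gm = tensor_map_addmap [OF p(2,3) g id_left_hom]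
  have ker: "?g w = \<zero>\<^bsub>TN''.T\<^esub> \<longleftrightarrow> (\<forall>\<psi>\<in>left_hom R P (regular R). g (contract N' \<psi> w) = \<zero>\<^bsub>N''\<^esub>)"
    if w: "w \<in> carrier TN'.T" for w
  proof (intro iffI ballI)
    fix \<psi> assume "?g w = \<zero>\<^bsub>TN''.T\<^esub>" and \<psi>: "\<psi> \<in> left_hom R P (regular R)"
    then show "g (contract N' \<psi> w) = \<zero>\<^bsub>N''\<^esub>"
      using contract_natural [OF N' N'' \<psi> g w]
        addmap_zero [OF TN''.tensor_abelian N''.M.abelian_group_axioms contract_addmap [OF N'' \<psi>]] by simp
  next
    assume *: "\<forall>\<psi>\<in>left_hom R P (regular R). g (contract N' \<psi> w) = \<zero>\<^bsub>N''\<^esub>"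
    have "?g w = (\<Oplus>\<^bsub>TN''.T\<^esub>i\<in>I. TN''.pure (contract N'' (\<phi> i) (?g w)) (p i))"
      by (rule contract_expand [OF N'' addmap_closed [OF gm w], symmetric])
    also have "\<dots> = (\<Oplus>\<^bsub>TN''.T\<^esub>i\<in>I. \<zero>\<^bsub>TN''.T\<^esub>)"
      by (rule TN''.T.finsum_cong')
        (use * basis in \<open>auto simp: contract_natural [OF N' N'' _ g w] TN''.pure_zero_left\<close>)
    finally show "?g w = \<zero>\<^bsub>TN''.T\<^esub>" by simp
  qed
  \<comment> \<open>Preimages of the contractions along the dual basis reassemble to a preimage of
    \<open>w\<close>.\<close>
  have im: "w \<in> ?f ` carrier TN.T \<longleftrightarrow> (\<forall>\<psi>\<in>left_hom R P (regular R). contract N' \<psi> w \<in> f ` carrier N)"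
    if w: "w \<in> carrier TN'.T" for w
  proof (intro iffI ballI)
    fix \<psi> assume "w \<in> ?f ` carrier TN.T" and \<psi>: "\<psi> \<in> left_hom R P (regular R)"
    then show "contract N' \<psi> w \<in> f ` carrier N"
      using contract_natural [OF N N' \<psi> f] addmap_closed [OF contract_addmap [OF N \<psi>]] by auto
  next
    assume *: "\<forall>\<psi>\<in>left_hom R P (regular R). contract N' \<psi> w \<in> f ` carrier N"
    have "\<forall>i\<in>I. \<exists>n. n \<in> carrier N \<and> contract N' (\<phi> i) w = f n"
      using * basis(3) by (metis imageE)
    then obtain n where n: "\<And>i. i \<in> I \<Longrightarrow> n i \<in> carrier N" "\<And>i. i \<in> I \<Longrightarrow> contract N' (\<phi> i) w = f (n i)"
      by metis
    have cl: "(\<Oplus>\<^bsub>TN.T\<^esub>i\<in>I. TN.pure (n i) (p i)) \<in> carrier TN.T"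
      using n basis(2) by (auto intro!: TN.T.finsum_closed TN.pure_closed)
    have "?f (\<Oplus>\<^bsub>TN.T\<^esub>i\<in>I. TN.pure (n i) (p i)) = (\<Oplus>\<^bsub>TN'.T\<^esub>i\<in>I. ?f (TN.pure (n i) (p i)))"
      by (rule addmap_finsum [OF TN.tensor_abelian TN'.tensor_abelian fm]) (use n basis(2) in \<open>auto intro!: TN.pure_closed\<close>)
    also have "\<dots> = (\<Oplus>\<^bsub>TN'.T\<^esub>i\<in>I. TN'.pure (contract N' (\<phi> i) w) (p i))"
      by (rule TN'.T.finsum_cong') (use n basis(2) right_hom_closed [OF f] in \<open>auto simp: fp intro!: TN'.pure_closed\<close>)
    also have "\<dots> = w" by (rule contract_expand [OF N' w])
    finally have "w = ?f (\<Oplus>\<^bsub>TN.T\<^esub>i\<in>I. TN.pure (n i) (p i))" ..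
    then show "w \<in> ?f ` carrier TN.T" using cl by (rule image_eqI)
  qed
  show "exact_at N N' N'' f g \<longleftrightarrow> exact_at TN.T TN'.T TN''.T ?f ?g"
  proof
    assume ex: "exact_at N N' N'' f g"
    have "w \<in> ?f ` carrier TN.T \<longleftrightarrow> ?g w = \<zero>\<^bsub>TN''.T\<^esub>" if w: "w \<in> carrier TN'.T" for w
      unfolding im [OF w] ker [OF w] using ex addmap_closed [OF contract_addmap [OF N'] w]
      by (auto simp: exact_at_def)
    moreover have "?f ` carrier TN.T \<subseteq> carrier TN'.T" using addmap_closed [OF fm] by auto
    ultimately show "exact_at TN.T TN'.T TN''.T ?f ?g" unfolding exact_at_def by blast
  next
    assume ex: "exact_at TN.T TN'.T TN''.T ?f ?g"
    \<comment> \<open>Exactness at a single pure tensor. Both sides quantify over all functionals,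
      so a conclusion about one \<psi> requires the other side for all functionals at the same
      \<open>v\<close>.\<close>
    have key: "(\<forall>\<psi>\<in>left_hom R P (regular R). ract N' y (\<psi> v) \<in> f ` carrier N) \<longleftrightarrow>
        (\<forall>\<psi>\<in>left_hom R P (regular R). ract N'' (g y) (\<psi> v) = \<zero>\<^bsub>N''\<^esub>)"
      if y: "y \<in> carrier N'" and v: "v \<in> carrier P" for y v
    proof -
      have w: "TN'.pure y v \<in> carrier TN'.T" using y v by (rule TN'.pure_closed)
      have "TN'.pure y v \<in> ?f ` carrier TN.T \<longleftrightarrow> ?g (TN'.pure y v) = \<zero>\<^bsub>TN''.T\<^esub>"
        using ex w unfolding exact_at_def by blast
      then show ?thesis
        unfolding im [OF w] ker [OF w] using left_hom_closed [of _ R P "regular R" v] v y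
        by (simp add: contract_pure [OF N'] right_hom_ract [OF g])
    qed
    have "y \<in> f ` carrier N \<longleftrightarrow> g y = \<zero>\<^bsub>N''\<^esub>" if y: "y \<in> carrier N'" for y
    proof
      assume "y \<in> f ` carrier N"
      then obtain n where n: "n \<in> carrier N" "y = f n" by blast
      have "ract N'' (g y) t = \<zero>\<^bsub>N''\<^esub>" if "t \<in> trace_ideal R P" for t
        using that
      proof (induction t)
        case (add \<psi> v t)
        have c: "\<psi>' v \<in> carrier R" if "\<psi>' \<in> left_hom R P (regular R)" for \<psi>' using left_hom_closed [OF that add(2)] by simp
        have "\<forall>\<psi>\<in>left_hom R P (regular R). ract N' y (\<psi> v) \<in> f ` carrier N"
        proof
          fix \<psi>' assume "\<psi>' \<in> left_hom R P (regular R)"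
          then have "ract N' y (\<psi>' v) = f (ract N n (\<psi>' v))" using n c by (simp add: right_hom_ract [OF f])
          then show "ract N' y (\<psi>' v) \<in> f ` carrier N" using n c \<open>\<psi>' \<in> _\<close> by (simp add: N.ract_closed)
        qed
        then have "ract N'' (g y) (\<psi> v) = \<zero>\<^bsub>N''\<^esub>" using key [OF y add(2)] add(1) by blast
        then show ?case
          using add c y trace_ideal_closed by (simp add: N''.ract_add_right right_hom_closed [OF g])
      qed (simp add: N''.zero_ract right_hom_closed [OF g y])
      from this [OF one] show "g y = \<zero>\<^bsub>N''\<^esub>" by (simp add: N''.ract_one right_hom_closed [OF g y])
    next
      assume gy: "g y = \<zero>\<^bsub>N''\<^esub>"
      have "ract N' y t \<in> f ` carrier N" if "t \<in> trace_ideal R P" for t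
        using that
      proof (induction t)
        case zero
        have "f \<zero>\<^bsub>N\<^esub> = \<zero>\<^bsub>N'\<^esub>"
          by (rule addmap_zero [OF N.M.abelian_group_axioms N'.M.abelian_group_axioms right_hom_addmap [OF f]])
        then show ?case by (simp add: N'.zero_ract y) (metis N.M.zero_closed image_eqI)
      next
        case (add \<psi> v t)
        have c: "\<psi>' v \<in> carrier R" if "\<psi>' \<in> left_hom R P (regular R)" for \<psi>' using left_hom_closed [OF that add(2)] by simp
        have "ract N' y (\<psi> v) \<in> f ` carrier N"
          using key [OF y add(2)] add(1) c by (simp add: gy N''.ract_zero)
        then obtain n n' where n: "n \<in> carrier N" "ract N' y (\<psi> v) = f n" "n' \<in> carrier N" "ract N' y t = f n'"
          using add by blast
        have "ract N' y (\<psi> v \<oplus>\<^bsub>R\<^esub> t) = f (n \<oplus>\<^bsub>N\<^esub> n')"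
          using n add c y trace_ideal_closed by (simp add: N'.ract_add_right addmap_add [OF right_hom_addmap [OF f]])
        then show ?case using n by (simp add: image_iff) (metis N.M.a_closed)
      qed
      from this [OF one] show "y \<in> f ` carrier N" by (simp add: N'.ract_one y)
    qed
    moreover have "f ` carrier N \<subseteq> carrier N'" using right_hom_closed [OF f] by auto
    ultimately show "exact_at N N' N'' f g" unfolding exact_at_def by blast
  qed
qed

end

end

section \<open>The left dual ring of a coring\<close>

text \<open>Elements of the left dual are extensional, while the counit, members of a dual basis and
  composites are arbitrary off the carrier. Contraction ignores the difference.\<close>

lemma contract_cong:
  assumes P: "left_module R P" and N: "right_module R N" and \<psi>: "\<psi> \<in> left_hom R P (regular R)"
    and \<psi>': "\<psi>' \<in> left_hom R P (regular R)" and eq: "\<And>v. v \<in> carrier P \<Longrightarrow> \<psi> v = \<psi>' v"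
    and t: "t \<in> carrier (tensor R N P)"
  shows "contract N \<psi> t = contract N \<psi>' t"
  by (rule tensor_pair.hom_ext [OF tensor_pairI [OF N P] contract_addmap [OF P N \<psi>] contract_addmap [OF P N \<psi>'] t])
    (simp add: contract_pure [OF P N \<psi>] contract_pure [OF P N \<psi>'] eq)

lemma contract_tensor_map:
  assumes P: "left_module R P" and P': "left_module R P'" and N: "right_module R N"
    and \<psi>: "\<psi> \<in> left_hom R P' (regular R)" and h: "h \<in> left_hom R P P'" and t: "t \<in> carrier (tensor R N P)"
  shows "contract N \<psi> (tensor_map R N P' (\<lambda>n. n) h t) = contract N (\<lambda>v. \<psi> (h v)) t"
proof -
  note p = tensor_pairI [OF N P] tensor_pairI [OF N P'] and \<psi>h = left_hom_comp [OF h \<psi>]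
  note m = tensor_map_addmap [OF p id_right_hom h] and mp = tensor_map_pure [OF p id_right_hom h]
  show ?thesis
    using t
  proof (rule tensor_pair.hom_ext [OF p(1), rotated 2])
    show "addmap (tensor R N P) N (\<lambda>t. contract N \<psi> (tensor_map R N P' (\<lambda>n. n) h t))"
      using m contract_addmap [OF P' N \<psi>] by (auto simp: addmap_def)
    show "addmap (tensor R N P) N (contract N (\<lambda>v. \<psi> (h v)))"
      by (rule contract_addmap [OF P N \<psi>h])
  qed (simp add: mp contract_pure [OF P' N \<psi>] contract_pure [OF P N \<psi>h] left_hom_closed [OF h])
qed

lemma contract_ract:
  assumes P: "bimodule R S P" and N: "right_module R N"
    and \<psi>: "\<psi> \<in> left_hom R P (regular R)" and t: "t \<in> carrier (tensor R N P)" and s: "s \<in> carrier S"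
  shows "(\<lambda>v. \<psi> (ract P v s)) \<in> left_hom R P (regular R)"
    and "contract N \<psi> (ract (tensor R N P) t s) = contract N (\<lambda>v. \<psi> (ract P v s)) t"
proof -
  interpret P: bimodule R S P by fact
  interpret N: right_module R N by fact
  interpret T: tensor_right R S N P by (rule tensor_rightI [OF N P])
  have lP: "left_module R P" by (rule P.left_module_axioms)
  have r: "(\<lambda>v. ract P v s) \<in> left_hom R P P"
    using s by (simp add: left_hom_iff addmap_def P.ract_closed P.ract_add_left P.lact_ract)
  show \<psi>': "(\<lambda>v. \<psi> (ract P v s)) \<in> left_hom R P (regular R)" by (rule left_hom_comp [OF r \<psi>])
  show "contract N \<psi> (ract T.T t s) = contract N (\<lambda>v. \<psi> (ract P v s)) t"
    using t
  proof (rule T.hom_ext [rotated 2])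
    show "addmap T.T N (\<lambda>t. contract N \<psi> (ract T.T t s))"
      using contract_addmap [OF lP N \<psi>] T.ract_addmap [OF s] by (auto simp: addmap_def)
    show "addmap T.T N (contract N (\<lambda>v. \<psi> (ract P v s)))" by (rule contract_addmap [OF lP N \<psi>'])
  qed (simp add: s T.ract_pure contract_pure [OF lP N \<psi>] contract_pure [OF lP N \<psi>'] P.ract_closed)
qed

lemma contract_left_hom:
  assumes P: "left_module R P" and N: "bimodule L R N" and \<psi>: "\<psi> \<in> left_hom R P (regular R)"
  shows "contract N \<psi> \<in> left_hom L (tensor R N P) N"
proof -
  interpret N: bimodule L R N by fact
  interpret T: tensor_left R L N P by (rule tensor_leftI [OF N P])
  note rN = N.right_module_axioms
  note ca = contract_addmap [OF P rN \<psi>] and cp = contract_pure [OF P rN \<psi>]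
  have c: "\<psi> q \<in> carrier R" if "q \<in> carrier P" for q using left_hom_closed [OF \<psi> that] by simp
  have "contract N \<psi> (lact T.T a t) = lact N a (contract N \<psi> t)" if a: "a \<in> carrier L" and t: "t \<in> carrier T.T" for a t
    using t
  proof (rule T.hom_ext [rotated 2])
    show "addmap T.T N (\<lambda>t. contract N \<psi> (lact T.T a t))"
      using ca T.lact_addmap [OF a] by (auto simp: addmap_def)
    show "addmap T.T N (\<lambda>t. lact N a (contract N \<psi> t))"
      using ca a by (auto simp: addmap_def N.lact_closed N.lact_add_right)
  qed (simp add: a T.lact_pure cp c N.lact_closed N.lact_ract)
  with ca show ?thesis by (simp add: left_hom_iff)
qed

lemma restrict_scalars_left:
  assumes M: "left_module A M" and S: "ring (A\<lparr>carrier := S\<rparr>)" "S \<subseteq> carrier A"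
  shows "left_module (A\<lparr>carrier := S\<rparr>) M"
proof -
  interpret M: left_module A M by fact
  show ?thesis
    using S(2)
    by (intro left_module.intro left_module_axioms.intro S(1) M.M.abelian_group_axioms)
      (auto simp: subset_iff M.lact_closed M.lact_add_left M.lact_add_right M.lact_assoc M.lact_one)
qed

lemma restrict_scalars_right:
  assumes M: "right_module A M" and S: "ring (A\<lparr>carrier := S\<rparr>)" "S \<subseteq> carrier A"
  shows "right_module (A\<lparr>carrier := S\<rparr>) M"
proof -
  interpret M: right_module A M by fact
  show ?thesis
    using S(2)
    by (intro right_module.intro right_module_axioms.intro S(1) M.M.abelian_group_axioms)
      (auto simp: subset_iff M.ract_closed M.ract_add_left M.ract_add_right M.ract_assoc M.ract_one)
qed

section \<open>Corings with a grouplike element\<close>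

locale grouplike_coring = coring A C for A :: "'a ring" and C :: "('a, 'c) coring" +
  fixes x :: 'c
  assumes grouplike: "grouplike A C x"
begin

lemma x_closed: "x \<in> carrier C" and comul_x: "comul C x = pure_tensor A C C x x" and counit_x: "counit C x = \<one>\<^bsub>A\<^esub>"
  using grouplike by (simp_all add: grouplike_def)

lemma rA: "right_module A (regular A)" and lA: "left_module A (regular A)"
  by (rule regular_right_module regular_left_module; rule L.ring_axioms)+

lemma lC: "left_module A C" and rC: "right_module A C" and bC: "bimodule A A C"
  by (rule left_module_axioms right_module_axioms bimodule_axioms)+

abbreviation "AHom \<equiv> left_hom A C (regular A)"
abbreviation "D \<equiv> left_dual A C"
abbreviation "CC \<equiv> tensor A C C"

sublocale CC: bimodule A A CC by (rule tensor_bimodule [OF bC bC])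
sublocale CCr: tensor_right A A C C by (rule tensor_rightI [OF rC bC])
sublocale CCl: tensor_left A A C C by (rule tensor_leftI [OF bC lC])

lemma comul_left: "comul C \<in> left_hom A C CC" and comul_right: "comul C \<in> right_hom A C CC"
  using comul_hom by (auto simp: bimod_hom_def)

lemma counit_left_hom: "counit C \<in> AHom" and counit_right_hom: "counit C \<in> right_hom A C (regular A)"
  using counit_hom by (auto simp: bimod_hom_def)

lemma AHom_closed: "f \<in> AHom \<Longrightarrow> c \<in> carrier C \<Longrightarrow> f c \<in> carrier A"
  using left_hom_closed [of f A C "regular A" c] by simp

lemma AHom_add: "f \<in> AHom \<Longrightarrow> c \<in> carrier C \<Longrightarrow> d \<in> carrier C \<Longrightarrow> f (c \<oplus>\<^bsub>C\<^esub> d) = f c \<oplus>\<^bsub>A\<^esub> f d"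
  using addmap_add [OF left_hom_addmap, of f A C "regular A" c d] by simp

lemma AHom_lact: "f \<in> AHom \<Longrightarrow> a \<in> carrier A \<Longrightarrow> c \<in> carrier C \<Longrightarrow> f (lact C a c) = a \<otimes>\<^bsub>A\<^esub> f c"
  using left_hom_lact [of f A C "regular A" a c] by simp

lemma AHomI:
  assumes "\<And>c. c \<in> carrier C \<Longrightarrow> f c \<in> carrier A"
    and "\<And>c d. c \<in> carrier C \<Longrightarrow> d \<in> carrier C \<Longrightarrow> f (c \<oplus>\<^bsub>C\<^esub> d) = f c \<oplus>\<^bsub>A\<^esub> f d"
    and "\<And>a c. a \<in> carrier A \<Longrightarrow> c \<in> carrier C \<Longrightarrow> f (lact C a c) = a \<otimes>\<^bsub>A\<^esub> f c"
  shows "f \<in> AHom"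
  using assms by (simp add: left_hom_iff addmap_def)

lemma AHom_addmap: "f \<in> AHom \<Longrightarrow> addmap C A f"
  by (simp add: addmap_def AHom_closed AHom_add)

lemmas AHom_sum = addmap_finsum [OF M.abelian_group_axioms L.abelian_group_axioms AHom_addmap]

lemma counit_closed: "c \<in> carrier C \<Longrightarrow> counit C c \<in> carrier A"
  by (rule AHom_closed [OF counit_left_hom])

lemma xa_closed: "a \<in> carrier A \<Longrightarrow> ract C x a \<in> carrier C"
  by (simp add: ract_closed x_closed)

lemma ax_closed: "a \<in> carrier A \<Longrightarrow> lact C a x \<in> carrier C"
  by (simp add: lact_closed x_closed)

lemma counit_xa: "a \<in> carrier A \<Longrightarrow> counit C (ract C x a) = a"
  using right_hom_ract [OF counit_right_hom, of a x] by (simp add: x_closed counit_x)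

lemma counit_ax: "a \<in> carrier A \<Longrightarrow> counit C (lact C a x) = a"
  by (simp add: AHom_lact [OF counit_left_hom] x_closed counit_x)

lemma comul_xa: "a \<in> carrier A \<Longrightarrow> comul C (ract C x a) = pure_tensor A C C x (ract C x a)"
  using right_hom_ract [OF comul_right, of a x] by (simp add: x_closed comul_x CCr.ract_pure)

text \<open>Sweedler's \<open>c\<^sub>1 f(c\<^sub>2)\<close>.\<close>

definition act :: "'c \<Rightarrow> ('c \<Rightarrow> 'a) \<Rightarrow> 'c"
  where "act c f = contract C f (comul C c)"

lemma act_eq: "tensor_lift C (\<lambda>d e. ract C d (f e)) (comul C c) = act c f"
  by (simp add: act_def contract_def)

lemma act_left_hom: "f \<in> AHom \<Longrightarrow> (\<lambda>c. act c f) \<in> left_hom A C C"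
  unfolding act_def by (rule left_hom_comp [OF comul_left contract_left_hom [OF lC bC]])

lemmas act_closed = left_hom_closed [OF act_left_hom]
lemmas act_lact = left_hom_lact [OF act_left_hom]

lemma act_cong: "f \<in> AHom \<Longrightarrow> g \<in> AHom \<Longrightarrow> c \<in> carrier C \<Longrightarrow> (\<And>d. d \<in> carrier C \<Longrightarrow> f d = g d) \<Longrightarrow> act c f = act c g"
  unfolding act_def by (rule contract_cong [OF lC rC]) (simp_all add: left_hom_closed [OF comul_left])

lemma act_xa: "f \<in> AHom \<Longrightarrow> a \<in> carrier A \<Longrightarrow> act (ract C x a) f = ract C x (f (ract C x a))"
  by (simp add: act_def comul_xa contract_pure [OF lC rC] x_closed xa_closed)

lemma act_x: "f \<in> AHom \<Longrightarrow> act x f = ract C x (f x)"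
  using act_xa [of f "\<one>\<^bsub>A\<^esub>"] by (simp add: ract_one x_closed)

lemma act_counit: "c \<in> carrier C \<Longrightarrow> act c (counit C) = c"
  using counit_right by (simp add: act_def contract_def)

text \<open>\<open>\<epsilon>(c\<^sub>1 f(c\<^sub>2)) = \<epsilon>(c\<^sub>1) f(c\<^sub>2) =
  f(\<epsilon>(c\<^sub>1) c\<^sub>2) = f(c)\<close>, by right linearity of \<epsilon>, left
  linearity of \<open>f\<close> and the counit law. This makes \<epsilon> a right unit of the left
  dual.\<close>

lemma counit_act:
  assumes f: "f \<in> AHom" and c: "c \<in> carrier C" shows "counit C (act c f) = f c"
proof -
  have b: "balanced A C C C (\<lambda>d e. lact C (counit C d) e)"
    using counit_closed AHom_add [OF counit_left_hom] right_hom_ract [OF counit_right_hom]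
    by (intro balancedI) (simp_all add: lact_closed lact_add_left lact_add_right lact_assoc)
  have "counit C (contract C f t) = f (tensor_lift C (\<lambda>d e. lact C (counit C d) e) t)" if t: "t \<in> carrier CC" for t
    using t
  proof (rule CCr.hom_ext [rotated 2])
    show "addmap CC A (\<lambda>t. counit C (contract C f t))"
      using contract_addmap [OF lC rC f] AHom_addmap [OF counit_left_hom] by (auto simp: addmap_def)
    show "addmap CC A (\<lambda>t. f (tensor_lift C (\<lambda>d e. lact C (counit C d) e) t))"
      using CCr.lift_addmap [OF M.abelian_group_axioms b] AHom_addmap [OF f] by (auto simp: addmap_def)
    show "counit C (contract C f (pure_tensor A C C d e)) =
        f (tensor_lift C (\<lambda>d e. lact C (counit C d) e) (pure_tensor A C C d e))"
      if "d \<in> carrier C" "e \<in> carrier C" for d e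
      using that right_hom_ract [OF counit_right_hom, of "f e" d] AHom_closed [OF f]
      by (simp add: contract_pure [OF lC rC f] CCr.lift_pure [OF M.abelian_group_axioms b] AHom_lact [OF f] counit_closed)
  qed
  from this [OF left_hom_closed [OF comul_left c]] show ?thesis
    by (simp add: act_def counit_left [OF c])
qed

text \<open>The two sides of coassociativity, each with its last factor contracted by
  \<open>f\<close>. They are computed for an arbitrary tensor \<open>t\<close>, before
  coassociativity is imposed, so that they serve both where it is given and where it has to be
  proved, as for \<open>dual_comodule\<close>.\<close>

lemma
  assumes N: "right_module A N" and \<rho>: "\<rho> \<in> right_hom A N (tensor A N C)"
    and f: "f \<in> AHom" and t: "t \<in> carrier (tensor A N C)"
  shows contract_tensor_assoc: "tensor_map A N C (\<lambda>n. n) (contract C f)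
        (tensor_assoc A A N C C (tensor_map A (tensor A N C) C \<rho> (\<lambda>c. c) t)) = \<rho> (contract N f t)"
    and contract_comul: "tensor_map A N C (\<lambda>n. n) (contract C f) (tensor_map A N CC (\<lambda>n. n) (comul C) t)
        = tensor_map A N C (\<lambda>n. n) (\<lambda>c. act c f) t"
proof -
  interpret N: right_module A N by fact
  interpret T: tensor_right A A N C by (rule tensor_rightI [OF N bC])
  interpret Tm: right_module A T.T by (rule T.tensor_right_module)
  interpret TC: tensor_pair A T.T C by (rule tensor_pairI [OF Tm.right_module_axioms lC])
  interpret NCC: tensor_pair A N CC by (rule tensor_pairI [OF N CC.left_module_axioms])
  let ?\<Phi> = "tensor_map A N C (\<lambda>n. n) (contract C f)" and ?a = "tensor_assoc A A N C C"
  have h: "contract C f \<in> left_hom A CC C" by (rule contract_left_hom [OF lC bC f])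
  note \<Phi>a = tensor_map_addmap [OF NCC.tensor_pair_axioms T.tensor_pair_axioms id_right_hom h]
    and \<Phi>p = tensor_map_pure [OF NCC.tensor_pair_axioms T.tensor_pair_axioms id_right_hom h]
  note aa = tensor_assoc_addmap [OF N bC lC] and ap = tensor_assoc_pure [OF N bC lC]
  note ra = tensor_map_addmap [OF T.tensor_pair_axioms TC.tensor_pair_axioms \<rho> id_left_hom]
    and rp = tensor_map_pure [OF T.tensor_pair_axioms TC.tensor_pair_axioms \<rho> id_left_hom]
  note fc = AHom_closed [OF f] and \<rho>c = right_hom_closed [OF \<rho>]
  have 1: "?\<Phi> (?a (TC.pure s c)) = ract T.T s (f c)" if s: "s \<in> carrier T.T" and c: "c \<in> carrier C" for s c
    using s
  proof (rule T.hom_ext [rotated 2])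
    show "addmap T.T T.T (\<lambda>s. ?\<Phi> (?a (TC.pure s c)))"
      using \<Phi>a aa TC.pure_addmap_left [OF c] by (auto simp: addmap_def)
    show "addmap T.T T.T (\<lambda>s. ract T.T s (f c))" by (rule T.ract_addmap [OF fc [OF c]])
  qed (simp add: c fc ap \<Phi>p CCr.pure_closed contract_pure [OF lC rC f] T.ract_pure)
  show "?\<Phi> (?a (tensor_map A T.T C \<rho> (\<lambda>c. c) t)) = \<rho> (contract N f t)"
    using t
  proof (rule T.hom_ext [rotated 2])
    show "addmap T.T T.T (\<lambda>t. ?\<Phi> (?a (tensor_map A T.T C \<rho> (\<lambda>c. c) t)))"
      using \<Phi>a aa ra by (auto simp: addmap_def)
    show "addmap T.T T.T (\<lambda>t. \<rho> (contract N f t))"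
      using right_hom_addmap [OF \<rho>] contract_addmap [OF lC N f] by (auto simp: addmap_def)
  qed (simp add: rp 1 \<rho>c contract_pure [OF lC N f] right_hom_ract [OF \<rho>] fc)
  note cp = tensor_map_pure [OF T.tensor_pair_axioms NCC.tensor_pair_axioms id_right_hom comul_left]
  have ca: "addmap T.T NCC.T (tensor_map A N CC (\<lambda>n. n) (comul C))"
    by (rule tensor_map_addmap [OF T.tensor_pair_axioms NCC.tensor_pair_axioms id_right_hom comul_left])
  note ha = tensor_map_addmap [OF T.tensor_pair_axioms T.tensor_pair_axioms id_right_hom act_left_hom [OF f]]
    and hp = tensor_map_pure [OF T.tensor_pair_axioms T.tensor_pair_axioms id_right_hom act_left_hom [OF f]]
  show "?\<Phi> (tensor_map A N CC (\<lambda>n. n) (comul C) t) = tensor_map A N C (\<lambda>n. n) (\<lambda>c. act c f) t"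
    using t
  proof (rule T.hom_ext [rotated 2])
    show "addmap T.T T.T (\<lambda>t. ?\<Phi> (tensor_map A N CC (\<lambda>n. n) (comul C) t))"
      using \<Phi>a ca by (auto simp: addmap_def)
  qed (simp_all add: ha hp cp \<Phi>p left_hom_closed [OF comul_left] act_def [symmetric])
qed

lemma coact_contract:
  assumes N: "right_module A N" and \<rho>: "\<rho> \<in> right_hom A N (tensor A N C)"
    and co: "tensor_assoc A A N C C (tensor_map A (tensor A N C) C \<rho> (\<lambda>c. c) (\<rho> n)) = tensor_map A N CC (\<lambda>n. n) (comul C) (\<rho> n)"
    and f: "f \<in> AHom" and n: "n \<in> carrier N"
  shows "\<rho> (contract N f (\<rho> n)) = tensor_map A N C (\<lambda>n. n) (\<lambda>c. act c f) (\<rho> n)"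
  using contract_tensor_assoc [OF N \<rho> f right_hom_closed [OF \<rho> n]] contract_comul [OF N \<rho> f right_hom_closed [OF \<rho> n]]
  by (simp add: co)

lemma contract_contract:
  assumes N: "right_module A N" and \<rho>: "\<rho> \<in> right_hom A N (tensor A N C)"
    and co: "tensor_assoc A A N C C (tensor_map A (tensor A N C) C \<rho> (\<lambda>c. c) (\<rho> n)) = tensor_map A N CC (\<lambda>n. n) (comul C) (\<rho> n)"
    and f: "f \<in> AHom" and g: "g \<in> AHom" and n: "n \<in> carrier N"
  shows "contract N g (\<rho> (contract N f (\<rho> n))) = contract N (\<lambda>c. g (act c f)) (\<rho> n)"
  unfolding coact_contract [OF N \<rho> co f n]
  by (rule contract_tensor_map [OF lC lC N g act_left_hom [OF f] right_hom_closed [OF \<rho> n]])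

text \<open>\<open>C\<close> is a comodule over itself, and for a comodule iterated contraction is
  contraction with the product. So \<open>act\<close> is a right action of the left dual on
  \<open>C\<close>, from which associativity of the product follows.\<close>

lemma act_act: "f \<in> AHom \<Longrightarrow> g \<in> AHom \<Longrightarrow> c \<in> carrier C \<Longrightarrow> act (act c f) g = act c (\<lambda>c. g (act c f))"
  unfolding act_def using contract_contract [OF rC comul_right coassoc] by (simp add: act_def)

section \<open>Ring structure of the left dual\<close>

lemma D_carrier: "f \<in> carrier D \<longleftrightarrow> f \<in> AHom \<and> f \<in> extensional (carrier C)"
  by (simp add: left_dual_def)

lemma D_AHom: "f \<in> carrier D \<Longrightarrow> f \<in> AHom"
  by (simp add: D_carrier)

lemma D_eqI: "f \<in> carrier D \<Longrightarrow> g \<in> carrier D \<Longrightarrow> (\<And>c. c \<in> carrier C \<Longrightarrow> f c = g c) \<Longrightarrow> f = g"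
  by (auto simp: D_carrier intro: extensionalityI)

lemma D_mult: "c \<in> carrier C \<Longrightarrow> (f \<otimes>\<^bsub>D\<^esub> g) c = g (act c f)"
  and D_one: "c \<in> carrier C \<Longrightarrow> \<one>\<^bsub>D\<^esub> c = counit C c"
  and D_zero: "c \<in> carrier C \<Longrightarrow> \<zero>\<^bsub>D\<^esub> c = \<zero>\<^bsub>A\<^esub>"
  and D_add: "c \<in> carrier C \<Longrightarrow> (f \<oplus>\<^bsub>D\<^esub> g) c = f c \<oplus>\<^bsub>A\<^esub> g c"
  by (simp_all add: left_dual_def act_eq)

lemma D_restrictI: "f \<in> AHom \<Longrightarrow> restrict f (carrier C) \<in> carrier D"
  by (simp add: D_carrier left_hom_iff addmap_def M.a_closed lact_closed)

lemma D_mult_closed: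
  assumes f: "f \<in> carrier D" and g: "g \<in> carrier D" shows "f \<otimes>\<^bsub>D\<^esub> g \<in> carrier D"
proof -
  have "(\<lambda>c. g (act c f)) \<in> AHom"
    by (rule left_hom_comp [OF act_left_hom [OF D_AHom [OF f]] D_AHom [OF g]])
  from D_restrictI [OF this] show ?thesis by (simp add: left_dual_def act_eq)
qed

lemma D_one_closed: "\<one>\<^bsub>D\<^esub> \<in> carrier D"
  using D_restrictI [OF counit_left_hom] by (simp add: left_dual_def)

lemma D_zero_closed: "\<zero>\<^bsub>D\<^esub> \<in> carrier D"
proof -
  have "(\<lambda>c. \<zero>\<^bsub>A\<^esub>) \<in> AHom" by (rule AHomI) simp_all
  from D_restrictI [OF this] show ?thesis by (simp add: left_dual_def)
qed

lemma D_add_closed: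
  assumes f: "f \<in> carrier D" and g: "g \<in> carrier D" shows "f \<oplus>\<^bsub>D\<^esub> g \<in> carrier D"
proof -
  note c = AHom_closed [OF D_AHom [OF f]] AHom_closed [OF D_AHom [OF g]]
  have "(\<lambda>c. f c \<oplus>\<^bsub>A\<^esub> g c) \<in> AHom"
    by (rule AHomI) (simp_all add: c AHom_add [OF D_AHom [OF f]] AHom_add [OF D_AHom [OF g]]
        AHom_lact [OF D_AHom [OF f]] AHom_lact [OF D_AHom [OF g]] L.a_ac L.r_distr)
  from D_restrictI [OF this] show ?thesis by (simp add: left_dual_def)
qed

lemma D_abelian: "abelian_group D"
proof (rule abelian_groupI)
  show "\<exists>g\<in>carrier D. g \<oplus>\<^bsub>D\<^esub> f = \<zero>\<^bsub>D\<^esub>" if f: "f \<in> carrier D" for f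
  proof
    note fA = D_AHom [OF f]
    have "(\<lambda>c. \<ominus>\<^bsub>A\<^esub> f c) \<in> AHom"
      by (rule AHomI) (simp_all add: AHom_closed [OF fA] AHom_add [OF fA] AHom_lact [OF fA] L.minus_add L.r_minus)
    from D_restrictI [OF this] show g: "restrict (\<lambda>c. \<ominus>\<^bsub>A\<^esub> f c) (carrier C) \<in> carrier D" .
    show "restrict (\<lambda>c. \<ominus>\<^bsub>A\<^esub> f c) (carrier C) \<oplus>\<^bsub>D\<^esub> f = \<zero>\<^bsub>D\<^esub>"
      by (rule D_eqI [OF D_add_closed [OF g f] D_zero_closed]) (simp add: D_add D_zero L.l_neg AHom_closed [OF fA])
  qed
  show "f \<oplus>\<^bsub>D\<^esub> g \<oplus>\<^bsub>D\<^esub> h = f \<oplus>\<^bsub>D\<^esub> (g \<oplus>\<^bsub>D\<^esub> h)" if "f \<in> carrier D" "g \<in> carrier D" "h \<in> carrier D" for f g h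
    using that by (intro D_eqI) (auto simp: D_add D_add_closed L.a_assoc AHom_closed D_AHom)
  show "f \<oplus>\<^bsub>D\<^esub> g = g \<oplus>\<^bsub>D\<^esub> f" if "f \<in> carrier D" "g \<in> carrier D" for f g
    using that by (intro D_eqI) (auto simp: D_add D_add_closed L.a_comm AHom_closed D_AHom)
  show "\<zero>\<^bsub>D\<^esub> \<oplus>\<^bsub>D\<^esub> f = f" if "f \<in> carrier D" for f
    using that by (intro D_eqI) (auto simp: D_add D_zero D_add_closed D_zero_closed AHom_closed D_AHom)
qed (simp_all add: D_add_closed D_zero_closed)

lemma D_act_mult: "f \<in> carrier D \<Longrightarrow> g \<in> carrier D \<Longrightarrow> c \<in> carrier C \<Longrightarrow> act c (f \<otimes>\<^bsub>D\<^esub> g) = act (act c f) g"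
  using act_act [OF D_AHom D_AHom]
    act_cong [OF D_AHom [OF D_mult_closed] left_hom_comp [OF act_left_hom [OF D_AHom] D_AHom]]
  by (simp add: D_mult)

lemma D_act_one: "c \<in> carrier C \<Longrightarrow> act c \<one>\<^bsub>D\<^esub> = c"
  using act_cong [OF D_AHom [OF D_one_closed] counit_left_hom] by (simp add: D_one act_counit)

text \<open>The product puts its left factor inside \<open>act\<close>, so distributivity on that
  side rests on additivity of contraction in the functional.\<close>

lemma D_act_add:
  assumes f: "f \<in> carrier D" and g: "g \<in> carrier D" and c: "c \<in> carrier C"
  shows "act c (f \<oplus>\<^bsub>D\<^esub> g) = act c f \<oplus>\<^bsub>C\<^esub> act c g"
proof -
  note fA = D_AHom [OF f] and gA = D_AHom [OF g] and fg = D_AHom [OF D_add_closed [OF f g]]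
  have "contract C (f \<oplus>\<^bsub>D\<^esub> g) t = contract C f t \<oplus>\<^bsub>C\<^esub> contract C g t" if "t \<in> carrier CC" for t
    using that
  proof (rule CCr.hom_ext [rotated 2])
    show "addmap CC C (\<lambda>t. contract C f t \<oplus>\<^bsub>C\<^esub> contract C g t)"
      using contract_addmap [OF lC rC fA] contract_addmap [OF lC rC gA]
      by (intro addmapI) (simp_all add: addmap_closed addmap_add M.a_ac)
    show "addmap CC C (contract C (f \<oplus>\<^bsub>D\<^esub> g))" by (rule contract_addmap [OF lC rC fg])
  qed (simp add: contract_pure [OF lC rC fA] contract_pure [OF lC rC gA] contract_pure [OF lC rC fg]
      D_add ract_add_right AHom_closed [OF fA] AHom_closed [OF gA])
  then show ?thesis by (simp add: act_def left_hom_closed [OF comul_left c])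
qed

lemma D_ring: "ring D"
proof (rule ringI [OF D_abelian])
  show "monoid D"
  proof (rule monoidI)
    show "f \<otimes>\<^bsub>D\<^esub> g \<otimes>\<^bsub>D\<^esub> h = f \<otimes>\<^bsub>D\<^esub> (g \<otimes>\<^bsub>D\<^esub> h)" if "f \<in> carrier D" "g \<in> carrier D" "h \<in> carrier D" for f g h
      by (rule D_eqI) (use that in \<open>simp_all add: D_mult_closed D_mult D_act_mult act_closed D_AHom\<close>)
    show "\<one>\<^bsub>D\<^esub> \<otimes>\<^bsub>D\<^esub> f = f" if "f \<in> carrier D" for f
      by (rule D_eqI) (use that in \<open>simp_all add: D_mult_closed D_one_closed D_mult D_act_one\<close>)
    show "f \<otimes>\<^bsub>D\<^esub> \<one>\<^bsub>D\<^esub> = f" if "f \<in> carrier D" for f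
      by (rule D_eqI) (use that in \<open>simp_all add: D_mult_closed D_one_closed D_mult D_one counit_act act_closed D_AHom\<close>)
  qed (simp_all add: D_mult_closed D_one_closed)
  show "(f \<oplus>\<^bsub>D\<^esub> g) \<otimes>\<^bsub>D\<^esub> h = f \<otimes>\<^bsub>D\<^esub> h \<oplus>\<^bsub>D\<^esub> g \<otimes>\<^bsub>D\<^esub> h" if "f \<in> carrier D" "g \<in> carrier D" "h \<in> carrier D" for f g h
    by (rule D_eqI) (use that in \<open>simp_all add: D_mult_closed D_add_closed D_mult D_add D_act_add AHom_add [OF D_AHom] act_closed D_AHom\<close>)
  show "h \<otimes>\<^bsub>D\<^esub> (f \<oplus>\<^bsub>D\<^esub> g) = h \<otimes>\<^bsub>D\<^esub> f \<oplus>\<^bsub>D\<^esub> h \<otimes>\<^bsub>D\<^esub> g" if "f \<in> carrier D" "g \<in> carrier D" "h \<in> carrier D" for f g h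
    by (rule D_eqI) (use that in \<open>simp_all add: D_mult_closed D_add_closed D_mult D_add act_closed D_AHom\<close>)
qed

sublocale D: ring D by (rule D_ring)

lemma D_eval_addmap: "c \<in> carrier C \<Longrightarrow> addmap D A (\<lambda>f. f c)"
  by (simp add: addmap_def D_add AHom_closed D_AHom)

lemma dual_incl_closed: "a \<in> carrier A \<Longrightarrow> dual_incl A C a \<in> carrier D"
proof -
  assume a: "a \<in> carrier A"
  have "(\<lambda>c. counit C c \<otimes>\<^bsub>A\<^esub> a) \<in> AHom"
    by (rule AHomI) (simp_all add: a counit_closed AHom_add [OF counit_left_hom] AHom_lact [OF counit_left_hom] L.l_distr L.m_assoc)
  from D_restrictI [OF this] show ?thesis by (simp add: dual_incl_def)
qed

lemma dual_incl_mult: "f \<in> carrier D \<Longrightarrow> a \<in> carrier A \<Longrightarrow> c \<in> carrier C \<Longrightarrow>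
    (f \<otimes>\<^bsub>D\<^esub> dual_incl A C a) c = f c \<otimes>\<^bsub>A\<^esub> a"
  by (simp add: D_mult dual_incl_def act_closed D_AHom counit_act)

end

section \<open>Elementwise form of the Morita context\<close>

lemma abelian_group_subset:
  assumes M: "abelian_group M" and S: "S \<subseteq> carrier M" "\<zero>\<^bsub>M\<^esub> \<in> S" "\<And>a b. a \<in> S \<Longrightarrow> b \<in> S \<Longrightarrow> a \<oplus>\<^bsub>M\<^esub> b \<in> S"
      "\<And>a. a \<in> S \<Longrightarrow> \<ominus>\<^bsub>M\<^esub> a \<in> S"
    and N: "carrier N = S" "ring.add N = ring.add M" "ring.zero N = ring.zero M"
  shows "abelian_group N"
proof -
  interpret M: abelian_group M by fact
  show ?thesis
  proof (rule abelian_groupI, unfold N)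
    show "\<exists>b\<in>S. b \<oplus>\<^bsub>M\<^esub> a = \<zero>\<^bsub>M\<^esub>" if "a \<in> S" for a
      using S(1,4) that by (intro bexI [of _ "\<ominus>\<^bsub>M\<^esub> a"]) (auto simp: M.l_neg)
  qed (use S in \<open>auto simp: subset_iff M.a_ac\<close>)
qed

lemma finsum_regular: "finsum (regular A) = finsum A"
  by (intro ext finsum_ring_cong) simp_all

context grouplike_coring
begin

abbreviation "B \<equiv> coinvariant_ring A C x"
abbreviation "Q \<equiv> morita_Q A C x"
abbreviation "Am \<equiv> morita_A A C x"

lemma B_simps [simp]: "ring.add B = ring.add A" "ring.zero B = ring.zero A" "monoid.mult B = monoid.mult A" "one B = one A"
  by (simp_all add: coinvariant_ring_def)

lemma B_iff: "b \<in> carrier B \<longleftrightarrow> b \<in> carrier A \<and> lact C b x = ract C x b"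
  by (simp add: coinvariant_ring_def)

lemma B_update: "A\<lparr>carrier := carrier B\<rparr> = B"
  by (simp add: coinvariant_ring_def)

lemma Q_simps [simp]: "ring.add Q = ring.add D" "ring.zero Q = ring.zero D"
    "lact Q f q = f \<otimes>\<^bsub>D\<^esub> q" "ract Q q b = q \<otimes>\<^bsub>D\<^esub> dual_incl A C b"
  by (simp_all add: morita_Q_def ring.defs)

lemma Q_iff: "q \<in> carrier Q \<longleftrightarrow> q \<in> carrier D \<and> (\<forall>c\<in>carrier C. act c q = lact C (q c) x)"
  by (simp add: morita_Q_def ring.defs act_eq)

lemma Am_simps [simp]: "carrier Am = carrier A" "ring.add Am = ring.add A" "ring.zero Am = ring.zero A"
    "lact Am b a = b \<otimes>\<^bsub>A\<^esub> a" "ract Am a f = f (ract C x a)"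
  by (simp_all add: morita_A_def ring.defs)

lemma B_A: "b \<in> carrier B \<Longrightarrow> b \<in> carrier A"
  by (simp add: B_iff)

lemma B_subring: "subring (carrier B) A"
proof (rule L.subringI)
  show "carrier B \<subseteq> carrier A" by (auto simp: B_iff)
  show "\<one>\<^bsub>A\<^esub> \<in> carrier B" by (simp add: B_iff lact_one ract_one x_closed)
  show "\<ominus>\<^bsub>A\<^esub> b \<in> carrier B" if b: "b \<in> carrier B" for b
  proof -
    have "lact C (\<ominus>\<^bsub>A\<^esub> b) x = \<ominus>\<^bsub>C\<^esub> lact C b x"
      by (rule addmap_neg [OF L.abelian_group_axioms M.abelian_group_axioms act_addmap_left [OF x_closed] B_A [OF b]])
    moreover have "ract C x (\<ominus>\<^bsub>A\<^esub> b) = \<ominus>\<^bsub>C\<^esub> ract C x b"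
      by (rule addmap_neg [OF L.abelian_group_axioms M.abelian_group_axioms act_addmap_right [OF x_closed] B_A [OF b]])
    ultimately show ?thesis using b by (simp add: B_iff)
  qed
  show "b \<otimes>\<^bsub>A\<^esub> b' \<in> carrier B" if "b \<in> carrier B" "b' \<in> carrier B" for b b'
    using that by (simp add: B_iff lact_assoc ract_assoc x_closed lact_ract [symmetric])
  show "b \<oplus>\<^bsub>A\<^esub> b' \<in> carrier B" if "b \<in> carrier B" "b' \<in> carrier B" for b b'
    using that by (simp add: B_iff lact_add_left ract_add_right x_closed)
qed

lemma B_ring: "ring B"
  using L.subring_is_ring [OF B_subring] by (simp add: B_update)

sublocale B: ring B by (rule B_ring)

lemma xba: "b \<in> carrier B \<Longrightarrow> a \<in> carrier A \<Longrightarrow> ract C x (b \<otimes>\<^bsub>A\<^esub> a) = lact C b (ract C x a)"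
  by (simp add: B_iff ract_assoc x_closed lact_ract [symmetric])

lemma xa_add: "a \<in> carrier A \<Longrightarrow> b \<in> carrier A \<Longrightarrow> ract C x (a \<oplus>\<^bsub>A\<^esub> b) = ract C x a \<oplus>\<^bsub>C\<^esub> ract C x b"
  by (simp add: ract_add_right x_closed)

lemma Q_D: "q \<in> carrier Q \<Longrightarrow> q \<in> carrier D" and Q_AHom: "q \<in> carrier Q \<Longrightarrow> q \<in> AHom"
  and Q_act: "q \<in> carrier Q \<Longrightarrow> c \<in> carrier C \<Longrightarrow> act c q = lact C (q c) x"
  by (simp_all add: Q_iff D_AHom)

text \<open>For \<open>c = xa\<close> the coproduct is \<open>x \<otimes> xa\<close>, so
  \<open>act\<close> returns \<open>x q(xa)\<close>, while membership in \<open>Q\<close> demands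
  \<open>q(xa) x\<close>. The two together say that \<open>q(xa)\<close> commutes with
  \<open>x\<close>.\<close>

lemma Q_xa: "q \<in> carrier Q \<Longrightarrow> a \<in> carrier A \<Longrightarrow> q (ract C x a) \<in> carrier B"
  using Q_act [of q "ract C x a"] act_xa [OF Q_AHom, of q a] by (simp add: B_iff xa_closed AHom_closed [OF Q_AHom])

lemma dual_incl_act:
  assumes u: "u \<in> carrier A" and b: "b \<in> carrier A"
  shows "act (lact C u x) (dual_incl A C b) = lact C u (ract C x b)"
proof -
  note i = D_AHom [OF dual_incl_closed [OF b]]
  have "dual_incl A C b x = b" using b by (simp add: dual_incl_def x_closed counit_x)
  then show ?thesis using u act_lact [OF i u x_closed] by (simp add: act_x [OF i])
qed

lemma Q_mult_left: "f \<in> carrier D \<Longrightarrow> q \<in> carrier Q \<Longrightarrow> f \<otimes>\<^bsub>D\<^esub> q \<in> carrier Q"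
  unfolding Q_iff [of "f \<otimes>\<^bsub>D\<^esub> q"]
  by (intro conjI ballI) (simp_all add: D_mult_closed D_act_mult Q_D Q_act act_closed D_AHom D_mult)

lemma Q_mult_right:
  assumes q: "q \<in> carrier Q" and b: "b \<in> carrier B" shows "q \<otimes>\<^bsub>D\<^esub> dual_incl A C b \<in> carrier Q"
  unfolding Q_iff
proof (intro conjI ballI)
  show "q \<otimes>\<^bsub>D\<^esub> dual_incl A C b \<in> carrier D" using D_mult_closed [OF Q_D [OF q] dual_incl_closed [OF B_A [OF b]]] .
  fix c assume c: "c \<in> carrier C"
  have qc: "q c \<in> carrier A" by (rule AHom_closed [OF Q_AHom [OF q] c])
  have "act c (q \<otimes>\<^bsub>D\<^esub> dual_incl A C b) = lact C (q c) (ract C x b)"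
    using b by (simp add: D_act_mult Q_D q dual_incl_closed B_A c Q_act dual_incl_act qc)
  also have "\<dots> = lact C (q c) (lact C b x)" using b by (simp add: B_iff)
  finally show "act c (q \<otimes>\<^bsub>D\<^esub> dual_incl A C b) = lact C ((q \<otimes>\<^bsub>D\<^esub> dual_incl A C b) c) x"
    using b qc c by (simp add: dual_incl_mult Q_D q B_A lact_assoc x_closed)
qed

lemma D_neg: "f \<in> carrier D \<Longrightarrow> c \<in> carrier C \<Longrightarrow> (\<ominus>\<^bsub>D\<^esub> f) c = \<ominus>\<^bsub>A\<^esub> f c"
  by (rule addmap_neg [OF D_abelian L.abelian_group_axioms D_eval_addmap])

lemma act_addmap_D: "c \<in> carrier C \<Longrightarrow> addmap D C (act c)"
  by (simp add: addmap_def D_act_add act_closed D_AHom)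

lemma Q_abelian: "abelian_group Q"
proof (rule abelian_group_subset [OF D_abelian])
  show "carrier Q \<subseteq> carrier D" by (auto simp: Q_iff)
  show "\<zero>\<^bsub>D\<^esub> \<in> carrier Q"
    using addmap_zero [OF D_abelian M.abelian_group_axioms act_addmap_D] by (simp add: Q_iff D_zero zero_lact x_closed)
  show "p \<oplus>\<^bsub>D\<^esub> q \<in> carrier Q" if "p \<in> carrier Q" "q \<in> carrier Q" for p q
    using that by (simp add: Q_iff D_act_add D_add lact_add_left AHom_closed D_AHom x_closed)
  show "\<ominus>\<^bsub>D\<^esub> q \<in> carrier Q" if q: "q \<in> carrier Q" for q
  proof -
    have "act c (\<ominus>\<^bsub>D\<^esub> q) = lact C ((\<ominus>\<^bsub>D\<^esub> q) c) x" if c: "c \<in> carrier C" for c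
      using addmap_neg [OF D_abelian M.abelian_group_axioms act_addmap_D [OF c] Q_D [OF q]]
        addmap_neg [OF L.abelian_group_axioms M.abelian_group_axioms act_addmap_left [OF x_closed] AHom_closed [OF Q_AHom [OF q] c]]
      by (simp add: D_neg Q_D q c Q_act)
    then show ?thesis using Q_D [OF q] by (simp add: Q_iff)
  qed
qed simp_all

lemma Am_abelian: "abelian_group Am"
  by (rule abelian_group_cong [OF L.abelian_group_axioms]) simp_all

section \<open>The pairings \<tau> and \<mu>\<close>

lemma tau_pair: "tensor_pair D Am Q"
  by (intro tensor_pair.intro tensor_pair_axioms.intro Am_abelian Q_abelian)
    (auto simp: AHom_closed D_AHom xa_closed Q_mult_left)

lemma mu_pair: "tensor_pair B Q Am"
  by (intro tensor_pair.intro tensor_pair_axioms.intro Am_abelian Q_abelian)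
    (auto simp: Q_mult_right B_A)

sublocale tau: tensor_pair D Am Q by (rule tau_pair)
sublocale mu: tensor_pair B Q Am by (rule mu_pair)

lemma tau_balanced: "balanced D Am Q B (\<lambda>a q. q (ract C x a))"
  by (rule balancedI)
    (simp_all add: Q_xa xa_add AHom_add [OF Q_AHom] D_add D_mult act_xa D_AHom xa_closed)

lemma mu_balanced: "balanced B Q Am D (\<lambda>q a. q \<otimes>\<^bsub>D\<^esub> dual_incl A C a)"
proof (rule balancedI)
  note [simp] = D_mult_closed dual_incl_closed B_A Q_D D_add_closed D_add dual_incl_mult AHom_closed Q_AHom
  show "(p \<oplus>\<^bsub>Q\<^esub> q) \<otimes>\<^bsub>D\<^esub> dual_incl A C a = p \<otimes>\<^bsub>D\<^esub> dual_incl A C a \<oplus>\<^bsub>D\<^esub> q \<otimes>\<^bsub>D\<^esub> dual_incl A C a"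
    if "p \<in> carrier Q" "q \<in> carrier Q" "a \<in> carrier Am" for p q a
    by (rule D_eqI) (use that in \<open>simp_all add: L.l_distr\<close>)
  show "q \<otimes>\<^bsub>D\<^esub> dual_incl A C (a \<oplus>\<^bsub>Am\<^esub> b) = q \<otimes>\<^bsub>D\<^esub> dual_incl A C a \<oplus>\<^bsub>D\<^esub> q \<otimes>\<^bsub>D\<^esub> dual_incl A C b"
    if "q \<in> carrier Q" "a \<in> carrier Am" "b \<in> carrier Am" for q a b
    by (rule D_eqI) (use that in \<open>simp_all add: L.r_distr\<close>)
  show "ract Q q b \<otimes>\<^bsub>D\<^esub> dual_incl A C a = q \<otimes>\<^bsub>D\<^esub> dual_incl A C (lact Am b a)"
    if "q \<in> carrier Q" "b \<in> carrier B" "a \<in> carrier Am" for q b a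
    by (rule D_eqI) (use that in \<open>simp_all add: L.m_assoc\<close>)
qed (auto simp: D_mult_closed dual_incl_closed Q_D)

lemma tau_pure: "a \<in> carrier A \<Longrightarrow> q \<in> carrier Q \<Longrightarrow> morita_tau A C x (pure_tensor D Am Q a q) = q (ract C x a)"
  unfolding morita_tau_def by (rule tau.lift_pure [OF B.abelian_group_axioms tau_balanced]) simp_all

lemma tau_addmap: "addmap tau.T B (morita_tau A C x)"
  unfolding morita_tau_def by (rule tau.lift_addmap [OF B.abelian_group_axioms tau_balanced])

lemma mu_pure: "q \<in> carrier Q \<Longrightarrow> a \<in> carrier A \<Longrightarrow> morita_mu A C (pure_tensor B Q Am q a) = q \<otimes>\<^bsub>D\<^esub> dual_incl A C a"
  unfolding morita_mu_def by (rule mu.lift_pure [OF D_abelian mu_balanced]) simp_all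

lemma mu_addmap: "addmap mu.T D (morita_mu A C)"
  unfolding morita_mu_def by (rule mu.lift_addmap [OF D_abelian mu_balanced])

definition "tau_image = morita_tau A C x ` carrier tau.T"

lemma tau_image_B: "b \<in> tau_image \<Longrightarrow> b \<in> carrier B"
  by (auto simp: tau_image_def addmap_closed [OF tau_addmap])

lemma tau_image_pure: "a \<in> carrier A \<Longrightarrow> q \<in> carrier Q \<Longrightarrow> q (ract C x a) \<in> tau_image"
  unfolding tau_image_def by (rule image_eqI [where x = "tau.pure a q"]) (simp_all add: tau_pure tau.pure_closed)

lemma tau_image_add: "b \<in> tau_image \<Longrightarrow> b' \<in> tau_image \<Longrightarrow> b \<oplus>\<^bsub>A\<^esub> b' \<in> tau_image"
  using addmap_add [OF tau_addmap] unfolding tau_image_def by (auto simp: image_iff) (metis tau.T.a_closed)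

lemma tau_image_zero: "\<zero>\<^bsub>A\<^esub> \<in> tau_image"
  using addmap_zero [OF tau.tensor_abelian B.abelian_group_axioms tau_addmap]
  unfolding tau_image_def by (metis B_simps(2) image_eqI tau.T.zero_closed)

lemma tau_image_induct [consumes 1, case_names pure add]:
  assumes "b \<in> tau_image" and "\<And>a q. a \<in> carrier A \<Longrightarrow> q \<in> carrier Q \<Longrightarrow> P (q (ract C x a))"
    and "\<And>b b'. b \<in> tau_image \<Longrightarrow> b' \<in> tau_image \<Longrightarrow> P b \<Longrightarrow> P b' \<Longrightarrow> P (b \<oplus>\<^bsub>A\<^esub> b')"
  shows "P b"
proof -
  obtain t where t: "t \<in> carrier tau.T" "b = morita_tau A C x t" using assms(1) by (auto simp: tau_image_def)
  have "P (morita_tau A C x t)"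
    using t(1)
  proof (induction rule: tau.tensor_induct)
    case (add t u)
    then show ?case
      using assms(3) [of "morita_tau A C x t" "morita_tau A C x u"]
      by (simp add: addmap_add [OF tau_addmap] tau_image_def)
  qed (simp add: assms(2) tau_pure)
  then show ?thesis by (simp add: t)
qed

text \<open>\<open>b q(xa) = q(b x a) = q(x b a)\<close>, since \<open>q\<close> is left linear and
  \<open>b\<close> commutes with \<open>x\<close>. With the closure of \<open>Q\<close> under right
  multiplication, used in the next lemma, this makes the image of \<tau> a two-sided ideal of
  \<open>B\<close>.\<close>

lemma tau_image_mult_left: "t \<in> tau_image \<Longrightarrow> b \<in> carrier B \<Longrightarrow> b \<otimes>\<^bsub>A\<^esub> t \<in> tau_image"
proof (induction rule: tau_image_induct)
  case (pure a q)
  then have "b \<otimes>\<^bsub>A\<^esub> q (ract C x a) = q (ract C x (b \<otimes>\<^bsub>A\<^esub> a))"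
    by (simp add: xba AHom_lact [OF Q_AHom] B_A xa_closed)
  then show ?case using pure by (simp add: tau_image_pure B_A)
next
  case (add t t')
  then show ?case using tau_image_B B_A by (simp add: L.r_distr tau_image_add)
qed

lemma tau_image_mult_right: "t \<in> tau_image \<Longrightarrow> b \<in> carrier B \<Longrightarrow> t \<otimes>\<^bsub>A\<^esub> b \<in> tau_image"
proof (induction rule: tau_image_induct)
  case (pure a q)
  then have "q (ract C x a) \<otimes>\<^bsub>A\<^esub> b = (q \<otimes>\<^bsub>D\<^esub> dual_incl A C b) (ract C x a)"
    by (simp add: dual_incl_mult Q_D B_A xa_closed)
  then show ?case using pure tau_image_pure [OF _ Q_mult_right] by simp
next
  case (add t t')
  then show ?case using tau_image_B B_A by (simp add: L.l_distr tau_image_add)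
qed

lemma tau_image_neg: "t \<in> tau_image \<Longrightarrow> \<ominus>\<^bsub>A\<^esub> t \<in> tau_image"
  using tau_image_mult_left [of t "\<ominus>\<^bsub>A\<^esub> \<one>\<^bsub>A\<^esub>"] subringE(3,5) [OF B_subring] B_A [OF tau_image_B, of t]
  by (simp add: L.l_minus)

section \<open>Strictness in terms of elements\<close>

definition gal_basis :: "'i set \<Rightarrow> ('i \<Rightarrow> 'c \<Rightarrow> 'a) \<Rightarrow> ('i \<Rightarrow> 'a) \<Rightarrow> bool"
  where "gal_basis I r s \<longleftrightarrow> finite I \<and> r \<in> I \<rightarrow> carrier Q \<and> s \<in> I \<rightarrow> carrier A \<and>
    (\<forall>c\<in>carrier C. (\<Oplus>\<^bsub>A\<^esub>i\<in>I. r i c \<otimes>\<^bsub>A\<^esub> s i) = counit C c)"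

lemma mu_sum_apply:
  assumes "r \<in> I \<rightarrow> carrier D" "s \<in> I \<rightarrow> carrier A" "c \<in> carrier C"
  shows "(\<Oplus>\<^bsub>D\<^esub>i\<in>I. r i \<otimes>\<^bsub>D\<^esub> dual_incl A C (s i)) c = (\<Oplus>\<^bsub>A\<^esub>i\<in>I. r i c \<otimes>\<^bsub>A\<^esub> s i)"
proof -
  note rs = funcset_mem [OF assms(1)] funcset_mem [OF assms(2)]
  have "(\<Oplus>\<^bsub>D\<^esub>i\<in>I. r i \<otimes>\<^bsub>D\<^esub> dual_incl A C (s i)) c = (\<Oplus>\<^bsub>A\<^esub>i\<in>I. (r i \<otimes>\<^bsub>D\<^esub> dual_incl A C (s i)) c)"
    by (rule addmap_finsum [OF D_abelian L.abelian_group_axioms D_eval_addmap [OF assms(3)]])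
      (use assms in \<open>auto intro!: D_mult_closed dual_incl_closed\<close>)
  also have "\<dots> = (\<Oplus>\<^bsub>A\<^esub>i\<in>I. r i c \<otimes>\<^bsub>A\<^esub> s i)"
    by (rule L.finsum_cong') (use rs assms(3) in \<open>auto simp: dual_incl_mult AHom_closed D_AHom\<close>)
  finally show ?thesis .
qed

text \<open>Since \<open>r # i(s)\<close> takes the value \<open>r(c) s\<close> at \<open>c\<close>,
  the pointwise condition is an equation between two elements of \<open>D\<close>. The pointwise
  form is convenient for evaluating at \<open>xa\<close>, the other for multiplying and for acting
  on \<open>C\<close>.\<close>

lemma gal_basis_iff_D:
  assumes "finite I" "r \<in> I \<rightarrow> carrier Q" "s \<in> I \<rightarrow> carrier A"
  shows "gal_basis I r s \<longleftrightarrow> (\<Oplus>\<^bsub>D\<^esub>i\<in>I. r i \<otimes>\<^bsub>D\<^esub> dual_incl A C (s i)) = \<one>\<^bsub>D\<^esub>"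
proof -
  have r: "r \<in> I \<rightarrow> carrier D" using assms(2) Q_D by blast
  have cl: "(\<Oplus>\<^bsub>D\<^esub>i\<in>I. r i \<otimes>\<^bsub>D\<^esub> dual_incl A C (s i)) \<in> carrier D"
    using r assms(3) by (auto intro!: D.finsum_closed dual_incl_closed)
  show ?thesis
    unfolding gal_basis_def using assms mu_sum_apply [OF r assms(3)] D_one D_eqI [OF cl D_one_closed] by auto
qed

lemma gal_basisD:
  assumes "gal_basis I r s"
  shows "finite I" "i \<in> I \<Longrightarrow> r i \<in> carrier Q" "i \<in> I \<Longrightarrow> s i \<in> carrier A"
    "c \<in> carrier C \<Longrightarrow> (\<Oplus>\<^bsub>A\<^esub>i\<in>I. r i c \<otimes>\<^bsub>A\<^esub> s i) = counit C c"
    "i \<in> I \<Longrightarrow> c \<in> carrier C \<Longrightarrow> r i c \<in> carrier A"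
proof -
  show "i \<in> I \<Longrightarrow> c \<in> carrier C \<Longrightarrow> r i c \<in> carrier A"
    using assms AHom_closed [OF Q_AHom] by (auto simp: gal_basis_def)
qed (use assms in \<open>auto simp: gal_basis_def\<close>)

text \<open>The image of \<tau> is a left ideal of \<open>B\<close>, so containing \<open>1\<close>
  is enough. For \<mu>, an element \<open>f\<close> is \<open>f\<close> times the unit, and
  \<open>f # r\<^sub>i\<close> stays in \<open>Q\<close> because \<open>Q\<close> is a left ideal of
  the left dual.\<close>

lemma morita_strictI:
  assumes g: "gal_basis (I :: 'i set) r s" and one: "\<one>\<^bsub>A\<^esub> \<in> tau_image"
  shows "morita_strict A C x"
  unfolding morita_strict_def
proof
  note G = gal_basisD [OF g]
  show "morita_tau A C x ` carrier tau.T = carrier B"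
    unfolding tau_image_def [symmetric]
    using tau_image_mult_left [OF one] tau_image_B B_A by force
  show "morita_mu A C ` carrier mu.T = carrier D"
  proof
    show "morita_mu A C ` carrier mu.T \<subseteq> carrier D" using addmap_closed [OF mu_addmap] by auto
    show "carrier D \<subseteq> morita_mu A C ` carrier mu.T"
    proof
      fix f assume f: "f \<in> carrier D"
      let ?t = "\<Oplus>\<^bsub>mu.T\<^esub>i\<in>I. mu.pure (f \<otimes>\<^bsub>D\<^esub> r i) (s i)"
      have pc: "mu.pure (f \<otimes>\<^bsub>D\<^esub> r i) (s i) \<in> carrier mu.T" if "i \<in> I" for i
        by (rule mu.pure_closed) (use f G that in \<open>simp_all add: Q_mult_left\<close>)
      have "morita_mu A C ?t = (\<Oplus>\<^bsub>D\<^esub>i\<in>I. morita_mu A C (mu.pure (f \<otimes>\<^bsub>D\<^esub> r i) (s i)))"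
        by (rule addmap_finsum [OF mu.tensor_abelian D_abelian mu_addmap]) (use pc in auto)
      also have "\<dots> = (\<Oplus>\<^bsub>D\<^esub>i\<in>I. f \<otimes>\<^bsub>D\<^esub> (r i \<otimes>\<^bsub>D\<^esub> dual_incl A C (s i)))"
        by (rule D.finsum_cong')
          (use f G in \<open>auto simp: mu_pure Q_mult_left Q_D dual_incl_closed D.m_assoc\<close>)
      also have "\<dots> = f \<otimes>\<^bsub>D\<^esub> (\<Oplus>\<^bsub>D\<^esub>i\<in>I. r i \<otimes>\<^bsub>D\<^esub> dual_incl A C (s i))"
        by (rule D.finsum_rdistr [symmetric]) (use f G in \<open>auto simp: Q_D dual_incl_closed\<close>)
      also have "(\<Oplus>\<^bsub>D\<^esub>i\<in>I. r i \<otimes>\<^bsub>D\<^esub> dual_incl A C (s i)) = \<one>\<^bsub>D\<^esub>"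
        using gal_basis_iff_D [of I r s] g by (auto simp: gal_basis_def)
      finally have "f = morita_mu A C ?t" using f by simp
      then show "f \<in> morita_mu A C ` carrier mu.T"
        by (rule image_eqI) (use pc in \<open>auto intro!: mu.T.finsum_closed\<close>)
    qed
  qed
qed

lemma morita_strictD:
  assumes "morita_strict A C x"
  obtains k :: nat and r s where "gal_basis {..<k} r s" "\<one>\<^bsub>A\<^esub> \<in> tau_image"
proof -
  have one: "\<one>\<^bsub>A\<^esub> \<in> tau_image"
    using assms B.one_closed by (simp add: morita_strict_def tau_image_def)
  have "\<one>\<^bsub>D\<^esub> \<in> morita_mu A C ` carrier mu.T"
    using assms D_one_closed by (simp add: morita_strict_def)
  then obtain t where t: "\<one>\<^bsub>D\<^esub> = morita_mu A C t" "t \<in> carrier mu.T" by (rule imageE)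
  obtain k :: nat and r s where rs: "r \<in> {..<k} \<rightarrow> carrier Q" "s \<in> {..<k} \<rightarrow> carrier Am"
    "t = (\<Oplus>\<^bsub>mu.T\<^esub>i\<in>{..<k}. mu.pure (r i) (s i))"
    by (rule mu.tensor_sumE [OF t(2)])
  have s: "s \<in> {..<k} \<rightarrow> carrier A" using rs(2) by simp
  have "morita_mu A C t = (\<Oplus>\<^bsub>D\<^esub>i\<in>{..<k}. morita_mu A C (mu.pure (r i) (s i)))"
    unfolding rs(3)
    by (rule addmap_finsum [OF mu.tensor_abelian D_abelian mu_addmap]) (use rs in \<open>auto intro!: mu.pure_closed\<close>)
  also have "\<dots> = (\<Oplus>\<^bsub>D\<^esub>i\<in>{..<k}. r i \<otimes>\<^bsub>D\<^esub> dual_incl A C (s i))"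
    by (rule D.finsum_cong') (use funcset_mem [OF rs(1)] funcset_mem [OF s] in \<open>auto simp: mu_pure Q_D dual_incl_closed\<close>)
  finally have "gal_basis {..<k} r s"
    using gal_basis_iff_D [OF _ rs(1) s] t(1) by simp
  then show ?thesis using one by (rule that)
qed

text \<open>The unit of the left dual acts on \<open>c\<close> as the identity. Written as
  \<open>\<Sum> r\<^sub>i # i(s\<^sub>i)\<close> it acts by first sending \<open>c\<close> to
  \<open>r\<^sub>i(c) x\<close>, as \<open>r\<^sub>i\<close> lies in \<open>Q\<close>, and then
  multiplying by \<open>s\<^sub>i\<close> on the right.\<close>

lemma gal_expand:
  assumes g: "gal_basis (I :: 'i set) r s" and c: "c \<in> carrier C"
  shows "(\<Oplus>\<^bsub>C\<^esub>i\<in>I. lact C (r i c) (ract C x (s i))) = c"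
proof -
  note G = gal_basisD [OF g]
  have "c = act c (\<Oplus>\<^bsub>D\<^esub>i\<in>I. r i \<otimes>\<^bsub>D\<^esub> dual_incl A C (s i))"
    using gal_basis_iff_D [of I r s] g by (simp add: gal_basis_def D_act_one c)
  also have "\<dots> = (\<Oplus>\<^bsub>C\<^esub>i\<in>I. act c (r i \<otimes>\<^bsub>D\<^esub> dual_incl A C (s i)))"
    by (rule addmap_finsum [OF D_abelian M.abelian_group_axioms act_addmap_D [OF c]])
      (use G in \<open>auto simp: D_mult_closed dual_incl_closed Q_D\<close>)
  also have "\<dots> = (\<Oplus>\<^bsub>C\<^esub>i\<in>I. lact C (r i c) (ract C x (s i)))"
    by (rule M.finsum_cong')
      (use G c in \<open>auto simp: D_act_mult Q_D dual_incl_closed Q_act dual_incl_act lact_closed xa_closed\<close>)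
  finally show ?thesis ..
qed

end

section \<open>The comparison map over a subring of the coinvariants\<close>

locale subring_coring = grouplike_coring A C x for A :: "'a ring" and C :: "('a, 'c) coring" and x +
  fixes S :: "'a set"
  assumes S: "subring S (coinvariant_ring A C x)"
begin

abbreviation "R \<equiv> A\<lparr>carrier := S\<rparr>"
abbreviation "rg \<equiv> regular A"

lemma S_B: "b \<in> S \<Longrightarrow> b \<in> carrier B"
  using subringE(1) [OF S] by auto

lemma S_A: "b \<in> S \<Longrightarrow> b \<in> carrier A"
  by (intro B_A S_B)

lemma R_ring: "ring R"
proof -
  have "B\<lparr>carrier := S\<rparr> = R" by (simp add: coinvariant_ring_def)
  then show ?thesis using B.subring_is_ring [OF S] by metis
qed

sublocale RR: ring R by (rule R_ring)

lemma S_neg: "b \<in> S \<Longrightarrow> \<ominus>\<^bsub>A\<^esub> b \<in> S"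
  using L.minus_equality [of "\<ominus>\<^bsub>R\<^esub> b" b] RR.l_neg [of b] RR.a_inv_closed [of b] S_A by simp

lemma bim_RA: "bimodule R A rg" and bim_AR: "bimodule A R rg" and right_RC: "right_module R C"
  and right_RA: "right_module R rg" and left_RA: "left_module R rg"
proof -
  have S: "S \<subseteq> carrier A" using S_A by blast
  show l: "left_module R rg" by (rule restrict_scalars_left [OF lA R_ring S])
  show r: "right_module R rg" by (rule restrict_scalars_right [OF rA R_ring S])
  show "right_module R C" by (rule restrict_scalars_right [OF rC R_ring S])
  show "bimodule R A rg" by (intro bimodule.intro bimodule_axioms.intro l rA) (simp add: S_A L.m_assoc)
  show "bimodule A R rg" by (intro bimodule.intro bimodule_axioms.intro r lA) (simp add: S_A L.m_assoc)
qed

lemma dual_can_left_hom: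
  assumes f: "f \<in> AHom" shows "(\<lambda>a. f (ract C x a)) \<in> left_hom R rg rg"
  unfolding left_hom_iff
  by (intro conjI addmapI ballI)
    (simp_all add: AHom_closed [OF f] xa_closed xa_add AHom_add [OF f] xba S_B S_A AHom_lact [OF f])

lemma left_End_R: "f \<in> carrier (left_End R rg) \<longleftrightarrow> f \<in> left_hom R rg rg \<and> f \<in> extensional (carrier A)"
  by (simp add: left_End_def)

lemma left_hom_restrict: "f \<in> left_hom R rg rg \<Longrightarrow> restrict f (carrier A) \<in> left_hom R rg rg"
  by (simp add: left_hom_iff addmap_def S_A)

lemma dual_can_ring_hom: "dual_can A C x \<in> ring_hom D (op_ring (left_End R rg))"
proof (rule ring_hom_memI)
  show "dual_can A C x f \<in> carrier (op_ring (left_End R rg))" if "f \<in> carrier D" for f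
    using left_hom_restrict [OF dual_can_left_hom [OF D_AHom [OF that]]]
    by (simp add: op_ring_def left_End_R dual_can_def)
  show "dual_can A C x (f \<otimes>\<^bsub>D\<^esub> g) = dual_can A C x f \<otimes>\<^bsub>op_ring (left_End R rg)\<^esub> dual_can A C x g"
    if "f \<in> carrier D" "g \<in> carrier D" for f g
    using that by (auto simp: op_ring_def left_End_def dual_can_def fun_eq_iff D_mult xa_closed act_xa D_AHom AHom_closed restrict_def)
  show "dual_can A C x (f \<oplus>\<^bsub>D\<^esub> g) = dual_can A C x f \<oplus>\<^bsub>op_ring (left_End R rg)\<^esub> dual_can A C x g"
    if "f \<in> carrier D" "g \<in> carrier D" for f g
    using that by (auto simp: op_ring_def left_End_def dual_can_def fun_eq_iff D_add xa_closed restrict_def)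
  show "dual_can A C x \<one>\<^bsub>D\<^esub> = \<one>\<^bsub>op_ring (left_End R rg)\<^esub>"
    by (auto simp: op_ring_def left_End_def dual_can_def fun_eq_iff D_one xa_closed counit_xa restrict_def)
qed

text \<open>The comparison map is a ring homomorphism in any case, so an isomorphism amounts to two
  conditions on values at \<open>xa\<close>. They are stated without the restriction to extensional
  functions, which spares later arguments from tracking it.\<close>

lemma dual_can_iso_iff:
  "dual_can A C x \<in> ring_iso D (op_ring (left_End R rg)) \<longleftrightarrow>
    (\<forall>f\<in>carrier D. \<forall>g\<in>carrier D. (\<forall>a\<in>carrier A. f (ract C x a) = g (ract C x a)) \<longrightarrow> f = g) \<and>
    (\<forall>\<psi>\<in>left_hom R rg rg. \<exists>f\<in>carrier D. \<forall>a\<in>carrier A. f (ract C x a) = \<psi> a)"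
proof -
  let ?E = "carrier (op_ring (left_End R rg))"
  have 1: "inj_on (dual_can A C x) (carrier D) \<longleftrightarrow>
    (\<forall>f\<in>carrier D. \<forall>g\<in>carrier D. (\<forall>a\<in>carrier A. f (ract C x a) = g (ract C x a)) \<longrightarrow> f = g)"
    unfolding inj_on_def dual_can_def restrict_def fun_eq_iff by meson
  have E: "?E = left_hom R rg rg \<inter> extensional (carrier A)"
    by (auto simp: op_ring_def left_End_def)
  have 2: "dual_can A C x ` carrier D = ?E \<longleftrightarrow> (\<forall>\<psi>\<in>left_hom R rg rg. \<exists>f\<in>carrier D. \<forall>a\<in>carrier A. f (ract C x a) = \<psi> a)"
  proof
    assume *: "dual_can A C x ` carrier D = ?E"
    show "\<forall>\<psi>\<in>left_hom R rg rg. \<exists>f\<in>carrier D. \<forall>a\<in>carrier A. f (ract C x a) = \<psi> a"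
    proof
      fix \<psi> assume "\<psi> \<in> left_hom R rg rg"
      then have "restrict \<psi> (carrier A) \<in> ?E" using left_hom_restrict by (simp add: E)
      then obtain f where f: "f \<in> carrier D" "restrict \<psi> (carrier A) = dual_can A C x f" using * by blast
      then show "\<exists>f\<in>carrier D. \<forall>a\<in>carrier A. f (ract C x a) = \<psi> a"
        by (intro bexI [of _ f] ballI) (metis dual_can_def restrict_apply')
    qed
  next
    assume *: "\<forall>\<psi>\<in>left_hom R rg rg. \<exists>f\<in>carrier D. \<forall>a\<in>carrier A. f (ract C x a) = \<psi> a"
    show "dual_can A C x ` carrier D = ?E"
    proof
      show "dual_can A C x ` carrier D \<subseteq> ?E" using ring_hom_closed [OF dual_can_ring_hom] by blast
      show "?E \<subseteq> dual_can A C x ` carrier D"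
      proof
        fix \<psi> assume "\<psi> \<in> ?E"
        then have \<psi>: "\<psi> \<in> left_hom R rg rg" "\<psi> \<in> extensional (carrier A)" by (simp_all add: E)
        from bspec [OF * \<psi>(1)] obtain f where f: "f \<in> carrier D" "\<forall>a\<in>carrier A. f (ract C x a) = \<psi> a" by blast
        have "\<psi> = dual_can A C x f"
          unfolding dual_can_def by (rule extensionalityI [OF \<psi>(2)]) (simp_all add: f(2))
        then show "\<psi> \<in> dual_can A C x ` carrier D" using f(1) by blast
      qed
    qed
  qed
  show ?thesis
    unfolding ring_iso_def bij_betw_def mem_Collect_eq 1 2 using dual_can_ring_hom by simp
qed

lemma tau_image_trace:
  assumes "S = carrier B" shows "tau_image \<subseteq> trace_ideal R rg"
proof
  fix t assume "t \<in> tau_image"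
  then show "t \<in> trace_ideal R rg"
  proof (induction rule: tau_image_induct)
    case (pure a q)
    have "(\<lambda>a. q (ract C x a)) \<in> left_hom R rg (regular R)"
      using dual_can_left_hom [OF Q_AHom [OF pure(2)]] Q_xa [OF pure(2)]
      by (simp add: left_hom_iff addmap_def assms)
    from trace_ideal_hom [OF left_RA this, of a] pure(1) show ?case by simp
  next
    case (add t u)
    then show ?case using trace_ideal_add [OF left_RA, of t u] by simp
  qed
qed

lemma gal_dual_basis:
  assumes "S = carrier B" and g: "gal_basis (I :: 'i set) r s"
  shows "dual_basis R rg I (\<lambda>i a. r i (ract C x a)) s"
  unfolding dual_basis_def
proof (intro conjI ballI)
  note G = gal_basisD [OF g]
  show "finite I" by (rule G)
  show "s \<in> I \<rightarrow> carrier rg" using G by auto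
  show "(\<lambda>a. r i (ract C x a)) \<in> left_hom R rg (regular R)" if "i \<in> I" for i
    using dual_can_left_hom [OF Q_AHom [OF G(2) [OF that]]] Q_xa [OF G(2) [OF that]]
    by (simp add: left_hom_iff addmap_def assms)
  show "(\<Oplus>\<^bsub>rg\<^esub>i\<in>I. lact rg (r i (ract C x a)) (s i)) = a" if "a \<in> carrier rg" for a
    using that G(4) [of "ract C x a"] by (simp add: finsum_regular xa_closed counit_xa)
qed

lemma strict_imp_dual_can:
  assumes SB: "S = carrier B" and g: "gal_basis (I :: 'i set) r s"
  shows "dual_can A C x \<in> ring_iso D (op_ring (left_End R rg))"
  unfolding dual_can_iso_iff
proof (intro conjI ballI impI)
  note G = gal_basisD [OF g]
  note ext = gal_expand [OF g]
  fix f h assume f: "f \<in> carrier D" and h: "h \<in> carrier D" and eq: "\<forall>a\<in>carrier A. f (ract C x a) = h (ract C x a)"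
  show "f = h"
  proof (rule D_eqI [OF f h])
    fix c assume c: "c \<in> carrier C"
    \<comment> \<open>Expanding \<open>c\<close> by \<open>gal_expand\<close> shows that
      \<open>k\<close> is determined by its values at the \<open>x s\<^sub>i\<close>.\<close>
    have *: "k c = (\<Oplus>\<^bsub>A\<^esub>i\<in>I. r i c \<otimes>\<^bsub>A\<^esub> k (ract C x (s i)))" if k: "k \<in> carrier D" for k
    proof -
      have "k c = k (\<Oplus>\<^bsub>C\<^esub>i\<in>I. lact C (r i c) (ract C x (s i)))" by (simp add: ext [OF c])
      also have "\<dots> = (\<Oplus>\<^bsub>A\<^esub>i\<in>I. k (lact C (r i c) (ract C x (s i))))"
        by (rule AHom_sum [OF D_AHom [OF k]]) (use G c in \<open>auto intro!: lact_closed xa_closed\<close>)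
      also have "\<dots> = (\<Oplus>\<^bsub>A\<^esub>i\<in>I. r i c \<otimes>\<^bsub>A\<^esub> k (ract C x (s i)))"
        by (rule L.finsum_cong') (use G c k in \<open>auto simp: AHom_lact D_AHom xa_closed AHom_closed\<close>)
      finally show ?thesis .
    qed
    have "f c = (\<Oplus>\<^bsub>A\<^esub>i\<in>I. r i c \<otimes>\<^bsub>A\<^esub> h (ract C x (s i)))"
      unfolding * [OF f]
      by (rule L.finsum_cong') (use G c h eq in \<open>auto simp: AHom_closed D_AHom xa_closed\<close>)
    then show "f c = h c" unfolding * [OF h] .
  qed
next
  note G = gal_basisD [OF g]
  fix \<psi> assume \<psi>: "\<psi> \<in> left_hom R rg rg"
  have \<psi>c: "\<psi> a \<in> carrier A" if "a \<in> carrier A" for a using left_hom_closed [OF \<psi>] that by simp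
  have \<psi>B: "\<psi> (b \<otimes>\<^bsub>A\<^esub> a) = b \<otimes>\<^bsub>A\<^esub> \<psi> a" if "a \<in> carrier A" "b \<in> carrier B" for a b
    using left_hom_lact [OF \<psi>, of b a] that by (simp add: SB)
  let ?f = "\<Oplus>\<^bsub>D\<^esub>i\<in>I. r i \<otimes>\<^bsub>D\<^esub> dual_incl A C (\<psi> (s i))"
  have fD: "?f \<in> carrier D" using G \<psi>c by (auto intro!: D.finsum_closed simp: D_mult_closed dual_incl_closed Q_D)
  \<comment> \<open>The coefficients \<open>r\<^sub>i(xa)\<close> lie in \<open>B\<close>, which is
    the base ring here, so \<psi> can be pulled out of the sum, and what remains inside is
    \<open>\<epsilon>(xa) = a\<close>.\<close>
  have "?f (ract C x a) = \<psi> a" if a: "a \<in> carrier A" for a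
  proof -
    have "?f (ract C x a) = (\<Oplus>\<^bsub>A\<^esub>i\<in>I. r i (ract C x a) \<otimes>\<^bsub>A\<^esub> \<psi> (s i))"
      by (rule mu_sum_apply) (use G \<psi>c a in \<open>auto intro: Q_D xa_closed\<close>)
    also have "\<dots> = (\<Oplus>\<^bsub>A\<^esub>i\<in>I. \<psi> (r i (ract C x a) \<otimes>\<^bsub>A\<^esub> s i))"
      by (rule L.finsum_cong') (use G \<psi>c a in \<open>auto simp: \<psi>B Q_xa xa_closed\<close>)
    also have "\<dots> = \<psi> (\<Oplus>\<^bsub>A\<^esub>i\<in>I. r i (ract C x a) \<otimes>\<^bsub>A\<^esub> s i)"
      using addmap_finsum [of A A \<psi> "\<lambda>i. r i (ract C x a) \<otimes>\<^bsub>A\<^esub> s i" I] left_hom_addmap [OF \<psi>] G a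
      by (simp add: L.abelian_group_axioms addmap_def xa_closed)
    finally show ?thesis using G(4) [OF xa_closed [OF a]] a by (simp add: counit_xa)
  qed
  then show "\<exists>f\<in>carrier D. \<forall>a\<in>carrier A. f (ract C x a) = \<psi> a" using fD by blast
qed

text \<open>
  That \<open>B = S\<close> uses only the trace ideal: if \<open>\<psi>(p)\<close> is a value of a map \<open>\<psi> : A \<rightarrow> S\<close>, then \<open>\<psi>\<close> is of the
  form \<open>f(x-)\<close>, so \<open>b \<psi>(p) = \<psi>(bp)\<close> lies in \<open>S\<close> for every \<open>b \<in> B\<close>.
\<close>

lemma dual_can_iso_imp:
  assumes iso: "dual_can A C x \<in> ring_iso D (op_ring (left_End R rg))"
    and d: "dual_basis R rg (I :: 'i set) \<phi> p" and one: "\<one>\<^bsub>A\<^esub> \<in> trace_ideal R rg"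
    and sep: "\<And>c d. c \<in> carrier C \<Longrightarrow> d \<in> carrier C \<Longrightarrow> (\<And>g. g \<in> carrier D \<Longrightarrow> g c = g d) \<Longrightarrow> c = d"
  shows "S = carrier B \<and> morita_strict A C x"
proof -
  have inj: "f = g" if "f \<in> carrier D" "g \<in> carrier D" "\<And>a. a \<in> carrier A \<Longrightarrow> f (ract C x a) = g (ract C x a)" for f g
    using iso that unfolding dual_can_iso_iff by blast
  have surj: "\<exists>f\<in>carrier D. \<forall>a\<in>carrier A. f (ract C x a) = \<psi> a" if "\<psi> \<in> left_hom R rg rg" for \<psi>
    using iso that unfolding dual_can_iso_iff by blast
  have ext: "\<psi> \<in> left_hom R rg rg" if "\<psi> \<in> left_hom R rg (regular R)" for \<psi>
    using that S_A by (auto simp: left_hom_iff addmap_def)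
  have bt: "b \<otimes>\<^bsub>A\<^esub> t \<in> S" if "t \<in> trace_ideal R rg" and b: "b \<in> carrier B" for t b
    using that(1)
  proof (induction t)
    case zero
    then show ?case using RR.zero_closed B_A [OF b] by simp
  next
    case (add \<psi> p t)
    obtain f where f: "f \<in> carrier D" "\<forall>a\<in>carrier A. f (ract C x a) = \<psi> a" using surj [OF ext [OF add(1)]] by blast
    have p: "p \<in> carrier A" using add(2) by simp
    have "b \<otimes>\<^bsub>A\<^esub> \<psi> p = \<psi> (b \<otimes>\<^bsub>A\<^esub> p)"
      using f p b AHom_lact [OF D_AHom [OF f(1)], of b "ract C x p"] by (simp add: xba B_A xa_closed flip: f(2))
    also have "\<dots> \<in> S" using left_hom_closed [OF add(1), of "b \<otimes>\<^bsub>A\<^esub> p"] p b by (simp add: B_A)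
    finally have "b \<otimes>\<^bsub>A\<^esub> \<psi> p \<in> S" .
    moreover have "\<psi> p \<in> carrier A" "t \<in> carrier A"
      using left_hom_closed [OF add(1,2)] trace_ideal_closed [OF left_RA add(3)] S_A by simp_all
    ultimately show ?case
      using add RR.a_closed [of "b \<otimes>\<^bsub>A\<^esub> \<psi> p" "b \<otimes>\<^bsub>A\<^esub> t"] b by (simp add: L.r_distr B_A)
  qed
  have SB: "S = carrier B"
    using bt [OF one] S_B B_A by force
  \<comment> \<open>The equation for \<open>Q\<close> is tested against functionals
    \<open>g\<close>. It then asks that \<open>f # g\<close> equal \<open>f # i(g(x))\<close>, and
    by injectivity of the comparison map it is enough to see this at \<open>xa\<close>: there
    \<open>g(x f(xa)) = g(f(xa) x) = f(xa) g(x)\<close>, because \<open>f(xa)\<close> commutes with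
    \<open>x\<close>.\<close>
  have QI: "f \<in> carrier Q" if f: "f \<in> carrier D" and fB: "\<And>a. a \<in> carrier A \<Longrightarrow> f (ract C x a) \<in> carrier B" for f
    unfolding Q_iff
  proof (intro conjI ballI f)
    fix c assume c: "c \<in> carrier C"
    note fA = D_AHom [OF f]
    show "act c f = lact C (f c) x"
    proof (rule sep)
      fix g assume g: "g \<in> carrier D"
      note gA = D_AHom [OF g]
      have gx: "g x \<in> carrier A" by (rule AHom_closed [OF gA x_closed])
      have "f \<otimes>\<^bsub>D\<^esub> g = f \<otimes>\<^bsub>D\<^esub> dual_incl A C (g x)"
      proof (rule inj)
        fix a assume a: "a \<in> carrier A"
        have "g (ract C x (f (ract C x a))) = g (lact C (f (ract C x a)) x)"
          using fB [OF a] by (simp add: B_iff)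
        then show "(f \<otimes>\<^bsub>D\<^esub> g) (ract C x a) = (f \<otimes>\<^bsub>D\<^esub> dual_incl A C (g x)) (ract C x a)"
          using a by (simp add: D_mult xa_closed act_xa fA dual_incl_mult [unfolded D_mult] f gx AHom_lact gA AHom_closed x_closed)
            (simp add: dual_incl_def ax_closed counit_ax AHom_closed fA xa_closed x_closed counit_xa)
      qed (use f g gx in \<open>simp_all add: D_mult_closed dual_incl_closed\<close>)
      from fun_cong [OF this, of c] show "g (act c f) = g (lact C (f c) x)"
        using c by (simp add: D_mult dual_incl_mult [unfolded D_mult] f gx AHom_lact gA AHom_closed x_closed)
          (simp add: AHom_lact gA AHom_closed fA x_closed dual_incl_def act_closed counit_act)
    qed (use c fA in \<open>simp_all add: act_closed lact_closed x_closed AHom_closed\<close>)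
  qed
  note P = dual_basisD [OF d]
  have "\<forall>i\<in>I. \<exists>f. f \<in> carrier D \<and> (\<forall>a\<in>carrier A. f (ract C x a) = \<phi> i a)"
    using surj ext P(3) by blast
  then obtain r where r: "\<And>i. i \<in> I \<Longrightarrow> r i \<in> carrier D" "\<And>i a. i \<in> I \<Longrightarrow> a \<in> carrier A \<Longrightarrow> r i (ract C x a) = \<phi> i a"
    by metis
  have rQ: "r i \<in> carrier Q" if "i \<in> I" for i
    using r that left_hom_closed [OF P(3) [OF that]] by (intro QI) (simp_all add: SB)
  have p: "p \<in> I \<rightarrow> carrier A" using P(2) by auto
  have "(\<Oplus>\<^bsub>D\<^esub>i\<in>I. r i \<otimes>\<^bsub>D\<^esub> dual_incl A C (p i)) = \<one>\<^bsub>D\<^esub>"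
  proof (rule inj)
    show "(\<Oplus>\<^bsub>D\<^esub>i\<in>I. r i \<otimes>\<^bsub>D\<^esub> dual_incl A C (p i)) \<in> carrier D"
      using r p by (auto intro!: D.finsum_closed D_mult_closed dual_incl_closed)
    fix a assume a: "a \<in> carrier A"
    have "(\<Oplus>\<^bsub>D\<^esub>i\<in>I. r i \<otimes>\<^bsub>D\<^esub> dual_incl A C (p i)) (ract C x a) = (\<Oplus>\<^bsub>A\<^esub>i\<in>I. r i (ract C x a) \<otimes>\<^bsub>A\<^esub> p i)"
      by (rule mu_sum_apply) (use r p a in \<open>auto simp: xa_closed\<close>)
    also have "\<dots> = (\<Oplus>\<^bsub>A\<^esub>i\<in>I. \<phi> i a \<otimes>\<^bsub>A\<^esub> p i)"
      by (rule L.finsum_cong') (use r p a P(5) S_A in \<open>auto\<close>)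
    also have "\<dots> = a" using P(4) [of a] a by (simp add: finsum_regular)
    finally show "(\<Oplus>\<^bsub>D\<^esub>i\<in>I. r i \<otimes>\<^bsub>D\<^esub> dual_incl A C (p i)) (ract C x a) = \<one>\<^bsub>D\<^esub> (ract C x a)"
      using a by (simp add: D_one xa_closed counit_xa)
  qed (rule D_one_closed)
  then have g: "gal_basis I r p" using gal_basis_iff_D [OF P(1) _ p, of r] rQ by auto
  \<comment> \<open>Every functional from \<open>A\<close> to the base ring is of the form
    \<open>f(x-)\<close> with \<open>f\<close> in \<open>Q\<close>, so each of its values is a value
    of \<tau>.\<close>
  have "t \<in> tau_image" if "t \<in> trace_ideal R rg" for t
    using that
  proof (induction t)
    case zero
    then show ?case by (simp add: tau_image_zero)
  next
    case (add \<psi> a t)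
    have a: "a \<in> carrier A" using add(2) by simp
    obtain f where f: "f \<in> carrier D" "\<forall>a\<in>carrier A. f (ract C x a) = \<psi> a" using surj [OF ext [OF add(1)]] by blast
    have "f \<in> carrier Q" using f left_hom_closed [OF add(1)] by (intro QI) (simp_all add: SB)
    from tau_image_pure [OF a this] have "\<psi> a \<in> tau_image" using f(2) a by simp
    from tau_image_add [OF this add(4)] show ?case by simp
  qed
  with one SB g show ?thesis by (blast intro: morita_strictI)
qed

end

section \<open>The canonical map and faithful flatness\<close>

lemma right_module_subset:
  assumes M: "right_module R M" and T: "T \<subseteq> carrier M" "\<zero>\<^bsub>M\<^esub> \<in> T" "\<And>a b. a \<in> T \<Longrightarrow> b \<in> T \<Longrightarrow> a \<oplus>\<^bsub>M\<^esub> b \<in> T"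
      "\<And>a. a \<in> T \<Longrightarrow> \<ominus>\<^bsub>M\<^esub> a \<in> T" "\<And>a r. a \<in> T \<Longrightarrow> r \<in> carrier R \<Longrightarrow> ract M a r \<in> T"
  shows "right_module R (M\<lparr>carrier := T\<rparr>)"
proof -
  interpret M: right_module R M by fact
  have c: "a \<in> carrier M" if "a \<in> T" for a using that T(1) by blast
  have "abelian_group (M\<lparr>carrier := T\<rparr>)"
    by (rule abelian_group_subset [OF M.M.abelian_group_axioms T(1-4)]) simp_all
  then show ?thesis
    by (intro right_module.intro right_module_axioms.intro M.R.ring_axioms)
      (simp_all add: T c M.ract_add_left M.ract_add_right M.ract_assoc M.ract_one)
qed

lemma regular_neg: "ring A \<Longrightarrow> a \<in> carrier A \<Longrightarrow> \<ominus>\<^bsub>regular A\<^esub> a = \<ominus>\<^bsub>A\<^esub> a"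
  using abelian_group.minus_equality [OF regular_abelian, of A "\<ominus>\<^bsub>A\<^esub> a" a]
  by (simp add: ring.ring_simprules)

section \<open>The canonical map as a morphism of corings\<close>

context subring_coring
begin

abbreviation "W \<equiv> tensor R rg rg"

sublocale W: tensor_right R A rg rg by (rule tensor_rightI [OF right_RA bim_RA])
sublocale Wl: tensor_left R A rg rg by (rule tensor_leftI [OF bim_AR left_RA])
sublocale Wb: bimodule A A W by (rule tensor_bimodule [OF bim_AR bim_RA])

lemma axa_closed: "a \<in> carrier A \<Longrightarrow> a' \<in> carrier A \<Longrightarrow> ract C (lact C a x) a' \<in> carrier C"
  by (simp add: ract_closed ax_closed)

lemma can_balanced: "balanced R rg rg C (\<lambda>a a'. ract C (lact C a x) a')"
proof (rule balancedI)
  fix a b a' assume *: "a \<in> carrier rg" "b \<in> carrier R" "a' \<in> carrier rg"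
  then have "lact C (a \<otimes>\<^bsub>A\<^esub> b) x = ract C (lact C a x) b"
    using S_B [of b] by (simp add: B_iff lact_assoc x_closed lact_ract)
  then show "ract C (lact C (ract rg a b) x) a' = ract C (lact C a x) (lact rg b a')"
    using * by (simp add: ract_assoc ax_closed S_A)
qed (simp_all add: axa_closed ax_closed lact_add_left ract_add_left ract_add_right x_closed)

lemma can_pure: "a \<in> carrier A \<Longrightarrow> a' \<in> carrier A \<Longrightarrow> can C x (W.pure a a') = ract C (lact C a x) a'"
  unfolding can_def by (rule W.lift_pure [OF M.abelian_group_axioms can_balanced]) simp_all

lemma can_addmap: "addmap W C (can C x)"
  unfolding can_def by (rule W.lift_addmap [OF M.abelian_group_axioms can_balanced])

lemmas can_closed = addmap_closed [OF can_addmap]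

lemma can_right_hom: "can C x \<in> right_hom A W C"
  unfolding right_hom_iff
proof (intro conjI can_addmap ballI)
  show "can C x (ract W w a) = ract C (can C x w) a" if "a \<in> carrier A" "w \<in> carrier W" for a w
    using that(2)
  proof (rule W.hom_ext [rotated 2])
    show "addmap W C (\<lambda>w. can C x (ract W w a))" "addmap W C (\<lambda>w. ract C (can C x w) a)"
      using that(1) can_addmap by (auto simp: addmap_def Wb.ract_closed Wb.ract_add_left ract_closed ract_add_left)
  qed (simp add: that(1) W.ract_pure can_pure ract_assoc ax_closed)
qed

lemma can_left_hom: "can C x \<in> left_hom A W C"
  unfolding left_hom_iff
proof (intro conjI can_addmap ballI)
  show "can C x (lact W a w) = lact C a (can C x w)" if "a \<in> carrier A" "w \<in> carrier W" for a w
    using that(2)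
  proof (rule W.hom_ext [rotated 2])
    show "addmap W C (\<lambda>w. can C x (lact W a w))" "addmap W C (\<lambda>w. lact C a (can C x w))"
      using that(1) can_addmap by (auto simp: addmap_def Wb.lact_closed Wb.lact_add_right lact_closed lact_add_right)
  qed (simp add: that(1) Wl.lact_pure can_pure lact_assoc lact_ract ax_closed x_closed)
qed

abbreviation "SC \<equiv> sweedler_coring A S"

lemma SC_simps:
  "carrier SC = carrier W" "ring.add SC = ring.add W" "lact SC = lact W" "ract SC = ract W"
  "comul SC = tensor_lift (tensor A W W) (\<lambda>a a'. pure_tensor A W W (W.pure a \<one>\<^bsub>A\<^esub>) (W.pure \<one>\<^bsub>A\<^esub> a'))"
  "counit SC = tensor_lift A (\<lambda>a a'. a \<otimes>\<^bsub>A\<^esub> a')"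
  by (simp_all add: sweedler_coring_def Let_def bimodule.defs)

text \<open>\<open>\<Delta>(a x a') = a x \<otimes> x a'\<close>, by bilinearity of \<Delta> and
  since \<open>x\<close> is grouplike; this is the image of
  \<open>(a \<otimes> 1) \<otimes> (1 \<otimes> a')\<close>. Bijectivity is therefore all that an
  isomorphism of corings adds.\<close>

lemma can_coring_hom: "can C x \<in> coring_hom A SC C"
proof -
  interpret WW: tensor_pair A W W by (rule tensor_pairI [OF Wb.right_module_axioms Wb.left_module_axioms])
  \<comment> \<open>An element of the subring crosses
    \<open>(a \<otimes> 1) \<otimes> (1 \<otimes> a')\<close> in three moves: to the right end of
    the first factor, across the middle tensor sign over \<open>A\<close>, and then to the right
    inside the second factor.\<close>
  have b: "balanced R rg rg WW.T (\<lambda>a a'. WW.pure (W.pure a \<one>\<^bsub>A\<^esub>) (W.pure \<one>\<^bsub>A\<^esub> a'))"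
  proof (rule balancedI)
    fix a b a' assume *: "a \<in> carrier rg" "b \<in> carrier R" "a' \<in> carrier rg"
    then have b: "b \<in> carrier A" by (simp add: S_A)
    have "W.pure (a \<otimes>\<^bsub>A\<^esub> b) \<one>\<^bsub>A\<^esub> = ract W (W.pure a \<one>\<^bsub>A\<^esub>) b"
      using W.pure_balanced [of a b "\<one>\<^bsub>A\<^esub>"] * b by (simp add: W.ract_pure)
    then have "WW.pure (W.pure (a \<otimes>\<^bsub>A\<^esub> b) \<one>\<^bsub>A\<^esub>) (W.pure \<one>\<^bsub>A\<^esub> a') = WW.pure (W.pure a \<one>\<^bsub>A\<^esub>) (lact W b (W.pure \<one>\<^bsub>A\<^esub> a'))"
      using * b by (simp add: WW.pure_balanced W.pure_closed)
    also have "lact W b (W.pure \<one>\<^bsub>A\<^esub> a') = W.pure \<one>\<^bsub>A\<^esub> (b \<otimes>\<^bsub>A\<^esub> a')"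
      using W.pure_balanced [of "\<one>\<^bsub>A\<^esub>" b a'] * b by (simp add: Wl.lact_pure)
    finally show "WW.pure (W.pure (ract rg a b) \<one>\<^bsub>A\<^esub>) (W.pure \<one>\<^bsub>A\<^esub> a') = WW.pure (W.pure a \<one>\<^bsub>A\<^esub>) (W.pure \<one>\<^bsub>A\<^esub> (lact rg b a'))"
      by simp
  qed (auto intro!: WW.pure_closed W.pure_closed
      simp: W.pure_add_left [simplified] W.pure_add_right [simplified] WW.pure_add_left WW.pure_add_right W.pure_closed)
  have m: "balanced R rg rg A (\<lambda>a a'. a \<otimes>\<^bsub>A\<^esub> a')"
    by (rule balancedI) (simp_all add: S_A L.m_assoc L.l_distr L.r_distr)
  note ta = tensor_map_addmap [OF WW.tensor_pair_axioms CCr.tensor_pair_axioms can_right_hom can_left_hom]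
    and tp = tensor_map_pure [OF WW.tensor_pair_axioms CCr.tensor_pair_axioms can_right_hom can_left_hom]
  have "comul C (can C x w) = tensor_map A C C (can C x) (can C x) (comul SC w)" if w: "w \<in> carrier W" for w
    using w
  proof (rule W.hom_ext [rotated 2])
    show "addmap W CC (\<lambda>w. comul C (can C x w))"
      using can_addmap right_hom_addmap [OF comul_right] by (auto simp: addmap_def)
    show "addmap W CC (\<lambda>w. tensor_map A C C (can C x) (can C x) (comul SC w))"
      unfolding SC_simps using W.lift_addmap [OF WW.tensor_abelian b] ta by (auto simp: addmap_def)
    show "comul C (can C x (W.pure a a')) = tensor_map A C C (can C x) (can C x) (comul SC (W.pure a a'))"
      if "a \<in> carrier rg" "a' \<in> carrier rg" for a a'
    proof -
      have a: "a \<in> carrier A" "a' \<in> carrier A" using that by simp_all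
      have "comul C (can C x (W.pure a a')) = lact CC a (comul C (ract C x a'))"
        using a left_hom_lact [OF comul_left, of a "ract C x a'"] by (simp add: can_pure xa_closed lact_ract x_closed)
      also have "\<dots> = pure_tensor A C C (lact C a x) (ract C x a')"
        using a by (simp add: comul_xa CCl.lact_pure x_closed xa_closed)
      finally show ?thesis
        using that a by (simp add: SC_simps W.lift_pure [OF WW.tensor_abelian b] tp W.pure_closed can_pure
            ract_one ax_closed lact_one x_closed)
    qed
  qed
  moreover have "counit SC w = counit C (can C x w)" if w: "w \<in> carrier W" for w
    using w
  proof (rule W.hom_ext [rotated 2])
    show "addmap W A (counit SC)" unfolding SC_simps by (rule W.lift_addmap [OF L.abelian_group_axioms m])
    show "addmap W A (\<lambda>w. counit C (can C x w))"
      using can_addmap AHom_addmap [OF counit_left_hom] by (auto simp: addmap_def)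
    show "counit SC (W.pure a a') = counit C (can C x (W.pure a a'))" if "a \<in> carrier rg" "a' \<in> carrier rg" for a a'
      using that right_hom_ract [OF counit_right_hom, of a' "lact C a x"]
      by (simp add: SC_simps W.lift_pure [OF L.abelian_group_axioms m] can_pure counit_ax ax_closed)
  qed
  moreover have "can C x \<in> bimod_hom A A SC C"
    using can_left_hom can_right_hom by (simp add: bimod_hom_def left_hom_iff right_hom_iff addmap_def SC_simps)
  ultimately show ?thesis by (simp add: coring_hom_def SC_simps)
qed

lemma can_iso_iff: "can C x \<in> coring_iso A SC C \<longleftrightarrow> bij_betw (can C x) (carrier W) (carrier C)"
  by (simp add: coring_iso_def can_coring_hom SC_simps)

lemma gal_can_bij:
  assumes SB: "S = carrier B" and g: "gal_basis (I :: 'i set) r s"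
  shows "bij_betw (can C x) (carrier W) (carrier C)"
proof (rule bij_betw_byWitness [where f' = "\<lambda>c. \<Oplus>\<^bsub>W\<^esub>i\<in>I. W.pure (r i c) (s i)"])
  note G = gal_basisD [OF g]
  let ?h = "\<lambda>c. \<Oplus>\<^bsub>W\<^esub>i\<in>I. W.pure (r i c) (s i)"
  have pc: "W.pure (r i c) (s i) \<in> carrier W" if "i \<in> I" "c \<in> carrier C" for i c
    by (rule W.pure_closed) (use G that in simp_all)
  have hc: "?h c \<in> carrier W" if "c \<in> carrier C" for c using pc that by (auto intro!: W.T.finsum_closed)
  show "can C x ` carrier W \<subseteq> carrier C" "?h ` carrier C \<subseteq> carrier W" using can_closed hc by auto
  show "\<forall>c\<in>carrier C. can C x (?h c) = c"
  proof
    fix c assume c: "c \<in> carrier C"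
    have "can C x (?h c) = (\<Oplus>\<^bsub>C\<^esub>i\<in>I. can C x (W.pure (r i c) (s i)))"
      by (rule addmap_finsum [OF W.tensor_abelian M.abelian_group_axioms can_addmap]) (use pc c in auto)
    also have "\<dots> = (\<Oplus>\<^bsub>C\<^esub>i\<in>I. lact C (r i c) (ract C x (s i)))"
      by (rule M.finsum_cong') (use G c in \<open>auto simp: can_pure lact_ract x_closed lact_closed xa_closed\<close>)
    finally show "can C x (?h c) = c" by (simp add: gal_expand [OF g c])
  qed
  have ha: "addmap C W ?h"
  proof (rule addmap_sum [OF W.tensor_abelian])
    fix i assume i: "i \<in> I"
    show "addmap C W (\<lambda>c. W.pure (r i c) (s i))"
      using pc [OF i] G(3,5) [OF i] AHom_add [OF Q_AHom [OF G(2) [OF i]]] W.pure_add_left [of _ _ "s i"]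
      by (simp add: addmap_def)
  qed
  show "\<forall>w\<in>carrier W. ?h (can C x w) = w"
  proof
    fix w assume "w \<in> carrier W"
    then show "?h (can C x w) = w"
    proof (rule W.hom_ext [rotated 2])
      show "addmap W W (\<lambda>w. ?h (can C x w))" using ha can_addmap by (auto simp: addmap_def)
      show "addmap W W (\<lambda>w. w)" by (simp add: addmap_def)
      fix a a' assume "a \<in> carrier rg" "a' \<in> carrier rg"
      then have a: "a \<in> carrier A" "a' \<in> carrier A" by simp_all
      \<comment> \<open>\<open>r\<^sub>i(a x a') = a r\<^sub>i(x a')\<close> with
        \<open>r\<^sub>i(x a')\<close> in the base ring, so it passes to the right factor, where the
        sum gives \<open>\<epsilon>(x a') = a'\<close>.\<close>
      have r: "r i (ract C x a') \<in> carrier B" if "i \<in> I" for i using Q_xa [OF G(2) [OF that] a(2)] .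
      have "?h (can C x (W.pure a a')) = (\<Oplus>\<^bsub>W\<^esub>i\<in>I. W.pure a (r i (ract C x a') \<otimes>\<^bsub>A\<^esub> s i))"
      proof (rule W.T.finsum_cong' [OF refl])
        show "(\<lambda>i. W.pure a (r i (ract C x a') \<otimes>\<^bsub>A\<^esub> s i)) \<in> I \<rightarrow> carrier W"
          using a G r B_A by (auto intro!: W.pure_closed)
        fix i assume i: "i \<in> I"
        have "r i (can C x (W.pure a a')) = a \<otimes>\<^bsub>A\<^esub> r i (ract C x a')"
          using a AHom_lact [OF Q_AHom [OF G(2) [OF i]], of a "ract C x a'"] by (simp add: can_pure lact_ract x_closed xa_closed)
        then show "W.pure (r i (can C x (W.pure a a'))) (s i) = W.pure a (r i (ract C x a') \<otimes>\<^bsub>A\<^esub> s i)"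
          using W.pure_balanced [of a "r i (ract C x a')" "s i"] a r [OF i] G(3) [OF i] by (simp add: SB)
      qed
      also have "\<dots> = W.pure a (\<Oplus>\<^bsub>rg\<^esub>i\<in>I. r i (ract C x a') \<otimes>\<^bsub>A\<^esub> s i)"
        by (rule W.pure_sum_right [symmetric]) (use a G r B_A in auto)
      also have "\<dots> = W.pure a a'"
        using G(4) [of "ract C x a'"] a by (simp add: finsum_regular xa_closed counit_xa)
      finally show "?h (can C x (W.pure a a')) = W.pure a a'" .
    qed
  qed
qed

section \<open>Descent from a faithfully flat extension\<close>

context
  assumes bij: "bij_betw (can C x) (carrier W) (carrier C)"
begin

definition "can_inv = inv_into (carrier W) (can C x)"

lemma can_inv_right: "can_inv \<in> right_hom A C W" and can_inv_left: "can_inv \<in> left_hom A C W"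
  unfolding can_inv_def
  by (rule right_hom_inverse [OF Wb.right_module_axioms can_right_hom bij])
    (rule left_hom_inverse [OF Wb.left_module_axioms can_left_hom bij])

lemma can_inv_can: "w \<in> carrier W \<Longrightarrow> can_inv (can C x w) = w"
  and can_can_inv: "c \<in> carrier C \<Longrightarrow> can C x (can_inv c) = c"
  unfolding can_inv_def using bij by (simp_all add: bij_betw_inv_into_left bij_betw_inv_into_right)

lemma can_inv_ax: "a \<in> carrier A \<Longrightarrow> can_inv (lact C a x) = W.pure a \<one>\<^bsub>A\<^esub>"
  and can_inv_xa: "a \<in> carrier A \<Longrightarrow> can_inv (ract C x a) = W.pure \<one>\<^bsub>A\<^esub> a"
  using can_inv_can [of "W.pure a \<one>\<^bsub>A\<^esub>"] can_inv_can [of "W.pure \<one>\<^bsub>A\<^esub> a"]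
  by (simp_all add: can_pure W.pure_closed ract_one lact_one x_closed ax_closed)

lemmas can_inv_closed = right_hom_closed [OF can_inv_right]

context
  assumes ff: "left_faithfully_flat TYPE('u) R rg"
    and uA: "carrier A \<lesssim> (UNIV :: 'u set)" and uC: "carrier C \<lesssim> (UNIV :: 'u set)"
begin

lemma lepoll_A: "T \<subseteq> carrier A \<Longrightarrow> T \<lesssim> (UNIV :: 'u set)"
  using uA lepoll_trans subset_imp_lepoll by blast

text \<open>The coinvariants are the kernel of \<open>\<delta>(a) = a x - x a\<close>, so the claim
  is exactness of \<open>S \<rightarrow> A \<rightarrow> C\<close>, and by faithful flatness it may
  be tested after tensoring with \<open>A\<close>. There the multiplication
  \<open>A \<otimes> A \<rightarrow> A\<close> provides a contraction of the sequence, as in descent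
  theory.\<close>

lemma faithfully_flat_S: "S = carrier B"
proof -
  let ?N = "rg\<lparr>carrier := S\<rparr>"
  define \<delta> where "\<delta> a = lact C a x \<ominus>\<^bsub>C\<^esub> ract C x a" for a
  have N: "right_module R ?N"
    by (rule right_module_subset [OF right_RA])
      (use S_A RR.zero_closed RR.a_closed RR.m_closed in \<open>auto simp: regular_neg L.ring_axioms S_neg\<close>)
  have i: "(\<lambda>a. a) \<in> right_hom R ?N rg" by (auto simp: right_hom_iff addmap_def S_A)
  have d: "\<delta> \<in> right_hom R rg C"
    unfolding right_hom_iff
  proof (intro conjI addmapI ballI)
    show "\<delta> a \<in> carrier C" if "a \<in> carrier rg" for a
      using that by (simp add: \<delta>_def ax_closed xa_closed)
    show "\<delta> (a \<oplus>\<^bsub>rg\<^esub> b) = \<delta> a \<oplus>\<^bsub>C\<^esub> \<delta> b" if "a \<in> carrier rg" "b \<in> carrier rg" for a b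
      using that by (simp add: \<delta>_def a_minus_def lact_add_left ract_add_right x_closed ax_closed xa_closed M.minus_add M.a_ac)
    show "\<delta> (ract rg a b) = ract C (\<delta> a) b" if ab: "b \<in> carrier R" "a \<in> carrier rg" for a b
    proof -
      have b: "b \<in> carrier A" "lact C b x = ract C x b" using ab S_B [of b] by (simp_all add: B_iff)
      then show ?thesis
        using ab addmap_minus [OF M.abelian_group_axioms M.abelian_group_axioms ract_addmap [OF b(1)], of "lact C a x" "ract C x a"]
        by (simp add: \<delta>_def lact_assoc ract_assoc x_closed lact_ract ax_closed xa_closed)
    qed
  qed
  interpret N: tensor_pair R ?N rg by (rule tensor_pairI [OF N left_RA])
  interpret CA: tensor_pair R C rg by (rule tensor_pairI [OF right_RC left_RA])
  note ip = tensor_map_pure [OF N.tensor_pair_axioms W.tensor_pair_axioms i id_left_hom]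
    and ia = tensor_map_addmap [OF N.tensor_pair_axioms W.tensor_pair_axioms i id_left_hom]
    and dp = tensor_map_pure [OF W.tensor_pair_axioms CA.tensor_pair_axioms d id_left_hom]
    and da = tensor_map_addmap [OF W.tensor_pair_axioms CA.tensor_pair_axioms d id_left_hom]
  let ?i = "tensor_map R rg rg (\<lambda>a. a) (\<lambda>p. p)" and ?d = "tensor_map R C rg \<delta> (\<lambda>p. p)"
  have \<delta>S: "\<delta> b = \<zero>\<^bsub>C\<^esub>" if "b \<in> S" for b
    using S_B [OF that] by (simp add: \<delta>_def B_iff M.minus_eq_zero_iff xa_closed)
  have m: "balanced R rg rg A (\<lambda>a a'. a \<otimes>\<^bsub>A\<^esub> a')"
    by (rule balancedI) (simp_all add: S_A L.m_assoc L.l_distr L.r_distr)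
  note mp = W.lift_pure [OF L.abelian_group_axioms m] and ma = W.lift_addmap [OF L.abelian_group_axioms m]
  have pb: "balanced R C rg W (\<lambda>c a. ract W (can_inv c) a)"
    using can_inv_closed addmap_add [OF right_hom_addmap [OF can_inv_right]] right_hom_ract [OF can_inv_right]
    by (intro balancedI) (simp_all add: Wb.ract_closed Wb.ract_add_left Wb.ract_add_right Wb.ract_assoc S_A)
  note pp = CA.lift_pure [OF W.tensor_abelian pb] and pa = CA.lift_addmap [OF W.tensor_abelian pb]
  \<comment> \<open>Through \<open>can\<close> the map \<delta> becomes
    \<open>a \<mapsto> a \<otimes> 1 - 1 \<otimes> a\<close>. Followed by the right action of the
    second factor it sends \<open>t\<close> to \<open>t - 1 \<otimes> m(t)\<close>, with
    \<open>m\<close> the multiplication; thus a tensor killed by \<open>?d\<close> has the form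
    \<open>1 \<otimes> m(t)\<close> and comes from \<open>S \<otimes> A\<close>.\<close>
  let ?\<Psi> = "tensor_lift W (\<lambda>c a. ract W (can_inv c) a)"
  let ?m = "tensor_lift A (\<lambda>a a'. a \<otimes>\<^bsub>A\<^esub> a')"
  have key: "?\<Psi> (?d t) = t \<ominus>\<^bsub>W\<^esub> W.pure \<one>\<^bsub>A\<^esub> (?m t)" if t: "t \<in> carrier W" for t
    using t
  proof (rule W.hom_ext [rotated 2])
    show "addmap W W (\<lambda>t. ?\<Psi> (?d t))" using pa da by (auto simp: addmap_def)
    have mc: "?m t \<in> carrier rg" if "t \<in> carrier W" for t using addmap_closed [OF ma that] by simp
    have "W.pure \<one>\<^bsub>A\<^esub> (?m (t \<oplus>\<^bsub>W\<^esub> u)) = W.pure \<one>\<^bsub>A\<^esub> (?m t) \<oplus>\<^bsub>W\<^esub> W.pure \<one>\<^bsub>A\<^esub> (?m u)"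
      if "t \<in> carrier W" "u \<in> carrier W" for t u
      using W.pure_add_right [of "\<one>\<^bsub>A\<^esub>" "?m t" "?m u"] mc [OF that(1)] mc [OF that(2)] that by (simp add: addmap_add [OF ma])
    then show "addmap W W (\<lambda>t. t \<ominus>\<^bsub>W\<^esub> W.pure \<one>\<^bsub>A\<^esub> (?m t))"
      using mc by (intro addmapI) (simp_all add: a_minus_def W.pure_closed W.T.minus_add W.T.a_ac)
    show "?\<Psi> (?d (W.pure a a')) = W.pure a a' \<ominus>\<^bsub>W\<^esub> W.pure \<one>\<^bsub>A\<^esub> (?m (W.pure a a'))"
      if "a \<in> carrier rg" "a' \<in> carrier rg" for a a'
    proof -
      have a: "a \<in> carrier A" "a' \<in> carrier A" using that by simp_all
      have "can_inv (\<delta> a) = W.pure a \<one>\<^bsub>A\<^esub> \<ominus>\<^bsub>W\<^esub> W.pure \<one>\<^bsub>A\<^esub> a"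
        using addmap_minus [OF M.abelian_group_axioms W.tensor_abelian right_hom_addmap [OF can_inv_right], of "lact C a x" "ract C x a"] a
        by (simp add: \<delta>_def can_inv_ax can_inv_xa ax_closed xa_closed)
      then have "?\<Psi> (?d (W.pure a a')) = ract W (W.pure a \<one>\<^bsub>A\<^esub> \<ominus>\<^bsub>W\<^esub> W.pure \<one>\<^bsub>A\<^esub> a) a'"
        using that right_hom_closed [OF d] by (simp add: dp pp)
      also have "\<dots> = ract W (W.pure a \<one>\<^bsub>A\<^esub>) a' \<ominus>\<^bsub>W\<^esub> ract W (W.pure \<one>\<^bsub>A\<^esub> a) a'"
        by (rule addmap_minus [OF W.tensor_abelian W.tensor_abelian Wb.ract_addmap])
          (use a in \<open>simp_all add: W.pure_closed\<close>)
      finally show ?thesis using a that by (simp add: W.ract_pure mp)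
    qed
  qed
  have "exact_at N.T W CA.T ?i ?d"
    unfolding exact_at_def
  proof (intro equalityI subsetI)
    fix w assume "w \<in> ?i ` carrier N.T"
    then obtain t where t: "t \<in> carrier N.T" "w = ?i t" by blast
    have "?d (?i t) = \<zero>\<^bsub>CA.T\<^esub>"
      using t(1)
    proof (rule N.hom_ext [rotated 2])
      show "addmap N.T CA.T (\<lambda>t. ?d (?i t))" using ia da by (auto simp: addmap_def)
      show "addmap N.T CA.T (\<lambda>t. \<zero>\<^bsub>CA.T\<^esub>)" by (simp add: addmap_def)
    qed (simp add: ip dp S_A \<delta>S CA.pure_zero_left)
    then show "w \<in> {y \<in> carrier W. ?d y = \<zero>\<^bsub>CA.T\<^esub>}" using t addmap_closed [OF ia] by simp
  next
    fix w assume "w \<in> {y \<in> carrier W. ?d y = \<zero>\<^bsub>CA.T\<^esub>}"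
    then have w: "w \<in> carrier W" "?d w = \<zero>\<^bsub>CA.T\<^esub>" by simp_all
    have mw: "?m w \<in> carrier rg" using addmap_closed [OF ma w(1)] by simp
    have "w \<ominus>\<^bsub>W\<^esub> W.pure \<one>\<^bsub>A\<^esub> (?m w) = \<zero>\<^bsub>W\<^esub>"
      using key [OF w(1)] w(2) addmap_zero [OF CA.tensor_abelian W.tensor_abelian pa] by simp
    then have "w = W.pure \<one>\<^bsub>A\<^esub> (?m w)"
      using w(1) mw by (subst (asm) W.T.minus_eq_zero_iff) (simp_all add: W.pure_closed)
    also have "\<dots> = ?i (N.pure \<one>\<^bsub>A\<^esub> (?m w))"
      using mw RR.one_closed by (simp add: ip)
    finally have "w = ?i (N.pure \<one>\<^bsub>A\<^esub> (?m w))" .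
    moreover have "N.pure \<one>\<^bsub>A\<^esub> (?m w) \<in> carrier N.T"
      using mw RR.one_closed by (intro N.pure_closed) simp_all
    ultimately show "w \<in> ?i ` carrier N.T" by blast
  qed
  moreover have "carrier ?N \<lesssim> (UNIV :: 'u set)" using lepoll_A [of S] S_A by auto
  ultimately have "exact_at ?N rg C (\<lambda>a. a) \<delta>"
    using left_faithfully_flat_exact [OF ff N right_RA right_RC _ _ uC i d] uA by simp
  then have "S = {a \<in> carrier A. \<delta> a = \<zero>\<^bsub>C\<^esub>}" by (simp add: exact_at_def)
  also have "\<dots> = carrier B"
    by (auto simp: \<delta>_def B_iff M.minus_eq_zero_iff ax_closed xa_closed)
  finally show ?thesis .
qed

text \<open>\<open>n \<otimes> a = \<Sum> n r\<^sub>i(xa) \<otimes> s\<^sub>i\<close> has its left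
  factors in the image \<open>I\<close> of \<tau>, so the inclusion of \<open>I\<close> into
  \<open>S\<close> becomes surjective after tensoring with \<open>A\<close>.\<close>

lemma faithfully_flat_tau:
  assumes g: "gal_basis (I :: 'i set) r s"
  shows "\<one>\<^bsub>A\<^esub> \<in> tau_image"
proof -
  note G = gal_basisD [OF g] and SB = faithfully_flat_S
  let ?N = "rg\<lparr>carrier := tau_image\<rparr>" and ?N' = "rg\<lparr>carrier := S\<rparr>"
  have tS: "t \<in> S" if "t \<in> tau_image" for t using tau_image_B [OF that] by (simp only: SB)
  have tA: "t \<in> carrier A" if "t \<in> tau_image" for t using B_A [OF tau_image_B [OF that]] .
  have N: "right_module R ?N"
    by (rule right_module_subset [OF right_RA])
      (auto simp: tA tau_image_zero tau_image_add tau_image_mult_right regular_neg L.ring_axioms tau_image_neg SB)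
  have N': "right_module R ?N'"
    by (rule right_module_subset [OF right_RA])
      (use S_A RR.zero_closed RR.a_closed RR.m_closed in \<open>auto simp: regular_neg L.ring_axioms S_neg\<close>)
  interpret N: tensor_pair R ?N rg by (rule tensor_pairI [OF N left_RA])
  interpret N': tensor_pair R ?N' rg by (rule tensor_pairI [OF N' left_RA])
  have i: "(\<lambda>a. a) \<in> right_hom R ?N ?N'" by (auto simp: right_hom_iff addmap_def SB tau_image_B)
  \<comment> \<open>Surjectivity of the inclusion is exactness at its codomain with the zero map as
    the next arrow.\<close>
  have z: "(\<lambda>a. \<zero>\<^bsub>A\<^esub>) \<in> right_hom R ?N' ?N'"
    using RR.zero_closed by (auto simp: right_hom_iff addmap_def S_A)
  note ip = tensor_map_pure [OF N.tensor_pair_axioms N'.tensor_pair_axioms i id_left_hom]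
    and ia = tensor_map_addmap [OF N.tensor_pair_axioms N'.tensor_pair_axioms i id_left_hom]
    and zp = tensor_map_pure [OF N'.tensor_pair_axioms N'.tensor_pair_axioms z id_left_hom]
    and za = tensor_map_addmap [OF N'.tensor_pair_axioms N'.tensor_pair_axioms z id_left_hom]
  let ?i = "tensor_map R ?N' rg (\<lambda>a. a) (\<lambda>p. p)" and ?z = "tensor_map R ?N' rg (\<lambda>a. \<zero>\<^bsub>A\<^esub>) (\<lambda>p. p)"
  have zz: "?z t = \<zero>\<^bsub>N'.T\<^esub>" if t: "t \<in> carrier N'.T" for t
    using t
  proof (rule N'.hom_ext [OF za, rotated])
    show "addmap N'.T N'.T (\<lambda>t. \<zero>\<^bsub>N'.T\<^esub>)" by (simp add: addmap_def)
    show "?z (N'.pure m n) = \<zero>\<^bsub>N'.T\<^esub>" if "m \<in> carrier ?N'" "n \<in> carrier rg" for m n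
      using N'.pure_zero_left [OF that(2)] that by (simp add: zp)
  qed
  have im: "t \<in> ?i ` carrier N.T" if t: "t \<in> carrier N'.T" for t
    using t
  proof (induction rule: N'.tensor_induct)
    case (pure n a)
    then have nS: "n \<in> S" and a: "a \<in> carrier A" by simp_all
    have n: "n \<in> carrier B" by (rule S_B [OF nS])
    have r: "r i (ract C x a) \<in> tau_image" if "i \<in> I" for i using tau_image_pure [OF a G(2) [OF that]] .
    have nr: "n \<otimes>\<^bsub>A\<^esub> r i (ract C x a) \<in> tau_image" if "i \<in> I" for i by (rule tau_image_mult_left [OF r [OF that] n])
    have c1: "(\<Oplus>\<^bsub>N.T\<^esub>i\<in>I. N.pure (n \<otimes>\<^bsub>A\<^esub> r i (ract C x a)) (s i)) \<in> carrier N.T"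
      using nr G by (auto intro!: N.T.finsum_closed N.pure_closed)
    have c2: "?i (\<Oplus>\<^bsub>N.T\<^esub>i\<in>I. N.pure (n \<otimes>\<^bsub>A\<^esub> r i (ract C x a)) (s i)) = N'.pure n a"
    proof -
      have "?i (\<Oplus>\<^bsub>N.T\<^esub>i\<in>I. N.pure (n \<otimes>\<^bsub>A\<^esub> r i (ract C x a)) (s i)) =
          (\<Oplus>\<^bsub>N'.T\<^esub>i\<in>I. ?i (N.pure (n \<otimes>\<^bsub>A\<^esub> r i (ract C x a)) (s i)))"
        by (rule addmap_finsum [OF N.tensor_abelian N'.tensor_abelian ia]) (use nr G in \<open>auto intro!: N.pure_closed\<close>)
      also have "\<dots> = (\<Oplus>\<^bsub>N'.T\<^esub>i\<in>I. N'.pure n (r i (ract C x a) \<otimes>\<^bsub>A\<^esub> s i))"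
      proof (rule N'.T.finsum_cong' [OF refl])
        show "(\<lambda>i. N'.pure n (r i (ract C x a) \<otimes>\<^bsub>A\<^esub> s i)) \<in> I \<rightarrow> carrier N'.T"
          using nS r tA G by (auto intro!: N'.pure_closed)
        fix i assume i: "i \<in> I"
        show "?i (N.pure (n \<otimes>\<^bsub>A\<^esub> r i (ract C x a)) (s i)) = N'.pure n (r i (ract C x a) \<otimes>\<^bsub>A\<^esub> s i)"
          using N'.pure_balanced [of n "r i (ract C x a)" "s i"] nr [OF i] tS [OF r [OF i]] G(3) [OF i] nS by (simp add: ip)
      qed
      also have "\<dots> = N'.pure n (\<Oplus>\<^bsub>rg\<^esub>i\<in>I. r i (ract C x a) \<otimes>\<^bsub>A\<^esub> s i)"
        by (rule N'.pure_sum_right [symmetric]) (use nS r tA G in auto)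
      finally show ?thesis
        using G(4) [of "ract C x a"] a by (simp add: finsum_regular xa_closed counit_xa)
    qed
    show ?case by (rule image_eqI [where f = ?i, OF c2 [symmetric] c1])
  next
    case (add t u)
    then obtain t' u' where "t' \<in> carrier N.T" "t = ?i t'" "u' \<in> carrier N.T" "u = ?i u'" by blast
    then show ?case by (intro image_eqI [of _ _ "t' \<oplus>\<^bsub>N.T\<^esub> u'"]) (simp_all add: addmap_add [OF ia])
  qed
  have "exact_at N.T N'.T N'.T ?i ?z"
    unfolding exact_at_def using im zz addmap_closed [OF ia] by blast
  moreover have "carrier ?N \<lesssim> (UNIV :: 'u set)" "carrier ?N' \<lesssim> (UNIV :: 'u set)"
    using lepoll_A [of S] lepoll_A [of tau_image] S_A tA by auto
  ultimately have "exact_at ?N ?N' ?N' (\<lambda>a. a) (\<lambda>a. \<zero>\<^bsub>A\<^esub>)"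
    using left_faithfully_flat_exact [OF ff N N' N' _ _ _ i z] by simp
  then show ?thesis using RR.one_closed by (auto simp: exact_at_def)
qed

end

end

end

context grouplike_coring
begin

text \<open>\<open>\<^sup>*C\<close> as a right \<open>A\<close>-module via \<open>f a = f # i(a)\<close>; \<open>Q\<close> is a \<open>B\<close>-submodule of it.\<close>

abbreviation "Dm \<equiv> Q\<lparr>carrier := carrier D\<rparr>"

lemma act_dual_incl:
  assumes b: "b \<in> carrier A" and c: "c \<in> carrier C" shows "act c (dual_incl A C b) = ract C c b"
proof -
  note i = D_AHom [OF dual_incl_closed [OF b]]
  note e = counit_left_hom
  have "contract C (dual_incl A C b) t = ract C (contract C (counit C) t) b" if "t \<in> carrier CC" for t
    using that
  proof (rule CCr.hom_ext [rotated 2])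
    show "addmap CC C (contract C (dual_incl A C b))" by (rule contract_addmap [OF lC rC i])
    show "addmap CC C (\<lambda>t. ract C (contract C (counit C) t) b)"
      using contract_addmap [OF lC rC e] b by (auto simp: addmap_def ract_closed ract_add_left)
    show "contract C (dual_incl A C b) (pure_tensor A C C m n) = ract C (contract C (counit C) (pure_tensor A C C m n)) b"
      if "m \<in> carrier C" "n \<in> carrier C" for m n
      using that b by (simp add: contract_pure [OF lC rC i] contract_pure [OF lC rC e]) (simp add: dual_incl_def ract_assoc counit_closed)
  qed
  from this [OF left_hom_closed [OF comul_left c]] show ?thesis
    using act_counit [OF c] by (simp add: act_def)
qed

lemma Dm_right: "right_module A Dm"
proof -
  have "abelian_group Dm" by (rule abelian_group_cong [OF D_abelian]) simp_all
  moreover note [simp] = D_mult_closed dual_incl_closed D_add_closed D_add dual_incl_mult AHom_closed D_AHom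
  have "f \<otimes>\<^bsub>D\<^esub> dual_incl A C (a \<oplus>\<^bsub>A\<^esub> b) = f \<otimes>\<^bsub>D\<^esub> dual_incl A C a \<oplus>\<^bsub>D\<^esub> f \<otimes>\<^bsub>D\<^esub> dual_incl A C b"
    "f \<otimes>\<^bsub>D\<^esub> dual_incl A C (a \<otimes>\<^bsub>A\<^esub> b) = f \<otimes>\<^bsub>D\<^esub> dual_incl A C a \<otimes>\<^bsub>D\<^esub> dual_incl A C b"
    if "f \<in> carrier D" "a \<in> carrier A" "b \<in> carrier A" for f a b
    by (rule D_eqI; use that in \<open>simp add: L.r_distr L.m_assoc\<close>)+
  moreover have "(f \<oplus>\<^bsub>D\<^esub> g) \<otimes>\<^bsub>D\<^esub> dual_incl A C a = f \<otimes>\<^bsub>D\<^esub> dual_incl A C a \<oplus>\<^bsub>D\<^esub> g \<otimes>\<^bsub>D\<^esub> dual_incl A C a"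
    if "f \<in> carrier D" "g \<in> carrier D" "a \<in> carrier A" for f g a
    by (rule D_eqI; use that in \<open>simp add: L.l_distr\<close>)
  moreover have "f \<otimes>\<^bsub>D\<^esub> dual_incl A C \<one>\<^bsub>A\<^esub> = f" if "f \<in> carrier D" for f
    by (rule D_eqI; use that in simp)
  ultimately show ?thesis
    by (intro right_module.intro right_module_axioms.intro L.ring_axioms) simp_all
qed

section \<open>Consequences of a dual basis of the coring\<close>

context
  fixes J :: "'j set" and \<gamma> d
  assumes db: "dual_basis A C J \<gamma> d"
begin

lemmas basis = dual_basisD [OF db]

lemma dual_basis_apply:
  assumes f: "f \<in> AHom" and c: "c \<in> carrier C"
  shows "f c = (\<Oplus>\<^bsub>A\<^esub>j\<in>J. \<gamma> j c \<otimes>\<^bsub>A\<^esub> f (d j))"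
proof -
  have "f c = f (\<Oplus>\<^bsub>C\<^esub>j\<in>J. lact C (\<gamma> j c) (d j))" by (simp add: basis(4) [OF c])
  also have "\<dots> = (\<Oplus>\<^bsub>A\<^esub>j\<in>J. f (lact C (\<gamma> j c) (d j)))"
    by (rule AHom_sum [OF f]) (use basis c in \<open>auto intro!: lact_closed\<close>)
  also have "\<dots> = (\<Oplus>\<^bsub>A\<^esub>j\<in>J. \<gamma> j c \<otimes>\<^bsub>A\<^esub> f (d j))"
    by (rule L.finsum_cong') (use basis c AHom_closed [OF f] in \<open>auto simp: AHom_lact [OF f]\<close>)
  finally show ?thesis .
qed

lemma dual_basis_determines:
  assumes "f \<in> carrier D" "g \<in> carrier D" "\<And>j. j \<in> J \<Longrightarrow> f (d j) = g (d j)" shows "f = g"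
proof (rule D_eqI [OF assms(1,2)])
  fix c assume c: "c \<in> carrier C"
  have "f c = (\<Oplus>\<^bsub>A\<^esub>j\<in>J. \<gamma> j c \<otimes>\<^bsub>A\<^esub> g (d j))"
    unfolding dual_basis_apply [OF D_AHom [OF assms(1)] c]
    by (rule L.finsum_cong') (use basis c assms in \<open>auto simp: AHom_closed D_AHom\<close>)
  then show "f c = g c" using dual_basis_apply [OF D_AHom [OF assms(2)] c] by simp
qed

lemma dual_basis_separates:
  assumes c: "c \<in> carrier C" "c' \<in> carrier C" and eq: "\<And>g. g \<in> carrier D \<Longrightarrow> g c = g c'" shows "c = c'"
proof -
  have "\<gamma> j c = \<gamma> j c'" if "j \<in> J" for j
    using eq [OF D_restrictI [OF basis(3) [OF that]]] c by simp
  then have "(\<Oplus>\<^bsub>C\<^esub>j\<in>J. lact C (\<gamma> j c) (d j)) = (\<Oplus>\<^bsub>C\<^esub>j\<in>J. lact C (\<gamma> j c') (d j))"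
    by (intro M.finsum_cong') (use basis c in \<open>auto intro!: lact_closed\<close>)
  then show ?thesis using basis(4) c by simp
qed

lemma D_lepoll:
  assumes "infinite (UNIV :: 'u set)" "carrier A \<lesssim> (UNIV :: 'u set)"
  shows "carrier D \<lesssim> (UNIV :: 'u set)"
proof -
  have "carrier D \<lesssim> (J \<rightarrow>\<^sub>E carrier A)"
    unfolding lepoll_def
  proof (intro exI conjI)
    show "inj_on (\<lambda>f. \<lambda>j\<in>J. f (d j)) (carrier D)"
    proof (rule inj_onI)
      fix f g assume *: "f \<in> carrier D" "g \<in> carrier D" "(\<lambda>j\<in>J. f (d j)) = (\<lambda>j\<in>J. g (d j))"
      show "f = g"
        by (rule dual_basis_determines [OF *(1,2)]) (metis *(3) restrict_apply')
    qed
    show "(\<lambda>f. \<lambda>j\<in>J. f (d j)) ` carrier D \<subseteq> J \<rightarrow>\<^sub>E carrier A"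
      using basis(2) by (auto simp: AHom_closed D_AHom)
  qed
  also have "\<dots> \<lesssim> (UNIV :: 'u set)" by (rule lepoll_PiE [OF assms(1) basis(1) assms(2)])
  finally show ?thesis .
qed

text \<open>Both sides of the defining equation are left linear in \<open>c\<close>, so the
  generators \<open>d j\<close> suffice. Finitely many conditions remain, whose differences form a
  map from the left dual into \<open>C^J\<close> with kernel \<open>Q\<close>.\<close>

lemma Q_iff_dual_basis:
  assumes f: "f \<in> carrier D" shows "f \<in> carrier Q \<longleftrightarrow> (\<forall>j\<in>J. act (d j) f = lact C (f (d j)) x)"
proof
  assume *: "\<forall>j\<in>J. act (d j) f = lact C (f (d j)) x"
  note fA = D_AHom [OF f]
  have "act c f = lact C (f c) x" if c: "c \<in> carrier C" for c
  proof -
    have "act c f = act (\<Oplus>\<^bsub>C\<^esub>j\<in>J. lact C (\<gamma> j c) (d j)) f" by (simp add: basis(4) [OF c])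
    also have "\<dots> = (\<Oplus>\<^bsub>C\<^esub>j\<in>J. act (lact C (\<gamma> j c) (d j)) f)"
      by (rule addmap_finsum [OF M.abelian_group_axioms M.abelian_group_axioms left_hom_addmap [OF act_left_hom [OF fA]]])
        (use basis c in \<open>auto intro!: lact_closed\<close>)
    also have "\<dots> = (\<Oplus>\<^bsub>C\<^esub>j\<in>J. lact C (\<gamma> j c \<otimes>\<^bsub>A\<^esub> f (d j)) x)"
      by (rule M.finsum_cong')
        (use * basis c AHom_closed [OF fA] in \<open>auto simp: act_lact [OF fA] lact_assoc x_closed lact_closed\<close>)
    also have "\<dots> = lact C (\<Oplus>\<^bsub>A\<^esub>j\<in>J. \<gamma> j c \<otimes>\<^bsub>A\<^esub> f (d j)) x"
      by (rule sum_lact [OF x_closed, symmetric]) (use basis c AHom_closed [OF fA] in auto)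
    finally show ?thesis by (simp add: dual_basis_apply [OF fA c])
  qed
  then show "f \<in> carrier Q" using f by (simp add: Q_iff)
qed (use basis(2) in \<open>simp add: Q_act\<close>)

end

end

section \<open>Tensors that represent endomorphisms of the coring\<close>

context subring_coring
begin

lemma Dm_R: "right_module R Dm"
  by (rule restrict_scalars_right [OF Dm_right R_ring]) (use S_A in blast)

abbreviation "DA \<equiv> tensor R Dm rg"

sublocale DA: tensor_pair R Dm rg by (rule tensor_pairI [OF Dm_R left_RA])

text \<open>\<open>D \<otimes> A\<close> over the subring is
  \<open>D \<otimes> (A \<otimes> A)\<close> with the outer product over \<open>A\<close>; through
  the canonical map it goes to \<open>D \<otimes> C\<close> over \<open>A\<close>, which evaluates
  to left linear endomorphisms of \<open>C\<close>. \<open>theta\<close> is this composite, with the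
  argument of the endomorphism put first.\<close>

definition "theta c = tensor_lift C (\<lambda>f a. lact C (f c) (ract C x a))"

lemma theta_balanced: "c \<in> carrier C \<Longrightarrow> balanced R Dm rg C (\<lambda>f a. lact C (f c) (ract C x a))"
  by (rule balancedI)
    (auto simp: lact_closed xa_closed AHom_closed D_AHom D_add lact_add_left lact_add_right xa_add
      dual_incl_mult S_A lact_assoc xba S_B)

lemma theta_pure: "c \<in> carrier C \<Longrightarrow> f \<in> carrier D \<Longrightarrow> a \<in> carrier A \<Longrightarrow>
    theta c (DA.pure f a) = lact C (f c) (ract C x a)"
  unfolding theta_def by (rule DA.lift_pure [OF M.abelian_group_axioms theta_balanced]) simp_all

lemma theta_addmap: "c \<in> carrier C \<Longrightarrow> addmap DA C (theta c)"
  unfolding theta_def by (rule DA.lift_addmap [OF M.abelian_group_axioms theta_balanced])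

lemma theta_left_hom: assumes t: "t \<in> carrier DA" shows "(\<lambda>c. theta c t) \<in> left_hom A C C"
  unfolding left_hom_iff
proof (intro conjI addmapI ballI)
  show "theta c t \<in> carrier C" if "c \<in> carrier C" for c by (rule addmap_closed [OF theta_addmap [OF that] t])
  show "theta (c \<oplus>\<^bsub>C\<^esub> c') t = theta c t \<oplus>\<^bsub>C\<^esub> theta c' t" if c: "c \<in> carrier C" "c' \<in> carrier C" for c c'
    using t
  proof (induction rule: DA.tensor_induct)
    case (pure f a)
    then show ?case using c by (simp add: theta_pure AHom_add [OF D_AHom] lact_add_left AHom_closed D_AHom xa_closed)
  next
    case (add t u)
    then show ?case using c addmap_closed [OF theta_addmap] by (simp add: addmap_add [OF theta_addmap] M.a_ac)
  qed
  show "theta (lact C a c) t = lact C a (theta c t)" if c: "a \<in> carrier A" "c \<in> carrier C" for a c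
    using t
  proof (induction rule: DA.tensor_induct)
    case (pure f a)
    then show ?case using c by (simp add: theta_pure AHom_lact [OF D_AHom] lact_assoc AHom_closed D_AHom xa_closed lact_closed)
  next
    case (add t u)
    then show ?case using c addmap_closed [OF theta_addmap] by (simp add: addmap_add [OF theta_addmap] lact_closed lact_add_right)
  qed
qed

text \<open>
  Coassociativity enters here: if \<open>\<Sum> f(c) x a = c\<close> for the tensor \<open>\<Sum> f \<otimes> a\<close> and all \<open>c\<close>, then
  \<open>\<Sum> c\<^sub>1 f(c\<^sub>2) \<otimes> xa = \<Delta>(c)\<close>.
\<close>

lemma theta_comul:
  assumes c: "c \<in> carrier C" and t: "t \<in> carrier DA"
  shows "balanced R Dm rg CC (\<lambda>f a. pure_tensor A C C (act c f) (ract C x a))"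
    and "tensor_lift CC (\<lambda>f a. pure_tensor A C C (act c f) (ract C x a)) t = tensor_map A C C (\<lambda>n. n) (\<lambda>e. theta e t) (comul C c)"
proof -
  note cp = CCr.tensor_pair_axioms
  show b: "balanced R Dm rg CC (\<lambda>f a. pure_tensor A C C (act c f) (ract C x a))"
    by (rule balancedI)
      (use c in \<open>auto simp: CCr.pure_closed act_closed D_AHom xa_closed D_act_add CCr.pure_add_left CCr.pure_add_right xa_add
        D_act_mult dual_incl_closed S_A act_dual_incl CCr.pure_balanced xba S_B\<close>)
  note bp = DA.lift_pure [OF CCr.tensor_abelian b] and ba = DA.lift_addmap [OF CCr.tensor_abelian b]
  note tp = tensor_map_pure [OF cp cp id_right_hom] and ta = tensor_map_addmap [OF cp cp id_right_hom]
  note cc = left_hom_closed [OF comul_left c]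
  show "tensor_lift CC (\<lambda>f a. pure_tensor A C C (act c f) (ract C x a)) t = tensor_map A C C (\<lambda>n. n) (\<lambda>e. theta e t) (comul C c)"
    using t
  proof (induction rule: DA.tensor_induct)
    case (pure f a)
    then have f: "f \<in> carrier D" "f \<in> AHom" and a: "a \<in> carrier A" by (simp_all add: D_AHom)
    have "DA.pure f a \<in> carrier DA" using f a by (intro DA.pure_closed) simp_all
    note th = theta_left_hom [OF this]
    \<comment> \<open>\<open>c\<^sub>1 f(c\<^sub>2) \<otimes> x a = c\<^sub>1 \<otimes> f(c\<^sub>2)
      x a\<close>, by balancedness over \<open>A\<close>; stated for any tensor in place of
      \<open>\<Delta>(c)\<close>, so that pure tensors suffice.\<close>
    have "pure_tensor A C C (contract C f y) (ract C x a) = tensor_map A C C (\<lambda>n. n) (\<lambda>e. theta e (DA.pure f a)) y"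
      if y: "y \<in> carrier CC" for y
      using y
    proof (rule CCr.hom_ext [rotated 2])
      show "addmap CC CC (\<lambda>y. pure_tensor A C C (contract C f y) (ract C x a))"
        using contract_addmap [OF lC rC f(2)] CCr.pure_addmap_left [OF xa_closed [OF a]] by (auto simp: addmap_def)
      show "addmap CC CC (tensor_map A C C (\<lambda>n. n) (\<lambda>e. theta e (DA.pure f a)))" by (rule ta [OF th])
    qed (simp add: tp [OF th] contract_pure [OF lC rC f(2)] theta_pure f a CCr.pure_balanced AHom_closed xa_closed)
    from this [OF cc] show ?case using f a by (simp add: bp flip: act_def)
  next
    case (add t u)
    have tu: "t \<oplus>\<^bsub>DA\<^esub> u \<in> carrier DA" using add by simp
    note th = theta_left_hom [OF add(1)] theta_left_hom [OF add(2)] theta_left_hom [OF tu]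
    have "tensor_map A C C (\<lambda>n. n) (\<lambda>e. theta e (t \<oplus>\<^bsub>DA\<^esub> u)) y =
        tensor_map A C C (\<lambda>n. n) (\<lambda>e. theta e t) y \<oplus>\<^bsub>CC\<^esub> tensor_map A C C (\<lambda>n. n) (\<lambda>e. theta e u) y"
      if y: "y \<in> carrier CC" for y
      using y
    proof (rule CCr.hom_ext [OF ta [OF th(3)], rotated])
      show "addmap CC CC (\<lambda>y. tensor_map A C C (\<lambda>n. n) (\<lambda>e. theta e t) y \<oplus>\<^bsub>CC\<^esub> tensor_map A C C (\<lambda>n. n) (\<lambda>e. theta e u) y)"
        using addmap_closed [OF ta [OF th(1)]] addmap_closed [OF ta [OF th(2)]]
        by (intro addmapI) (simp_all add: addmap_add [OF ta [OF th(1)]] addmap_add [OF ta [OF th(2)]] CC.M.a_ac)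
    qed (use add left_hom_closed [OF th(1)] left_hom_closed [OF th(2)] in
        \<open>simp add: tp [OF th(1)] tp [OF th(2)] tp [OF th(3)] addmap_add [OF theta_addmap] CCr.pure_add_right\<close>)
    from this [OF cc] show ?case using add by (simp add: addmap_add [OF ba])
  qed
qed

section \<open>The kernel sequence of \<open>Q\<close> tensored with \<open>A\<close>\<close>

context
  fixes J :: "'j set" and \<gamma> d
  assumes bij: "bij_betw (can C x) (carrier W) (carrier C)" and db: "dual_basis A C J \<gamma> d"
begin

lemmas basis = dual_basisD [OF db]

abbreviation "PC \<equiv> power_module J C"
abbreviation "PA \<equiv> tensor R PC rg"

interpretation PC: right_module R PC by (rule power_module_right [OF right_RC])
interpretation PA: tensor_pair R PC rg by (rule tensor_pairI [OF PC.right_module_axioms left_RA])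

text \<open>The identity of \<open>C\<close> is
  \<open>c \<mapsto> \<Sum> \<gamma>\<^sub>j(c) d\<^sub>j\<close>, that is, the element
  \<open>\<Sum> \<gamma>\<^sub>j \<otimes> d\<^sub>j\<close> of \<open>D \<otimes> C\<close> over
  \<open>A\<close>. Pulling the \<open>d\<^sub>j\<close> back along the canonical map gives a
  preimage under \<open>theta\<close>.\<close>

lemma identity_lift: "\<exists>t\<in>carrier DA. \<forall>c\<in>carrier C. theta c t = c"
proof -
  define g where "g j = restrict (\<gamma> j) (carrier C)" for j
  have g: "g j \<in> carrier D" if "j \<in> J" for j using D_restrictI [OF basis(3) [OF that]] by (simp add: g_def)
  \<comment> \<open>\<open>g \<otimes> (u \<otimes> v) \<mapsto> (g # i(u)) \<otimes> v\<close>, the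
    identification of \<open>D \<otimes> (A \<otimes> A)\<close> with
    \<open>D \<otimes> A\<close>.\<close>
  let ?\<beta> = "\<lambda>g u v. DA.pure (g \<otimes>\<^bsub>D\<^esub> dual_incl A C u) v"
  interpret Dm: right_module A Dm by (rule Dm_right)
  have b: "balanced R rg rg DA (?\<beta> h)" if h: "h \<in> carrier D" for h
  proof (rule balancedI)
    show "?\<beta> h (u \<oplus>\<^bsub>rg\<^esub> u') v = ?\<beta> h u v \<oplus>\<^bsub>DA\<^esub> ?\<beta> h u' v" if "u \<in> carrier rg" "u' \<in> carrier rg" "v \<in> carrier rg" for u u' v
      using Dm.ract_add_right [of u u' h] DA.pure_add_left [of "h \<otimes>\<^bsub>D\<^esub> dual_incl A C u" "h \<otimes>\<^bsub>D\<^esub> dual_incl A C u'" v] that h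
      by (simp add: D_mult_closed dual_incl_closed)
    show "?\<beta> h (ract rg u b) v = ?\<beta> h u (lact rg b v)" if "u \<in> carrier rg" "b \<in> carrier R" "v \<in> carrier rg" for u b v
      using Dm.ract_assoc [of u b h] DA.pure_balanced [of "h \<otimes>\<^bsub>D\<^esub> dual_incl A C u" b v] that h S_A [of b]
      by (simp add: D_mult_closed dual_incl_closed)
    show "?\<beta> h u (v \<oplus>\<^bsub>rg\<^esub> v') = ?\<beta> h u v \<oplus>\<^bsub>DA\<^esub> ?\<beta> h u v'" if "u \<in> carrier rg" "v \<in> carrier rg" "v' \<in> carrier rg" for u v v'
      using DA.pure_add_right [of "h \<otimes>\<^bsub>D\<^esub> dual_incl A C u" v v'] that h by (simp add: D_mult_closed dual_incl_closed)
  qed (use h in \<open>auto intro!: DA.pure_closed simp: D_mult_closed dual_incl_closed\<close>)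
  note bp = W.lift_pure [OF DA.tensor_abelian b] and ba = W.lift_addmap [OF DA.tensor_abelian b]
  let ?L = "\<lambda>h. tensor_lift DA (?\<beta> h)"
  have tL: "theta c (?L h w) = lact C (h c) (can C x w)" if h: "h \<in> carrier D" and c: "c \<in> carrier C" and w: "w \<in> carrier W" for h c w
    using w
  proof (rule W.hom_ext [rotated 2])
    show "addmap W C (\<lambda>w. theta c (?L h w))" using ba [OF h] theta_addmap [OF c] by (auto simp: addmap_def)
    show "addmap W C (\<lambda>w. lact C (h c) (can C x w))"
      using can_addmap AHom_closed [OF D_AHom [OF h] c] by (auto simp: addmap_def lact_closed lact_add_right)
    show "theta c (?L h (W.pure u v)) = lact C (h c) (can C x (W.pure u v))" if "u \<in> carrier rg" "v \<in> carrier rg" for u v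
      using that h c AHom_closed [OF D_AHom [OF h] c]
      by (simp add: bp [OF h] theta_pure D_mult_closed dual_incl_closed dual_incl_mult can_pure lact_assoc lact_ract x_closed xa_closed)
  qed
  note ic = can_inv_closed [OF bij basis(2)]
  let ?t = "\<Oplus>\<^bsub>DA\<^esub>j\<in>J. ?L (g j) (can_inv (d j))"
  have Lc: "?L (g j) (can_inv (d j)) \<in> carrier DA" if "j \<in> J" for j
    by (rule addmap_closed [OF ba [OF g [OF that]] ic [OF that]])
  have "theta c ?t = c" if c: "c \<in> carrier C" for c
  proof -
    have "theta c ?t = (\<Oplus>\<^bsub>C\<^esub>j\<in>J. theta c (?L (g j) (can_inv (d j))))"
      by (rule addmap_finsum [OF DA.tensor_abelian M.abelian_group_axioms theta_addmap [OF c]]) (use Lc in auto)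
    also have "\<dots> = (\<Oplus>\<^bsub>C\<^esub>j\<in>J. lact C (\<gamma> j c) (d j))"
    proof (rule M.finsum_cong' [OF refl])
      show "(\<lambda>j. lact C (\<gamma> j c) (d j)) \<in> J \<rightarrow> carrier C" using basis c by (auto intro!: lact_closed)
      show "theta c (?L (g j) (can_inv (d j))) = lact C (\<gamma> j c) (d j)" if "j \<in> J" for j
        unfolding tL [OF g [OF that] c ic [OF that]] can_can_inv [OF bij basis(2) [OF that]] using c by (simp add: g_def)
    qed
    finally show ?thesis by (simp add: basis(4) [OF c])
  qed
  moreover have "?t \<in> carrier DA" using Lc by (auto intro!: DA.T.finsum_closed)
  ultimately show ?thesis by blast
qed

definition "Theta j = tensor_lift CC (\<lambda>h a. pure_tensor A C C (h j) (ract C x a))"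

lemma Theta_balanced:
  assumes j: "j \<in> J" shows "balanced R PC rg CC (\<lambda>h a. pure_tensor A C C (h j) (ract C x a))"
proof -
  have h: "h j \<in> carrier C" if "h \<in> J \<rightarrow>\<^sub>E carrier C" for h using PiE_mem [OF that j] .
  show ?thesis
    by (rule balancedI)
      (simp_all add: j h CCr.pure_closed CCr.pure_add_left CCr.pure_add_right xa_closed xa_add CCr.pure_balanced xba S_B S_A)
qed

lemma Theta_pure: "j \<in> J \<Longrightarrow> h \<in> carrier PC \<Longrightarrow> a \<in> carrier A \<Longrightarrow> Theta j (PA.pure h a) = pure_tensor A C C (h j) (ract C x a)"
  unfolding Theta_def by (rule PA.lift_pure [OF CCr.tensor_abelian Theta_balanced]) simp_all

lemma Theta_addmap: "j \<in> J \<Longrightarrow> addmap PA CC (Theta j)"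
  unfolding Theta_def by (rule PA.lift_addmap [OF CCr.tensor_abelian Theta_balanced])

text \<open>The maps \<open>Theta j\<close> are jointly injective: \<open>C \<otimes> A \<cong> C \<otimes>\<^sub>A (A \<otimes> A) \<cong> C \<otimes>\<^sub>A C\<close>.\<close>

lemma Theta_inj:
  assumes z: "z \<in> carrier PA" and 0: "\<And>j. j \<in> J \<Longrightarrow> Theta j z = \<zero>\<^bsub>CC\<^esub>"
  shows "z = \<zero>\<^bsub>PA\<^esub>"
proof -
  \<comment> \<open>The inclusion of the summand with index \<open>j\<close>, which lets an element
    of \<open>C^J\<close> be written as the sum of its coordinates.\<close>
  define \<iota> where "\<iota> j c = (\<lambda>i\<in>J. if i = j then c else \<zero>\<^bsub>C\<^esub>)" for j c
  have \<iota>c: "\<iota> j c \<in> carrier PC" if "c \<in> carrier C" for j c using that by (auto simp: \<iota>_def)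
  have \<iota>a: "\<iota> j (c \<oplus>\<^bsub>C\<^esub> c') = \<iota> j c \<oplus>\<^bsub>PC\<^esub> \<iota> j c'" if "c \<in> carrier C" "c' \<in> carrier C" for j c c'
    using that by (auto simp: \<iota>_def fun_eq_iff restrict_def)
  have \<iota>r: "\<iota> j (ract C c b) = ract PC (\<iota> j c) b" if "c \<in> carrier C" "b \<in> carrier A" for j c b
    using that by (auto simp: \<iota>_def fun_eq_iff restrict_def ract_zero)
  let ?\<beta> = "\<lambda>j c u v. PA.pure (\<iota> j (ract C c u)) v"
  have b: "balanced R rg rg PA (?\<beta> j c)" if c: "c \<in> carrier C" for j c
  proof (rule balancedI)
    show "?\<beta> j c (ract rg u b) v = ?\<beta> j c u (lact rg b v)" if "u \<in> carrier rg" "b \<in> carrier R" "v \<in> carrier rg" for u b v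
      using PA.pure_balanced [of "\<iota> j (ract C c u)" b v] \<iota>r [of "ract C c u" b j] that c S_A [of b]
      by (simp add: ract_assoc ract_closed \<iota>c del: power_module_simps)
  qed (use c in \<open>simp_all add: PA.pure_closed \<iota>c ract_closed ract_add_right \<iota>a PA.pure_add_left PA.pure_add_right [unfolded regular_simps] del: power_module_simps\<close>)
  note bp = W.lift_pure [OF PA.tensor_abelian b] and ba = W.lift_addmap [OF PA.tensor_abelian b]
  let ?L = "\<lambda>j c w. tensor_lift PA (?\<beta> j c) w"
  have Ladd: "?L j (c \<oplus>\<^bsub>C\<^esub> c') w = ?L j c w \<oplus>\<^bsub>PA\<^esub> ?L j c' w"
    if c: "c \<in> carrier C" "c' \<in> carrier C" and w: "w \<in> carrier W" for j c c' w
    using w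
  proof (induction rule: W.tensor_induct)
    case (pure u v)
    then show ?case using c
      by (simp add: bp ract_add_left \<iota>a PA.pure_add_left \<iota>c ract_closed del: power_module_simps)
  next
    case (add t u)
    then show ?case using c addmap_closed [OF ba] by (simp add: addmap_add [OF ba] PA.T.a_ac)
  qed
  have Lact: "?L j (ract C c a) w = ?L j c (lact W a w)" if c: "c \<in> carrier C" "a \<in> carrier A" and w: "w \<in> carrier W" for j c a w
    using w
  proof (induction rule: W.tensor_induct)
    case (pure u v)
    then show ?case using c by (simp add: bp Wl.lact_pure ract_assoc ract_closed)
  next
    case (add t u)
    then show ?case using c by (simp add: addmap_add [OF ba] Wb.lact_add_right Wb.lact_closed ract_closed)
  qed
  note cl = can_inv_left [OF bij] and cc = can_inv_closed [OF bij]
  have B: "balanced A C C PA (\<lambda>c e. ?L j c (can_inv e))" for j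
    by (rule balancedI)
      (simp_all add: addmap_closed [OF ba] cc Ladd Lact addmap_add [OF ba] addmap_add [OF left_hom_addmap [OF cl]] left_hom_lact [OF cl])
  note Bp = CCr.lift_pure [OF PA.tensor_abelian B] and Ba = CCr.lift_addmap [OF PA.tensor_abelian B]
  \<comment> \<open>A left inverse of \<open>Theta j\<close> up to the inclusion of the summand:
    \<open>can_inv (x a)\<close> is \<open>1 \<otimes> a\<close>, so \<open>c \<otimes> x a\<close>
    returns to \<open>c \<otimes> a\<close>. Summing over \<open>j\<close> recovers
    \<open>z\<close>, and joint injectivity follows.\<close>
  let ?B = "\<lambda>j. tensor_lift PA (\<lambda>c e. ?L j c (can_inv e))"
  have sum\<iota>: "(\<Oplus>\<^bsub>PC\<^esub>j\<in>J. \<iota> j (h j)) = h" if h: "h \<in> carrier PC" for h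
  proof -
    have hc: "h j \<in> carrier C" if "j \<in> J" for j using h that by (auto dest: PiE_mem)
    have ev: "addmap PC C (\<lambda>h. h i)" if "i \<in> J" for i
      using that by (auto simp: addmap_def dest: PiE_mem)
    have sc: "(\<Oplus>\<^bsub>PC\<^esub>j\<in>J. \<iota> j (h j)) \<in> carrier PC" using \<iota>c hc by (auto intro!: PC.M.finsum_closed simp del: power_module_simps)
    show ?thesis
    proof (rule PiE_ext)
      show "(\<Oplus>\<^bsub>PC\<^esub>j\<in>J. \<iota> j (h j)) \<in> J \<rightarrow>\<^sub>E carrier C" "h \<in> J \<rightarrow>\<^sub>E carrier C" using sc h by simp_all
      fix i assume i: "i \<in> J"
      have "(\<Oplus>\<^bsub>PC\<^esub>j\<in>J. \<iota> j (h j)) i = (\<Oplus>\<^bsub>C\<^esub>j\<in>J. \<iota> j (h j) i)"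
        by (rule addmap_finsum [OF PC.M.abelian_group_axioms M.abelian_group_axioms ev [OF i]]) (use \<iota>c hc in \<open>auto simp del: power_module_simps\<close>)
      also have "\<dots> = (\<Oplus>\<^bsub>C\<^esub>j\<in>J. if i = j then h j else \<zero>\<^bsub>C\<^esub>)"
        by (rule M.finsum_cong') (use i hc in \<open>auto simp: \<iota>_def\<close>)
      also have "\<dots> = h i" by (rule M.finsum_singleton [OF i basis(1)]) (use hc in auto)
      finally show "(\<Oplus>\<^bsub>PC\<^esub>j\<in>J. \<iota> j (h j)) i = h i" .
    qed
  qed
  have rec: "(\<Oplus>\<^bsub>PA\<^esub>j\<in>J. ?B j (Theta j z)) = z" if "z \<in> carrier PA" for z
    using that
  proof (rule PA.hom_ext [rotated 2])
    show "addmap PA PA (\<lambda>z. \<Oplus>\<^bsub>PA\<^esub>j\<in>J. ?B j (Theta j z))"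
      by (rule addmap_sum [OF PA.tensor_abelian]) (rule addmap_comp [OF Theta_addmap Ba])
    fix h a assume pure: "h \<in> carrier PC" "a \<in> carrier rg"
    have hc: "h j \<in> carrier C" if "j \<in> J" for j using pure(1) that by (auto dest: PiE_mem)
    have a: "a \<in> carrier A" using pure(2) by simp
    have "(\<Oplus>\<^bsub>PA\<^esub>j\<in>J. ?B j (Theta j (PA.pure h a))) = (\<Oplus>\<^bsub>PA\<^esub>j\<in>J. PA.pure (\<iota> j (h j)) a)"
    proof (rule PA.T.finsum_cong' [OF refl])
      show "(\<lambda>j. PA.pure (\<iota> j (h j)) a) \<in> J \<rightarrow> carrier PA" using \<iota>c hc pure(2) by (auto intro!: PA.pure_closed simp del: power_module_simps)
      show "?B j (Theta j (PA.pure h a)) = PA.pure (\<iota> j (h j)) a" if "j \<in> J" for j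
        using that hc a by (simp add: Theta_pure [OF that pure(1) a] Bp xa_closed can_inv_xa [OF bij] bp ract_one)
    qed
    also have "\<dots> = PA.pure (\<Oplus>\<^bsub>PC\<^esub>j\<in>J. \<iota> j (h j)) a"
      by (rule PA.pure_sum_left [symmetric]) (use \<iota>c hc pure(2) in \<open>auto simp del: power_module_simps\<close>)
    finally show "(\<Oplus>\<^bsub>PA\<^esub>j\<in>J. ?B j (Theta j (PA.pure h a))) = PA.pure h a"
      by (simp only: sum\<iota> [OF pure(1)])
  qed (rule addmap_id)
  have "?B j (Theta j z) = \<zero>\<^bsub>PA\<^esub>" if "j \<in> J" for j
    unfolding 0 [OF that] by (rule addmap_zero [OF CCr.tensor_abelian PA.tensor_abelian Ba])
  then have "(\<Oplus>\<^bsub>PA\<^esub>j\<in>J. ?B j (Theta j z)) = (\<Oplus>\<^bsub>PA\<^esub>j\<in>J. \<zero>\<^bsub>PA\<^esub>)"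
    by (intro PA.T.finsum_cong') auto
  then show ?thesis using rec [OF z] by simp
qed

text \<open>By flatness the kernel of \<delta> tensored with \<open>A\<close> is the image of
  \<open>Q \<otimes> A\<close>. The tensor \<open>t\<close> that represents the identity of
  \<open>C\<close> lies in this kernel, so it comes from \<open>Q \<otimes> A\<close>, and an
  expansion of a preimage into pure tensors yields the family.\<close>

lemma faithfully_flat_gal_basis:
  assumes ff: "left_faithfully_flat TYPE('u) R rg" and inf: "infinite (UNIV :: 'u set)"
    and uA: "carrier A \<lesssim> (UNIV :: 'u set)" and uC: "carrier C \<lesssim> (UNIV :: 'u set)"
  obtains k :: nat and r s where "gal_basis {..<k} r s"
proof -
  have SB: "S = carrier B" by (rule faithfully_flat_S [OF bij ff uA uC])
  let ?N = "Dm\<lparr>carrier := carrier Q\<rparr>"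
  interpret DR: right_module R Dm by (rule Dm_R)
  have negD: "\<ominus>\<^bsub>Dm\<^esub> f = \<ominus>\<^bsub>D\<^esub> f" if "f \<in> carrier D" for f
    using DA.M.minus_equality [of "\<ominus>\<^bsub>D\<^esub> f" f] that by (simp add: D.l_neg)
  have negQ: "\<ominus>\<^bsub>D\<^esub> q \<in> carrier Q" if "q \<in> carrier Q" for q
    using abelian_group.l_neg [OF Q_abelian that] abelian_group.a_inv_closed [OF Q_abelian that]
      D.minus_equality [of "\<ominus>\<^bsub>Q\<^esub> q" q] Q_D that by simp
  have N: "right_module R ?N"
    by (rule right_module_subset [OF Dm_R])
      (use abelian_groupE(1,2) [OF Q_abelian] in \<open>auto simp: Q_D negD negQ SB Q_mult_right\<close>)
  define \<delta> where "\<delta> f = (\<lambda>j\<in>J. act (d j) f \<ominus>\<^bsub>C\<^esub> lact C (f (d j)) x)" for f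
  have ac: "act (d j) f \<in> carrier C" "f (d j) \<in> carrier A" if "j \<in> J" "f \<in> carrier D" for j f
    using basis(2) that by (simp_all add: act_closed AHom_closed D_AHom)
  have i: "(\<lambda>f. f) \<in> right_hom R ?N Dm" by (auto simp: right_hom_iff addmap_def Q_D)
  have dh: "\<delta> \<in> right_hom R Dm PC"
    unfolding right_hom_iff
  proof (intro conjI addmapI ballI)
    show "\<delta> f \<in> carrier PC" if "f \<in> carrier Dm" for f
      using that ac by (auto simp: \<delta>_def lact_closed x_closed)
    show "\<delta> (f \<oplus>\<^bsub>Dm\<^esub> g) = \<delta> f \<oplus>\<^bsub>PC\<^esub> \<delta> g" if "f \<in> carrier Dm" "g \<in> carrier Dm" for f g
      using that ac basis(2)
      by (auto simp: \<delta>_def fun_eq_iff restrict_def D_act_add D_add lact_add_left x_closed a_minus_def M.minus_add M.a_ac lact_closed)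
    show "\<delta> (ract Dm f b) = ract PC (\<delta> f) b" if fb: "b \<in> carrier R" "f \<in> carrier Dm" for f b
    proof -
      have b: "b \<in> carrier A" "lact C b x = ract C x b" using fb S_B [of b] by (simp_all add: B_iff)
      have "act (d j) (f \<otimes>\<^bsub>D\<^esub> dual_incl A C b) \<ominus>\<^bsub>C\<^esub> lact C ((f \<otimes>\<^bsub>D\<^esub> dual_incl A C b) (d j)) x =
          ract C (act (d j) f \<ominus>\<^bsub>C\<^esub> lact C (f (d j)) x) b" if "j \<in> J" for j
        using fb b ac [OF that] basis(2) [OF that]
          addmap_minus [OF M.abelian_group_axioms M.abelian_group_axioms ract_addmap [OF b(1)], of "act (d j) f" "lact C (f (d j)) x"]
        by (simp add: D_act_mult dual_incl_closed act_dual_incl dual_incl_mult lact_assoc x_closed lact_ract lact_closed)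
      then show ?thesis by (auto simp: \<delta>_def fun_eq_iff restrict_def)
    qed
  qed
  have ker: "f \<in> carrier Q \<longleftrightarrow> \<delta> f = \<zero>\<^bsub>PC\<^esub>" if f: "f \<in> carrier D" for f
    unfolding Q_iff_dual_basis [OF db f] using ac f basis(2)
    by (auto simp: \<delta>_def fun_eq_iff restrict_def M.minus_eq_zero_iff lact_closed x_closed)
  interpret N: tensor_pair R ?N rg by (rule tensor_pairI [OF N left_RA])
  have "exact_at ?N Dm PC (\<lambda>f. f) \<delta>"
    using ker Q_D by (auto simp: exact_at_def)
  moreover have "carrier Dm \<lesssim> (UNIV :: 'u set)" using D_lepoll [OF db inf uA] by simp
  moreover have "carrier ?N \<lesssim> (UNIV :: 'u set)"
    using lepoll_trans [OF subset_imp_lepoll D_lepoll [OF db inf uA], of "carrier Q"] Q_D by auto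
  moreover have "carrier PC \<lesssim> (UNIV :: 'u set)" using lepoll_PiE [OF inf basis(1) uC] by simp
  ultimately have ex: "exact_at N.T DA PA (tensor_map R Dm rg (\<lambda>f. f) (\<lambda>p. p)) (tensor_map R PC rg \<delta> (\<lambda>p. p))"
    using left_faithfully_flat_exact [OF ff N Dm_R PC.right_module_axioms _ _ _ i dh] by blast
  obtain t where t: "t \<in> carrier DA" "\<And>c. c \<in> carrier C \<Longrightarrow> theta c t = c" using identity_lift by blast
  let ?d = "tensor_map R PC rg \<delta> (\<lambda>p. p)"
  note dp = tensor_map_pure [OF DA.tensor_pair_axioms PA.tensor_pair_axioms dh id_left_hom]
    and da = tensor_map_addmap [OF DA.tensor_pair_axioms PA.tensor_pair_axioms dh id_left_hom]
  have "?d t = \<zero>\<^bsub>PA\<^esub>"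
  proof (rule Theta_inj [OF addmap_closed [OF da t(1)]])
    fix j assume j: "j \<in> J"
    note dj = basis(2) [OF j]
    note X = theta_comul(1) [OF dj t(1)]
    let ?X = "tensor_lift CC (\<lambda>f a. pure_tensor A C C (act (d j) f) (ract C x a))"
    note Xp = DA.lift_pure [OF CCr.tensor_abelian X] and Xa = DA.lift_addmap [OF CCr.tensor_abelian X]
    \<comment> \<open>The two terms of \<delta> give
      \<open>c\<^sub>1 f(c\<^sub>2) \<otimes> x a\<close> and
      \<open>f(c) x \<otimes> x a = \<Delta>(f(c) x a)\<close> for \<open>c = d\<^sub>j\<close>.
      Summed over \<open>t\<close> both become \<open>\<Delta>(c)\<close>, because \<open>t\<close>
      represents the identity.\<close>
    have "Theta j (?d t) = ?X t \<ominus>\<^bsub>CC\<^esub> comul C (theta (d j) t)"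
      using t(1)
    proof (rule DA.hom_ext [rotated 2])
      show "addmap DA CC (\<lambda>t. Theta j (?d t))" using da Theta_addmap [OF j] by (auto simp: addmap_def)
      have "addmap DA CC (\<lambda>t. comul C (theta (d j) t))"
        using theta_addmap [OF dj] left_hom_addmap [OF comul_left] by (auto simp: addmap_def)
      then show "addmap DA CC (\<lambda>t. ?X t \<ominus>\<^bsub>CC\<^esub> comul C (theta (d j) t))"
        using Xa by (auto simp: addmap_def a_minus_def CC.M.minus_add CC.M.a_ac)
      fix f a assume f: "f \<in> carrier Dm" and a: "a \<in> carrier rg"
      have fD: "f \<in> carrier D" and aA: "a \<in> carrier A" using f a by simp_all
      have 1: "comul C (theta (d j) (DA.pure f a)) = pure_tensor A C C (lact C (f (d j)) x) (ract C x a)"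
        using ac [OF j fD] left_hom_lact [OF comul_left, of "f (d j)" "ract C x a"]
        by (simp add: theta_pure dj fD aA xa_closed comul_xa CCl.lact_pure x_closed)
      have "Theta j (?d (DA.pure f a)) = pure_tensor A C C (act (d j) f \<ominus>\<^bsub>C\<^esub> lact C (f (d j)) x) (ract C x a)"
        using right_hom_closed [OF dh f] j aA by (simp add: dp [OF f a] Theta_pure) (simp add: \<delta>_def)
      also have "\<dots> = pure_tensor A C C (act (d j) f) (ract C x a) \<ominus>\<^bsub>CC\<^esub> pure_tensor A C C (lact C (f (d j)) x) (ract C x a)"
        by (rule addmap_minus [OF M.abelian_group_axioms CCr.tensor_abelian CCr.pure_addmap_left [OF xa_closed [OF aA]]])
          (use ac [OF j fD] in \<open>simp_all add: lact_closed x_closed\<close>)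
      finally show "Theta j (?d (DA.pure f a)) = ?X (DA.pure f a) \<ominus>\<^bsub>CC\<^esub> comul C (theta (d j) (DA.pure f a))"
        by (simp only: 1 Xp [OF f a])
    qed
    also have "?X t = comul C (d j)"
    proof -
      note cp = CCr.tensor_pair_axioms
      have "?X t = tensor_map A C C (\<lambda>n. n) (\<lambda>e. theta e t) (comul C (d j))" by (rule theta_comul(2) [OF dj t(1)])
      also have "\<dots> = comul C (d j)"
        using left_hom_closed [OF comul_left dj]
      proof (rule CCr.hom_ext [OF tensor_map_addmap [OF cp cp id_right_hom theta_left_hom [OF t(1)]], where g = "\<lambda>y. y", rotated])
        show "addmap CC CC (\<lambda>y. y)" by (simp add: addmap_def)
      qed (simp add: tensor_map_pure [OF cp cp id_right_hom theta_left_hom [OF t(1)]] t(2))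
      finally show ?thesis .
    qed
    finally show "Theta j (?d t) = \<zero>\<^bsub>CC\<^esub>"
      using left_hom_closed [OF comul_left dj] by (simp add: t(2) dj CC.M.minus_eq_zero_iff)
  qed
  then have "t \<in> tensor_map R Dm rg (\<lambda>f. f) (\<lambda>p. p) ` carrier N.T"
    using ex t(1) by (auto simp: exact_at_def)
  then obtain t' where t': "t = tensor_map R Dm rg (\<lambda>f. f) (\<lambda>p. p) t'" "t' \<in> carrier N.T" by (rule imageE)
  note ip = tensor_map_pure [OF N.tensor_pair_axioms DA.tensor_pair_axioms i id_left_hom]
    and ia = tensor_map_addmap [OF N.tensor_pair_axioms DA.tensor_pair_axioms i id_left_hom]
  obtain k :: nat and r s where rs: "r \<in> {..<k} \<rightarrow> carrier ?N" "s \<in> {..<k} \<rightarrow> carrier rg"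
    "t' = (\<Oplus>\<^bsub>N.T\<^esub>i\<in>{..<k}. N.pure (r i) (s i))"
    by (rule N.tensor_sumE [OF t'(2)])
  have r: "r i \<in> carrier Q" "r i \<in> carrier D" and s: "s i \<in> carrier A" if "i < k" for i
    using that rs(1,2) Q_D by auto
  have "(\<Oplus>\<^bsub>A\<^esub>i\<in>{..<k}. r i c \<otimes>\<^bsub>A\<^esub> s i) = counit C c" if c: "c \<in> carrier C" for c
  proof -
    \<comment> \<open>Applying \<epsilon> to \<open>\<Sum> r\<^sub>i(c) x s\<^sub>i = c\<close>
      turns each summand into \<open>r\<^sub>i(c) s\<^sub>i\<close>.\<close>
    let ?h = "\<lambda>t. counit C (theta c (tensor_map R Dm rg (\<lambda>f. f) (\<lambda>p. p) t))"
    have h: "addmap N.T A ?h"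
      using ia theta_addmap [OF c] AHom_addmap [OF counit_left_hom] by (auto simp: addmap_def)
    have hp: "?h (N.pure (r i) (s i)) = r i c \<otimes>\<^bsub>A\<^esub> s i" if "i < k" for i
    proof -
      have m: "r i \<in> carrier ?N" "s i \<in> carrier rg" using r [OF that] s [OF that] by simp_all
      show ?thesis
        unfolding ip [OF m] using r [OF that] s [OF that] c
        by (simp add: theta_pure AHom_lact [OF counit_left_hom] AHom_closed D_AHom xa_closed counit_xa)
    qed
    have "counit C c = ?h t'" by (simp add: t'(1) [symmetric] t(2) c)
    also have "\<dots> = (\<Oplus>\<^bsub>A\<^esub>i\<in>{..<k}. ?h (N.pure (r i) (s i)))"
      unfolding rs(3)
      by (rule addmap_finsum [OF N.tensor_abelian L.abelian_group_axioms h])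
        (rule funcsetI, rule N.pure_closed [OF funcset_mem [OF rs(1)] funcset_mem [OF rs(2)]])
    also have "\<dots> = (\<Oplus>\<^bsub>A\<^esub>i\<in>{..<k}. r i c \<otimes>\<^bsub>A\<^esub> s i)"
      by (rule L.finsum_cong') (use r s c hp in \<open>auto simp: AHom_closed D_AHom\<close>)
    finally show ?thesis ..
  qed
  then have "gal_basis {..<k} r s" using r s by (auto simp: gal_basis_def)
  then show ?thesis by (rule that)
qed

end

end

section \<open>The adjoint pair of a strict context\<close>

text \<open>Tensor products see only the module fields of a record, so adding a coaction to a module
  does not change them.\<close>

lemma pure_tensor_cong:
  assumes "carrier M = carrier M'" "ring.add M = ring.add M'" "ract M = ract M'"
  shows "pure_tensor R M N = pure_tensor R M' N"
  using assms by (simp add: fun_eq_iff pure_tensor_def tensor_kernel_def tensor_relators_def)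

lemma tensor_cong:
  assumes "carrier M = carrier M'" "ring.add M = ring.add M'" "ract M = ract M'" "lact M = lact M'"
  shows "tensor R M N = tensor R M' N"
proof -
  have "tensor_group R M N = tensor_group R M' N"
    using assms by (simp add: tensor_group_def tensor_kernel_def tensor_relators_def)
  then show ?thesis
    by (simp add: tensor_def pure_tensor_cong [OF assms(1-3)] assms(3,4))
qed

lemma right_module_cong:
  assumes M: "right_module R M" and eq: "carrier N = carrier M" "ring.add N = ring.add M" "ring.zero N = ring.zero M"
    "\<And>m a. m \<in> carrier M \<Longrightarrow> a \<in> carrier R \<Longrightarrow> ract N m a = ract M m a"
  shows "right_module R N"
proof -
  interpret M: right_module R M by fact
  have "abelian_group N" by (rule abelian_group_cong [OF M.M.abelian_group_axioms]) (simp_all add: eq)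
  then show ?thesis
    by (intro right_module.intro right_module_axioms.intro M.R.ring_axioms)
      (simp_all add: eq M.ract_closed M.ract_add_left M.ract_add_right M.ract_assoc M.ract_one)
qed

context grouplike_coring
begin

lemma carrier_subring_coring: "subring_coring A C x (carrier B)"
  by (intro subring_coring.intro subring_coring_axioms.intro grouplike_coring_axioms B.carrier_is_subring)

lemma bim_BA: "bimodule B A (regular A)" and left_BA: "left_module B (regular A)"
  using subring_coring.bim_RA [OF carrier_subring_coring] subring_coring.left_RA [OF carrier_subring_coring] by (simp_all only: B_update)

text \<open>The factor \<open>a\<close> is placed inside so that the value at \<open>1\<close> is
  \<open>q(xa)\<close>, a typical element of the image of \<tau>. Contracting
  \<open>n \<otimes> 1\<close> then gives \<open>n q(xa)\<close>.\<close>

lemma Q_left_hom: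
  assumes q: "q \<in> carrier Q" and a: "a \<in> carrier A"
  shows "(\<lambda>a'. q (ract C x (a' \<otimes>\<^bsub>A\<^esub> a))) \<in> left_hom B (regular A) (regular B)"
proof -
  have "ract C x (b \<otimes>\<^bsub>A\<^esub> a' \<otimes>\<^bsub>A\<^esub> a) = lact C b (ract C x (a' \<otimes>\<^bsub>A\<^esub> a))" if "b \<in> carrier B" "a' \<in> carrier A" for b a'
    using that a by (simp add: L.m_assoc B_A xba)
  then show ?thesis
    unfolding left_hom_iff
    using q a by (auto simp: addmap_def Q_xa L.l_distr xa_add AHom_add [OF Q_AHom] xa_closed AHom_lact [OF Q_AHom] B_A)
qed

section \<open>The unit of the adjunction\<close>

context
  fixes N :: "('l, 'a, 'n) bimodule"
  assumes N: "right_module B N"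
begin

abbreviation "IC \<equiv> induced_comodule A C x N"
abbreviation "NA \<equiv> tensor B N (regular A)"

interpretation N: right_module B N by (rule N)
interpretation NA: tensor_right B A N "regular A" by (rule tensor_rightI [OF N bim_BA])
interpretation NAm: right_module A NA by (rule NA.tensor_right_module)
interpretation NAC: tensor_right A A NA C by (rule tensor_rightI [OF NAm.right_module_axioms bC])

lemma IC_simps:
  "carrier IC = carrier NA" "ring.add IC = ring.add NA" "ring.zero IC = ring.zero NA" "ract IC = ract NA"
  "coact IC = tensor_lift (tensor A NA C) (\<lambda>n a. pure_tensor A NA C (NA.pure n \<one>\<^bsub>A\<^esub>) (ract C x a))"
  by (simp_all add: induced_comodule_def Let_def bimodule.defs)

lemma pure_IC: "pure_tensor A IC C = pure_tensor A NA C"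
  by (rule pure_tensor_cong) (simp_all add: IC_simps)

lemma coact_balanced:
  "balanced B N (regular A) NAC.T (\<lambda>n a. pure_tensor A NA C (NA.pure n \<one>\<^bsub>A\<^esub>) (ract C x a))"
proof (rule balancedI)
  fix n b a assume *: "n \<in> carrier N" "b \<in> carrier B" "a \<in> carrier (regular A)"
  have "NA.pure (ract N n b) \<one>\<^bsub>A\<^esub> = ract NA (NA.pure n \<one>\<^bsub>A\<^esub>) b"
    using NA.pure_balanced [of n b "\<one>\<^bsub>A\<^esub>"] * by (simp add: NA.ract_pure B_A)
  then show "NAC.pure (NA.pure (ract N n b) \<one>\<^bsub>A\<^esub>) (ract C x a) = NAC.pure (NA.pure n \<one>\<^bsub>A\<^esub>) (ract C x (lact (regular A) b a))"
    using * by (simp add: NAC.pure_balanced NA.pure_closed B_A xa_closed xba)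
qed (simp_all add: NAC.pure_closed NA.pure_closed xa_closed NA.pure_add_left NAC.pure_add_left NAC.pure_add_right xa_add)

lemma coact_IC_pure: "n \<in> carrier N \<Longrightarrow> a \<in> carrier A \<Longrightarrow> coact IC (NA.pure n a) = NAC.pure (NA.pure n \<one>\<^bsub>A\<^esub>) (ract C x a)"
  unfolding IC_simps by (rule NA.lift_pure [OF NAC.tensor_abelian coact_balanced]) simp_all

lemma coact_IC_addmap: "addmap NA NAC.T (coact IC)"
  unfolding IC_simps by (rule NA.lift_addmap [OF NAC.tensor_abelian coact_balanced])

text \<open>Both halves are proved first for multiples by elements of the image of \<tau> and then
  specialised to \<open>1\<close>. From \<open>n \<otimes> 1\<close> every \<open>n q(xa)\<close> is
  recovered, whence injectivity; and for a coinvariant \<open>t\<close> each \<open>t q(xa)\<close>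
  lies in the image of the unit, whence surjectivity.\<close>

lemma unit_right_iso:
  assumes one: "\<one>\<^bsub>A\<^esub> \<in> tau_image"
  shows "unit_map A C x N \<in> right_iso B N (coinvariants A C x IC)"
proof -
  let ?G = "coinvariants A C x IC"
  have G: "carrier ?G = {t \<in> carrier NA. coact IC t = NAC.pure t x}" "ring.add ?G = ring.add NA" "ract ?G = ract NA"
    by (simp_all add: coinvariants_def bimodule.defs IC_simps pure_IC)
  have u: "unit_map A C x N n = NA.pure n \<one>\<^bsub>A\<^esub>" for n by (simp add: unit_map_def)
  have uG: "NA.pure n \<one>\<^bsub>A\<^esub> \<in> carrier ?G" if "n \<in> carrier N" for n
    using that by (simp add: G NA.pure_closed coact_IC_pure ract_one x_closed)
  have hom: "unit_map A C x N \<in> right_hom B N ?G"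
    unfolding right_hom_iff
    using uG NA.pure_balanced [of _ _ "\<one>\<^bsub>A\<^esub>"] by (auto simp: addmap_def u G(2,3) NA.pure_add_left NA.ract_pure B_A)
  have cp: "contract N \<psi> (NA.pure n a) = ract N n (\<psi> a)"
    if "\<psi> \<in> left_hom B (regular A) (regular B)" "n \<in> carrier N" "a \<in> carrier A" for \<psi> n a
    using contract_pure [OF left_BA N that(1,2), of a] that(3) by simp
  have "inj_on (unit_map A C x N) (carrier N)"
  proof (rule inj_onI)
    fix n n' assume n: "n \<in> carrier N" "n' \<in> carrier N" and "unit_map A C x N n = unit_map A C x N n'"
    then have eq: "NA.pure n \<one>\<^bsub>A\<^esub> = NA.pure n' \<one>\<^bsub>A\<^esub>" by (simp add: u)
    have "ract N n t = ract N n' t" if "t \<in> tau_image" for t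
      using that
    proof (induction rule: tau_image_induct)
      case (pure a q)
      note \<psi> = Q_left_hom [OF pure(2,1)]
      show ?case
        using cp [OF \<psi> n(1), of "\<one>\<^bsub>A\<^esub>"] cp [OF \<psi> n(2), of "\<one>\<^bsub>A\<^esub>"] eq pure by simp
    next
      case (add b b')
      then show ?case
        using N.ract_add_right [of b b' n] N.ract_add_right [of b b' n'] n tau_image_B by simp
    qed
    from this [OF one] show "n = n'" using N.ract_one n by simp
  qed
  moreover have "unit_map A C x N ` carrier N = carrier ?G"
  proof
    show "unit_map A C x N ` carrier N \<subseteq> carrier ?G" using uG by (auto simp: u)
    show "carrier ?G \<subseteq> unit_map A C x N ` carrier N"
    proof
      fix t assume "t \<in> carrier ?G"
      then have t: "t \<in> carrier NA" "coact IC t = NAC.pure t x" by (simp_all add: G)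
      have "ract NA t w \<in> unit_map A C x N ` carrier N" if "w \<in> tau_image" for w
        using that
      proof (induction rule: tau_image_induct)
        case (pure a q)
        note \<psi> = Q_left_hom [OF pure(2,1)]
        \<comment> \<open>The zero of \<open>CC\<close> serves as the tensor that
          \<open>contract_ract\<close> asks for.\<close>
        have f: "(\<lambda>c. q (ract C c a)) \<in> AHom"
          by (rule contract_ract(1) [OF bC rC Q_AHom [OF pure(2)] _ pure(1)]) (rule CC.M.zero_closed)
        note Ea = contract_addmap [OF lC NAm.right_module_axioms f] and Ep = contract_pure [OF lC NAm.right_module_axioms f]
        note ca = contract_addmap [OF left_BA N \<psi>]
        \<comment> \<open>The coaction of \<open>n \<otimes> a'\<close> is
          \<open>(n \<otimes> 1) \<otimes> x a'\<close>; contraction with \<open>q(-a)\<close>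
          leaves \<open>n q(x a' a) \<otimes> 1\<close>, since \<open>q(x a' a)\<close> lies in
          \<open>B\<close>. Computed from the coaction \<open>t \<otimes> x\<close> of a coinvariant
          \<open>t\<close>, the same contraction is \<open>t q(xa)\<close>.\<close>
        have "contract NA (\<lambda>c. q (ract C c a)) (coact IC t) = NA.pure (contract N (\<lambda>a'. q (ract C x (a' \<otimes>\<^bsub>A\<^esub> a))) t) \<one>\<^bsub>A\<^esub>"
          using t(1)
        proof (rule NA.hom_ext [rotated 2])
          show "addmap NA NA (\<lambda>t. contract NA (\<lambda>c. q (ract C c a)) (coact IC t))"
            using Ea coact_IC_addmap by (auto simp: addmap_def)
          show "addmap NA NA (\<lambda>t. NA.pure (contract N (\<lambda>a'. q (ract C x (a' \<otimes>\<^bsub>A\<^esub> a))) t) \<one>\<^bsub>A\<^esub>)"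
            using ca NA.pure_addmap_left [of "\<one>\<^bsub>A\<^esub>"] by (auto simp: addmap_def)
          fix n a' assume n: "n \<in> carrier N" and "a' \<in> carrier (regular A)"
          then have a': "a' \<in> carrier A" by simp
          have qB: "q (ract C x (a' \<otimes>\<^bsub>A\<^esub> a)) \<in> carrier B" using pure a' by (simp add: Q_xa)
          show "contract NA (\<lambda>c. q (ract C c a)) (coact IC (NA.pure n a')) =
              NA.pure (contract N (\<lambda>a'. q (ract C x (a' \<otimes>\<^bsub>A\<^esub> a))) (NA.pure n a')) \<one>\<^bsub>A\<^esub>"
            using NA.pure_balanced [OF n qB, of "\<one>\<^bsub>A\<^esub>"] n a' pure qB
            by (simp add: coact_IC_pure Ep NA.pure_closed xa_closed cp [OF \<psi>] NA.ract_pure ract_assoc [symmetric] x_closed B_A)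
        qed
        moreover have "contract NA (\<lambda>c. q (ract C c a)) (coact IC t) = ract NA t (q (ract C x a))"
          using t Ep x_closed by simp
        ultimately have "ract NA t (q (ract C x a)) = unit_map A C x N (contract N (\<lambda>a'. q (ract C x (a' \<otimes>\<^bsub>A\<^esub> a))) t)"
          by (simp add: u)
        then show ?case using addmap_closed [OF ca t(1)] by (rule image_eqI)
      next
        case (add b b')
        then obtain n n' where n: "n \<in> carrier N" "ract NA t b = unit_map A C x N n"
          "n' \<in> carrier N" "ract NA t b' = unit_map A C x N n'" by blast
        have "ract NA t (b \<oplus>\<^bsub>A\<^esub> b') = unit_map A C x N (n \<oplus>\<^bsub>N\<^esub> n')"
          using n add NAm.ract_add_right [of b b' t] t tau_image_B B_A by (simp add: u NA.pure_add_left)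
        then show ?case by (rule image_eqI) (use n in simp)
      qed
      from this [OF one] show "t \<in> unit_map A C x N ` carrier N" using t NAm.ract_one by simp
    qed
  qed
  ultimately show ?thesis using hom by (simp add: right_iso_def bij_betw_def)
qed

end

section \<open>The counit of the adjunction\<close>

context
  fixes M :: "('l, 'a, 'm, 'c) comodule"
  assumes M: "comodule A C M"
begin

interpretation M: comodule A C M by (rule M)

abbreviation "coinv \<equiv> coinvariants A C x M"
abbreviation "\<rho> \<equiv> coact M"

interpretation MC: tensor_right A A M C by (rule tensor_rightI [OF M.right_module_axioms bC])

lemma coinv_simps: "carrier coinv = {m \<in> carrier M. \<rho> m = MC.pure m x}" "ring.add coinv = ring.add M"
    "ring.zero coinv = ring.zero M" "ract coinv = ract M"
  by (simp_all add: coinvariants_def bimodule.defs)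

lemma coinv_right: "right_module B coinv"
proof -
  have MB: "right_module B M"
    using restrict_scalars_right [OF M.right_module_axioms, of "carrier B"] B_ring B_A by (simp add: B_update subset_iff)
  note r = right_hom_addmap [OF M.coact_hom]
  have "right_module B (M\<lparr>carrier := carrier coinv\<rparr>)"
  proof (rule right_module_subset [OF MB])
    show "carrier coinv \<subseteq> carrier M" by (auto simp: coinv_simps)
    show "\<zero>\<^bsub>M\<^esub> \<in> carrier coinv"
      using addmap_zero [OF M.M.abelian_group_axioms MC.tensor_abelian r] MC.pure_zero_left [OF x_closed] by (simp add: coinv_simps)
    show "m \<oplus>\<^bsub>M\<^esub> n \<in> carrier coinv" if "m \<in> carrier coinv" "n \<in> carrier coinv" for m n
      using that by (simp add: coinv_simps addmap_add [OF r] MC.pure_add_left x_closed)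
    show "\<ominus>\<^bsub>M\<^esub> m \<in> carrier coinv" if "m \<in> carrier coinv" for m
      using that addmap_neg [OF M.M.abelian_group_axioms MC.tensor_abelian r] MC.pure_neg_left [OF x_closed] by (simp add: coinv_simps)
    show "ract M m b \<in> carrier coinv" if m: "m \<in> carrier coinv" and b: "b \<in> carrier B" for m b
    proof -
      \<comment> \<open>\<open>\<rho>(m b) = m \<otimes> x b = m \<otimes> b x = m b \<otimes>
        x\<close>.\<close>
      have bA: "b \<in> carrier A" and bx: "lact C b x = ract C x b" using b by (simp_all add: B_iff)
      have "\<rho> (ract M m b) = MC.pure m (ract C x b)"
        using m bA by (simp add: coinv_simps right_hom_ract [OF M.coact_hom] MC.ract_pure x_closed)
      also have "\<dots> = MC.pure (ract M m b) x"
        using m bA by (simp add: bx [symmetric] MC.pure_balanced coinv_simps x_closed)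
      finally show ?thesis using m bA by (simp add: coinv_simps M.ract_closed)
    qed
  qed
  then show ?thesis by (rule right_module_cong) (simp_all add: coinv_simps)
qed

interpretation V: right_module B coinv by (rule coinv_right)
interpretation VA: tensor_right B A coinv "regular A" by (rule tensor_rightI [OF coinv_right bim_BA])
interpretation VAm: right_module A VA.T by (rule VA.tensor_right_module)
interpretation VAC: tensor_pair A VA.T C by (rule tensor_pairI [OF VAm.right_module_axioms lC])

lemma counit_map_balanced: "balanced B coinv (regular A) M (\<lambda>m a. ract M m a)"
  by (rule balancedI) (simp_all add: coinv_simps M.ract_closed M.ract_add_left M.ract_add_right M.ract_assoc B_A)

lemma counit_map_pure: "m \<in> carrier coinv \<Longrightarrow> a \<in> carrier A \<Longrightarrow> counit_map M (VA.pure m a) = ract M m a"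
  unfolding counit_map_def by (rule VA.lift_pure [OF M.M.abelian_group_axioms counit_map_balanced]) simp_all

lemma counit_map_addmap: "addmap VA.T M (counit_map M)"
  unfolding counit_map_def by (rule VA.lift_addmap [OF M.M.abelian_group_axioms counit_map_balanced])

lemma counit_map_right_hom: "counit_map M \<in> right_hom A VA.T M"
  unfolding right_hom_iff
proof (intro conjI counit_map_addmap ballI)
  show "counit_map M (ract VA.T t a) = ract M (counit_map M t) a" if a: "a \<in> carrier A" and t: "t \<in> carrier VA.T" for t a
    using t
  proof (rule VA.hom_ext [rotated 2])
    show "addmap VA.T M (\<lambda>t. counit_map M (ract VA.T t a))" "addmap VA.T M (\<lambda>t. ract M (counit_map M t) a)"
      using counit_map_addmap VA.ract_addmap [OF a] M.ract_addmap [OF a] by (auto simp: addmap_def)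
  qed (use a in \<open>simp add: VA.ract_pure counit_map_pure M.ract_assoc coinv_simps\<close>)
qed

lemma counit_map_comodule_hom: "counit_map M \<in> comodule_hom A C (induced_comodule A C x coinv) M"
proof -
  let ?I = "induced_comodule A C x coinv"
  note I = IC_simps [OF coinv_right]
  note tp = tensor_map_pure [OF VAC.tensor_pair_axioms MC.tensor_pair_axioms counit_map_right_hom id_left_hom]
    and ta = tensor_map_addmap [OF VAC.tensor_pair_axioms MC.tensor_pair_axioms counit_map_right_hom id_left_hom]
  have "\<rho> (counit_map M t) = tensor_map A M C (counit_map M) (\<lambda>c. c) (coact ?I t)" if t: "t \<in> carrier VA.T" for t
    using t
  proof (rule VA.hom_ext [rotated 2])
    show "addmap VA.T MC.T (\<lambda>t. \<rho> (counit_map M t))"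
      using counit_map_addmap right_hom_addmap [OF M.coact_hom] by (auto simp: addmap_def)
    show "addmap VA.T MC.T (\<lambda>t. tensor_map A M C (counit_map M) (\<lambda>c. c) (coact ?I t))"
      using ta coact_IC_addmap [OF coinv_right] by (auto simp: addmap_def)
    fix m a assume m: "m \<in> carrier coinv" and "a \<in> carrier (regular A)"
    then have a: "a \<in> carrier A" by simp
    have mM: "m \<in> carrier M" "\<rho> m = MC.pure m x" using m by (simp_all add: coinv_simps)
    have "\<rho> (counit_map M (VA.pure m a)) = MC.pure m (ract C x a)"
      using m a mM by (simp add: counit_map_pure right_hom_ract [OF M.coact_hom] MC.ract_pure x_closed)
    also have "\<dots> = tensor_map A M C (counit_map M) (\<lambda>c. c) (coact ?I (VA.pure m a))"
      using m a mM by (simp add: coact_IC_pure [OF coinv_right] tp VA.pure_closed xa_closed counit_map_pure M.ract_one)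
    finally show "\<rho> (counit_map M (VA.pure m a)) = tensor_map A M C (counit_map M) (\<lambda>c. c) (coact ?I (VA.pure m a))" .
  qed
  moreover have "counit_map M \<in> right_hom A ?I M"
    using counit_map_right_hom by (simp add: right_hom_iff addmap_def I)
  ultimately show ?thesis by (simp add: comodule_hom_def I)
qed

lemma counit_comodule_iso:
  assumes g: "gal_basis (I :: 'i set) r s"
  shows "counit_map M \<in> comodule_iso A C (induced_comodule A C x coinv) M"
proof -
  note G = gal_basisD [OF g] and I = IC_simps [OF coinv_right] and lm = M.right_module_axioms
  have rA: "r i \<in> AHom" if "i \<in> I" for i using Q_AHom [OF G(2) [OF that]] .
  note \<rho>c = right_hom_closed [OF M.coact_hom]
  note ca = contract_addmap [OF lC lm] and cp = contract_pure [OF lC lm]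
  have cc: "contract M f (\<rho> m) \<in> carrier M" if "f \<in> AHom" "m \<in> carrier M" for f m
    by (rule addmap_closed [OF ca [OF that(1)] \<rho>c [OF that(2)]])
  \<comment> \<open>For \<open>r\<close> in \<open>Q\<close> coassociativity gives
    \<open>\<rho>(m\<^sub>0 r(m\<^sub>1)) = m\<^sub>0 \<otimes> m\<^sub>1 r(m\<^sub>2) = m\<^sub>0
    \<otimes> r(m\<^sub>1) x\<close>, and the coefficient moves to the left. So the proposed inverse
    takes values in the coinvariants tensored with \<open>A\<close>.\<close>
  have coin: "contract M (r i) (\<rho> m) \<in> carrier coinv" if i: "i \<in> I" and m: "m \<in> carrier M" for i m
  proof -
    note q = G(2) [OF i]
    note h = act_left_hom [OF rA [OF i]]
    note tp = tensor_map_pure [OF MC.tensor_pair_axioms MC.tensor_pair_axioms id_right_hom h]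
      and ta = tensor_map_addmap [OF MC.tensor_pair_axioms MC.tensor_pair_axioms id_right_hom h]
    have "tensor_map A M C (\<lambda>n. n) (\<lambda>c. act c (r i)) y = MC.pure (contract M (r i) y) x" if y: "y \<in> carrier MC.T" for y
      using y
    proof (rule MC.hom_ext [OF ta, rotated])
      show "addmap MC.T MC.T (\<lambda>y. MC.pure (contract M (r i) y) x)"
        using ca [OF rA [OF i]] MC.pure_addmap_left [OF x_closed] by (auto simp: addmap_def)
    qed (simp add: tp cp rA i Q_act q MC.pure_balanced AHom_closed x_closed)
    from this [OF \<rho>c [OF m]] coact_contract [OF lm M.coact_hom M.coact_coassoc [OF m] rA [OF i] m]
    show ?thesis using cc [OF rA [OF i] m] by (simp add: coinv_simps)
  qed
  let ?h = "\<lambda>m. \<Oplus>\<^bsub>VA.T\<^esub>i\<in>I. VA.pure (contract M (r i) (\<rho> m)) (s i)"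
  have pc: "VA.pure (contract M (r i) (\<rho> m)) (s i) \<in> carrier VA.T" if "i \<in> I" "m \<in> carrier M" for i m
    by (rule VA.pure_closed [OF coin [OF that]]) (use G that in simp)
  have hc: "?h m \<in> carrier VA.T" if "m \<in> carrier M" for m using pc that by (auto intro!: VA.T.finsum_closed)
  have "bij_betw (counit_map M) (carrier VA.T) (carrier M)"
  proof (rule bij_betw_byWitness [where f' = ?h])
    show "counit_map M ` carrier VA.T \<subseteq> carrier M" "?h ` carrier M \<subseteq> carrier VA.T"
      using addmap_closed [OF counit_map_addmap] hc by auto
    show "\<forall>m\<in>carrier M. counit_map M (?h m) = m"
    proof
      fix m assume m: "m \<in> carrier M"
      \<comment> \<open>Before the coaction is inserted: on \<open>n \<otimes> c\<close> the sum is
        \<open>n \<Sum> r\<^sub>i(c) s\<^sub>i = n \<epsilon>(c)\<close>, so the counit law of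
        \<open>M\<close> finishes the computation.\<close>
      have sum: "(\<Oplus>\<^bsub>M\<^esub>i\<in>I. ract M (contract M (r i) y) (s i)) = contract M (counit C) y" if y: "y \<in> carrier MC.T" for y
        using y
      proof (rule MC.hom_ext [rotated 2])
        show "addmap MC.T M (\<lambda>y. \<Oplus>\<^bsub>M\<^esub>i\<in>I. ract M (contract M (r i) y) (s i))"
          by (rule addmap_sum [OF M.M.abelian_group_axioms])
            (rule addmap_comp [OF ca [OF rA] M.ract_addmap [OF G(3)]])
        show "addmap MC.T M (contract M (counit C))" by (rule ca [OF counit_left_hom])
        fix n c assume n: "n \<in> carrier M" and c: "c \<in> carrier C"
        have "(\<Oplus>\<^bsub>M\<^esub>i\<in>I. ract M (contract M (r i) (MC.pure n c)) (s i)) = (\<Oplus>\<^bsub>M\<^esub>i\<in>I. ract M n (r i c \<otimes>\<^bsub>A\<^esub> s i))"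
          by (rule M.M.finsum_cong') (use n c G rA in \<open>auto simp: cp M.ract_assoc M.ract_closed\<close>)
        also have "\<dots> = ract M n (\<Oplus>\<^bsub>A\<^esub>i\<in>I. r i c \<otimes>\<^bsub>A\<^esub> s i)"
          by (rule M.sum_ract [OF n, symmetric]) (use G c in auto)
        finally show "(\<Oplus>\<^bsub>M\<^esub>i\<in>I. ract M (contract M (r i) (MC.pure n c)) (s i)) = contract M (counit C) (MC.pure n c)"
          using n c by (simp add: G(4) cp [OF counit_left_hom])
      qed
      have "counit_map M (?h m) = (\<Oplus>\<^bsub>M\<^esub>i\<in>I. counit_map M (VA.pure (contract M (r i) (\<rho> m)) (s i)))"
        by (rule addmap_finsum [OF VA.tensor_abelian M.M.abelian_group_axioms counit_map_addmap]) (use pc m in auto)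
      also have "\<dots> = (\<Oplus>\<^bsub>M\<^esub>i\<in>I. ract M (contract M (r i) (\<rho> m)) (s i))"
        by (rule M.M.finsum_cong') (use G m coin cc rA in \<open>auto simp: counit_map_pure M.ract_closed\<close>)
      also have "\<dots> = m"
        unfolding sum [OF \<rho>c [OF m]] using M.coact_counit [OF m] by (simp add: contract_def)
      finally show "counit_map M (?h m) = m" .
    qed
    have ha: "addmap M VA.T ?h"
    proof (rule addmap_sum [OF VA.tensor_abelian])
      fix i assume i: "i \<in> I"
      show "addmap M VA.T (\<lambda>m. VA.pure (contract M (r i) (\<rho> m)) (s i))"
      proof (rule addmapI [OF pc [OF i]])
        fix m n assume mn: "m \<in> carrier M" "n \<in> carrier M"
        show "VA.pure (contract M (r i) (\<rho> (m \<oplus>\<^bsub>M\<^esub> n))) (s i) =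
            VA.pure (contract M (r i) (\<rho> m)) (s i) \<oplus>\<^bsub>VA.T\<^esub> VA.pure (contract M (r i) (\<rho> n)) (s i)"
          using VA.pure_add_left [OF coin [OF i mn(1)] coin [OF i mn(2)], of "s i"] mn G(3) [OF i] \<rho>c
          by (simp add: addmap_add [OF right_hom_addmap [OF M.coact_hom]] addmap_add [OF ca [OF rA [OF i]]] coinv_simps)
      qed
    qed
    show "\<forall>t\<in>carrier VA.T. ?h (counit_map M t) = t"
    proof
      fix t assume "t \<in> carrier VA.T"
      then show "?h (counit_map M t) = t"
      proof (rule VA.hom_ext [rotated 2])
        show "addmap VA.T VA.T (\<lambda>t. ?h (counit_map M t))"
          using addmap_closed [OF counit_map_addmap] addmap_add [OF counit_map_addmap] addmap_closed [OF ha] addmap_add [OF ha]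
          by (intro addmapI) simp_all
        show "addmap VA.T VA.T (\<lambda>t. t)" by (simp add: addmap_def)
        fix m a assume m: "m \<in> carrier coinv" and "a \<in> carrier (regular A)"
        then have a: "a \<in> carrier A" by simp
        have mM: "m \<in> carrier M" "\<rho> m = MC.pure m x" using m by (simp_all add: coinv_simps)
        have \<rho>ma: "\<rho> (ract M m a) = MC.pure m (ract C x a)"
          using a mM by (simp add: right_hom_ract [OF M.coact_hom] MC.ract_pure x_closed)
        \<comment> \<open>Contracting \<open>\<rho>(m a) = m \<otimes> x a\<close> produces the
          coefficients \<open>r\<^sub>i(x a)\<close>. They lie in \<open>B\<close>, so they cross
          the tensor sign and sum with the \<open>s\<^sub>i\<close> to \<open>a\<close>.\<close>
        have rB: "r i (ract C x a) \<in> carrier B" if "i \<in> I" for i using Q_xa [OF G(2) [OF that] a] .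
        have "?h (counit_map M (VA.pure m a)) = (\<Oplus>\<^bsub>VA.T\<^esub>i\<in>I. VA.pure m (r i (ract C x a) \<otimes>\<^bsub>A\<^esub> s i))"
        proof (rule VA.T.finsum_cong' [OF refl])
          show "(\<lambda>i. VA.pure m (r i (ract C x a) \<otimes>\<^bsub>A\<^esub> s i)) \<in> I \<rightarrow> carrier VA.T"
            using m G rB B_A by (auto intro!: VA.pure_closed)
          fix i assume i: "i \<in> I"
          show "VA.pure (contract M (r i) (\<rho> (counit_map M (VA.pure m a)))) (s i) = VA.pure m (r i (ract C x a) \<otimes>\<^bsub>A\<^esub> s i)"
            using VA.pure_balanced [OF m rB [OF i], of "s i"] G(3) [OF i] mM a
            by (simp add: counit_map_pure [OF m] \<rho>ma cp [OF rA [OF i]] xa_closed coinv_simps)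
        qed
        also have "\<dots> = VA.pure m (\<Oplus>\<^bsub>regular A\<^esub>i\<in>I. r i (ract C x a) \<otimes>\<^bsub>A\<^esub> s i)"
          by (rule VA.pure_sum_right [symmetric]) (use m G rB B_A in auto)
        finally show "?h (counit_map M (VA.pure m a)) = VA.pure m a"
          using G(4) [of "ract C x a"] a by (simp add: finsum_regular xa_closed counit_xa)
      qed
    qed
  qed
  then show ?thesis using counit_map_comodule_hom by (simp add: comodule_iso_def I)
qed

end

lemma gal_adjoint_equivalence:
  assumes "gal_basis (I :: 'i set) r s" "\<one>\<^bsub>A\<^esub> \<in> tau_image"
  shows "adjoint_equivalence TYPE('u) A C x"
  unfolding adjoint_equivalence_def
  using unit_right_iso [OF _ assms(2)] counit_comodule_iso [OF _ assms(1)] by blast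

end

section \<open>From the equivalence to the Morita context\<close>

context grouplike_coring
begin

text \<open>Let \<open>V = B/I\<close> with \<open>I\<close> the image of \<tau>. In
  \<open>V \<otimes> A\<close> one has \<open>1 \<otimes> 1 = 1 \<otimes> \<Sum> r\<^sub>i(x)
  s\<^sub>i = \<Sum> r\<^sub>i(x) \<otimes> s\<^sub>i = 0\<close>, as
  \<open>\<epsilon>(x) = 1\<close> and \<open>r\<^sub>i(x)\<close> lies in \<open>I\<close>.
  Injectivity of the unit gives \<open>1 = 0\<close> in \<open>V\<close>.\<close>

lemma adjoint_equivalence_tau:
  assumes eq: "adjoint_equivalence TYPE('u) A C x" and g: "gal_basis (I :: 'i set) r s"
    and uA: "carrier A \<lesssim> (UNIV :: 'u set)"
  shows "\<one>\<^bsub>A\<^esub> \<in> tau_image"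
proof -
  note G = gal_basisD [OF g]
  let ?B = "regular B"
  have B: "right_module B ?B" by (rule regular_right_module [OF B_ring])
  interpret rB: right_module B ?B by (rule B)
  have "carrier ?B \<subseteq> carrier A" using B_A by auto
  then have uB: "carrier ?B \<lesssim> (UNIV :: 'u set)" by (rule lepoll_trans [OF subset_imp_lepoll uA])
  have neg: "\<ominus>\<^bsub>?B\<^esub> b = \<ominus>\<^bsub>A\<^esub> b" if "b \<in> carrier B" for b
    using rB.M.minus_equality [of "\<ominus>\<^bsub>A\<^esub> b" b] subringE(5) [OF B_subring that] that by (simp add: L.l_neg B_A)
  obtain e :: "'a \<Rightarrow> 'u" where e: "\<And>a b. a \<in> carrier ?B \<Longrightarrow> b \<in> carrier ?B \<Longrightarrow> e a = e b \<longleftrightarrow> a \<ominus>\<^bsub>?B\<^esub> b \<in> tau_image"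
    and ic: "image_congruence ?B e"
    by (rule quotient_map_exists [of ?B tau_image, OF rB.M.abelian_group_axioms _ _ _ _ uB])
      (use neg tau_image_B tau_image_zero tau_image_add tau_image_neg in auto)
  have e0: "e a = e b \<longleftrightarrow> a \<ominus>\<^bsub>A\<^esub> b \<in> tau_image" if "a \<in> carrier B" "b \<in> carrier B" for a b
    using e [of a b] that by (simp add: a_minus_def neg)
  have cong: "e (ract ?B a b) = e (ract ?B a' b)"
    if b: "b \<in> carrier B" and "a \<in> carrier ?B" "a' \<in> carrier ?B" and ee: "e a = e a'" for a a' b
  proof -
    have a: "a \<in> carrier B" "a' \<in> carrier B" using that by simp_all
    have "(a \<ominus>\<^bsub>A\<^esub> a') \<otimes>\<^bsub>A\<^esub> b \<in> tau_image" using tau_image_mult_right [OF _ b] ee e0 [OF a] by blast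
    moreover have "(a \<ominus>\<^bsub>A\<^esub> a') \<otimes>\<^bsub>A\<^esub> b = a \<otimes>\<^bsub>A\<^esub> b \<ominus>\<^bsub>A\<^esub> a' \<otimes>\<^bsub>A\<^esub> b"
      using a b by (simp add: a_minus_def L.l_distr L.l_minus B_A)
    ultimately show ?thesis
      using e0 [of "a \<otimes>\<^bsub>A\<^esub> b" "a' \<otimes>\<^bsub>A\<^esub> b"] a b B.m_closed by simp
  qed
  define V :: "(unit, 'a, 'u) bimodule" where "V = image_struct e undefined (ract ?B) ?B"
  have V: "right_module B V" unfolding V_def by (rule image_right_module(1) [OF B ic cong])
  have eV: "e \<in> right_hom B ?B V" unfolding V_def by (rule image_right_module(2) [OF B ic cong])
  have zV: "\<zero>\<^bsub>V\<^esub> = e \<zero>\<^bsub>A\<^esub>" by (simp add: V_def image_struct_simps)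
  interpret V: right_module B V by (rule V)
  interpret VA: tensor_pair B V "regular A" by (rule tensor_pairI [OF V left_BA])
  have ec: "e b \<in> carrier V" if "b \<in> carrier B" for b using right_hom_closed [OF eV, of b] that by simp
  have "unit_map A C x V \<in> right_iso B V (coinvariants A C x (induced_comodule A C x V))"
    using eq V unfolding adjoint_equivalence_def by blast
  then have inj: "inj_on (unit_map A C x V) (carrier V)" by (simp add: right_iso_def bij_betw_def)
  have rt: "r i x \<in> tau_image" if "i \<in> I" for i
    using tau_image_pure [OF L.one_closed G(2) [OF that]] by (simp add: ract_one x_closed)
  have "VA.pure (e \<one>\<^bsub>A\<^esub>) \<one>\<^bsub>A\<^esub> = VA.pure (e \<one>\<^bsub>A\<^esub>) (\<Oplus>\<^bsub>regular A\<^esub>i\<in>I. r i x \<otimes>\<^bsub>A\<^esub> s i)"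
    using G(4) [OF x_closed] by (simp add: finsum_regular counit_x)
  also have "\<dots> = (\<Oplus>\<^bsub>VA.T\<^esub>i\<in>I. VA.pure (e \<one>\<^bsub>A\<^esub>) (r i x \<otimes>\<^bsub>A\<^esub> s i))"
    by (rule VA.pure_sum_right) (use ec B.one_closed G x_closed in auto)
  also have "\<dots> = (\<Oplus>\<^bsub>VA.T\<^esub>i\<in>I. \<zero>\<^bsub>VA.T\<^esub>)"
  proof (rule VA.T.finsum_cong' [OF refl])
    fix i assume i: "i \<in> I"
    have rB: "r i x \<in> carrier B" by (rule tau_image_B [OF rt [OF i]])
    have "ract V (e \<one>\<^bsub>A\<^esub>) (r i x) = e (r i x)"
      using right_hom_ract [OF eV rB, of "\<one>\<^bsub>A\<^esub>"] B.one_closed rB B_A by simp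
    also have "\<dots> = \<zero>\<^bsub>V\<^esub>"
      using e0 [OF rB, of "\<zero>\<^bsub>A\<^esub>"] B.zero_closed rt [OF i] rB B_A by (simp add: zV a_minus_def L.neg_zero)
    finally show "VA.pure (e \<one>\<^bsub>A\<^esub>) (r i x \<otimes>\<^bsub>A\<^esub> s i) = \<zero>\<^bsub>VA.T\<^esub>"
      using VA.pure_balanced [of "e \<one>\<^bsub>A\<^esub>" "r i x" "s i"] VA.pure_zero_left [of "s i"] ec B.one_closed rB G(3) [OF i] by simp
  qed auto
  also have "\<dots> = VA.pure \<zero>\<^bsub>V\<^esub> \<one>\<^bsub>A\<^esub>" using VA.pure_zero_left [of "\<one>\<^bsub>A\<^esub>"] by simp
  finally have "unit_map A C x V (e \<one>\<^bsub>A\<^esub>) = unit_map A C x V \<zero>\<^bsub>V\<^esub>" by (simp add: unit_map_def)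
  then have "e \<one>\<^bsub>A\<^esub> = e \<zero>\<^bsub>A\<^esub>"
    using inj_onD [OF inj] ec [of "\<one>\<^bsub>A\<^esub>"] B.one_closed V.M.zero_closed by (simp add: zV)
  then show ?thesis
    using e0 [of "\<one>\<^bsub>A\<^esub>" "\<zero>\<^bsub>A\<^esub>"] B.one_closed B.zero_closed by (simp add: a_minus_def L.neg_zero)
qed

text \<open>The comodule that corresponds to the regular right \<open>\<^sup>*C\<close>-module, on a copy \<open>V\<close> of \<open>\<^sup>*C\<close>.\<close>

definition dual_comodule :: "'j set \<Rightarrow> ('j \<Rightarrow> 'c \<Rightarrow> 'a) \<Rightarrow> ('j \<Rightarrow> 'c) \<Rightarrow> ('l, 'a, 'v) bimodule
    \<Rightarrow> (('c \<Rightarrow> 'a) \<Rightarrow> 'v) \<Rightarrow> ('v \<Rightarrow> 'c \<Rightarrow> 'a) \<Rightarrow> ('l, 'a, 'v, 'c) comodule"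
  where "dual_comodule J \<gamma> d V e v = bimodule.extend V
    \<lparr>coact = \<lambda>u. \<Oplus>\<^bsub>tensor A V C\<^esub>j\<in>J. pure_tensor A V C (e (v u \<otimes>\<^bsub>D\<^esub> restrict (\<gamma> j) (carrier C))) (d j)\<rparr>"

section \<open>A comodule structure on the left dual ring\<close>

context
  fixes J :: "'j set" and \<gamma> d and V :: "('l, 'a, 'v) bimodule" and e v
  assumes db: "dual_basis A C J \<gamma> d" and V: "right_module A V"
    and e: "e \<in> right_hom A Dm V" and v: "\<And>u. u \<in> carrier V \<Longrightarrow> v u \<in> carrier D" "\<And>u. u \<in> carrier V \<Longrightarrow> e (v u) = u"
    and ve: "\<And>f. f \<in> carrier D \<Longrightarrow> v (e f) = f"
begin

abbreviation "DC \<equiv> dual_comodule J \<gamma> d V e v"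

lemma DC_simps: "carrier DC = carrier V" "ring.add DC = ring.add V" "ring.zero DC = ring.zero V"
    "ract DC = ract V" "lact DC = lact V"
  by (simp_all add: dual_comodule_def bimodule.defs)

lemma DC_coact: "coact DC u = (\<Oplus>\<^bsub>tensor A DC C\<^esub>j\<in>J. pure_tensor A DC C (e (v u \<otimes>\<^bsub>D\<^esub> restrict (\<gamma> j) (carrier C))) (d j))"
  unfolding tensor_cong [OF DC_simps(1,2,4,5)] pure_tensor_cong [OF DC_simps(1,2,4)]
  by (simp add: dual_comodule_def bimodule.defs)

lemma DC_right: "right_module A DC"
  by (rule right_module_cong [OF V]) (simp_all add: DC_simps)

interpretation DC: right_module A DC by (rule DC_right)
interpretation X: tensor_right A A DC C by (rule tensor_rightI [OF DC_right bC])
interpretation Xm: right_module A X.T by (rule X.tensor_right_module)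
interpretation Y: tensor_pair A DC CC by (rule tensor_pairI [OF DC_right CC.left_module_axioms])
interpretation Dm: right_module A Dm by (rule Dm_right)

lemma e_right_hom: "e \<in> right_hom A Dm DC"
  using e by (simp add: right_hom_iff addmap_def DC_simps)

lemma
  shows e_closed: "f \<in> carrier D \<Longrightarrow> e f \<in> carrier DC"
    and e_add: "f \<in> carrier D \<Longrightarrow> h \<in> carrier D \<Longrightarrow> e (f \<oplus>\<^bsub>D\<^esub> h) = e f \<oplus>\<^bsub>DC\<^esub> e h"
    and e_ract: "f \<in> carrier D \<Longrightarrow> a \<in> carrier A \<Longrightarrow> ract DC (e f) a = e (f \<otimes>\<^bsub>D\<^esub> dual_incl A C a)"
    and DC_cases: "u \<in> carrier DC \<Longrightarrow> \<exists>f\<in>carrier D. u = e f"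
proof -
  show "u \<in> carrier DC \<Longrightarrow> \<exists>f\<in>carrier D. u = e f"
    using v [of u] by (intro bexI [of _ "v u"]) (simp_all add: DC_simps)
qed (use right_hom_closed [OF e_right_hom] addmap_add [OF right_hom_addmap [OF e_right_hom]] right_hom_ract [OF e_right_hom] in simp_all)

lemma e_eq_iff: "f \<in> carrier D \<Longrightarrow> h \<in> carrier D \<Longrightarrow> e f = e h \<longleftrightarrow> f = h"
  using ve by metis

lemma e_addmap: "addmap D DC e"
  by (simp add: addmap_def e_closed e_add)

lemmas C_basis = dual_basisD [OF db]

definition "gg j = restrict (\<gamma> j) (carrier C)"

lemma gg: "j \<in> J \<Longrightarrow> gg j \<in> carrier D"
  unfolding gg_def by (rule D_restrictI [OF C_basis(3)])

lemma DC_coact_e: "f \<in> carrier D \<Longrightarrow> coact DC (e f) = (\<Oplus>\<^bsub>X.T\<^esub>j\<in>J. X.pure (e (f \<otimes>\<^bsub>D\<^esub> gg j)) (d j))"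
  by (simp add: DC_coact ve gg_def)

lemma coact_term: "f \<in> carrier D \<Longrightarrow> j \<in> J \<Longrightarrow> X.pure (e (f \<otimes>\<^bsub>D\<^esub> gg j)) (d j) \<in> carrier X.T"
  by (intro X.pure_closed e_closed D_mult_closed gg C_basis(2))

lemma DC_coact_closed: "u \<in> carrier DC \<Longrightarrow> coact DC u \<in> carrier X.T"
  using DC_cases [of u] coact_term by (auto simp: DC_coact_e intro!: X.T.finsum_closed)

text \<open>A dual basis of the left module \<open>C\<close> dualises: the \<open>gg j\<close>
  together with evaluation at the \<open>d j\<close> form one of the left dual as a right
  \<open>A\<close>-module.\<close>

lemma gg_expand:
  assumes h: "h \<in> carrier D"
  shows "(\<Oplus>\<^bsub>D\<^esub>j\<in>J. gg j \<otimes>\<^bsub>D\<^esub> dual_incl A C (h (d j))) = h"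
proof (rule D_eqI [OF _ h])
  have hd: "h (d j) \<in> carrier A" if "j \<in> J" for j using AHom_closed [OF D_AHom [OF h] C_basis(2) [OF that]] .
  show "(\<Oplus>\<^bsub>D\<^esub>j\<in>J. gg j \<otimes>\<^bsub>D\<^esub> dual_incl A C (h (d j))) \<in> carrier D"
    using gg hd by (auto intro!: D.finsum_closed D_mult_closed dual_incl_closed)
  fix c assume c: "c \<in> carrier C"
  have "(\<Oplus>\<^bsub>D\<^esub>j\<in>J. gg j \<otimes>\<^bsub>D\<^esub> dual_incl A C (h (d j))) c = (\<Oplus>\<^bsub>A\<^esub>j\<in>J. gg j c \<otimes>\<^bsub>A\<^esub> h (d j))"
    by (rule mu_sum_apply) (use gg hd c in auto)
  also have "\<dots> = h c"
    using dual_basis_apply [OF db D_AHom [OF h] c] c by (simp add: gg_def)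
  finally show "(\<Oplus>\<^bsub>D\<^esub>j\<in>J. gg j \<otimes>\<^bsub>D\<^esub> dual_incl A C (h (d j))) c = h c" .
qed

text \<open>This is the property for which the coaction is designed: the action of the left dual
  recovered from it is right multiplication. It follows by expanding \<open>h\<close> in the dual
  basis.\<close>

lemma contract_coact:
  assumes f: "f \<in> carrier D" and h: "h \<in> carrier D"
  shows "contract DC h (coact DC (e f)) = e (f \<otimes>\<^bsub>D\<^esub> h)"
proof -
  note hA = D_AHom [OF h]
  have hd: "h (d j) \<in> carrier A" if "j \<in> J" for j using AHom_closed [OF hA C_basis(2) [OF that]] .
  note ca = contract_addmap [OF lC DC_right hA] and cp = contract_pure [OF lC DC_right hA]
  have "contract DC h (coact DC (e f)) = (\<Oplus>\<^bsub>DC\<^esub>j\<in>J. contract DC h (X.pure (e (f \<otimes>\<^bsub>D\<^esub> gg j)) (d j)))"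
    unfolding DC_coact_e [OF f]
    by (rule addmap_finsum [OF X.tensor_abelian DC.M.abelian_group_axioms ca]) (use f coact_term in auto)
  also have "\<dots> = (\<Oplus>\<^bsub>DC\<^esub>j\<in>J. e (f \<otimes>\<^bsub>D\<^esub> (gg j \<otimes>\<^bsub>D\<^esub> dual_incl A C (h (d j)))))"
    by (rule DC.M.finsum_cong')
      (use f gg hd C_basis(2) in \<open>auto simp: cp e_closed D_mult_closed e_ract dual_incl_closed D.m_assoc\<close>)
  also have "\<dots> = e (\<Oplus>\<^bsub>D\<^esub>j\<in>J. f \<otimes>\<^bsub>D\<^esub> (gg j \<otimes>\<^bsub>D\<^esub> dual_incl A C (h (d j))))"
    by (rule addmap_finsum [OF D_abelian DC.M.abelian_group_axioms e_addmap, symmetric])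
      (use f gg hd in \<open>auto intro!: D_mult_closed dual_incl_closed\<close>)
  also have "(\<Oplus>\<^bsub>D\<^esub>j\<in>J. f \<otimes>\<^bsub>D\<^esub> (gg j \<otimes>\<^bsub>D\<^esub> dual_incl A C (h (d j)))) = f \<otimes>\<^bsub>D\<^esub> h"
    using D.finsum_rdistr [OF C_basis(1) f, of "\<lambda>j. gg j \<otimes>\<^bsub>D\<^esub> dual_incl A C (h (d j))"] gg hd
    by (simp add: gg_expand [OF h] Pi_iff dual_incl_closed D_mult_closed)
  finally show ?thesis .
qed

text \<open>By \<open>contract_expand\<close> a tensor is rebuilt from its contractions with the
  dual basis. Combined with \<open>contract_coact\<close>, this turns statements about the coaction
  into identities in the ring \<open>D\<close>.\<close>

lemma contract_separates:
  assumes y: "y \<in> carrier X.T" "y' \<in> carrier X.T"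
    and eq: "\<And>h. h \<in> carrier D \<Longrightarrow> contract DC h y = contract DC h y'"
  shows "y = y'"
proof -
  have "contract DC (\<gamma> j) z = contract DC (gg j) z" if "j \<in> J" "z \<in> carrier X.T" for j z
    by (rule contract_cong [OF lC DC_right C_basis(3) [OF that(1)] D_AHom [OF gg [OF that(1)]] _ that(2)]) (simp add: gg_def)
  then have "contract DC (\<gamma> j) y = contract DC (\<gamma> j) y'" if "j \<in> J" for j
    using eq [OF gg [OF that]] y that by simp
  then have "(\<Oplus>\<^bsub>X.T\<^esub>j\<in>J. X.pure (contract DC (\<gamma> j) y) (d j)) = (\<Oplus>\<^bsub>X.T\<^esub>j\<in>J. X.pure (contract DC (\<gamma> j) y') (d j))"
    by (intro X.T.finsum_cong')
      (use y C_basis addmap_closed [OF contract_addmap [OF lC DC_right C_basis(3)]] in \<open>auto intro!: X.pure_closed\<close>)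
  then show ?thesis
    using contract_expand [OF lC db DC_right y(1)] contract_expand [OF lC db DC_right y(2)] by simp
qed

text \<open>Tested by functionals \<open>k\<close>, additivity is distributivity of the product in
  \<open>D\<close>, and linearity is \<open>(f # i(a)) # k = f # (i(a) # k)\<close>.\<close>

lemma DC_coact_right_hom: "coact DC \<in> right_hom A DC X.T"
  unfolding right_hom_iff
proof (intro conjI addmapI ballI)
  note cl = DC_coact_closed
  show "coact DC u \<in> carrier X.T" if "u \<in> carrier DC" for u by (rule cl [OF that])
  show "coact DC (u \<oplus>\<^bsub>DC\<^esub> w) = coact DC u \<oplus>\<^bsub>X.T\<^esub> coact DC w" if "u \<in> carrier DC" "w \<in> carrier DC" for u w
  proof -
    obtain f where f: "f \<in> carrier D" "u = e f" using DC_cases [OF \<open>u \<in> carrier DC\<close>] by blast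
    obtain h where h: "h \<in> carrier D" "w = e h" using DC_cases [OF \<open>w \<in> carrier DC\<close>] by blast
    show ?thesis
    proof (rule contract_separates)
      fix k assume k: "k \<in> carrier D"
      note ca = contract_addmap [OF lC DC_right D_AHom [OF k]]
      show "contract DC k (coact DC (u \<oplus>\<^bsub>DC\<^esub> w)) = contract DC k (coact DC u \<oplus>\<^bsub>X.T\<^esub> coact DC w)"
        using f h k cl that
        by (simp add: addmap_add [OF ca] contract_coact D_add_closed D_mult_closed D.l_distr flip: e_add)
    qed (use cl that in simp_all)
  qed
  show "coact DC (ract DC u a) = ract X.T (coact DC u) a" if a: "a \<in> carrier A" and u: "u \<in> carrier DC" for u a
  proof -
    obtain f where f: "f \<in> carrier D" "u = e f" using DC_cases u by meson
    show ?thesis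
    proof (rule contract_separates)
      fix k assume k: "k \<in> carrier D"
      note kA = D_AHom [OF k] and i = dual_incl_closed [OF a]
      note cr = contract_ract [OF bC DC_right kA cl [OF u] a]
      have "contract DC k (ract X.T (coact DC u) a) = contract DC (dual_incl A C a \<otimes>\<^bsub>D\<^esub> k) (coact DC u)"
        unfolding cr(2)
        by (rule contract_cong [OF lC DC_right cr(1) D_AHom [OF D_mult_closed [OF i k]] _ cl [OF u]])
          (simp add: D_mult act_dual_incl a)
      then show "contract DC k (coact DC (ract DC u a)) = contract DC k (ract X.T (coact DC u) a)"
        using f k i a by (simp add: e_ract contract_coact D_mult_closed D.m_assoc)
    qed (use cl u a in \<open>simp_all add: DC.ract_closed Xm.ract_closed\<close>)
  qed
qed

text \<open>The last factor is contracted with \<open>gg j\<close> and then \<open>d j\<close> is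
  put back in its place; summed over \<open>j\<close> this is the identity, so the contractions of
  the last factor determine a threefold tensor.\<close>

lemma contract_CC_separates:
  assumes y: "y \<in> carrier Y.T" "y' \<in> carrier Y.T"
    and eq: "\<And>h. h \<in> carrier D \<Longrightarrow> tensor_map A DC C (\<lambda>n. n) (contract C h) y = tensor_map A DC C (\<lambda>n. n) (contract C h) y'"
  shows "y = y'"
proof -
  let ?b = "\<lambda>j. tensor_map A DC CC (\<lambda>n. n) (\<lambda>c. pure_tensor A C C c (d j))"
  let ?p = "\<lambda>j. tensor_map A DC C (\<lambda>n. n) (contract C (gg j))"
  have bh: "(\<lambda>c. pure_tensor A C C c (d j)) \<in> left_hom A C CC" if "j \<in> J" for j
    using that C_basis(2) by (simp add: left_hom_iff CCr.pure_addmap_left CCl.lact_pure)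
  have ph: "contract C (gg j) \<in> left_hom A CC C" if "j \<in> J" for j
    by (rule contract_left_hom [OF lC bC D_AHom [OF gg [OF that]]])
  note ba = tensor_map_addmap [OF X.tensor_pair_axioms Y.tensor_pair_axioms id_right_hom bh]
    and bp = tensor_map_pure [OF X.tensor_pair_axioms Y.tensor_pair_axioms id_right_hom bh]
    and pa = tensor_map_addmap [OF Y.tensor_pair_axioms X.tensor_pair_axioms id_right_hom ph]
    and pp = tensor_map_pure [OF Y.tensor_pair_axioms X.tensor_pair_axioms id_right_hom ph]
  have cl: "?b j (?p j z) \<in> carrier Y.T" if "j \<in> J" "z \<in> carrier Y.T" for j z
    by (rule addmap_closed [OF ba [OF that(1)] addmap_closed [OF pa [OF that(1)] that(2)]])
  have rec: "(\<Oplus>\<^bsub>Y.T\<^esub>j\<in>J. ?b j (?p j z)) = z" if "z \<in> carrier Y.T" for z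
    using that
  proof (rule Y.hom_ext [rotated 2])
    show "addmap Y.T Y.T (\<lambda>z. \<Oplus>\<^bsub>Y.T\<^esub>j\<in>J. ?b j (?p j z))"
      by (rule addmap_sum [OF Y.tensor_abelian]) (rule addmap_comp [OF pa ba])
    show "addmap Y.T Y.T (\<lambda>z. z)" by (simp add: addmap_def)
    fix n z assume n: "n \<in> carrier DC" and z: "z \<in> carrier CC"
    have c: "contract C (gg j) z \<in> carrier C" if "j \<in> J" for j by (rule left_hom_closed [OF ph [OF that] z])
    have "(\<Oplus>\<^bsub>Y.T\<^esub>j\<in>J. ?b j (?p j (Y.pure n z))) = (\<Oplus>\<^bsub>Y.T\<^esub>j\<in>J. Y.pure n (pure_tensor A C C (contract C (gg j) z) (d j)))"
      by (rule Y.T.finsum_cong')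
        (use n z c C_basis(2) in \<open>auto simp: pp bp intro!: Y.pure_closed CCr.pure_closed\<close>)
    also have "\<dots> = Y.pure n (\<Oplus>\<^bsub>CC\<^esub>j\<in>J. pure_tensor A C C (contract C (gg j) z) (d j))"
      by (rule Y.pure_sum_right [symmetric]) (use n c C_basis(2) in \<open>auto intro!: CCr.pure_closed\<close>)
    also have "(\<Oplus>\<^bsub>CC\<^esub>j\<in>J. pure_tensor A C C (contract C (gg j) z) (d j)) = (\<Oplus>\<^bsub>CC\<^esub>j\<in>J. pure_tensor A C C (contract C (\<gamma> j) z) (d j))"
    proof (rule CC.M.finsum_cong' [OF refl])
      have eq: "contract C (gg j) z = contract C (\<gamma> j) z" if "j \<in> J" for j
        by (rule contract_cong [OF lC rC D_AHom [OF gg [OF that]] C_basis(3) [OF that] _ z]) (simp add: gg_def)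
      show "(\<lambda>j. pure_tensor A C C (contract C (\<gamma> j) z) (d j)) \<in> J \<rightarrow> carrier CC"
        using c eq C_basis(2) by (auto intro!: CCr.pure_closed)
      show "pure_tensor A C C (contract C (gg j) z) (d j) = pure_tensor A C C (contract C (\<gamma> j) z) (d j)" if "j \<in> J" for j
        using eq [OF that] by simp
    qed
    also have "\<dots> = z" by (rule contract_expand [OF lC db rC z])
    finally show "(\<Oplus>\<^bsub>Y.T\<^esub>j\<in>J. ?b j (?p j (Y.pure n z))) = Y.pure n z" .
  qed
  have "(\<Oplus>\<^bsub>Y.T\<^esub>j\<in>J. ?b j (?p j y)) = (\<Oplus>\<^bsub>Y.T\<^esub>j\<in>J. ?b j (?p j y'))"
    by (rule Y.T.finsum_cong') (use cl y eq gg in auto)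
  then show ?thesis using rec y by simp
qed

text \<open>After contracting the last factor with \<open>h\<close> and the remaining one with
  \<open>k\<close>, coassociativity reads \<open>(f # h) # k = f # (h # k)\<close>. The counit law
  is \<open>f # \<epsilon> = f\<close>.\<close>

lemma DC_comodule: "comodule A C DC"
proof (intro comodule.intro comodule_axioms.intro DC_right DC_coact_right_hom)
  fix u assume u: "u \<in> carrier DC"
  obtain f where f: "f \<in> carrier D" "u = e f" using DC_cases u by meson
  note \<rho> = DC_coact_right_hom and cl = DC_coact_closed [OF u]
  interpret XC: tensor_pair A X.T C by (rule tensor_pairI [OF Xm.right_module_axioms lC])
  show "tensor_assoc A A DC C C (tensor_map A X.T C (coact DC) (\<lambda>c. c) (coact DC u)) =
      tensor_map A DC CC (\<lambda>n. n) (comul C) (coact DC u)"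
  proof (rule contract_CC_separates)
    show "tensor_assoc A A DC C C (tensor_map A X.T C (coact DC) (\<lambda>c. c) (coact DC u)) \<in> carrier Y.T"
      by (rule addmap_closed [OF tensor_assoc_addmap [OF DC_right bC lC]
          addmap_closed [OF tensor_map_addmap [OF X.tensor_pair_axioms XC.tensor_pair_axioms \<rho> id_left_hom] cl]])
    show "tensor_map A DC CC (\<lambda>n. n) (comul C) (coact DC u) \<in> carrier Y.T"
      by (rule addmap_closed [OF tensor_map_addmap [OF X.tensor_pair_axioms Y.tensor_pair_axioms id_right_hom comul_left] cl])
    fix h assume h: "h \<in> carrier D"
    note hA = D_AHom [OF h]
    have "coact DC (contract DC h (coact DC u)) = tensor_map A DC C (\<lambda>n. n) (\<lambda>c. act c h) (coact DC u)"
    proof (rule contract_separates)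
      note fh = D_mult_closed [OF f(1) h]
      have c: "contract DC h (coact DC u) = e (f \<otimes>\<^bsub>D\<^esub> h)" using f h by (simp add: contract_coact)
      show "coact DC (contract DC h (coact DC u)) \<in> carrier X.T"
        unfolding c by (rule DC_coact_closed [OF e_closed [OF fh]])
      show "tensor_map A DC C (\<lambda>n. n) (\<lambda>c. act c h) (coact DC u) \<in> carrier X.T"
        by (rule addmap_closed [OF tensor_map_addmap [OF X.tensor_pair_axioms X.tensor_pair_axioms id_right_hom act_left_hom [OF hA]] cl])
      fix k assume k: "k \<in> carrier D"
      have "contract DC k (tensor_map A DC C (\<lambda>n. n) (\<lambda>c. act c h) (coact DC u)) = contract DC (\<lambda>c. k (act c h)) (coact DC u)"
        by (rule contract_tensor_map [OF lC lC DC_right D_AHom [OF k] act_left_hom [OF hA] cl])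
      also have "\<dots> = contract DC (h \<otimes>\<^bsub>D\<^esub> k) (coact DC u)"
        by (rule contract_cong [OF lC DC_right left_hom_comp [OF act_left_hom [OF hA] D_AHom [OF k]] D_AHom [OF D_mult_closed [OF h k]] _ cl])
          (simp add: D_mult)
      finally show "contract DC k (coact DC (contract DC h (coact DC u))) =
          contract DC k (tensor_map A DC C (\<lambda>n. n) (\<lambda>c. act c h) (coact DC u))"
        using f h k fh by (simp add: c contract_coact D_mult_closed D.m_assoc)
    qed
    then show "tensor_map A DC C (\<lambda>n. n) (contract C h) (tensor_assoc A A DC C C (tensor_map A X.T C (coact DC) (\<lambda>c. c) (coact DC u)))
        = tensor_map A DC C (\<lambda>n. n) (contract C h) (tensor_map A DC CC (\<lambda>n. n) (comul C) (coact DC u))"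
      using contract_tensor_assoc [OF DC_right \<rho> hA cl] contract_comul [OF DC_right \<rho> hA cl] by simp
  qed
  have "contract DC (counit C) (coact DC u) = contract DC \<one>\<^bsub>D\<^esub> (coact DC u)"
    by (rule contract_cong [OF lC DC_right counit_left_hom D_AHom [OF D_one_closed] _ cl]) (simp add: D_one)
  then show "tensor_lift DC (\<lambda>n c. ract DC n (counit C c)) (coact DC u) = u"
    using f contract_coact [OF f(1) D_one_closed] by (simp add: contract_def)
qed

text \<open>Contracting \<open>e f \<otimes> x\<close> with \<open>h\<close> shows
  \<open>f # h = f # i(h(x))\<close>. At \<open>c\<close> this says that \<open>h\<close> takes the
  same value on \<open>c\<^sub>1 f(c\<^sub>2)\<close> and on \<open>f(c) x\<close>. This holds for
  every \<open>h\<close>, and functionals separate points.\<close>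

lemma DC_coinvariants: "f \<in> carrier D \<Longrightarrow> e f \<in> carrier (coinvariants A C x DC) \<Longrightarrow> f \<in> carrier Q"
proof -
  assume f: "f \<in> carrier D" and "e f \<in> carrier (coinvariants A C x DC)"
  then have \<rho>: "coact DC (e f) = X.pure (e f) x" by (simp add: coinvariants_def bimodule.defs)
  have "act c f = lact C (f c) x" if c: "c \<in> carrier C" for c
  proof (rule dual_basis_separates [OF db])
    note fc = AHom_closed [OF D_AHom [OF f] c]
    show "act c f \<in> carrier C" "lact C (f c) x \<in> carrier C" using f c fc by (simp_all add: act_closed D_AHom ax_closed)
    fix h assume h: "h \<in> carrier D"
    have hx: "h x \<in> carrier A" using h by (simp add: AHom_closed D_AHom x_closed)
    have "e (f \<otimes>\<^bsub>D\<^esub> h) = ract DC (e f) (h x)"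
      using contract_coact [OF f h] contract_pure [OF lC DC_right D_AHom [OF h] e_closed [OF f] x_closed] by (simp add: \<rho>)
    then have "f \<otimes>\<^bsub>D\<^esub> h = f \<otimes>\<^bsub>D\<^esub> dual_incl A C (h x)"
      using f h hx by (simp add: e_ract e_eq_iff D_mult_closed dual_incl_closed)
    from fun_cong [OF this, of c] show "h (act c f) = h (lact C (f c) x)"
      using f h c hx fc by (simp add: dual_incl_mult) (simp add: D_mult AHom_lact D_AHom x_closed)
  qed
  then show ?thesis using f by (simp add: Q_iff)
qed

text \<open>The unit of \<open>D\<close> corresponds to a value of the counit map, hence to a sum of
  coinvariants times elements of \<open>A\<close>; and the coinvariants of this comodule come from
  \<open>Q\<close>.\<close>

lemma DC_gal_basis:
  assumes surj: "counit_map DC ` carrier (tensor B (coinvariants A C x DC) (regular A)) = carrier DC"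
  obtains k :: nat and r s where "gal_basis {..<k} r s"
proof -
  let ?N = "coinvariants A C x DC"
  note M = DC_comodule
  note NB = coinv_right [OF M]
  interpret VA: tensor_pair B ?N "regular A" by (rule tensor_pairI [OF NB left_BA])
  note ca = counit_map_addmap [OF M] and cp = counit_map_pure [OF M]
  have "e \<one>\<^bsub>D\<^esub> \<in> counit_map DC ` carrier VA.T"
    unfolding surj by (rule e_closed [OF D_one_closed])
  then obtain t where t: "e \<one>\<^bsub>D\<^esub> = counit_map DC t" "t \<in> carrier VA.T" by (rule imageE)
  obtain k :: nat and u s where us: "u \<in> {..<k} \<rightarrow> carrier ?N" "s \<in> {..<k} \<rightarrow> carrier (regular A)"
    "t = (\<Oplus>\<^bsub>VA.T\<^esub>i\<in>{..<k}. VA.pure (u i) (s i))"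
    by (rule VA.tensor_sumE [OF t(2)])
  have s: "s i \<in> carrier A" and uN: "u i \<in> carrier ?N" if "i < k" for i using us that by auto
  have uD: "v (u i) \<in> carrier D" "e (v (u i)) = u i" if "i < k" for i
    using uN [OF that] v [of "u i"] by (simp_all add: coinvariants_def bimodule.defs DC_simps)
  have rQ: "v (u i) \<in> carrier Q" if "i < k" for i
    using DC_coinvariants [OF uD(1) [OF that]] uD(2) [OF that] uN [OF that] by simp
  have "e \<one>\<^bsub>D\<^esub> = (\<Oplus>\<^bsub>DC\<^esub>i\<in>{..<k}. counit_map DC (VA.pure (u i) (s i)))"
    unfolding t(1) us(3)
    by (rule addmap_finsum [OF VA.tensor_abelian DC.M.abelian_group_axioms ca])
      (rule funcsetI, rule VA.pure_closed [OF funcset_mem [OF us(1)] funcset_mem [OF us(2)]])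
  also have "\<dots> = (\<Oplus>\<^bsub>DC\<^esub>i\<in>{..<k}. e (v (u i) \<otimes>\<^bsub>D\<^esub> dual_incl A C (s i)))"
  proof (rule DC.M.finsum_cong' [OF refl])
    show "(\<lambda>i. e (v (u i) \<otimes>\<^bsub>D\<^esub> dual_incl A C (s i))) \<in> {..<k} \<rightarrow> carrier DC"
      using uD s by (auto intro!: e_closed D_mult_closed dual_incl_closed)
    fix i assume "i \<in> {..<k}"
    then have i: "i < k" by simp
    show "counit_map DC (VA.pure (u i) (s i)) = e (v (u i) \<otimes>\<^bsub>D\<^esub> dual_incl A C (s i))"
      using cp [OF uN [OF i] s [OF i]] e_ract [OF uD(1) [OF i] s [OF i]] uD(2) [OF i] by simp
  qed
  also have "\<dots> = e (\<Oplus>\<^bsub>D\<^esub>i\<in>{..<k}. v (u i) \<otimes>\<^bsub>D\<^esub> dual_incl A C (s i))"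
    by (rule addmap_finsum [OF D_abelian DC.M.abelian_group_axioms e_addmap, symmetric])
      (use uD s in \<open>auto intro!: D_mult_closed dual_incl_closed\<close>)
  finally have "(\<Oplus>\<^bsub>D\<^esub>i\<in>{..<k}. v (u i) \<otimes>\<^bsub>D\<^esub> dual_incl A C (s i)) = \<one>\<^bsub>D\<^esub>"
    using uD s by (subst (asm) e_eq_iff) (auto intro!: D.finsum_closed D_mult_closed dual_incl_closed D_one_closed)
  then have "gal_basis {..<k} (\<lambda>i. v (u i)) s"
    using gal_basis_iff_D [of "{..<k}" "\<lambda>i. v (u i)" s] rQ s by auto
  then show ?thesis by (rule that)
qed

end

text \<open>The equivalence speaks of comodules with carrier in \<open>'u\<close>, so the comodule
  is built on a copy of the left dual there; \<open>D_lepoll\<close> provides the embedding.\<close>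

lemma adjoint_equivalence_gal_basis:
  assumes eq: "adjoint_equivalence TYPE('u) A C x" and db: "dual_basis A C (J :: 'j set) \<gamma> d"
    and u: "infinite (UNIV :: 'u set)" "carrier A \<lesssim> (UNIV :: 'u set)"
  obtains k :: nat and r s where "gal_basis {..<k} r s"
proof -
  have "carrier Dm \<lesssim> (UNIV :: 'u set)" using D_lepoll [OF db u] by simp
  then obtain V :: "(unit, 'a, 'u) bimodule" and e v where V: "right_module A V" "e \<in> right_hom A Dm V" "v \<in> right_hom A V Dm"
    "\<And>f. f \<in> carrier Dm \<Longrightarrow> v (e f) = f" "\<And>u. u \<in> carrier V \<Longrightarrow> e (v u) = u"
    using right_module_copy [OF Dm_right] by metis
  have vD: "v u \<in> carrier D" if "u \<in> carrier V" for u using right_hom_closed [OF V(3) that] by simp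
  have ve: "v (e f) = f" if "f \<in> carrier D" for f using V(4) that by simp
  let ?M = "dual_comodule J \<gamma> d V e v"
  note M = DC_comodule [OF db V(1,2) vD V(5) ve]
  have "counit_map ?M \<in> comodule_iso A C (induced_comodule A C x (coinvariants A C x ?M)) ?M"
    using eq M unfolding adjoint_equivalence_def by blast
  then have "counit_map ?M ` carrier (tensor B (coinvariants A C x ?M) (regular A)) = carrier ?M"
    by (simp add: comodule_iso_def bij_betw_def IC_simps [OF coinv_right [OF M]])
  from DC_gal_basis [OF db V(1,2) vD V(5) ve this] show ?thesis using that by blast
qed

end

text \<open>Condition (3) is the hub: it implies each of the others and follows from each of them.
  It consists of equations between elements and does not quantify over modules in \<open>'u\<close>,
  so the explicit constructions start from it.\<close>

theorem theorem4p7: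
  fixes A :: "'a ring" and C :: "('a, 'c) coring" and x :: 'c and B' :: "'a set"
  assumes "ring A" and "coring A C" and "grouplike A C x"
    and "infinite (UNIV :: 'u set)"
    and "carrier A \<lesssim> (UNIV :: 'u set)" and "carrier C \<lesssim> (UNIV :: 'u set)"
    and "left_progenerator TYPE('u) A C"
    and "subring B' (coinvariant_ring A C x)"
  shows
    "let B = carrier (coinvariant_ring A C x);
         R' = A\<lparr>carrier := B'\<rparr>;
         S1 = can C x \<in> coring_iso A (sweedler_coring A B') C \<and>
              left_faithfully_flat TYPE('u) R' (regular A);
         S2 = dual_can A C x \<in> ring_iso (left_dual A C) (op_ring (left_End R' (regular A))) \<and>
              left_progenerator TYPE('u) R' (regular A);
         S3 = (B = B' \<and> morita_strict A C x);
         S4 = (B = B' \<and> adjoint_equivalence TYPE('u) A C x)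
     in (S1 \<longleftrightarrow> S2) \<and> (S2 \<longleftrightarrow> S3) \<and> (S3 \<longleftrightarrow> S4)"
proof -
  interpret subring_coring A C x B'
    by (intro subring_coring.intro subring_coring_axioms.intro grouplike_coring.intro grouplike_coring_axioms.intro assms)
  have uS: "carrier R \<lesssim> (UNIV :: 'u set)"
    using lepoll_trans [OF subset_imp_lepoll assms(5), of B'] S_A by auto
  have uA: "carrier rg \<lesssim> (UNIV :: 'u set)" using assms(5) by simp
  obtain J \<gamma> where db: "dual_basis A C J \<gamma> (\<lambda>c. c)"
    using dual_basis_exists [OF lC _ _ assms(4-6)] assms(7) unfolding left_progenerator_def by blast
  note sep = dual_basis_separates [OF db]
  let ?S1 = "can C x \<in> coring_iso A SC C \<and> left_faithfully_flat TYPE('u) R rg"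
  let ?S2 = "dual_can A C x \<in> ring_iso D (op_ring (left_End R rg)) \<and> left_progenerator TYPE('u) R rg"
  let ?S3 = "carrier B = B' \<and> morita_strict A C x"
  let ?S4 = "carrier B = B' \<and> adjoint_equivalence TYPE('u) A C x"
  have from3: "?S1 \<and> ?S2 \<and> ?S4" if "?S3"
  proof -
    have SB: "B' = carrier B" and st: "morita_strict A C x" using that by simp_all
    obtain k :: nat and r s where g: "gal_basis {..<k} r s" and one: "\<one>\<^bsub>A\<^esub> \<in> tau_image"
      by (rule morita_strictD [OF st])
    note dA = gal_dual_basis [OF SB g]
    \<comment> \<open>The functionals \<open>q(x-)\<close> with \<open>q\<close> in \<open>Q\<close>
      take values in \<open>B\<close>, so the image of \<tau> is contained in the trace ideal of
      \<open>A\<close>.\<close>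
    have tr: "\<one>\<^bsub>R\<^esub> \<in> trace_ideal R rg" using tau_image_trace [OF SB] one by auto
    have "left_faithfully_flat TYPE('u) R rg" by (rule dual_basis_faithfully_flat [OF left_RA dA tr])
    moreover have "left_progenerator TYPE('u) R rg"
      unfolding left_progenerator_def
      using left_RA dual_basis_finitely_generated [OF left_RA dA] dual_basis_projective [OF left_RA dA]
        trace_ideal_generator [OF left_RA tr] by blast
    ultimately show ?thesis
      using can_iso_iff gal_can_bij [OF SB g] strict_imp_dual_can [OF SB g] gal_adjoint_equivalence [OF g one] SB by blast
  qed
  have 1: "?S3" if "?S1"
  proof -
    have bij: "bij_betw (can C x) (carrier W) (carrier C)" and ff: "left_faithfully_flat TYPE('u) R rg"
      using that can_iso_iff by simp_all
    obtain k :: nat and r s where g: "gal_basis {..<k} r s"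
      by (rule faithfully_flat_gal_basis [OF bij db ff assms(4-6)])
    show ?thesis
      using faithfully_flat_S [OF bij ff assms(5,6)] morita_strictI [OF g faithfully_flat_tau [OF bij ff assms(5,6) g]] by simp
  qed
  have 2: "?S3" if "?S2"
  proof -
    have pg: "left_finitely_generated R rg" "left_projective TYPE('u) R rg" "left_generator TYPE('u) R rg"
      using that by (simp_all add: left_progenerator_def)
    obtain I \<phi> where dA: "dual_basis R rg I \<phi> (\<lambda>a. a)"
      by (rule dual_basis_exists [OF left_RA pg(1,2) assms(4) uS uA])
    have one: "\<one>\<^bsub>A\<^esub> \<in> trace_ideal R rg"
      using one_in_trace_ideal [OF left_RA pg(3) uS] by simp
    have "B' = carrier B \<and> morita_strict A C x"
      by (rule dual_can_iso_imp [OF conjunct1 [OF that] dA one]) (rule sep)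
    then show ?thesis by simp
  qed
  have 4: "?S3" if "?S4"
  proof -
    have eq: "adjoint_equivalence TYPE('u) A C x" using that by blast
    obtain k :: nat and r s where g: "gal_basis {..<k} r s"
      by (rule adjoint_equivalence_gal_basis [OF eq db assms(4,5)])
    show ?thesis
      using that morita_strictI [OF g adjoint_equivalence_tau [OF eq g assms(5)]] by blast
  qed
  show ?thesis unfolding Let_def using from3 1 2 4 by blast
qed

end
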